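(* Let $p$ be a prime, let $A$ be the division algebra of fractions of the skew-polynomial ring $k\{x,y\}$ with $xy=\zeta yx$ ($\zeta\in k$ a primitive $p$-th root of unity), a central simple algebra of degree $n=p$, and let $G=K\rtimes H$ be the finite group of automorphisms of $A$ generated by the automorphisms $\sigma_{(a,b)}$ ($(a,b)\in(\mathbb{Z}/p\mathbb{Z})^2$) and $\tau$ given by $$\sigma_{(a,b)}(x)=\zeta^a x,\quad \sigma_{(a,b)}(y)=\zeta^b y,\qquad \tau(x)=y,\quad \tau(y)=x^{-1}y^{-1},$$ where $K=\{\sigma_{(a,b)}\}\simeq(\mathbb{Z}/p\mathbb{Z})^2$ and $H=\langle\tau\rangle\simeq\mathbb{Z}/3\mathbb{Z}$. Let $\phi_p\colon H\to\mathrm{SL}_2(\mathbb{Z}/p\mathbb{Z})$ be the representation sending $\tau$ to $\begin{pmatrix}0&-1\\1&-1\end{pmatrix}$. Let $X$ be the $G\times\mathrm{PGL}_n$-variety associated to the (geometric) action of $G$ on $A$. (a) For $x \in X$ in general position, there exists a maximal torus $T_x$ of $\mathrm{PGL}_n$ such that $\mathrm{Stab}_{G \times \mathrm{PGL}_n}(x) \subseteq G \times \mathrm{N}(T_x)$, where $\mathrm{N}(T_x)$ is the normalizer of $T_x$ in $\mathrm{PGL}_n$. (b) $A$ has a $G$-invariant maximal subfield if and only if the 2-dimensional representation $\phi_p\colon H\to\mathrm{SL}_2(\mathbb{Z}/p\mathbb{Z})$ is reducible over $\mathbb{Z}/p\mathbb{Z}$. (c) The following implication is false in general: if an algebraic group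 $G'$ acts geometrically on a central simple algebra $A'$ of degree $n'$ with associated $G'\times\mathrm{PGL}_{n'}$-variety $X'$, and for every $x\in X'$ in general position there exists a maximal torus $T_x$ of $\mathrm{PGL}_{n'}$ with $\mathrm{Stab}_{G'\times\mathrm{PGL}_{n'}}(x)\subseteq G'\times \mathrm{N}(T_x)$, then $A'$ has a $G'$-invariant maximal étale subalgebra.
   Context: Conventions: $k$ is an algebraically closed field of characteristic zero. Algebraic groups are linear algebraic groups over $k$ (not necessarily connected; finite groups are included); varieties are over $k$. Central simple algebras are finite-dimensional over their centers, and their centers are finitely generated field extensions of $k$. Groups act on algebras by $k$-algebra automorphisms. $M_n=M_n(k)$, on which $\mathrm{PGL}_n=\mathrm{PGL}_n(k)$ acts by conjugation. A $G$-variety is a variety with a regular action of $G$. "For $x\in X$ in general position" means for all $x$ in some dense open subset of $X$. For an irreducible variety $X$ with generically free $\mathrm{PGL}_n$-action (trivial stabilizers on a dense open subset), $k_n(X)$ denotes the $k$-algebra of $\mathrm{PGL}_n$-equivariant rational maps $X\dashrightarrow M_n$; it is a central simple algebra of degree $n$ with center $k(X)^{\mathrm{PGL}_n}$. Geometric actions: an action of an algebraic group $G$ on a central simple algebra $A$ of degree $n$ is geometric if there is an irreducible $G\times \mathrm{PGL}_n$-variety $X$ such that $A$ is $G$-equivariantly isomorphic to $k_n(X)$, where $G$ acts on $k_n(X)$ by $(gf)(x)=f(g^{-1}x)$. Such an $X$ (necessarily $\mathrm{PGL}_n$-generically free) is the associated variety of the action; it is unique up to birational isomorphism of $G\times\mathrm{PGL}_n$-varieties.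 Every action of a finite group on a central simple algebra is geometric. A maximal étale subalgebra of $A$ is a subalgebra which is a finite direct sum of (separable) field extensions of the center $\mathrm{Z}(A)$ and has dimension $\deg(A)$ over $\mathrm{Z}(A)$; if $A$ is a division algebra these are exactly the maximal subfields. *)

theory Defs
  imports
    "HOL-Analysis.Abstract_Topology"
    "HOL-Algebra.Embedded_Algebras"
    "HOL-Algebra.Generated_Fields"
    "HOL-Algebra.Group_Action"
    "HOL-Algebra.Ideal"
    "Jordan_Normal_Form.VS_Connect"
    "Berlekamp_Zassenhaus.Finite_Field"
begin

hide_const (open) Multiset.mult Polynomial.smult Modules.module

section \<open>Varieties as spaces with functions\<close>

text \<open>
  Varieties over an algebraically closed field are treated in the classical language of spaces
  with functions: a topological space together with, for every open set, the set of functions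
  regular on it.  Functions are total in HOL; only their values on the open set matter, and
  \<open>regfun X U\<close> is only meaningful for open \<open>U\<close>.
\<close>

record ('k, 'x) fspace =
  ftop :: "'x topology"
  regfun :: "'x set \<Rightarrow> ('x \<Rightarrow> 'k) set"

abbreviation points :: "('k, 'x) fspace \<Rightarrow> 'x set"
  where "points X \<equiv> topspace (ftop X)"

definition morphism :: "('k, 'x) fspace \<Rightarrow> ('k, 'y) fspace \<Rightarrow> ('x \<Rightarrow> 'y) \<Rightarrow> bool"
  where "morphism X Y f \<longleftrightarrow> continuous_map (ftop X) (ftop Y) f \<and>
    (\<forall>V h. openin (ftop Y) V \<and> h \<in> regfun Y V \<longrightarrow>
       h \<circ> f \<in> regfun X {x \<in> points X. f x \<in> V})"

definition fspace_iso :: "('k, 'x) fspace \<Rightarrow> ('k, 'y) fspace \<Rightarrow> ('x \<Rightarrow> 'y) \<Rightarrow> bool"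
  where "fspace_iso X Y f \<longleftrightarrow> bij_betw f (points X) (points Y) \<and>
    morphism X Y f \<and> morphism Y X (inv_into (points X) f)"

text \<open>The structure induced on a subset: functions which locally extend to regular functions.\<close>

definition subspace_of :: "('k, 'x) fspace \<Rightarrow> 'x set \<Rightarrow> ('k, 'x) fspace"
  where "subspace_of X S =
    \<lparr>ftop = subtopology (ftop X) S,
     regfun = (\<lambda>V. {f. \<forall>x\<in>V. \<exists>W g. openin (ftop X) W \<and> x \<in> W \<and> g \<in> regfun X W \<and>
                              (\<forall>y\<in>V \<inter> W. f y = g y)})\<rparr>"

text \<open>
  The categorical product of spaces with functions.  Finite sums \<open>\<Sum> f\<^sub>i(x) g\<^sub>i(y)\<close> with
  \<open>f\<^sub>i\<close>, \<open>g\<^sub>i\<close> regular on \<open>U\<close>, \<open>V\<close> are to be regular on \<open>U \<times> V\<close>; their non-vanishing loci form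
  a basis, and regular functions are locally quotients of such sums.
\<close>

definition tensor_functions ::
    "('k::field, 'x) fspace \<Rightarrow> ('k, 'y) fspace \<Rightarrow> 'x set \<Rightarrow> 'y set \<Rightarrow> ('x \<times> 'y \<Rightarrow> 'k) set"
  where "tensor_functions X Y U V =
    {h. \<exists>(m::nat) f g. (\<forall>i<m. f i \<in> regfun X U \<and> g i \<in> regfun Y V) \<and>
                       h = (\<lambda>(x, y). \<Sum>i<m. f i x * g i y)}"

definition prod_space ::
    "('k::field, 'x) fspace \<Rightarrow> ('k, 'y) fspace \<Rightarrow> ('k, 'x \<times> 'y) fspace"
  where "prod_space X Y =
    \<lparr>ftop = topology_generated_by
       {{z \<in> U \<times> V. h z \<noteq> 0} | U V h.
          openin (ftop X) U \<and> openin (ftop Y) V \<and> h \<in> tensor_functions X Y U V},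
     regfun = (\<lambda>W. {f. \<forall>w\<in>W. \<exists>U V g h.
          openin (ftop X) U \<and> openin (ftop Y) V \<and> w \<in> U \<times> V \<and>
          g \<in> tensor_functions X Y U V \<and> h \<in> tensor_functions X Y U V \<and> h w \<noteq> 0 \<and>
          (\<forall>z\<in>W \<inter> U \<times> V. h z \<noteq> 0 \<longrightarrow> f z = g z / h z)})\<rparr>"

text \<open>Polynomials in a given set \<open>F\<close> of coordinate functions.\<close>

inductive_set polyfun :: "('x \<Rightarrow> 'k::field) set \<Rightarrow> ('x \<Rightarrow> 'k) set" for F
  where
    polyfun_const: "(\<lambda>_. c) \<in> polyfun F"
  | polyfun_coord: "f \<in> F \<Longrightarrow> f \<in> polyfun F"
  | polyfun_add: "f \<in> polyfun F \<Longrightarrow> g \<in> polyfun F \<Longrightarrow> (\<lambda>x. f x + g x) \<in> polyfun F"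
  | polyfun_mult: "f \<in> polyfun F \<Longrightarrow> g \<in> polyfun F \<Longrightarrow> (\<lambda>x. f x * g x) \<in> polyfun F"

text \<open>The Zariski topology on \<open>S\<close> and local quotients of polynomials, for coordinates \<open>F\<close>.\<close>

definition zariski_space :: "'x set \<Rightarrow> ('x \<Rightarrow> 'k::field) set \<Rightarrow> ('k, 'x) fspace"
  where "zariski_space S F =
    \<lparr>ftop = topology_generated_by {{x \<in> S. q x \<noteq> 0} | q. q \<in> polyfun F},
     regfun = (\<lambda>U. {f. \<forall>x\<in>U. \<exists>g\<in>polyfun F. \<exists>h\<in>polyfun F. h x \<noteq> 0 \<and>
                         (\<forall>y\<in>U. h y \<noteq> 0 \<longrightarrow> f y = g y / h y)})\<rparr>"

definition affine_space :: "nat \<Rightarrow> ('k::field, 'k vec) fspace"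
  where "affine_space r = zariski_space (carrier_vec r) {(\<lambda>v. v $ i) | i. i < r}"

definition space_with_functions :: "('k, 'x) fspace \<Rightarrow> bool"
  where "space_with_functions X \<longleftrightarrow>
    (\<forall>U f g. openin (ftop X) U \<and> f \<in> regfun X U \<and> (\<forall>x\<in>U. f x = g x) \<longrightarrow> g \<in> regfun X U) \<and>
    (\<forall>\<U> f. (\<forall>U\<in>\<U>. openin (ftop X) U) \<longrightarrow>
       (f \<in> regfun X (\<Union>\<U>) \<longleftrightarrow> (\<forall>U\<in>\<U>. f \<in> regfun X U)))"

definition affine_variety :: "('k::field, 'x) fspace \<Rightarrow> bool"
  where "affine_variety X \<longleftrightarrow> space_with_functions X \<and>
    (\<exists>r Z f. closedin (ftop (affine_space r)) Z \<and> fspace_iso X (subspace_of (affine_space r) Z) f)"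

definition variety :: "('k::field, 'x) fspace \<Rightarrow> bool"
  where "variety X \<longleftrightarrow> space_with_functions X \<and>
    (\<exists>\<U>. finite \<U> \<and> \<Union>\<U> = points X \<and>
       (\<forall>U\<in>\<U>. openin (ftop X) U \<and> affine_variety (subspace_of X U))) \<and>
    closedin (ftop (prod_space X X)) {(x, x) | x. x \<in> points X}"

definition irreducible_space :: "'x topology \<Rightarrow> bool"
  where "irreducible_space T \<longleftrightarrow> topspace T \<noteq> {} \<and>
    (\<forall>U V. openin T U \<and> openin T V \<and> U \<noteq> {} \<and> V \<noteq> {} \<longrightarrow> U \<inter> V \<noteq> {})"

definition dense_open :: "'x topology \<Rightarrow> 'x set \<Rightarrow> bool"
  where "dense_open T U \<longleftrightarrow> openin T U \<and> T closure_of U = topspace T"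

section \<open>Linear algebraic groups\<close>

definition alg_group :: "('g, 'm) monoid_scheme \<Rightarrow> ('k::field, 'g) fspace \<Rightarrow> bool"
  where "alg_group G S \<longleftrightarrow> group G \<and> carrier G = points S \<and> affine_variety S \<and>
    morphism (prod_space S S) S (\<lambda>(g, h). g \<otimes>\<^bsub>G\<^esub> h) \<and> morphism S S (m_inv G)"

definition discrete_space :: "'g set \<Rightarrow> ('k, 'g) fspace"
  where "discrete_space S = \<lparr>ftop = discrete_topology S, regfun = (\<lambda>_. UNIV)\<rparr>"

definition regular_action ::
    "('g, 'm) monoid_scheme \<Rightarrow> ('k::field, 'g) fspace \<Rightarrow> ('k, 'x) fspace \<Rightarrow> ('g \<Rightarrow> 'x \<Rightarrow> 'x) \<Rightarrow> bool"
  where "regular_action G S X act \<longleftrightarrow> group_action G (points X) act \<and>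
    morphism (prod_space S X) X (\<lambda>(g, x). act g x)"

subsection \<open>\<open>PGL\<^sub>n\<close> as the quotient of \<open>GL\<^sub>n\<close> by the scalars\<close>

definition mat_space :: "nat \<Rightarrow> ('k::field, 'k mat) fspace"
  where "mat_space n =
    zariski_space (carrier_mat n n) {(\<lambda>m. m $$ (i, j)) | i j. i < n \<and> j < n}"

definition GL :: "nat \<Rightarrow> 'k::field mat monoid"
  where "GL n = units_of (ring_mat TYPE('k) n ())"

definition GL_space :: "nat \<Rightarrow> ('k::field, 'k mat) fspace"
  where "GL_space n = subspace_of (mat_space n) (carrier (GL n))"

definition scalars :: "nat \<Rightarrow> 'k::field mat set"
  where "scalars n = {c \<cdot>\<^sub>m 1\<^sub>m n | c. c \<noteq> 0}"

definition PGL :: "nat \<Rightarrow> 'k::field mat set monoid"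
  where "PGL n = GL n Mod scalars n"

text \<open>
  Quotient structure.  The points are cosets, so the preimage of \<open>U\<close> in \<open>GL\<^sub>n\<close> is \<open>\<Union>U\<close>.
\<close>

definition PGL_space :: "nat \<Rightarrow> ('k::field, 'k mat set) fspace"
  where "PGL_space n =
    \<lparr>ftop = topology (\<lambda>U. U \<subseteq> carrier (PGL n) \<and> openin (ftop (GL_space n)) (\<Union>U)),
     regfun = (\<lambda>U. {f. (\<lambda>g. f (scalars n #>\<^bsub>GL n\<^esub> g)) \<in> regfun (GL_space n) (\<Union>U)})\<rparr>"

definition pgl_conj :: "nat \<Rightarrow> 'k::field mat set \<Rightarrow> 'k mat \<Rightarrow> 'k mat"
  where "pgl_conj n P m = (let g = (SOME g. g \<in> P) in g * m * inv\<^bsub>GL n\<^esub> g)"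

subsection \<open>Tori\<close>

definition Gm_power :: "nat \<Rightarrow> 'k::field vec monoid"
  where "Gm_power r =
    \<lparr>carrier = {v \<in> carrier_vec r. \<forall>i<r. v $ i \<noteq> 0},
     mult = (\<lambda>v w. vec r (\<lambda>i. v $ i * w $ i)),
     one = vec r (\<lambda>_. 1)\<rparr>"

definition pgl_torus :: "nat \<Rightarrow> 'k::field mat set set \<Rightarrow> bool"
  where "pgl_torus n T \<longleftrightarrow> subgroup T (PGL n) \<and> closedin (ftop (PGL_space n)) T \<and>
    (\<exists>r h. h \<in> iso ((PGL n)\<lparr>carrier := T\<rparr>) (Gm_power r) \<and>
           fspace_iso (subspace_of (PGL_space n) T)
                      (subspace_of (affine_space r) (carrier (Gm_power r))) h)"

definition maximal_torus :: "nat \<Rightarrow> 'k::field mat set set \<Rightarrow> bool"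
  where "maximal_torus n T \<longleftrightarrow> pgl_torus n T \<and> (\<forall>T'. pgl_torus n T' \<and> T \<subseteq> T' \<longrightarrow> T' = T)"

section \<open>Algebras over \<open>k\<close>\<close>

text \<open>
  The library locale \<open>algebra\<close> is restricted to commutative algebras, so
  associative algebras are introduced here on the same record type.
\<close>

definition k_algebra :: "('k::field, 'a) module \<Rightarrow> bool"
  where "k_algebra A \<longleftrightarrow> ring A \<and> module (class_ring :: 'k ring) A \<and>
    (\<forall>c. \<forall>a\<in>carrier A. \<forall>b\<in>carrier A.
       (c \<odot>\<^bsub>A\<^esub> a) \<otimes>\<^bsub>A\<^esub> b = c \<odot>\<^bsub>A\<^esub> (a \<otimes>\<^bsub>A\<^esub> b) \<and>
       a \<otimes>\<^bsub>A\<^esub> (c \<odot>\<^bsub>A\<^esub> b) = c \<odot>\<^bsub>A\<^esub> (a \<otimes>\<^bsub>A\<^esub> b))"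

definition k_alg_hom :: "('k::field, 'a) module \<Rightarrow> ('k, 'b) module \<Rightarrow> ('a \<Rightarrow> 'b) set"
  where "k_alg_hom A B =
    {f \<in> Ring.ring_hom A B. \<forall>c. \<forall>a\<in>carrier A. f (c \<odot>\<^bsub>A\<^esub> a) = c \<odot>\<^bsub>B\<^esub> f a}"

definition k_alg_aut :: "('k::field, 'a) module \<Rightarrow> ('a \<Rightarrow> 'a) monoid"
  where "k_alg_aut A = (BijGroup (carrier A))\<lparr>carrier := Bij (carrier A) \<inter> k_alg_hom A A\<rparr>"

definition k_alg_action ::
    "('g, 'm) monoid_scheme \<Rightarrow> ('k::field, 'a) module \<Rightarrow> ('g \<Rightarrow> 'a \<Rightarrow> 'a) \<Rightarrow> bool"
  where "k_alg_action G A \<alpha> \<longleftrightarrow> group_action G (carrier A) \<alpha> \<and>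
    (\<forall>g\<in>carrier G. \<alpha> g \<in> k_alg_hom A A)"

definition centre :: "('a, 'm) ring_scheme \<Rightarrow> 'a set"
  where "centre A = {z \<in> carrier A. \<forall>a\<in>carrier A. z \<otimes>\<^bsub>A\<^esub> a = a \<otimes>\<^bsub>A\<^esub> z}"

definition simple_ring :: "('a, 'm) ring_scheme \<Rightarrow> bool"
  where "simple_ring A \<longleftrightarrow> ring A \<and> \<one>\<^bsub>A\<^esub> \<noteq> \<zero>\<^bsub>A\<^esub> \<and>
    (\<forall>I. ideal I A \<longrightarrow> I = {\<zero>\<^bsub>A\<^esub>} \<or> I = carrier A)"

definition central_simple_algebra :: "('k::field, 'a) module \<Rightarrow> nat \<Rightarrow> bool"
  where "central_simple_algebra A n \<longleftrightarrow> k_algebra A \<and> simple_ring A \<and>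
    ring.dimension A (n\<^sup>2) (centre A) (carrier A) \<and>
    (\<exists>S. finite S \<and> S \<subseteq> centre A \<and>
         centre A = generate_field A (range (\<lambda>c. c \<odot>\<^bsub>A\<^esub> \<one>\<^bsub>A\<^esub>) \<union> S))"

text \<open>
  The direct sum decomposition \<open>E = \<Oplus> eE\<close> is given by orthogonal idempotents \<open>e\<close>.  The fields
  \<open>eE\<close> are separable over \<open>Z(A)\<close> automatically when the base field has characteristic zero.
\<close>

definition maximal_etale_subalgebra :: "('k::field, 'a) module \<Rightarrow> nat \<Rightarrow> 'a set \<Rightarrow> bool"
  where "maximal_etale_subalgebra A n E \<longleftrightarrow>
    subcring E A \<and> centre A \<subseteq> E \<and> ring.dimension A n (centre A) E \<and>
    (\<exists>I. finite I \<and> I \<subseteq> E \<and>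
         (\<forall>e\<in>I. \<forall>e'\<in>I. e \<otimes>\<^bsub>A\<^esub> e' = (if e = e' then e else \<zero>\<^bsub>A\<^esub>)) \<and>
         (\<Oplus>\<^bsub>A\<^esub>e\<in>I. e) = \<one>\<^bsub>A\<^esub> \<and>
         (\<forall>e\<in>I. field (A\<lparr>carrier := (\<lambda>a. e \<otimes>\<^bsub>A\<^esub> a) ` E, one := e\<rparr>)))"

definition maximal_subfield :: "('a, 'm) ring_scheme \<Rightarrow> 'a set \<Rightarrow> bool"
  where "maximal_subfield A L \<longleftrightarrow> subfield L A \<and> (\<forall>L'. subfield L' A \<and> L \<subseteq> L' \<longrightarrow> L' = L)"

definition invariant_under ::
    "('g, 'm) monoid_scheme \<Rightarrow> ('g \<Rightarrow> 'a \<Rightarrow> 'a) \<Rightarrow> 'a set \<Rightarrow> bool"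
  where "invariant_under G \<alpha> E \<longleftrightarrow> (\<forall>g\<in>carrier G. \<alpha> g ` E = E)"

section \<open>The algebra \<open>k\<^sub>n(X)\<close> and geometric actions\<close>

text \<open>
  A rational map is an equivalence class of functions, each regular (and equivariant) on some
  dense open set, two functions being equivalent if they agree on a dense open set.
\<close>

definition rat_reps ::
    "nat \<Rightarrow> ('k::field, 'x) fspace \<Rightarrow> ('k mat set \<Rightarrow> 'x \<Rightarrow> 'x) \<Rightarrow> ('x \<Rightarrow> 'k mat) set"
  where "rat_reps n X act =
    {f. \<exists>U. dense_open (ftop X) U \<and> morphism (subspace_of X U) (mat_space n) f \<and>
        (\<forall>P\<in>carrier (PGL n). \<forall>x\<in>U. act P x \<in> U \<longrightarrow> f (act P x) = pgl_conj n P (f x))}"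

definition rat_class ::
    "nat \<Rightarrow> ('k::field, 'x) fspace \<Rightarrow> ('k mat set \<Rightarrow> 'x \<Rightarrow> 'x) \<Rightarrow> ('x \<Rightarrow> 'k mat) \<Rightarrow> ('x \<Rightarrow> 'k mat) set"
  where "rat_class n X act f =
    {g \<in> rat_reps n X act. \<exists>U. dense_open (ftop X) U \<and> (\<forall>x\<in>U. g x = f x)}"

definition kn_algebra ::
    "nat \<Rightarrow> ('k::field, 'x) fspace \<Rightarrow> ('k mat set \<Rightarrow> 'x \<Rightarrow> 'x) \<Rightarrow> ('k, ('x \<Rightarrow> 'k mat) set) module"
  where "kn_algebra n X act =
    \<lparr>carrier = rat_class n X act ` rat_reps n X act,
     mult = (\<lambda>C D. \<Union>f\<in>C. \<Union>g\<in>D. rat_class n X act (\<lambda>x. f x * g x)),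
     one = rat_class n X act (\<lambda>_. 1\<^sub>m n),
     zero = rat_class n X act (\<lambda>_. 0\<^sub>m n n),
     add = (\<lambda>C D. \<Union>f\<in>C. \<Union>g\<in>D. rat_class n X act (\<lambda>x. f x + g x)),
     smult = (\<lambda>c C. \<Union>f\<in>C. rat_class n X act (\<lambda>x. c \<cdot>\<^sub>m f x))\<rparr>"

definition pgl_part ::
    "('g, 'm) monoid_scheme \<Rightarrow> ('g \<times> 'k mat set \<Rightarrow> 'x \<Rightarrow> 'x) \<Rightarrow> 'k mat set \<Rightarrow> 'x \<Rightarrow> 'x"
  where "pgl_part G act P = act (\<one>\<^bsub>G\<^esub>, P)"

definition kn_act ::
    "('g, 'm) monoid_scheme \<Rightarrow> nat \<Rightarrow> ('k::field, 'x) fspace \<Rightarrow> ('g \<times> 'k mat set \<Rightarrow> 'x \<Rightarrow> 'x) \<Rightarrow>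
     'g \<Rightarrow> ('x \<Rightarrow> 'k mat) set \<Rightarrow> ('x \<Rightarrow> 'k mat) set"
  where "kn_act G n X act g C =
    (\<Union>f\<in>C. rat_class n X (pgl_part G act) (\<lambda>x. f (act (inv\<^bsub>G\<^esub> g, \<one>\<^bsub>PGL n\<^esub>) x)))"

definition generically_free ::
    "('g, 'm) monoid_scheme \<Rightarrow> ('k, 'x) fspace \<Rightarrow> ('g \<Rightarrow> 'x \<Rightarrow> 'x) \<Rightarrow> bool"
  where "generically_free G X act \<longleftrightarrow>
    (\<exists>U. dense_open (ftop X) U \<and> (\<forall>x\<in>U. stabilizer G act x = {\<one>\<^bsub>G\<^esub>}))"

text \<open>
  \<open>associated_variety G S n A \<alpha> X act\<close>: the action \<open>\<alpha>\<close> of the algebraic group \<open>(G, S)\<close> on the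
  central simple algebra \<open>A\<close> of degree \<open>n\<close> is geometric, and \<open>X\<close> with the action \<open>act\<close>
  of \<open>G \<times> PGL\<^sub>n\<close> is an associated variety.
\<close>

definition associated_variety ::
    "('g, 'm) monoid_scheme \<Rightarrow> ('k::field, 'g) fspace \<Rightarrow> nat \<Rightarrow> ('k, 'a) module \<Rightarrow>
     ('g \<Rightarrow> 'a \<Rightarrow> 'a) \<Rightarrow> ('k, 'x) fspace \<Rightarrow> ('g \<times> 'k mat set \<Rightarrow> 'x \<Rightarrow> 'x) \<Rightarrow> bool"
  where "associated_variety G S n A \<alpha> X act \<longleftrightarrow>
    central_simple_algebra A n \<and> k_alg_action G A \<alpha> \<and>
    variety X \<and> irreducible_space (ftop X) \<and>
    regular_action (G \<times>\<times> PGL n) (prod_space S (PGL_space n)) X act \<and>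
    generically_free (PGL n) X (pgl_part G act) \<and>
    (\<exists>\<psi>. \<psi> \<in> k_alg_hom A (kn_algebra n X (pgl_part G act)) \<and>
         bij_betw \<psi> (carrier A) (carrier (kn_algebra n X (pgl_part G act))) \<and>
         (\<forall>g\<in>carrier G. \<forall>a\<in>carrier A. \<psi> (\<alpha> g a) = kn_act G n X act g (\<psi> a)))"

definition stabilizers_normalize_tori ::
    "('g, 'm) monoid_scheme \<Rightarrow> nat \<Rightarrow> ('k::field, 'x) fspace \<Rightarrow>
     ('g \<times> 'k mat set \<Rightarrow> 'x \<Rightarrow> 'x) \<Rightarrow> bool"
  where "stabilizers_normalize_tori G n X act \<longleftrightarrow>
    (\<exists>U. dense_open (ftop X) U \<and>
      (\<forall>x\<in>U. \<exists>T. maximal_torus n T \<and>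
         stabilizer (G \<times>\<times> PGL n) act x \<subseteq> carrier G \<times> normalizer (PGL n) T))"

section \<open>Skew polynomials and their division algebra of fractions\<close>

text \<open>
  \<open>k{x,y}\<close> with \<open>xy = \<zeta>yx\<close>.  The coefficient function \<open>f\<close> stands for \<open>\<Sum> f(i,j) y\<^sup>j x\<^sup>i\<close>, and
  \<open>(y\<^sup>j x\<^sup>i)(y\<^sup>l x\<^sup>m) = \<zeta>\<^sup>i\<^sup>l y\<^sup>j\<^sup>+\<^sup>l x\<^sup>i\<^sup>+\<^sup>m\<close>.
\<close>

definition skew_monom :: "nat \<Rightarrow> nat \<Rightarrow> nat \<times> nat \<Rightarrow> 'k::field"
  where "skew_monom i j = (\<lambda>m. if m = (i, j) then 1 else 0)"

definition skew_poly :: "'k::field \<Rightarrow> ('k, nat \<times> nat \<Rightarrow> 'k) module"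
  where "skew_poly \<zeta> =
    \<lparr>carrier = {f. finite {m. f m \<noteq> 0}},
     mult = (\<lambda>f g. \<lambda>(a, b). \<Sum>i\<le>a. \<Sum>j\<le>b. f (i, j) * g (a - i, b - j) * \<zeta> ^ (i * (b - j))),
     one = skew_monom 0 0,
     zero = (\<lambda>_. 0),
     add = (\<lambda>f g m. f m + g m),
     smult = (\<lambda>c f m. c * f m)\<rparr>"

lemma skew_monom_mult:
  "skew_monom i j \<otimes>\<^bsub>skew_poly \<zeta>\<^esub> skew_monom i' j' =
   \<zeta> ^ (i * j') \<odot>\<^bsub>skew_poly \<zeta>\<^esub> skew_monom (i + i') (j + j')"
proof
  fix m :: "nat \<times> nat"
  obtain a b where m: "m = (a, b)" by force
  have *: "skew_monom i j (u, v) * skew_monom i' j' (a - u, b - v) * \<zeta> ^ (u * (b - v)) =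
      (if v = j then if u = i then skew_monom i' j' (a - i, b - j) * \<zeta> ^ (i * (b - j)) else 0 else 0)"
    for u v by (auto simp: skew_monom_def)
  have "(\<Sum>u\<le>a. \<Sum>v\<le>b. skew_monom i j (u, v) * skew_monom i' j' (a - u, b - v) * \<zeta> ^ (u * (b - v)))
      = (if i \<le> a \<and> j \<le> b then skew_monom i' j' (a - i, b - j) * \<zeta> ^ (i * (b - j)) else 0)"
    unfolding * by (cases "j \<le> b") (simp_all add: sum.delta)
  also have "\<dots> = \<zeta> ^ (i * j') * skew_monom (i + i') (j + j') (a, b)"
    by (auto simp: skew_monom_def)
  finally show "(skew_monom i j \<otimes>\<^bsub>skew_poly \<zeta>\<^esub> skew_monom i' j') m =
      (\<zeta> ^ (i * j') \<odot>\<^bsub>skew_poly \<zeta>\<^esub> skew_monom (i + i') (j + j')) m"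
    by (simp add: skew_poly_def m)
qed

definition division_algebra_of_fractions ::
    "('k::field, 'r) module \<Rightarrow> ('k, 'a) module \<Rightarrow> ('r \<Rightarrow> 'a) \<Rightarrow> bool"
  where "division_algebra_of_fractions R A \<iota> \<longleftrightarrow>
    k_algebra A \<and> Units A = carrier A - {\<zero>\<^bsub>A\<^esub>} \<and>
    \<iota> \<in> k_alg_hom R A \<and> inj_on \<iota> (carrier R) \<and>
    (\<forall>a\<in>carrier A. \<exists>f\<in>carrier R. \<exists>g\<in>carrier R. g \<noteq> \<zero>\<^bsub>R\<^esub> \<and> a = \<iota> f \<otimes>\<^bsub>A\<^esub> inv\<^bsub>A\<^esub> (\<iota> g))"

section \<open>Representations\<close>

definition SL :: "nat \<Rightarrow> 'f::field mat monoid"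
  where "SL n = \<lparr>carrier = {m \<in> carrier_mat n n. det m = 1}, mult = (*), one = 1\<^sub>m n\<rparr>"

definition reducible_representation ::
    "('g, 'm) monoid_scheme \<Rightarrow> nat \<Rightarrow> ('g \<Rightarrow> 'f::field mat) \<Rightarrow> bool"
  where "reducible_representation G n \<phi> \<longleftrightarrow>
    (\<exists>W. VectorSpace.subspace class_ring W (module_vec TYPE('f) n) \<and> W \<noteq> {0\<^sub>v n} \<and> W \<noteq> carrier_vec n \<and>
         (\<forall>g\<in>carrier G. \<forall>w\<in>W. \<phi> g *\<^sub>v w \<in> W))"

end

theory Submission imports Defs "Jordan_Normal_Form.Char_Poly" begin

hide_const (open) Multiset.mult Polynomial.smult Modules.module

text \<open>
  Two facts about a symbol algebra with generators \<open>xy = \<zeta>yx\<close>, \<open>\<zeta>\<close> a primitive \<open>n\<close>-th root of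
  unity, carry all three parts.  Conjugation by the generators splits the algebra, and every subspace
  that is stable under both conjugations, into weight vectors, which are central multiples of the
  monomials \<open>x\<^sup>i y\<^sup>j\<close> (\<open>weight_vector_induct\<close>, \<open>weight_eq_monomial\<close>).  And two invertible matrices with
  \<open>XY = \<zeta>YX\<close> have a common basis in which \<open>X\<close> is diagonal with distinct eigenvalues
  (\<open>q_commuting_diagonalizable\<close>), so that \<open>X\<close> lies in exactly one maximal torus.

  For the first part, let \<open>X\<close> and \<open>Y\<close> be the values at a general point of the rational maps that
  correspond to the two generators.  If \<open>(g, P)\<close> fixes the point, conjugation by \<open>P\<close> moves \<open>X\<close> and \<open>Y\<close>
  in the way in which \<open>g\<close> moves the generators.  If \<open>g\<close> is a scaling, \<open>X\<close> is rescaled and \<open>P\<close>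
  normalizes its torus.  Otherwise one generator goes to a multiple of the other by a \<open>p\<close>-th root of unity, which
  forces \<open>X\<^sup>p = Y\<^sup>p\<close> because both powers are scalar; but \<open>x\<^sup>p\<close> and \<open>y\<^sup>p\<close> differ, so this fails
  generically (\<open>stabilizers_normalize_tori_of_generators\<close>).

  For the second part, an invariant maximal subfield is stable under the two conjugations, hence it
  contains a noncentral monomial, and it is the centralizer of that monomial.  The rotation maps
  monomials to monomials through the given matrix, and it fixes the centralizer exactly if the exponent vector
  is an eigenvector modulo \<open>p\<close> (\<open>invariant_maximal_subfield_iff\<close>).  In dimension two this is the
  reducibility of the representation (\<open>reducible_iff_eigenvector\<close>).

  The counterexample of the third part is the case \<open>p = 2\<close>, where the representation is irreducible.
  The group is the tetrahedral group, acting on triples of anticommuting matrices of square \<open>- 1\<close>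
  by rotations and sign changes, together with a parameter on which it acts through the cube roots of unity.  All
  triples are conjugate, so the variety is irreducible, its algebra of equivariant rational maps is a quaternion algebra over the
  rational functions in the parameter (\<open>central_gen\<close>, \<open>central_simple_KN\<close>), and the parameter
  forces stabilizers in general position to involve no rotation (\<open>stabilizers_tvar\<close>).  An invariant
  maximal etale subalgebra would contain all three axes, which do not commute (\<open>no_invariant_etale\<close>).
\<close>

abbreviation opens :: "('k, 'x) fspace => 'x set => bool"
  where "opens X \<equiv> openin (ftop X)"

section \<open>Spaces whose regular functions form a sheaf of k-algebras\<close>

text \<open>
  All spaces that occur below (zariski spaces, subspaces, products, quotients, varieties) share the
  following closure properties, and these are what makes morphisms easy to construct: a map into a
  zariski space is a morphism as soon as its coordinates are regular.
\<close>

definition k_space :: "('k::field, 'x) fspace => bool"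
 where "k_space X \<longleftrightarrow>
  (ALL U c. opens X U --> (%_. c)\<in>regfun X U) &
  (ALL U f g. opens X U & f\<in>regfun X U & g\<in>regfun X U -->
    (%x. f x + g x)\<in>regfun X U & (%x. f x * g x)\<in>regfun X U) &
  (ALL U f. opens X U & f\<in>regfun X U -->
    opens X {x\<in>U. f x~=0} & (%x. inverse (f x))\<in>regfun X {x\<in>U. f x~=0}) &
  (ALL U f. opens X U -->
    (f\<in>regfun X U \<longleftrightarrow>
     (ALL x:U. EX V g. opens X V & x\<in>V & g\<in>regfun X V & (ALL y:U\<inter>V. f y = g y))))"

lemma k_spaceI:
 assumes "!!U c. opens X U==>(%_. c)\<in>regfun X U"
  and "!!U f g. opens X U==>f\<in>regfun X U==>g\<in>regfun X U ==>
    (%x. f x + g x)\<in>regfun X U"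
  and "!!U f g. opens X U==>f\<in>regfun X U==>g\<in>regfun X U ==>
    (%x. f x * g x)\<in>regfun X U"
  and "!!U f. opens X U==>f\<in>regfun X U==>opens X {x\<in>U. f x~=0}"
  and "!!U f. opens X U==>f\<in>regfun X U ==>
    (%x. inverse (f x))\<in>regfun X {x\<in>U. f x~=0}"
  and "!!U f. opens X U ==>
    (!!x. x\<in>U==>EX V g. opens X V & x\<in>V & g\<in>regfun X V & (ALL y:U\<inter>V. f y = g y)) ==>
    f\<in>regfun X U"
 shows "k_space X"
 unfolding k_space_def
proof (intro conjI allI impI iffI ballI)
 fix U f x assume "opens X U" "f\<in>regfun X U" "x\<in>U"
 thus "EX V g. opens X V & x\<in>V & g\<in>regfun X V & (ALL y:U\<inter>V. f y = g y)" by blast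
qed (use assms in auto)

context
 fixes X :: "('k::field, 'x) fspace"
 assumes X: "k_space X"
begin

lemma regfun_const: "opens X U==>(%_. c)\<in>regfun X U"
 using X[unfolded k_space_def, THEN conjunct1] by blast

lemma regfun_add:
 "opens X U==>f\<in>regfun X U==>g\<in>regfun X U==>(%x. f x + g x)\<in>regfun X U"
 using X[unfolded k_space_def, THEN conjunct2, THEN conjunct1] by blast

lemma regfun_mult:
 "opens X U==>f\<in>regfun X U==>g\<in>regfun X U==>(%x. f x * g x)\<in>regfun X U"
 using X[unfolded k_space_def, THEN conjunct2, THEN conjunct1] by blast

lemma openin_regfun_nonzero:
 "opens X U==>f\<in>regfun X U==>opens X {x\<in>U. f x~=0}"
 using X[unfolded k_space_def, THEN conjunct2, THEN conjunct2, THEN conjunct1] by blast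

lemma regfun_inverse:
 "opens X U==>f\<in>regfun X U ==>
  (%x. inverse (f x))\<in>regfun X {x\<in>U. f x~=0}"
 using X[unfolded k_space_def, THEN conjunct2, THEN conjunct2, THEN conjunct1] by blast

lemma regfun_local:
 "opens X U ==>
  (!!x. x\<in>U==>EX V g. opens X V & x\<in>V & g\<in>regfun X V & (ALL y:U\<inter>V. f y = g y)) ==>
  f\<in>regfun X U"
 using X[unfolded k_space_def, THEN conjunct2, THEN conjunct2, THEN conjunct2, rule_format, THEN iffD2] by blast

lemma regfun_restrict:
 assumes "opens X U" "opens X V" "V \<subseteq> U" "f\<in>regfun X U" "!!x. x\<in>V==>f x = g x"
 shows "g\<in>regfun X V"
 by (rule regfun_local) (use assms in \<open>auto intro!: exI[of _ U] exI[of _ f]\<close>)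

lemma regfun_sum:
 assumes "opens X U" "!!i. i\<in>I==>f i\<in>regfun X U"
 shows "(%x. \<Sum>i\<in>I. f i x)\<in>regfun X U"
 using assms(2)
proof (induction I rule: infinite_finite_induct)
 case (insert i I)
 thus ?case using regfun_add[OF assms(1), of "f i" "%x. \<Sum>i\<in>I. f i x"] by simp
qed (use regfun_const[OF assms(1)] in auto)

lemma regfun_divide:
 assumes "opens X U" "f\<in>regfun X U" "g\<in>regfun X U"
 shows "(%x. f x / g x)\<in>regfun X {x\<in>U. g x~=0}"
 unfolding divide_inverse
 by (intro regfun_mult regfun_inverse openin_regfun_nonzero assms
    regfun_restrict[OF assms(1) _ _ assms(2)]) auto

end

subsection \<open>Zariski spaces\<close>

lemma openin_topology_generated_by_base:
 assumes "!!b c. b\<in>B==>c\<in>B==>b\<inter>c\<in>B"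
 shows "openin (topology_generated_by B) U \<longleftrightarrow> (ALL x:U. EX b:B. x\<in>b & b \<subseteq> U)"
proof
 assume "openin (topology_generated_by B) U"
 hence "generate_topology_on B U" by (simp add: openin_topology_generated_by_iff)
 thus "ALL x:U. EX b:B. x\<in>b & b \<subseteq> U"
 proof induction
  case (Int a b)
  show ?case
  proof
   fix x assume "x\<in>a\<inter>b"
   then obtain c d where cd: "c\<in>B" "x\<in>c" "c \<subseteq> a" "d\<in>B" "x\<in>d" "d \<subseteq> b"
    using Int.IH by (meson IntD1 IntD2)
   show "EX e:B. x\<in>e & e \<subseteq> a\<inter>b"
    by (rule bexI[of _ "c\<inter>d"]) (use cd assms[of c d] in auto)
  qed
 next
  case (UN K)
  show ?case
  proof
   fix x assume "x\<in>\<Union>K"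
   then obtain k where k: "k\<in>K" "x\<in>k" by (rule UnionE)
   with UN.IH[OF k(1)] obtain b where "b\<in>B" "x\<in>b" "b \<subseteq> k" by (meson bspec)
   with k show "EX b:B. x\<in>b & b \<subseteq> \<Union>K" by (intro bexI[of _ b]) auto
  qed
 next
  case (Basis s)
  thus ?case by (intro ballI bexI[of _ s]) auto
 qed simp
next
 assume *: "ALL x:U. EX b:B. x\<in>b & b \<subseteq> U"
 hence "U = \<Union>{b\<in>B. b \<subseteq> U}" by fast
 moreover have "openin (topology_generated_by B) (\<Union>{b\<in>B. b \<subseteq> U})"
  by (rule openin_Union) (auto intro: topology_generated_by_Basis)
 ultimately show "openin (topology_generated_by B) U" by simp
qed

lemma openin_zariski:
 "openin (ftop (zariski_space S F)) U \<longleftrightarrow>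
  (ALL x:U. EX q:polyfun F. x\<in>S & q x~=0 & (ALL y:S. q y~=0 --> y\<in>U))"
proof -
 have "openin (ftop (zariski_space S F)) U \<longleftrightarrow>
   (ALL x:U. EX b:{{x\<in>S. q x~=0} | q. q\<in>polyfun F}. x\<in>b & b \<subseteq> U)"
  unfolding zariski_space_def fspace.simps
 proof (rule openin_topology_generated_by_base, clarify)
  fix q r assume "q\<in>polyfun F" "r\<in>polyfun F"
  thus "EX qa. {x\<in>S. q x~=0}\<inter>{x\<in>S. r x~=0} = {x\<in>S. qa x~=0} & qa\<in>polyfun F"
   by (intro exI[of _ "%x. q x * r x"] conjI polyfun_mult) auto
 qed
 also have "... \<longleftrightarrow> (ALL x:U. EX q:polyfun F. x\<in>S & q x~=0 & (ALL y:S. q y~=0 --> y\<in>U))"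
  by (simp add: setcompr_eq_image subset_iff conj_assoc Ball_def imp_conjL)
 finally show ?thesis .
qed

lemma openin_zariski_nonzero:
 "q\<in>polyfun F==>openin (ftop (zariski_space S F)) {x\<in>S. q x~=0}"
 unfolding openin_zariski by blast

lemma points_zariski [simp]: "points (zariski_space S F) = S"
proof
 show "S \<subseteq> points (zariski_space S F)"
  using openin_subset[OF openin_zariski_nonzero[OF polyfun_const[of 1 F]]] by auto
 show "points (zariski_space S F) \<subseteq> S"
  using openin_topspace[of "ftop (zariski_space S F)"] unfolding openin_zariski by blast
qed

lemma regfun_zariski:
 "f\<in>regfun (zariski_space S F) U \<longleftrightarrow>
  (ALL x:U. EX g:polyfun F. EX h:polyfun F. h x~=0 & (ALL y:U. h y~=0 --> f y = g y / h y))"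
 by (simp add: zariski_space_def)

lemma k_space_zariski: "k_space (zariski_space S F)"
proof (rule k_spaceI)
 let ?X = "zariski_space S F"
 fix U assume U: "openin (ftop ?X) U"
 show "(%_. c)\<in>regfun ?X U" for c
  unfolding regfun_zariski
  by (intro ballI bexI[of _ "%_. c"] bexI[of _ "%_. 1"]) (auto intro: polyfun_const)
 show "(%x. f x + g x)\<in>regfun ?X U" if "f\<in>regfun ?X U" "g\<in>regfun ?X U" for f g
  unfolding regfun_zariski
 proof
  fix x assume "x\<in>U"
  with that obtain a b c d where *: "a\<in>polyfun F" "b\<in>polyfun F" "c\<in>polyfun F" "d\<in>polyfun F"
   "b x~=0" "d x~=0" "ALL y:U. b y~=0 --> f y = a y / b y" "ALL y:U. d y~=0 --> g y = c y / d y"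
   unfolding regfun_zariski by metis
  show "EX a:polyfun F. EX b:polyfun F. b x~=0 & (ALL y:U. b y~=0 --> f y + g y = a y / b y)"
   by (intro bexI[of _ "%y. a y * d y + c y * b y"] bexI[of _ "%y. b y * d y"] polyfun_add polyfun_mult *)
     (use * in \<open>auto simp: add_frac_eq\<close>)
 qed
 show "(%x. f x * g x)\<in>regfun ?X U" if "f\<in>regfun ?X U" "g\<in>regfun ?X U" for f g
  unfolding regfun_zariski
 proof
  fix x assume "x\<in>U"
  with that obtain a b c d where *: "a\<in>polyfun F" "b\<in>polyfun F" "c\<in>polyfun F" "d\<in>polyfun F"
   "b x~=0" "d x~=0" "ALL y:U. b y~=0 --> f y = a y / b y" "ALL y:U. d y~=0 --> g y = c y / d y"
   unfolding regfun_zariski by metis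
  show "EX a:polyfun F. EX b:polyfun F. b x~=0 & (ALL y:U. b y~=0 --> f y * g y = a y / b y)"
   by (intro bexI[of _ "%y. a y * c y"] bexI[of _ "%y. b y * d y"] polyfun_mult *)
     (use * in auto)
 qed
 fix f
 {
  fix x assume f: "f\<in>regfun ?X U" and x: "x\<in>U" and nz: "f x~=0"
  then obtain a b where *: "a\<in>polyfun F" "b\<in>polyfun F" "b x~=0" "ALL y:U. b y~=0 --> f y = a y / b y"
   unfolding regfun_zariski by metis
  hence "a x~=0" using nz x by auto
  with * have "EX a:polyfun F. EX b:polyfun F. a x~=0 & b x~=0 & (ALL y:U. b y~=0 --> f y = a y / b y)"
   by auto
 } note local_quot = this
 show "openin (ftop ?X) {x\<in>U. f x~=0}" if f: "f\<in>regfun ?X U"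
  unfolding openin_zariski
 proof
  fix x assume x: "x\<in>{x\<in>U. f x~=0}"
  then obtain a b where *: "a\<in>polyfun F" "b\<in>polyfun F" "a x~=0" "b x~=0"
   "ALL y:U. b y~=0 --> f y = a y / b y" using local_quot[OF f] by blast
  from U x obtain q where q: "q\<in>polyfun F" "x\<in>S" "q x~=0" "ALL y:S. q y~=0 --> y\<in>U"
   unfolding openin_zariski by blast
  show "EX q:polyfun F. x\<in>S & q x~=0 & (ALL y:S. q y~=0 --> y\<in>{x\<in>U. f x~=0})"
   by (intro bexI[of _ "%y. q y * (a y * b y)"] polyfun_mult q *) (use q * in auto)
 qed
 show "(%x. inverse (f x))\<in>regfun ?X {x\<in>U. f x~=0}" if f: "f\<in>regfun ?X U"
  unfolding regfun_zariski
 proof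
  fix x assume x: "x\<in>{x\<in>U. f x~=0}"
  then obtain a b where *: "a\<in>polyfun F" "b\<in>polyfun F" "a x~=0" "b x~=0"
   "ALL y:U. b y~=0 --> f y = a y / b y" using local_quot[OF f] by blast
  show "EX g:polyfun F. EX h:polyfun F. h x~=0 &
    (ALL y:{x\<in>U. f x~=0}. h y~=0 --> inverse (f y) = g y / h y)"
   by (intro bexI[of _ "%y. b y * b y"] bexI[of _ "%y. a y * b y"] polyfun_mult *)
     (use * in auto)
 qed
 show "f\<in>regfun ?X U"
  if "!!x. x\<in>U==>EX V g. openin (ftop ?X) V & x\<in>V & g\<in>regfun ?X V & (ALL y:U\<inter>V. f y = g y)"
  unfolding regfun_zariski
 proof
  fix x assume x: "x\<in>U"
  from that[OF this] obtain V g where V: "openin (ftop ?X) V" "x\<in>V" "g\<in>regfun ?X V"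
   "ALL y:U\<inter>V. f y = g y" by blast
  then obtain a b where *: "a\<in>polyfun F" "b\<in>polyfun F" "b x~=0"
   "ALL y:V. b y~=0 --> g y = a y / b y" unfolding regfun_zariski by metis
  from V obtain q where q: "q\<in>polyfun F" "x\<in>S" "q x~=0" "ALL y:S. q y~=0 --> y\<in>V"
   unfolding openin_zariski by blast
  have "U \<subseteq> S" using openin_subset[OF U] by simp
  thus "EX g:polyfun F. EX h:polyfun F. h x~=0 & (ALL y:U. h y~=0 --> f y = g y / h y)"
   by (intro bexI[of _ "%y. a y * q y"] bexI[of _ "%y. b y * q y"] polyfun_mult q *)
     (use q * V in auto)
 qed
qed

lemma polyfun_regular: "q\<in>polyfun F==>q\<in>regfun (zariski_space S F) U"
 unfolding regfun_zariski
 by (intro ballI bexI[of _ q] bexI[of _ "%_. 1"]) (auto intro: polyfun_const)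

subsection \<open>Subspaces\<close>

lemma ftop_subspace [simp]: "ftop (subspace_of X S) = subtopology (ftop X) S"
 by (simp add: subspace_of_def)

lemma regfun_subspace:
 "f\<in>regfun (subspace_of X S) V \<longleftrightarrow>
  (ALL x:V. EX W g. opens X W & x\<in>W & g\<in>regfun X W & (ALL y:V\<inter>W. f y = g y))"
 by (simp add: subspace_of_def)

lemma k_space_subspace:
 assumes X: "k_space X"
 shows "k_space (subspace_of X S)"
proof (rule k_spaceI)
 let ?Y = "subspace_of X S"
 fix V assume V: "openin (ftop ?Y) V"
 then obtain T where T: "opens X T" "V = T\<inter>S" by (auto simp: openin_subtopology)
 show "(%_. c)\<in>regfun ?Y V" for c
  unfolding regfun_subspace using T regfun_const[OF X T(1)] by blast
 {
  fix f g x assume fg: "f\<in>regfun ?Y V" "g\<in>regfun ?Y V" and x: "x\<in>V"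
  from fg(1) x obtain W1 f1 where 1: "opens X W1" "x\<in>W1" "f1\<in>regfun X W1" "ALL y:V\<inter>W1. f y = f1 y"
   unfolding regfun_subspace by blast
  from fg(2) x obtain W2 f2 where 2: "opens X W2" "x\<in>W2" "f2\<in>regfun X W2" "ALL y:V\<inter>W2. g y = f2 y"
   unfolding regfun_subspace by blast
  have W: "opens X (W1\<inter>W2)" using 1 2 by blast
  have "f1\<in>regfun X (W1\<inter>W2)" "f2\<in>regfun X (W1\<inter>W2)"
   using regfun_restrict[OF X 1(1) W _ 1(3)] regfun_restrict[OF X 2(1) W _ 2(3)] by auto
  with W 1 2 have "EX W f1 f2. opens X W & x\<in>W & f1\<in>regfun X W & f2\<in>regfun X W &
    (ALL y:V\<inter>W. f y = f1 y & g y = f2 y)" by blast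
 } note common = this
 show "(%x. f x + g x)\<in>regfun ?Y V" if "f\<in>regfun ?Y V" "g\<in>regfun ?Y V" for f g
  unfolding regfun_subspace
 proof
  fix x assume "x\<in>V"
  from common[OF that this] obtain W f1 f2 where "opens X W" "x\<in>W" "f1\<in>regfun X W" "f2\<in>regfun X W"
    "ALL y:V\<inter>W. f y = f1 y & g y = f2 y" by blast
  thus "EX W h. opens X W & x\<in>W & h\<in>regfun X W & (ALL y:V\<inter>W. f y + g y = h y)"
   using regfun_add[OF X, of W f1 f2] by (intro exI[of _ W] exI[of _ "%y. f1 y + f2 y"]) auto
 qed
 show "(%x. f x * g x)\<in>regfun ?Y V" if "f\<in>regfun ?Y V" "g\<in>regfun ?Y V" for f g
  unfolding regfun_subspace
 proof
  fix x assume "x\<in>V"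
  from common[OF that this] obtain W f1 f2 where "opens X W" "x\<in>W" "f1\<in>regfun X W" "f2\<in>regfun X W"
    "ALL y:V\<inter>W. f y = f1 y & g y = f2 y" by blast
  thus "EX W h. opens X W & x\<in>W & h\<in>regfun X W & (ALL y:V\<inter>W. f y * g y = h y)"
   using regfun_mult[OF X, of W f1 f2] by (intro exI[of _ W] exI[of _ "%y. f1 y * f2 y"]) auto
 qed
 fix f
 show "openin (ftop ?Y) {x\<in>V. f x~=0}" if f: "f\<in>regfun ?Y V"
 proof (subst openin_subopen, intro ballI)
  fix x assume x: "x\<in>{x\<in>V. f x~=0}"
  with f obtain W g where W: "opens X W" "x\<in>W" "g\<in>regfun X W" "ALL y:V\<inter>W. f y = g y"
   unfolding regfun_subspace by blast
  have "opens X (T\<inter>{y\<in>W. g y~=0})" using openin_regfun_nonzero[OF X W(1,3)] T by blast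
  hence "openin (ftop ?Y) (S\<inter>(T\<inter>{y\<in>W. g y~=0}))" by (simp add: openin_subtopology_Int2)
  moreover have "x\<in>S\<inter>(T\<inter>{y\<in>W. g y~=0})" "S\<inter>(T\<inter>{y\<in>W. g y~=0}) \<subseteq> {x\<in>V. f x~=0}"
   using W T x by auto
  ultimately show "EX T. openin (ftop ?Y) T & x\<in>T & T \<subseteq> {x\<in>V. f x~=0}" by blast
 qed
 show "(%x. inverse (f x))\<in>regfun ?Y {x\<in>V. f x~=0}" if f: "f\<in>regfun ?Y V"
  unfolding regfun_subspace
 proof
  fix x assume x: "x\<in>{x\<in>V. f x~=0}"
  with f obtain W g where W: "opens X W" "x\<in>W" "g\<in>regfun X W" "ALL y:V\<inter>W. f y = g y"
   unfolding regfun_subspace by blast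
  show "EX W g. opens X W & x\<in>W & g\<in>regfun X W &
    (ALL y:{x\<in>V. f x~=0}\<inter>W. inverse (f y) = g y)"
   by (rule exI[of _ "{x\<in>W. g x~=0}"], rule exI[of _ "%x. inverse (g x)"])
     (use W x openin_regfun_nonzero[OF X W(1,3)] regfun_inverse[OF X W(1,3)] in auto)
 qed
 show "f\<in>regfun ?Y V"
  if "!!x. x\<in>V==>EX U g. openin (ftop ?Y) U & x\<in>U & g\<in>regfun ?Y U & (ALL y:V\<inter>U. f y = g y)"
  unfolding regfun_subspace
 proof
  fix x assume x: "x\<in>V"
  from that[OF this] obtain U g where U: "openin (ftop ?Y) U" "x\<in>U" "g\<in>regfun ?Y U"
   "ALL y:V\<inter>U. f y = g y" by blast
  then obtain T' where T': "opens X T'" "U = T'\<inter>S" by (auto simp: openin_subtopology)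
  from U obtain W h where W: "opens X W" "x\<in>W" "h\<in>regfun X W" "ALL y:U\<inter>W. g y = h y"
   unfolding regfun_subspace by blast
  have o: "opens X (W\<inter>T')" using W T' by blast
  show "EX W h. opens X W & x\<in>W & h\<in>regfun X W & (ALL y:V\<inter>W. f y = h y)"
   by (rule exI[of _ "W\<inter>T'"], rule exI[of _ h])
     (use o W T' T U x regfun_restrict[OF X W(1) o _ W(3)] in auto)
 qed
qed

subsection \<open>Products\<close>

lemma tensor_functions_add:
 assumes "h1\<in>tensor_functions X Y U V" "h2\<in>tensor_functions X Y U V"
 shows "(%z. h1 z + h2 z)\<in>tensor_functions X Y U V"
proof -
 from assms(1) obtain m f g where 1: "ALL i<m. f i\<in>regfun X U & g i\<in>regfun Y V"
  "h1 = (%(x, y). \<Sum>i<(m::nat). f i x * g i y)" unfolding tensor_functions_def by blast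
 from assms(2) obtain n f' g' where 2: "ALL i<n. f' i\<in>regfun X U & g' i\<in>regfun Y V"
  "h2 = (%(x, y). \<Sum>i<(n::nat). f' i x * g' i y)" unfolding tensor_functions_def by blast
 let ?F = "%i. if i < m then f i else f' (i - m)" and ?G = "%i. if i < m then g i else g' (i - m)"
 have "(\<Sum>i<m+n. ?F i x * ?G i y) = (\<Sum>i<m. f i x * g i y) + (\<Sum>i<n. f' i x * g' i y)" for x y
 proof -
  have "(\<Sum>i<k. ?F (m + i) x * ?G (m + i) y) = (\<Sum>i<k. f' i x * g' i y)" for k
   by (induction k) auto
  moreover have "(\<Sum>i<m+n. ?F i x * ?G i y) = (\<Sum>i<m. ?F i x * ?G i y) + (\<Sum>i<n. ?F (m + i) x * ?G (m + i) y)"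
   by (induction n) (auto simp: add.assoc)
  ultimately show ?thesis by simp
 qed
 hence "(%z. h1 z + h2 z) = (%(x, y). \<Sum>i<m+n. ?F i x * ?G i y)"
  using 1 2 by (auto simp: fun_eq_iff)
 moreover have "ALL i<m+n. ?F i\<in>regfun X U & ?G i\<in>regfun Y V" using 1 2 by auto
 ultimately show ?thesis unfolding tensor_functions_def
  by (intro CollectI exI[of _ "m + n"] exI[of _ ?F] exI[of _ ?G] conjI)
qed

lemma tensor_functions_simple:
 "f\<in>regfun X U==>g\<in>regfun Y V==>(%z. f (fst z) * g (snd z))\<in>tensor_functions X Y U V"
 unfolding tensor_functions_def
 by (rule CollectI, rule exI[of _ 1], rule exI[of _ "%_. f"], rule exI[of _ "%_. g"]) auto

lemma tensor_functions_induct [consumes 1, case_names zero add]: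
 assumes "h\<in>tensor_functions X Y U V" "P (%_. 0)"
  "!!f g h. f\<in>regfun X U==>g\<in>regfun Y V==>P h==>P (%z. h z + f (fst z) * g (snd z))"
 shows "P h"
proof -
 from assms(1) obtain m f g where 1: "ALL i<m. f i\<in>regfun X U & g i\<in>regfun Y V"
  "h = (%(x, y). \<Sum>i<(m::nat). f i x * g i y)" unfolding tensor_functions_def by blast
 from 1(1) have "P (%(x, y). \<Sum>i<(m::nat). f i x * g i y)"
 proof (induction m)
  case (Suc m)
  hence "P (%z. (%(x, y). \<Sum>i<(m::nat). f i x * g i y) z + f m (fst z) * g m (snd z))"
   by (intro assms(3)) auto
  thus ?case by (simp add: case_prod_beta)
 qed (use assms(2) in \<open>simp add: case_prod_unfold\<close>)
 thus ?thesis using 1 by simp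
qed

context
 fixes X :: "('k::field, 'x) fspace" and Y :: "('k, 'y) fspace"
 assumes X: "k_space X" and Y: "k_space Y"
begin

lemma tensor_functions_zero:
 "opens X U==>opens Y V==>(%_. 0)\<in>tensor_functions X Y U V"
 using tensor_functions_simple[OF regfun_const[OF X] regfun_const[OF Y], of U V 0 0] by simp

lemma tensor_functions_one:
 "opens X U==>opens Y V==>(%_. c)\<in>tensor_functions X Y U V"
 using tensor_functions_simple[OF regfun_const[OF X] regfun_const[OF Y], of U V c 1] by simp

lemma tensor_functions_mult:
 assumes o: "opens X U" "opens Y V"
  and h: "h1\<in>tensor_functions X Y U V" "h2\<in>tensor_functions X Y U V"
 shows "(%z. h1 z * h2 z)\<in>tensor_functions X Y U V"
 using h(1)
proof (induction rule: tensor_functions_induct)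
 case zero thus ?case using tensor_functions_zero[OF o] by simp
next
 case (add f g h1)
 have "(%z. f (fst z) * g (snd z) * h2 z)\<in>tensor_functions X Y U V"
  using h(2)
 proof (induction rule: tensor_functions_induct)
  case zero thus ?case using tensor_functions_zero[OF o] by simp
 next
  case (add f' g' h')
  have "(%z. f (fst z) * g (snd z) * h' z + (f (fst z) * f' (fst z)) * (g (snd z) * g' (snd z)))
   \<in>tensor_functions X Y U V"
   by (intro tensor_functions_add add(3)
     tensor_functions_simple[of "%x. f x * f' x" _ _ "%y. g y * g' y"]
     regfun_mult[OF X o(1)] regfun_mult[OF Y o(2)] add \<open>f\<in>_\<close> \<open>g\<in>_\<close>)
  thus ?case by (simp add: algebra_simps)
 qed
 from tensor_functions_add[OF add(3) this] show ?case by (simp add: algebra_simps)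
qed

lemma tensor_functions_restrict:
 assumes "opens X U" "opens Y V" "opens X U'" "opens Y V'"
  "U' \<subseteq> U" "V' \<subseteq> V" "h\<in>tensor_functions X Y U V"
 shows "h\<in>tensor_functions X Y U' V'"
 using assms(7)
proof (induction rule: tensor_functions_induct)
 case zero thus ?case using tensor_functions_zero assms by blast
next
 case (add f g h)
 show ?case
  by (intro tensor_functions_add add tensor_functions_simple
    regfun_restrict[OF X assms(1,3,5) add(1)] regfun_restrict[OF Y assms(2,4,6) add(2)]) auto
qed

lemma openin_prod:
 "openin (ftop (prod_space X Y)) W \<longleftrightarrow>
  (ALL w:W. EX U V h. opens X U & opens Y V & h\<in>tensor_functions X Y U V &
   w\<in>U\<times>V & h w~=0 & {z\<in>U\<times>V. h z~=0} \<subseteq> W)"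
proof -
 let ?B = "{{z\<in>U\<times>V. h z~=0} | U V h.
     opens X U & opens Y V & h\<in>tensor_functions X Y U V}"
 have "openin (ftop (prod_space X Y)) W \<longleftrightarrow> (ALL x:W. EX b:?B. x\<in>b & b \<subseteq> W)"
  unfolding prod_space_def fspace.simps
 proof (rule openin_topology_generated_by_base)
  fix b c assume "b\<in>?B" "c\<in>?B"
  then obtain U V h U' V' h' where
   1: "opens X U" "opens Y V" "h\<in>tensor_functions X Y U V" "b = {z\<in>U\<times>V. h z~=0}" and
   2: "opens X U'" "opens Y V'" "h'\<in>tensor_functions X Y U' V'" "c = {z\<in>U'\<times>V'. h' z~=0}"
   by blast
  let ?U = "U\<inter>U'" and ?V = "V\<inter>V'"
  have o: "opens X ?U" "opens Y ?V" using 1 2 by blast+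
  have "(%z. h z * h' z)\<in>tensor_functions X Y ?U ?V"
   by (intro tensor_functions_mult o tensor_functions_restrict[OF 1(1,2) o _ _ 1(3)]
     tensor_functions_restrict[OF 2(1,2) o _ _ 2(3)]) auto
  moreover have "b\<inter>c = {z\<in>?U\<times>?V. h z * h' z~=0}" using 1 2 by auto
  ultimately show "b\<inter>c\<in>?B"
   by (intro CollectI exI[of _ ?U] exI[of _ ?V] exI[of _ "%z. h z * h' z"] conjI o)
 qed
 also have "... \<longleftrightarrow> (ALL w:W. EX U V h. opens X U & opens Y V & h\<in>tensor_functions X Y U V &
   w\<in>U\<times>V & h w~=0 & {z\<in>U\<times>V. h z~=0} \<subseteq> W)"
 proof (rule ball_cong[OF refl], rule iffI)
  fix w assume "EX b:?B. w\<in>b & b \<subseteq> W"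
  then obtain b where b: "b\<in>?B" "w\<in>b" "b \<subseteq> W" by (elim bexE conjE) (rule that)
  from b(1) obtain U V h where *: "b = {z\<in>U\<times>V. h z~=0}" "opens X U" "opens Y V"
   "h\<in>tensor_functions X Y U V" by (elim CollectE exE conjE) (rule that)
  show "EX U V h. opens X U & opens Y V & h\<in>tensor_functions X Y U V &
   w\<in>U\<times>V & h w~=0 & {z\<in>U\<times>V. h z~=0} \<subseteq> W"
   by (rule exI[of _ U], rule exI[of _ V], rule exI[of _ h]) (use b * in auto)
 next
  fix w assume "EX U V h. opens X U & opens Y V & h\<in>tensor_functions X Y U V &
   w\<in>U\<times>V & h w~=0 & {z\<in>U\<times>V. h z~=0} \<subseteq> W"
  then obtain U V h where *: "opens X U" "opens Y V" "h\<in>tensor_functions X Y U V"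
   "w\<in>U\<times>V" "h w~=0" "{z\<in>U\<times>V. h z~=0} \<subseteq> W" by (elim exE conjE) (rule that)
  show "EX b:?B. w\<in>b & b \<subseteq> W"
   by (rule bexI[of _ "{z\<in>U\<times>V. h z~=0}"], use * in simp,
     intro CollectI exI[of _ U] exI[of _ V] exI[of _ h] conjI refl *(1-3))
 qed
 finally show ?thesis .
qed

lemma openin_prod_tensor:
 "opens X U==>opens Y V==>h\<in>tensor_functions X Y U V ==>
  openin (ftop (prod_space X Y)) {z\<in>U\<times>V. h z~=0}"
 unfolding openin_prod by blast

lemma openin_prod_Times:
 "opens X U==>opens Y V==>openin (ftop (prod_space X Y)) (U\<times>V)"
 using openin_prod_tensor[of U V "%_. 1"] tensor_functions_one[of U V 1] by simp

lemma points_prod: "points (prod_space X Y) = points X\<times>points Y"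
proof
 show "points X\<times>points Y \<subseteq> points (prod_space X Y)"
  by (rule openin_subset[OF openin_prod_Times]) auto
 show "points (prod_space X Y) \<subseteq> points X\<times>points Y"
 proof
  fix w assume "w\<in>points (prod_space X Y)"
  from openin_prod[THEN iffD1, OF openin_topspace, rule_format, OF this]
  obtain U V where "opens X U" "opens Y V" "w\<in>U\<times>V"
   by (elim exE conjE) (rule that)
  thus "w\<in>points X\<times>points Y" using openin_subset[of "ftop X" U] openin_subset[of "ftop Y" V] by auto
 qed
qed

lemma regfun_prod:
 "f\<in>regfun (prod_space X Y) W \<longleftrightarrow>
  (ALL w:W. EX U V g h. opens X U & opens Y V & w\<in>U\<times>V &
     g\<in>tensor_functions X Y U V & h\<in>tensor_functions X Y U V & h w~=0 &
     (ALL z:W\<inter>U\<times>V. h z~=0 --> f z = g z / h z))"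
 by (simp add: prod_space_def)

lemma tensor_functions_regular:
 "opens X U==>opens Y V==>h\<in>tensor_functions X Y U V ==>
  h\<in>regfun (prod_space X Y) (U\<times>V)"
 unfolding regfun_prod
 by (rule ballI, rule exI[of _ U], rule exI[of _ V], rule exI[of _ h], rule exI[of _ "%_. 1"])
   (auto intro: tensor_functions_one)

lemma k_space_prod: "k_space (prod_space X Y)"
proof (rule k_spaceI)
 let ?P = "prod_space X Y"
 fix W assume W: "openin (ftop ?P) W"
 have WP: "W \<subseteq> points X\<times>points Y" using openin_subset[OF W] points_prod by simp
 show "(%_. c)\<in>regfun ?P W" for c
  unfolding regfun_prod
  by (rule ballI, rule exI[of _ "points X"], rule exI[of _ "points Y"], rule exI[of _ "%_. c"],
    rule exI[of _ "%_. 1"]) (use WP in \<open>auto intro: tensor_functions_one\<close>)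
 {
  fix f1 f2 w assume f: "f1\<in>regfun ?P W" "f2\<in>regfun ?P W" and w: "w\<in>W"
  from regfun_prod[THEN iffD1, OF f(1), rule_format, OF w] obtain U V g h where
   1: "opens X U" "opens Y V" "w\<in>U\<times>V" "g\<in>tensor_functions X Y U V"
    "h\<in>tensor_functions X Y U V" "h w~=0" "ALL z:W\<inter>U\<times>V. h z~=0 --> f1 z = g z / h z"
   by (elim exE conjE) (rule that)
  from regfun_prod[THEN iffD1, OF f(2), rule_format, OF w] obtain U' V' g' h' where
   2: "opens X U'" "opens Y V'" "w\<in>U'\<times>V'" "g'\<in>tensor_functions X Y U' V'"
    "h'\<in>tensor_functions X Y U' V'" "h' w~=0" "ALL z:W\<inter>U'\<times>V'. h' z~=0 --> f2 z = g' z / h' z"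
   by (elim exE conjE) (rule that)
  let ?U = "U\<inter>U'" and ?V = "V\<inter>V'"
  have o: "opens X ?U" "opens Y ?V" using 1 2 by blast+
  have "g\<in>tensor_functions X Y ?U ?V" "h\<in>tensor_functions X Y ?U ?V"
   "g'\<in>tensor_functions X Y ?U ?V" "h'\<in>tensor_functions X Y ?U ?V"
   using tensor_functions_restrict[OF 1(1,2) o _ _ 1(4)] tensor_functions_restrict[OF 1(1,2) o _ _ 1(5)]
    tensor_functions_restrict[OF 2(1,2) o _ _ 2(4)] tensor_functions_restrict[OF 2(1,2) o _ _ 2(5)]
   by auto
  hence "EX U V g h g' h'. opens X U & opens Y V & w\<in>U\<times>V &
    g\<in>tensor_functions X Y U V & h\<in>tensor_functions X Y U V & g'\<in>tensor_functions X Y U V &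
    h'\<in>tensor_functions X Y U V & h w~=0 & h' w~=0 &
    (ALL z:W\<inter>U\<times>V. (h z~=0 --> f1 z = g z / h z) & (h' z~=0 --> f2 z = g' z / h' z))"
   by (intro exI[of _ ?U] exI[of _ ?V] exI[of _ g] exI[of _ h] exI[of _ g'] exI[of _ h'])
     (use 1 2 o in auto)
 } note common = this
 show "(%x. f1 x + f2 x)\<in>regfun ?P W" if f: "f1\<in>regfun ?P W" "f2\<in>regfun ?P W" for f1 f2
  unfolding regfun_prod
 proof
  fix w assume "w\<in>W"
  from common[OF f this] obtain U V g h g' h' where o: "opens X U" "opens Y V" and
    *: "w\<in>U\<times>V" "g\<in>tensor_functions X Y U V" "h\<in>tensor_functions X Y U V" "g'\<in>tensor_functions X Y U V"
    "h'\<in>tensor_functions X Y U V" "h w~=0" "h' w~=0"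
    "ALL z:W\<inter>U\<times>V. (h z~=0 --> f1 z = g z / h z) & (h' z~=0 --> f2 z = g' z / h' z)"
   by (elim exE conjE) (rule that)
  have t: "(%z. g z * h' z + g' z * h z)\<in>tensor_functions X Y U V" "(%z. h z * h' z)\<in>tensor_functions X Y U V"
   by (intro tensor_functions_add tensor_functions_mult o *)+
  have e: "h z * h' z~=0 --> f1 z + f2 z = (g z * h' z + g' z * h z) / (h z * h' z)"
   if "z\<in>W\<inter>U\<times>V" for z using *(8) that by (auto simp: add_frac_eq)
  show "EX U V g h. opens X U & opens Y V & w\<in>U\<times>V &
     g\<in>tensor_functions X Y U V & h\<in>tensor_functions X Y U V & h w~=0 &
     (ALL z:W\<inter>U\<times>V. h z~=0 --> f1 z + f2 z = g z / h z)"
   by (rule exI[of _ U], rule exI[of _ V], rule exI[of _ "%z. g z * h' z + g' z * h z"],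
     rule exI[of _ "%z. h z * h' z"]) (use o * t e in auto)
 qed
 show "(%x. f1 x * f2 x)\<in>regfun ?P W" if f: "f1\<in>regfun ?P W" "f2\<in>regfun ?P W" for f1 f2
  unfolding regfun_prod
 proof
  fix w assume "w\<in>W"
  from common[OF f this] obtain U V g h g' h' where o: "opens X U" "opens Y V" and
    *: "w\<in>U\<times>V" "g\<in>tensor_functions X Y U V" "h\<in>tensor_functions X Y U V" "g'\<in>tensor_functions X Y U V"
    "h'\<in>tensor_functions X Y U V" "h w~=0" "h' w~=0"
    "ALL z:W\<inter>U\<times>V. (h z~=0 --> f1 z = g z / h z) & (h' z~=0 --> f2 z = g' z / h' z)"
   by (elim exE conjE) (rule that)
  have t: "(%z. g z * g' z)\<in>tensor_functions X Y U V" "(%z. h z * h' z)\<in>tensor_functions X Y U V"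
   by (intro tensor_functions_mult o *)+
  show "EX U V g h. opens X U & opens Y V & w\<in>U\<times>V &
     g\<in>tensor_functions X Y U V & h\<in>tensor_functions X Y U V & h w~=0 &
     (ALL z:W\<inter>U\<times>V. h z~=0 --> f1 z * f2 z = g z / h z)"
   by (rule exI[of _ U], rule exI[of _ V], rule exI[of _ "%z. g z * g' z"],
     rule exI[of _ "%z. h z * h' z"]) (use o * t in auto)
 qed
 fix f
 {
  fix w assume f: "f\<in>regfun ?P W" and w: "w\<in>W" "f w~=0"
  from openin_prod[THEN iffD1, OF W, rule_format, OF w(1)] obtain U V q where
   1: "opens X U" "opens Y V" "w\<in>U\<times>V" "q\<in>tensor_functions X Y U V"
    "q w~=0" "{z\<in>U\<times>V. q z~=0} \<subseteq> W"
   by (elim exE conjE) (rule that)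
  from regfun_prod[THEN iffD1, OF f, rule_format, OF w(1)] obtain U' V' g h where
   2: "opens X U'" "opens Y V'" "w\<in>U'\<times>V'" "g\<in>tensor_functions X Y U' V'"
    "h\<in>tensor_functions X Y U' V'" "h w~=0" "ALL z:W\<inter>U'\<times>V'. h z~=0 --> f z = g z / h z"
   by (elim exE conjE) (rule that)
  let ?U = "U\<inter>U'" and ?V = "V\<inter>V'"
  have o: "opens X ?U" "opens Y ?V" using 1 2 by blast+
  have t: "q\<in>tensor_functions X Y ?U ?V" "h\<in>tensor_functions X Y ?U ?V" "g\<in>tensor_functions X Y ?U ?V"
   using tensor_functions_restrict[OF 1(1,2) o _ _ 1(4)] tensor_functions_restrict[OF 2(1,2) o _ _ 2(4)]
    tensor_functions_restrict[OF 2(1,2) o _ _ 2(5)] by auto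
  have gw: "g w~=0" using 2 w by auto
  have "EX U V q g h. opens X U & opens Y V & w\<in>U\<times>V & q\<in>tensor_functions X Y U V &
    g\<in>tensor_functions X Y U V & h\<in>tensor_functions X Y U V & q w~=0 & g w~=0 & h w~=0 &
    {z\<in>U\<times>V. q z~=0} \<subseteq> W & (ALL z:W\<inter>U\<times>V. h z~=0 --> f z = g z / h z)"
   by (intro exI[of _ ?U] exI[of _ ?V] exI[of _ q] exI[of _ g] exI[of _ h])
     (use 1 2 o t gw in auto)
 } note quot = this
 show "openin (ftop ?P) {x\<in>W. f x~=0}" if f: "f\<in>regfun ?P W"
  unfolding openin_prod
 proof
  fix w assume w: "w\<in>{x\<in>W. f x~=0}"
  hence "w\<in>W" "f w~=0" by auto
  from quot[OF f this] obtain U V q g h where o: "opens X U" "opens Y V" and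
   *: "w\<in>U\<times>V" "q\<in>tensor_functions X Y U V" "g\<in>tensor_functions X Y U V" "h\<in>tensor_functions X Y U V"
   "q w~=0" "g w~=0" "h w~=0"
   "{z\<in>U\<times>V. q z~=0} \<subseteq> W" "ALL z:W\<inter>U\<times>V. h z~=0 --> f z = g z / h z"
   by (elim exE conjE) (rule that)
  have t: "(%z. q z * (g z * h z))\<in>tensor_functions X Y U V" by (intro tensor_functions_mult o *)
  have "{z\<in>U\<times>V. q z * (g z * h z)~=0} \<subseteq> {x\<in>W. f x~=0}"
  proof
   fix z assume z: "z\<in>{z\<in>U\<times>V. q z * (g z * h z)~=0}"
   hence "z\<in>W" using *(8) by auto
   with z *(9) show "z\<in>{x\<in>W. f x~=0}" by auto
  qed
  thus "EX U V h. opens X U & opens Y V & h\<in>tensor_functions X Y U V &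
   w\<in>U\<times>V & h w~=0 & {z\<in>U\<times>V. h z~=0} \<subseteq> {x\<in>W. f x~=0}"
   by (intro exI[of _ U] exI[of _ V] exI[of _ "%z. q z * (g z * h z)"]) (use o * t in auto)
 qed
 show "(%x. inverse (f x))\<in>regfun ?P {x\<in>W. f x~=0}" if f: "f\<in>regfun ?P W"
  unfolding regfun_prod
 proof
  fix w assume w: "w\<in>{x\<in>W. f x~=0}"
  hence "w\<in>W" "f w~=0" by auto
  from quot[OF f this] obtain U V q g h where o: "opens X U" "opens Y V" and
   *: "w\<in>U\<times>V" "q\<in>tensor_functions X Y U V" "g\<in>tensor_functions X Y U V" "h\<in>tensor_functions X Y U V"
   "q w~=0" "g w~=0" "h w~=0"
   "{z\<in>U\<times>V. q z~=0} \<subseteq> W" "ALL z:W\<inter>U\<times>V. h z~=0 --> f z = g z / h z"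
   by (elim exE conjE) (rule that)
  have t: "(%z. h z * h z)\<in>tensor_functions X Y U V" "(%z. g z * h z)\<in>tensor_functions X Y U V"
   by (intro tensor_functions_mult o *)+
  show "EX U V g h. opens X U & opens Y V & w\<in>U\<times>V &
     g\<in>tensor_functions X Y U V & h\<in>tensor_functions X Y U V & h w~=0 &
     (ALL z:{x\<in>W. f x~=0}\<inter>U\<times>V. h z~=0 --> inverse (f z) = g z / h z)"
   by (rule exI[of _ U], rule exI[of _ V], rule exI[of _ "%z. h z * h z"],
     rule exI[of _ "%z. g z * h z"]) (use o * t in auto)
 qed
 show "f\<in>regfun ?P W"
  if loc: "!!x. x\<in>W==>EX V g. openin (ftop ?P) V & x\<in>V & g\<in>regfun ?P V & (ALL y:W\<inter>V. f y = g y)"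
  unfolding regfun_prod
 proof
  fix w assume w: "w\<in>W"
  from loc[OF this] obtain W' f' where W': "openin (ftop ?P) W'" "w\<in>W'" "f'\<in>regfun ?P W'"
   "ALL y:W\<inter>W'. f y = f' y" by blast
  from openin_prod[THEN iffD1, OF W'(1), rule_format, OF W'(2)] obtain U V q where
   1: "opens X U" "opens Y V" "w\<in>U\<times>V" "q\<in>tensor_functions X Y U V"
    "q w~=0" "{z\<in>U\<times>V. q z~=0} \<subseteq> W'"
   by (elim exE conjE) (rule that)
  from regfun_prod[THEN iffD1, OF W'(3), rule_format, OF W'(2)] obtain U' V' g h where
   2: "opens X U'" "opens Y V'" "w\<in>U'\<times>V'" "g\<in>tensor_functions X Y U' V'"
    "h\<in>tensor_functions X Y U' V'" "h w~=0" "ALL z:W'\<inter>U'\<times>V'. h z~=0 --> f' z = g z / h z"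
   by (elim exE conjE) (rule that)
  let ?U = "U\<inter>U'" and ?V = "V\<inter>V'"
  have o: "opens X ?U" "opens Y ?V" using 1 2 by blast+
  have t: "(%z. g z * q z)\<in>tensor_functions X Y ?U ?V" "(%z. h z * q z)\<in>tensor_functions X Y ?U ?V"
   using tensor_functions_restrict[OF 1(1,2) o _ _ 1(4)] tensor_functions_restrict[OF 2(1,2) o _ _ 2(4)]
    tensor_functions_restrict[OF 2(1,2) o _ _ 2(5)] by (auto intro!: tensor_functions_mult o)
  have e: "f z = (g z * q z) / (h z * q z)" if z: "z\<in>W\<inter>?U\<times>?V" "h z * q z~=0" for z
  proof -
   have "z\<in>W'" using 1(6) z by auto
   with z 2(7) W' show ?thesis by auto
  qed
  show "EX U V g h. opens X U & opens Y V & w\<in>U\<times>V &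
     g\<in>tensor_functions X Y U V & h\<in>tensor_functions X Y U V & h w~=0 &
     (ALL z:W\<inter>U\<times>V. h z~=0 --> f z = g z / h z)"
   by (rule exI[of _ ?U], rule exI[of _ ?V], rule exI[of _ "%z. g z * q z"],
     rule exI[of _ "%z. h z * q z"]) (use o 1 2 t e in auto)
 qed
qed

end

lemma k_space_discrete: "k_space (discrete_space S)"
 by (rule k_spaceI) (auto simp: discrete_space_def)

section \<open>Morphisms\<close>

lemma morphism_points: "morphism X Y f==>x\<in>points X==>f x\<in>points Y"
 unfolding morphism_def continuous_map_def by blast

lemma morphism_openin:
 "morphism X Y f==>opens Y V==>opens X {x\<in>points X. f x\<in>V}"
 unfolding morphism_def continuous_map_def by blast

lemma morphism_regfun:
 "morphism X Y f==>opens Y V==>h\<in>regfun Y V ==>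
  (%x. h (f x))\<in>regfun X {x\<in>points X. f x\<in>V}"
 unfolding morphism_def comp_def by blast

lemma morphismI:
 assumes "!!x. x\<in>points X==>f x\<in>points Y"
  and "!!V. opens Y V==>opens X {x\<in>points X. f x\<in>V}"
  and "!!V h. opens Y V==>h\<in>regfun Y V ==>
   (%x. h (f x))\<in>regfun X {x\<in>points X. f x\<in>V}"
 shows "morphism X Y f"
 unfolding morphism_def continuous_map_def comp_def using assms by auto

lemma morphism_regfun_points:
 assumes "k_space X" "morphism X Y f" "h\<in>regfun Y (points Y)"
 shows "(%x. h (f x))\<in>regfun X (points X)"
 using morphism_regfun[OF assms(2) openin_topspace assms(3)] morphism_points[OF assms(2)]
 by (simp cong: conj_cong)

lemma morphism_compose:
 assumes f: "morphism X Y f" and g: "morphism Y Z g"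
 shows "morphism X Z (%x. g (f x))"
proof (rule morphismI)
 fix V assume V: "opens Z V"
 have e: "{x\<in>points X. g (f x)\<in>V} = {x\<in>points X. f x\<in>{y\<in>points Y. g y\<in>V}}"
  using morphism_points[OF f] by auto
 show "opens X {x\<in>points X. g (f x)\<in>V}"
  unfolding e by (intro morphism_openin[OF f] morphism_openin[OF g] V)
 fix h assume h: "h\<in>regfun Z V"
 show "(%x. h (g (f x)))\<in>regfun X {x\<in>points X. g (f x)\<in>V}"
  unfolding e
  by (rule morphism_regfun[OF f, of _ "%y. h (g y)"])
    (intro morphism_openin[OF g] morphism_regfun[OF g] V h)+
qed (use morphism_points[OF f] morphism_points[OF g] in auto)

lemma morphism_cong:
 assumes X: "k_space X" and f: "morphism X Y f" and fg: "!!x. x\<in>points X==>f x = g x"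
 shows "morphism X Y g"
proof (rule morphismI)
 fix V assume V: "opens Y V"
 have e: "{x\<in>points X. g x\<in>V} = {x\<in>points X. f x\<in>V}" using fg by auto
 show "opens X {x\<in>points X. g x\<in>V}" unfolding e by (rule morphism_openin[OF f V])
 fix h assume h: "h\<in>regfun Y V"
 have o: "opens X {x\<in>points X. f x\<in>V}" by (rule morphism_openin[OF f V])
 show "(%x. h (g x))\<in>regfun X {x\<in>points X. g x\<in>V}"
  unfolding e by (rule regfun_restrict[OF X o o _ morphism_regfun[OF f V h]]) (use fg in auto)
qed (use morphism_points[OF f] fg in auto)

lemma polyfun_compose_regular:
 assumes Y: "k_space Y" and reg: "!!f. f\<in>F==>(%y. f (\<Phi> y))\<in>regfun Y (points Y)"
  and q: "q\<in>polyfun F"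
 shows "(%y. q (\<Phi> y))\<in>regfun Y (points Y)"
 using q
 by (induction) (auto intro: regfun_const[OF Y] regfun_add[OF Y] regfun_mult[OF Y] reg)

text \<open>The universal property of zariski spaces: regular coordinates suffice.\<close>

lemma morphism_into_zariski:
 assumes Y: "k_space Y" and pts: "!!y. y\<in>points Y==>\<Phi> y\<in>S"
  and reg: "!!f. f\<in>F==>(%y. f (\<Phi> y))\<in>regfun Y (points Y)"
 shows "morphism Y (zariski_space S F) \<Phi>"
proof (rule morphismI)
 note preg = polyfun_compose_regular[of Y F \<Phi>, OF Y reg]
 fix V assume V: "openin (ftop (zariski_space S F)) V"
 have o: "opens Y {y\<in>points Y. q (\<Phi> y)~=0}" if "q\<in>polyfun F" for q
  by (rule openin_regfun_nonzero[OF Y openin_topspace preg[OF _ that]]) auto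
 show oV: "opens Y {y\<in>points Y. \<Phi> y\<in>V}"
 proof (subst openin_subopen, intro ballI)
  fix y assume y: "y\<in>{y\<in>points Y. \<Phi> y\<in>V}"
  then obtain q where q: "q\<in>polyfun F" "q (\<Phi> y)~=0" "ALL z:S. q z~=0 --> z\<in>V"
   using V unfolding openin_zariski by blast
  show "EX T. opens Y T & y\<in>T & T \<subseteq> {y\<in>points Y. \<Phi> y\<in>V}"
   by (rule exI[of _ "{y\<in>points Y. q (\<Phi> y)~=0}"]) (use o[OF q(1)] q y pts in auto)
 qed
 fix h assume h: "h\<in>regfun (zariski_space S F) V"
 show "(%x. h (\<Phi> x))\<in>regfun Y {x\<in>points Y. \<Phi> x\<in>V}"
 proof (rule regfun_local[OF Y oV])
  fix y assume y: "y\<in>{y\<in>points Y. \<Phi> y\<in>V}"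
  then obtain a b where ab: "a\<in>polyfun F" "b\<in>polyfun F" "b (\<Phi> y)~=0"
   "ALL z:V. b z~=0 --> h z = a z / b z" using h unfolding regfun_zariski by blast
  have "(%y. a (\<Phi> y) / b (\<Phi> y))\<in>regfun Y {y\<in>points Y. b (\<Phi> y)~=0}"
   by (intro regfun_divide[OF Y openin_topspace] preg ab) auto
  with o[OF ab(2)] ab y
  show "EX W g. opens Y W & y\<in>W & g\<in>regfun Y W &
    (ALL z:{x\<in>points Y. \<Phi> x\<in>V}\<inter>W. h (\<Phi> z) = g z)"
   by (intro exI[of _ "{y\<in>points Y. b (\<Phi> y)~=0}"] exI[of _ "%y. a (\<Phi> y) / b (\<Phi> y)"]) auto
 qed
qed (use pts in auto)

lemma morphism_zariski_coord:
 assumes "k_space Y" "morphism Y (zariski_space S F) \<Phi>" "q\<in>polyfun F"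
 shows "(%y. q (\<Phi> y))\<in>regfun Y (points Y)"
 by (rule morphism_regfun_points[OF assms(1,2) polyfun_regular[OF assms(3)]])

lemma points_subspace: "points (subspace_of X S) = points X\<inter>S"
 by simp

lemma morphism_into_subspace:
 assumes Y: "k_space Y" and f: "morphism Y X f" and S: "!!y. y\<in>points Y==>f y\<in>S"
 shows "morphism Y (subspace_of X S) f"
proof (rule morphismI)
 fix V assume V: "openin (ftop (subspace_of X S)) V"
 then obtain T where T: "opens X T" "V = T\<inter>S" by (auto simp: openin_subtopology)
 have e: "{y\<in>points Y. f y\<in>V} = {y\<in>points Y. f y\<in>T}" using S T by auto
 show oV: "opens Y {y\<in>points Y. f y\<in>V}" unfolding e by (rule morphism_openin[OF f T(1)])
 fix h assume h: "h\<in>regfun (subspace_of X S) V"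
 show "(%x. h (f x))\<in>regfun Y {x\<in>points Y. f x\<in>V}"
 proof (rule regfun_local[OF Y oV])
  fix y assume y: "y\<in>{y\<in>points Y. f y\<in>V}"
  with h obtain W g where W: "opens X W" "f y\<in>W" "g\<in>regfun X W" "ALL z:V\<inter>W. h z = g z"
   unfolding regfun_subspace by blast
  show "EX U g. opens Y U & y\<in>U & g\<in>regfun Y U &
    (ALL z:{x\<in>points Y. f x\<in>V}\<inter>U. h (f z) = g z)"
   by (rule exI[of _ "{y\<in>points Y. f y\<in>W}"], rule exI[of _ "%y. g (f y)"])
     (use morphism_openin[OF f W(1)] morphism_regfun[OF f W(1,3)] W y in auto)
 qed
qed (use morphism_points[OF f] S in auto)

lemma regfun_subspaceI:
 "opens X W==>V \<subseteq> W==>h\<in>regfun X W==>h\<in>regfun (subspace_of X S) V"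
 unfolding regfun_subspace by (intro ballI exI[of _ W] exI[of _ h]) auto

lemma morphism_from_subspace:
 assumes f: "morphism X Y f"
 shows "morphism (subspace_of X S) Y f"
proof (rule morphismI)
 fix V assume V: "opens Y V"
 have e: "{x\<in>points (subspace_of X S). f x\<in>V} = S\<inter>{x\<in>points X. f x\<in>V}" by auto
 have o: "opens X {x\<in>points X. f x\<in>V}" by (rule morphism_openin[OF f V])
 show "openin (ftop (subspace_of X S)) {x\<in>points (subspace_of X S). f x\<in>V}"
  unfolding e unfolding ftop_subspace using o by (rule openin_subtopology_Int2)
 fix h assume h: "h\<in>regfun Y V"
 show "(%x. h (f x))\<in>regfun (subspace_of X S) {x\<in>points (subspace_of X S). f x\<in>V}"
  unfolding e by (rule regfun_subspaceI[OF o _ morphism_regfun[OF f V h]]) auto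
qed (use morphism_points[OF f] in auto)

lemma morphism_id: "morphism X X (%x. x)"
 unfolding morphism_def comp_def continuous_map_def
proof (intro conjI allI impI)
 fix V h assume *: "opens X V & h\<in>regfun X V"
 hence "{x\<in>points X. x\<in>V} = V" using openin_subset[of "ftop X" V] by auto
 thus "(%x. h x)\<in>regfun X {x\<in>points X. x\<in>V}" using * by simp
next
 fix V assume *: "opens X V"
 hence "{x\<in>points X. x\<in>V} = V" using openin_subset[of "ftop X" V] by auto
 thus "opens X {x\<in>points X. x\<in>V}" using * by simp
qed auto

lemma morphism_inclusion: "morphism (subspace_of X S) X (%x. x)"
 by (rule morphism_from_subspace[OF morphism_id])

lemma morphism_subspace_mono:
 assumes "k_space X" "morphism (subspace_of X U) Y f" "V \<subseteq> U"
 shows "morphism (subspace_of X V) Y f"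
 by (rule morphism_compose[OF morphism_into_subspace[OF k_space_subspace[OF assms(1)] morphism_inclusion] assms(2)])
   (use assms(3) in auto)

lemma regfun_subspace_open:
 assumes X: "k_space X" and V: "opens X V" and f: "f\<in>regfun (subspace_of X S) V"
 shows "f\<in>regfun X V"
proof (rule regfun_local[OF X V])
 fix x assume "x\<in>V"
 with f show "EX W g. opens X W & x\<in>W & g\<in>regfun X W & (ALL y:V\<inter>W. f y = g y)"
  unfolding regfun_subspace by blast
qed

lemma morphism_const:
 assumes X: "k_space X" and c: "c\<in>points Y"
 shows "morphism X Y (%_. c)"
proof (rule morphismI)
 fix V
 have e: "{x\<in>points X. c\<in>V} = (if c\<in>V then points X else {})" by auto
 show "opens X {x\<in>points X. c\<in>V}" unfolding e by auto
 fix h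
 assume "h\<in>regfun Y V"
 show "(%x. h c)\<in>regfun X {x\<in>points X. c\<in>V}" unfolding e by (auto intro: regfun_const[OF X])
qed (use c in auto)

context
 fixes X :: "('k::field, 'x) fspace" and Y :: "('k, 'y) fspace"
 assumes X: "k_space X" and Y: "k_space Y"
begin

lemma morphism_fst: "morphism (prod_space X Y) X fst"
proof (rule morphismI)
 fix V assume V: "opens X V"
 have e: "{z\<in>points (prod_space X Y). fst z\<in>V} = V\<times>points Y"
  using openin_subset[OF V] by (auto simp: points_prod[OF X Y])
 show "openin (ftop (prod_space X Y)) {z\<in>points (prod_space X Y). fst z\<in>V}"
  unfolding e by (intro openin_prod_Times[OF X Y] V openin_topspace)
 fix h assume h: "h\<in>regfun X V"
 show "(%z. h (fst z))\<in>regfun (prod_space X Y) {z\<in>points (prod_space X Y). fst z\<in>V}"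
  unfolding e
  using tensor_functions_regular[OF X Y V openin_topspace
    tensor_functions_simple[OF h regfun_const[OF Y openin_topspace, of 1]]] by simp
qed (auto simp: points_prod[OF X Y])

lemma morphism_snd: "morphism (prod_space X Y) Y snd"
proof (rule morphismI)
 fix V assume V: "opens Y V"
 have e: "{z\<in>points (prod_space X Y). snd z\<in>V} = points X\<times>V"
  using openin_subset[OF V] by (auto simp: points_prod[OF X Y])
 show "openin (ftop (prod_space X Y)) {z\<in>points (prod_space X Y). snd z\<in>V}"
  unfolding e by (intro openin_prod_Times[OF X Y] V openin_topspace)
 fix h assume h: "h\<in>regfun Y V"
 show "(%z. h (snd z))\<in>regfun (prod_space X Y) {z\<in>points (prod_space X Y). snd z\<in>V}"
  unfolding e
  using tensor_functions_regular[OF X Y openin_topspace V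
    tensor_functions_simple[OF regfun_const[OF X openin_topspace, of 1] h]] by simp
qed (auto simp: points_prod[OF X Y])

lemma morphism_pair:
 assumes Z: "k_space Z" and f: "morphism Z X f" and g: "morphism Z Y g"
 shows "morphism Z (prod_space X Y) (%z. (f z, g z))"
proof (rule morphismI)
 have pre: "opens Z {z\<in>points Z. f z\<in>U & g z\<in>V}"
  if "opens X U" "opens Y V" for U V
 proof -
  have "{z\<in>points Z. f z\<in>U & g z\<in>V} = {z\<in>points Z. f z\<in>U}\<inter>{z\<in>points Z. g z\<in>V}" by auto
  thus ?thesis using morphism_openin[OF f that(1)] morphism_openin[OF g that(2)] by auto
 qed
 have tens: "(%z. h (f z, g z))\<in>regfun Z {z\<in>points Z. f z\<in>U & g z\<in>V}"
  if o: "opens X U" "opens Y V" and h: "h\<in>tensor_functions X Y U V" for U V h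
  using h
 proof (induction rule: tensor_functions_induct)
  case zero show ?case by (rule regfun_const[OF Z pre[OF o]])
 next
  case (add a b h)
  show ?case unfolding fst_conv snd_conv
   by (intro regfun_add[OF Z pre[OF o]] add regfun_mult[OF Z pre[OF o]]
     regfun_restrict[OF Z morphism_openin[OF f o(1)] pre[OF o] _ morphism_regfun[OF f o(1) add(1)]]
     regfun_restrict[OF Z morphism_openin[OF g o(2)] pre[OF o] _ morphism_regfun[OF g o(2) add(2)]]) auto
 qed
 fix W assume W: "openin (ftop (prod_space X Y)) W"
 show oW: "opens Z {z\<in>points Z. (f z, g z)\<in>W}"
 proof (subst openin_subopen, intro ballI)
  fix z assume z: "z\<in>{z\<in>points Z. (f z, g z)\<in>W}"
  hence "(f z, g z)\<in>W" by simp
  from openin_prod[OF X Y, THEN iffD1, OF W, rule_format, OF this] obtain U V h where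
   o: "opens X U" "opens Y V" and h: "h\<in>tensor_functions X Y U V"
   and *: "(f z, g z)\<in>U\<times>V" "h (f z, g z)~=0" "{z\<in>U\<times>V. h z~=0} \<subseteq> W"
   by (elim exE conjE) (rule that)
  show "EX T. opens Z T & z\<in>T & T \<subseteq> {z\<in>points Z. (f z, g z)\<in>W}"
   by (rule exI[of _ "{z\<in>{z\<in>points Z. f z\<in>U & g z\<in>V}. h (f z, g z)~=0}"])
     (use openin_regfun_nonzero[OF Z pre[OF o] tens[OF o h]] * z in auto)
 qed
 fix h assume h: "h\<in>regfun (prod_space X Y) W"
 show "(%z. h (f z, g z))\<in>regfun Z {z\<in>points Z. (f z, g z)\<in>W}"
 proof (rule regfun_local[OF Z oW])
  fix z assume z: "z\<in>{z\<in>points Z. (f z, g z)\<in>W}"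
  hence "(f z, g z)\<in>W" by simp
  from regfun_prod[OF X Y, THEN iffD1, OF h, rule_format, OF this] obtain U V a b where
   o: "opens X U" "opens Y V" and
   *: "(f z, g z)\<in>U\<times>V" and ab: "a\<in>tensor_functions X Y U V" "b\<in>tensor_functions X Y U V" and
   nz: "b (f z, g z)~=0" and e: "ALL z:W\<inter>U\<times>V. b z~=0 --> h z = a z / b z"
   by (elim exE conjE) (rule that)
  let ?T = "{z\<in>{z\<in>points Z. f z\<in>U & g z\<in>V}. b (f z, g z)~=0}"
  show "EX T k. opens Z T & z\<in>T & k\<in>regfun Z T &
    (ALL y:{z\<in>points Z. (f z, g z)\<in>W}\<inter>T. h (f y, g y) = k y)"
   by (rule exI[of _ ?T], rule exI[of _ "%z. a (f z, g z) / b (f z, g z)"])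
     (use openin_regfun_nonzero[OF Z pre[OF o] tens[OF o ab(2)]]
      regfun_divide[OF Z pre[OF o] tens[OF o ab(1)] tens[OF o ab(2)]] * nz z e in auto)
 qed
qed (use morphism_points[OF f] morphism_points[OF g] in \<open>auto simp: points_prod[OF X Y]\<close>)

end

section \<open>Varieties\<close>

lemma space_with_functions_cong:
 "space_with_functions X==>opens X U==>f\<in>regfun X U==>(!!x. x\<in>U==>f x = g x) ==>
  g\<in>regfun X U"
 unfolding space_with_functions_def by blast

lemma space_with_functions_Union:
 assumes "space_with_functions X" "!!U. U\<in>\<U>==>opens X U"
 shows "f\<in>regfun X (\<Union>\<U>) \<longleftrightarrow> (ALL U:\<U>. f\<in>regfun X U)"
 using assms(1)[unfolded space_with_functions_def, THEN conjunct2, rule_format, of \<U>] assms(2) by blast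

lemma space_with_functions_restrict:
 assumes X: "space_with_functions X" and U: "opens X U" "opens X V" "V \<subseteq> U"
  and f: "f\<in>regfun X U"
 shows "f\<in>regfun X V"
proof -
 have "\<Union>{U, V} = U" using U by auto
 hence "f\<in>regfun X (\<Union>{U, V})" using f by simp
 thus ?thesis using space_with_functions_Union[OF X, of "{U, V}" f] U by auto
qed

lemma space_with_functions_local:
 assumes X: "space_with_functions X" and U: "opens X U"
  and loc: "!!x. x\<in>U==>EX V g. opens X V & x\<in>V & g\<in>regfun X V & (ALL y:U\<inter>V. f y = g y)"
 shows "f\<in>regfun X U"
proof -
 from loc obtain V g where V: "!!x. x\<in>U==>opens X (V x) & x\<in>V x & g x\<in>regfun X (V x) &
   (ALL y:U\<inter>V x. f y = g x y)" by metis
 have "f\<in>regfun X (U\<inter>V x)" if x: "x\<in>U" for x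
 proof -
  have o: "opens X (U\<inter>V x)" using U V[OF x] by blast
  have "g x\<in>regfun X (U\<inter>V x)"
   using space_with_functions_restrict[OF X _ o, of "V x" "g x"] V[OF x] by auto
  thus ?thesis by (rule space_with_functions_cong[OF X o]) (use V[OF x] in auto)
 qed
 hence "f\<in>regfun X (\<Union>((%x. U\<inter>V x) ` U))"
  by (subst space_with_functions_Union[OF X]) (use U V in auto)
 moreover have "\<Union>((%x. U\<inter>V x) ` U) = U" using V by auto
 ultimately show ?thesis by simp
qed

lemma k_space_imp_space_with_functions:
 assumes X: "k_space X"
 shows "space_with_functions X"
 unfolding space_with_functions_def
proof (intro conjI allI impI iffI ballI)
 fix U f g assume *: "opens X U & f\<in>regfun X U & (ALL x:U. f x = g x)"
 show "g\<in>regfun X U" by (rule regfun_restrict[OF X, of U U f]) (use * in auto)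
next
 fix \<U> f U assume *: "ALL U:\<U>. opens X U" "f\<in>regfun X (\<Union>\<U>)" "U\<in>\<U>"
 show "f\<in>regfun X U" by (rule regfun_restrict[OF X _ _ _ *(2)]) (use * in auto)
next
 fix \<U> f assume *: "ALL U:\<U>. opens X U" "ALL U:\<U>. f\<in>regfun X U"
 show "f\<in>regfun X (\<Union>\<U>)"
 proof (rule regfun_local[OF X])
  show "opens X (\<Union>\<U>)" using * by auto
  fix x assume "x\<in>\<Union>\<U>"
  then obtain U where "U\<in>\<U>" "x\<in>U" by blast
  thus "EX V g. opens X V & x\<in>V & g\<in>regfun X V & (ALL y:\<Union>\<U>\<inter>V. f y = g y)"
   using * by (intro exI[of _ U] exI[of _ f]) auto
 qed
qed

lemma k_space_iso:
 fixes X :: "('k::field, 'x) fspace"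
 assumes X: "space_with_functions X" and Y: "k_space Y" and iso: "fspace_iso X Y \<phi>"
 shows "k_space X"
proof -
 define \<psi> where "\<psi> = inv_into (points X) \<phi>"
 have bij: "bij_betw \<phi> (points X) (points Y)" and \<phi>: "morphism X Y \<phi>" and \<psi>: "morphism Y X \<psi>"
  using iso unfolding fspace_iso_def \<psi>_def by auto
 have \<psi>\<phi>: "\<psi> (\<phi> x) = x" if "x\<in>points X" for x
  using bij that unfolding \<psi>_def bij_betw_def by simp
 have \<phi>\<psi>: "\<phi> (\<psi> y) = y" if "y\<in>points Y" for y
  using bij that unfolding \<psi>_def by (simp add: bij_betw_inv_into_right)
 let ?T = "%U. {y\<in>points Y. \<psi> y\<in>U}"
 have T: "{x\<in>points X. \<phi> x\<in>?T U} = U" if "U \<subseteq> points X" for U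
  using that \<psi>\<phi> morphism_points[OF \<phi>] by auto
 have op: "opens X U \<longleftrightarrow> opens Y (?T U)" if "U \<subseteq> points X" for U
  using morphism_openin[OF \<phi>, of "?T U"] morphism_openin[OF \<psi>, of U] T[OF that] by auto
 have reg: "f\<in>regfun X U \<longleftrightarrow> (%y. f (\<psi> y))\<in>regfun Y (?T U)" if U: "opens X U" for f U
 proof
  assume f: "f\<in>regfun X U"
  show "(%y. f (\<psi> y))\<in>regfun Y (?T U)"
   by (rule morphism_regfun[OF \<psi> U f])
 next
  assume f: "(%y. f (\<psi> y))\<in>regfun Y (?T U)"
  have "(%x. f (\<psi> (\<phi> x)))\<in>regfun X {x\<in>points X. \<phi> x\<in>?T U}"
   by (rule morphism_regfun[OF \<phi> morphism_openin[OF \<psi> U] f])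
  hence "(%x. f (\<psi> (\<phi> x)))\<in>regfun X U" using T[OF openin_subset[OF U]] by simp
  thus "f\<in>regfun X U"
   by (rule space_with_functions_cong[OF X U]) (use openin_subset[OF U] \<psi>\<phi> in auto)
 qed
 show ?thesis
 proof (rule k_spaceI)
  fix U assume U: "opens X U"
  note oT = morphism_openin[OF \<psi> U]
  show "(%_. c)\<in>regfun X U" for c
   unfolding reg[OF U] by (rule regfun_const[OF Y oT])
  show "(%x. f x + g x)\<in>regfun X U" if "f\<in>regfun X U" "g\<in>regfun X U" for f g
   using that unfolding reg[OF U] by (rule regfun_add[OF Y oT])
  show "(%x. f x * g x)\<in>regfun X U" if "f\<in>regfun X U" "g\<in>regfun X U" for f g
   using that unfolding reg[OF U] by (rule regfun_mult[OF Y oT])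
  fix f :: "'x => 'k"
  have TU: "?T {x\<in>U. f x~=0} = {y\<in>?T U. f (\<psi> y)~=0}" by auto
  show o: "opens X {x\<in>U. f x~=0}" if "f\<in>regfun X U"
   using openin_regfun_nonzero[OF Y oT that[unfolded reg[OF U]]] openin_subset[OF U]
   by (subst op) (auto simp: TU)
  show "(%x. inverse (f x))\<in>regfun X {x\<in>U. f x~=0}" if "f\<in>regfun X U"
   unfolding reg[OF o[OF that]] TU by (rule regfun_inverse[OF Y oT that[unfolded reg[OF U]]])
  show "f\<in>regfun X U"
   if "!!x. x\<in>U==>EX V g. opens X V & x\<in>V & g\<in>regfun X V & (ALL y:U\<inter>V. f y = g y)"
   by (rule space_with_functions_local[OF X U that])
 qed
qed

lemma variety_imp_k_space:
 assumes "variety X"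
 shows "k_space X"
proof -
 from assms have X: "space_with_functions X" unfolding variety_def by blast
 from assms obtain \<U> where \<U>: "\<Union>\<U> = points X" "!!U. U\<in>\<U>==>opens X U"
   "!!U. U\<in>\<U>==>affine_variety (subspace_of X U)"
  unfolding variety_def by blast
 have kU: "k_space (subspace_of X U)" if "U\<in>\<U>" for U
 proof -
  from \<U>(3)[OF that] obtain r Z f where "space_with_functions (subspace_of X U)"
   "fspace_iso (subspace_of X U) (subspace_of (affine_space r) Z) f"
   unfolding affine_variety_def by blast
  moreover have "k_space (subspace_of (affine_space r) Z)"
   by (simp add: affine_space_def k_space_subspace k_space_zariski)
  ultimately show ?thesis using k_space_iso by blast
 qed
 have regU: "f\<in>regfun X V \<longleftrightarrow> f\<in>regfun (subspace_of X U) V"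
  if "U\<in>\<U>" and V: "opens X V" "V \<subseteq> U" for f U V
 proof
  show "f\<in>regfun (subspace_of X U) V" if "f\<in>regfun X V"
   using regfun_subspaceI[OF V(1) _ that] by blast
  assume "f\<in>regfun (subspace_of X U) V"
  thus "f\<in>regfun X V"
   by (intro space_with_functions_local[OF X V(1)]) (unfold regfun_subspace, blast)
 qed
 have opU: "openin (ftop (subspace_of X U)) V \<longleftrightarrow> opens X V"
  if "U\<in>\<U>" "V \<subseteq> U" for U V
  using \<U>(2)[OF that(1)] that(2) by (simp add: openin_open_subtopology)
 have glue: "f\<in>regfun X V \<longleftrightarrow> (ALL U:\<U>. f\<in>regfun (subspace_of X U) (V\<inter>U))" if V: "opens X V" for f V
 proof -
  have "V = \<Union>((%U. V\<inter>U) ` \<U>)" using \<U>(1) openin_subset[OF V] by auto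
  hence "f\<in>regfun X V \<longleftrightarrow> f\<in>regfun X (\<Union>((%U. V\<inter>U) ` \<U>))" by simp
  also have "... \<longleftrightarrow> (ALL U:\<U>. f\<in>regfun X (V\<inter>U))"
   by (subst space_with_functions_Union[OF X]) (use V \<U>(2) in auto)
  also have "... \<longleftrightarrow> (ALL U:\<U>. f\<in>regfun (subspace_of X U) (V\<inter>U))"
   using V \<U>(2) by (intro ball_cong refl regU) auto
  finally show ?thesis .
 qed
 show ?thesis
 proof (rule k_spaceI)
  fix V assume V: "opens X V"
  have oV: "openin (ftop (subspace_of X U)) (V\<inter>U)" if "U\<in>\<U>" for U
   using V \<U>(2)[OF that] opU[OF that, of "V\<inter>U"] by auto
  show "(%_. c)\<in>regfun X V" for c
   unfolding glue[OF V] using regfun_const[OF kU oV] by blast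
  show "(%x. f x + g x)\<in>regfun X V" if "f\<in>regfun X V" "g\<in>regfun X V" for f g
   using that regfun_add[OF kU oV] unfolding glue[OF V] by blast
  show "(%x. f x * g x)\<in>regfun X V" if "f\<in>regfun X V" "g\<in>regfun X V" for f g
   using that regfun_mult[OF kU oV] unfolding glue[OF V] by blast
  fix f
  show o: "opens X {x\<in>V. f x~=0}" if f: "f\<in>regfun X V"
  proof -
   have "opens X {x\<in>V\<inter>U. f x~=0}" if U: "U\<in>\<U>" for U
    using openin_regfun_nonzero[OF kU[OF U] oV[OF U], of f] f[unfolded glue[OF V]] U
     opU[OF U, of "{x\<in>V\<inter>U. f x~=0}"] by auto
   hence "opens X (\<Union>((%U. {x\<in>V\<inter>U. f x~=0}) ` \<U>))" by (intro openin_Union) auto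
   moreover have "\<Union>((%U. {x\<in>V\<inter>U. f x~=0}) ` \<U>) = {x\<in>V. f x~=0}"
    using \<U>(1) openin_subset[OF V] by auto
   ultimately show ?thesis by simp
  qed
  show "(%x. inverse (f x))\<in>regfun X {x\<in>V. f x~=0}" if f: "f\<in>regfun X V"
   unfolding glue[OF o[OF f]]
  proof
   fix U assume U: "U\<in>\<U>"
   have "{x\<in>V. f x~=0}\<inter>U = {x\<in>V\<inter>U. f x~=0}" by auto
   thus "(%x. inverse (f x))\<in>regfun (subspace_of X U) ({x\<in>V. f x~=0}\<inter>U)"
    using regfun_inverse[OF kU[OF U] oV[OF U], of f] f[unfolded glue[OF V]] U by simp
  qed
  show "f\<in>regfun X V"
   if "!!x. x\<in>V==>EX U g. opens X U & x\<in>U & g\<in>regfun X U & (ALL y:V\<inter>U. f y = g y)"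
   by (rule space_with_functions_local[OF X V that])
 qed
qed

section \<open>Symbol algebras\<close>

locale k_alg =
 fixes A :: "('k::field, 'a) module" (structure)
 assumes k_algebra: "k_algebra A"

sublocale k_alg \<subseteq> ring A
 using k_algebra unfolding k_algebra_def by blast

context k_alg
begin

lemma module: "module (class_ring :: 'k ring) A"
 using k_algebra unfolding k_algebra_def by blast

lemma smult_closed [simp]: "a\<in>carrier A==>(c::'k)\<odot>a\<in>carrier A"
 using module.smult_closed[OF module, of c a] by simp

lemma smult_l_distr: "a\<in>carrier A==>((c::'k) + d)\<odot>a = c\<odot>a\<oplus>d\<odot>a"
 using module.smult_l_distr[OF module, of c d a] by simp

lemma smult_r_distr:
 "a\<in>carrier A==>b\<in>carrier A==>(c::'k)\<odot>(a\<oplus>b) = c\<odot>a\<oplus>c\<odot>b"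
 using module.smult_r_distr[OF module, of c a b] by simp

lemma smult_assoc1: "a\<in>carrier A==>(c::'k)\<odot>(d\<odot>a) = (c * d)\<odot>a"
 using module.smult_assoc1[OF module, of c d a] by simp

lemma smult_one [simp]: "a\<in>carrier A==>(1::'k)\<odot>a = a"
 using module.smult_one[OF module, of a] by simp

lemma smult_zero [simp]: "a\<in>carrier A==>(0::'k)\<odot>a = \<zero>"
 using module.smult_l_null[OF module, of a] by simp

lemma smult_r_null [simp]: "(c::'k)\<odot>\<zero> = \<zero>"
 using module.smult_r_null[OF module, of c] by simp

lemma smult_mult_l [simp]:
 "a\<in>carrier A==>b\<in>carrier A==>((c::'k)\<odot>a)\<otimes>b = c\<odot>(a\<otimes>b)"
 using k_algebra unfolding k_algebra_def by blast

lemma smult_mult_r [simp]: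
 "a\<in>carrier A==>b\<in>carrier A==>a\<otimes>((c::'k)\<odot>b) = c\<odot>(a\<otimes>b)"
 using k_algebra unfolding k_algebra_def by blast

lemma smult_minus_one: "a\<in>carrier A==>(- 1 :: 'k)\<odot>a = \<ominus> a"
 using smult_l_distr[of a "- 1" 1] minus_equality[of "(- 1)\<odot>a" a] by simp

lemma smult_cancel: "a\<in>carrier A==>(c::'k)\<odot>a = \<zero>==>c~=0==>a = \<zero>"
 using smult_assoc1[of a "inverse c" c] by simp

lemma smult_unit_cancel:
 assumes "u\<in>Units A" "(c::'k)\<odot>u = d\<odot>u" "\<one>~=\<zero>"
 shows "c = d"
proof (rule ccontr)
 assume "c~=d"
 have u: "u\<in>carrier A" using assms(1) by (rule Units_closed)
 have "(c - d)\<odot>u = c\<odot>u\<oplus>(- 1)\<odot>(d\<odot>u)"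
  using smult_l_distr[OF u, of c "- d"] u by (simp add: smult_assoc1)
 also have "... = \<zero>" using assms(2) u by (simp add: smult_minus_one r_neg)
 finally have "u = \<zero>" using smult_cancel[OF u] \<open>c~=d\<close> by simp
 hence "\<one> = \<zero>" using assms(1) Units_l_inv[of u] by simp
 thus False using assms(3) by simp
qed

lemma centre_iff: "z\<in>centre A \<longleftrightarrow> z\<in>carrier A & (ALL a:carrier A. z\<otimes>a = a\<otimes>z)"
 by (simp add: centre_def)

lemma centre_commute: "z\<in>centre A==>a\<in>carrier A==>z\<otimes>a = a\<otimes>z"
 by (simp add: centre_def)

lemma centre_carrier: "z\<in>centre A==>z\<in>carrier A"
 by (simp add: centre_def)

lemma centre_one [simp]: "\<one>\<in>centre A"
 by (simp add: centre_def)

lemma centre_smult: "z\<in>centre A==>(c::'k)\<odot>z\<in>centre A"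
 by (simp add: centre_iff)

lemma centre_add: "z\<in>centre A==>w\<in>centre A==>z\<oplus>w\<in>centre A"
 by (simp add: centre_iff l_distr r_distr)

lemma centre_uminus: "z\<in>centre A==>\<ominus> z\<in>centre A"
 using centre_smult[of z "- 1"] by (simp add: smult_minus_one centre_carrier)

lemma centre_mult: "z\<in>centre A==>w\<in>centre A==>z\<otimes>w\<in>centre A"
 unfolding centre_iff by (metis m_assoc m_closed)

lemma commute_inv:
 assumes u: "u\<in>Units A" and a: "a\<in>carrier A" and ua: "u\<otimes>a = a\<otimes>u"
 shows "inv u\<otimes>a = a\<otimes>inv u"
proof -
 have uc: "u\<in>carrier A" "inv u\<in>carrier A" using u by auto
 have "inv u\<otimes>a = inv u\<otimes>(a\<otimes>u)\<otimes>inv u" using uc a u by (simp add: m_assoc)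
 also have "... = (inv u\<otimes>u)\<otimes>a\<otimes>inv u" unfolding ua[symmetric] using uc a by (simp add: m_assoc)
 finally show ?thesis using uc a u by simp
qed

lemma centre_inv: "z\<in>centre A==>z\<in>Units A==>inv z\<in>centre A"
 unfolding centre_iff by (auto intro: commute_inv)

lemma subfieldI_inverse:
 assumes "S \<subseteq> carrier A" "\<one>\<in>S" "\<one>~=\<zero>"
  and "!!a. a\<in>S==>\<ominus> a\<in>S" "!!a b. a\<in>S==>b\<in>S==>a\<oplus>b\<in>S"
  and "!!a b. a\<in>S==>b\<in>S==>a\<otimes>b\<in>S" "!!a b. a\<in>S==>b\<in>S==>a\<otimes>b = b\<otimes>a"
  and inv: "!!a. a\<in>S==>a~=\<zero>==>a\<in>Units A & inv a\<in>S"
 shows "subfield S A"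
proof -
 have "subring S A" by (rule subringI) (use assms in auto)
 hence "subcring S A" by (rule subcringI) (use assms in auto)
 thus ?thesis
 proof (rule subfieldI)
  show "Units (A\<lparr>carrier := S\<rparr>) = S - {\<zero>}"
  proof
   show "Units (A\<lparr>carrier := S\<rparr>) \<subseteq> S - {\<zero>}"
    using assms(1,3) by (auto simp: Units_def)
   show "S - {\<zero>} \<subseteq> Units (A\<lparr>carrier := S\<rparr>)"
   proof
    fix z assume "z\<in>S - {\<zero>}"
    hence z: "z\<in>S" "z\<in>Units A" "inv z\<in>S" using inv by auto
    have "EX w:S. w\<otimes>z = \<one> & z\<otimes>w = \<one>"
     by (rule bexI[of _ "inv z"]) (use z in auto)
    thus "z\<in>Units (A\<lparr>carrier := S\<rparr>)"
     using z unfolding Units_def by auto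
   qed
  qed
 qed
qed

lemma centre_subfield:
 assumes "\<one>~=\<zero>" "!!z. z\<in>centre A==>z~=\<zero>==>z\<in>Units A"
 shows "subfield (centre A) A"
 by (rule subfieldI_inverse)
   (use assms centre_inv in \<open>auto simp: centre_carrier centre_uminus centre_mult centre_add centre_commute\<close>)

text \<open>Sums over an initial segment of the naturals, as these are all that the decomposition needs.\<close>

lemma finsum_Suc:
 "f\<in>{..<Suc n} \<rightarrow> carrier A==>finsum A f {..<Suc n} = f n\<oplus>finsum A f {..<n}"
 unfolding lessThan_Suc by (subst finsum_insert) auto

lemma finsum_subspace:
 assumes "\<zero>\<in>V" "!!u v. u\<in>V==>v\<in>V==>u\<oplus>v\<in>V" "V \<subseteq> carrier A" "!!i. i < n==>f i\<in>V"
 shows "finsum A f {..<n::nat}\<in>V"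
 using assms(4)
proof (induction n)
 case (Suc n)
 hence "f\<in>{..<Suc n} \<rightarrow> carrier A" using assms(3) by auto
 thus ?case using Suc assms by (subst finsum_Suc) auto
qed (simp add: assms)

lemma finsum_smult_const:
 assumes "a\<in>carrier A"
 shows "finsum A (%i. (c i :: 'k)\<odot>a) {..<n::nat} = (\<Sum>i<n. c i)\<odot>a"
proof (induction n)
 case (Suc n)
 thus ?case using assms by (subst finsum_Suc) (auto simp: smult_l_distr add.commute)
qed (simp add: assms)

lemma finsum_smult_r:
 assumes "!!i. f i\<in>carrier A"
 shows "(c :: 'k)\<odot>finsum A f {..<n::nat} = finsum A (%i. c\<odot>f i) {..<n}"
proof (induction n)
 case (Suc n)
 thus ?case using assms
  by (subst finsum_Suc, fastforce, subst finsum_Suc) (auto simp: smult_r_distr finsum_closed)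
qed simp

lemma finsum_swap:
 assumes "!!i j. f i j\<in>carrier A"
 shows "finsum A (%i. finsum A (f i) {..<n}) {..<m} = finsum A (%j. finsum A (%i. f i j) {..<m::nat}) {..<n::nat}"
proof (induction m)
 case (Suc m)
 have "finsum A (%i. finsum A (f i) {..<n}) {..<Suc m} =
   finsum A (f m) {..<n}\<oplus>finsum A (%j. finsum A (%i. f i j) {..<m}) {..<n}"
  using Suc assms by (subst finsum_Suc) (auto intro!: finsum_closed)
 also have "... = finsum A (%j. f m j\<oplus>finsum A (%i. f i j) {..<m}) {..<n}"
  using assms by (subst finsum_addf) (auto intro!: finsum_closed)
 also have "... = finsum A (%j. finsum A (%i. f i j) {..<Suc m}) {..<n}"
  using assms by (intro finsum_cong') (auto simp: finsum_Suc intro!: finsum_closed)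
 finally show ?case .
qed (simp add: finsum_zero)

end

text \<open>
  An operator of exponent \<open>p\<close> is diagonalisable.  This is used as an induction principle: an
  additive property that holds for the eigenvectors in an invariant subspace holds on that subspace.
\<close>

lemma (in k_alg) eigenvector_induct:
 fixes \<zeta> :: 'k
 assumes p: "p > 0" "of_nat p~=(0 :: 'k)" and zeta: "\<zeta> ^ p = 1" "ALL m. 0 < m & m < p --> \<zeta> ^ m~=1"
  and V: "V \<subseteq> carrier A" "\<zero>\<in>V" "!!u v. u\<in>V==>v\<in>V==>u\<oplus>v\<in>V" "!!(c::'k) u. u\<in>V==>c\<odot>u\<in>V"
  and T: "!!u. u\<in>V==>T u\<in>V" "!!u v. u\<in>V==>v\<in>V==>T (u\<oplus>v) = T u\<oplus>T v"
   "!!(c::'k) u. u\<in>V==>T (c\<odot>u) = c\<odot>T u" "!!u. u\<in>V==>(T ^^ p) u = u"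
  and P: "P \<zero>" "!!u v. u\<in>V==>v\<in>V==>P u==>P v==>P (u\<oplus>v)"
   "!!k u. u\<in>V==>T u = \<zeta> ^ k\<odot>u==>P u"
  and u: "u\<in>V"
 shows "P u"
proof -
 have TV: "(T ^^ m) u\<in>V" for m by (induction m) (auto intro: T u)
 hence TA: "(T ^^ m) u\<in>carrier A" for m using V(1) by blast
 have V0: "T \<zero> = \<zero>" using T(3)[OF V(2), of 0] V T(1)[OF V(2)] by (simp add: subsetD)
 define S where "S c = finsum A (%m. c ^ m\<odot>(T ^^ m) u) {..<p}" for c :: 'k
 have SV: "S c\<in>V" for c unfolding S_def by (rule finsum_subspace) (use V TV in auto)
 have TS: "T (finsum A (%m. c ^ m\<odot>(T ^^ m) u) {..<n}) = finsum A (%m. c ^ m\<odot>(T ^^ Suc m) u) {..<n}" for c :: 'k and n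
 proof (induction n)
  case (Suc n)
  have "finsum A (%m. c ^ m\<odot>(T ^^ m) u) {..<n}\<in>V" by (rule finsum_subspace) (use V TV in auto)
  hence "T (finsum A (%m. c ^ m\<odot>(T ^^ m) u) {..<Suc n})
    = c ^ n\<odot>(T ^^ Suc n) u\<oplus>T (finsum A (%m. c ^ m\<odot>(T ^^ m) u) {..<n})"
   using TA TV V by (subst finsum_Suc) (auto simp: T)
  also have "... = finsum A (%m. c ^ m\<odot>(T ^^ Suc m) u) {..<Suc n}"
   using TA[of "Suc _"] unfolding Suc by (subst finsum_Suc) (auto simp del: funpow.simps)
  finally show ?case .
 qed (simp add: V0)
 \<comment> \<open>Shifting the summation index shows that \<open>S c\<close> is an eigenvector for \<open>1 / c\<close>.\<close>
 have eig: "c\<odot>T (S c) = S c" if c: "c ^ p = 1" for c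
 proof -
  have fA: "finsum A (%m. c ^ m\<odot>(T ^^ m) u) {..<n}\<in>carrier A" for n
   using TA by (auto intro!: finsum_closed)
  have "c\<odot>T (S c) = finsum A (%m. c ^ Suc m\<odot>(T ^^ Suc m) u) {..<p}"
   unfolding S_def TS using TA[of "Suc _"]
   by (subst finsum_smult_r) (auto simp: smult_assoc1 simp del: funpow.simps)
  moreover have shift: "finsum A (%m. c ^ Suc m\<odot>(T ^^ Suc m) u) {..<n}\<oplus>u =
    finsum A (%m. c ^ m\<odot>(T ^^ m) u) {..<n}\<oplus>c ^ n\<odot>(T ^^ n) u" for n
  proof (induction n)
   case (Suc n)
   have cl: "finsum A (%m. c ^ Suc m\<odot>(T ^^ Suc m) u) {..<n}\<in>carrier A"
    using TA[of "Suc _"] by (auto intro!: finsum_closed simp del: funpow.simps)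
   have "finsum A (%m. c ^ Suc m\<odot>(T ^^ Suc m) u) {..<Suc n}\<oplus>u =
     c ^ Suc n\<odot>(T ^^ Suc n) u\<oplus>(finsum A (%m. c ^ Suc m\<odot>(T ^^ Suc m) u) {..<n}\<oplus>u)"
    using TA[of "Suc _"] cl TA[of 0] by (subst finsum_Suc) (auto simp: a_assoc simp del: funpow.simps)
   also have "... = finsum A (%m. c ^ m\<odot>(T ^^ m) u) {..<Suc n}\<oplus>c ^ Suc n\<odot>(T ^^ Suc n) u"
    unfolding Suc using TA TA[of "Suc n"] fA by (subst finsum_Suc) (auto simp: a_ac simp del: funpow.simps)
   finally show ?case .
  qed (use TA[of 0] in auto)
  have "finsum A (%m. c ^ Suc m\<odot>(T ^^ Suc m) u) {..<p} = S c"
  proof -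
   have cl: "finsum A (%m. c ^ Suc m\<odot>(T ^^ Suc m) u) {..<p}\<in>carrier A"
    using TA[of "Suc _"] by (auto intro!: finsum_closed simp del: funpow.simps)
   have uA: "u\<in>carrier A" using TA[of 0] by simp
   have "finsum A (%m. c ^ Suc m\<odot>(T ^^ Suc m) u) {..<p}\<oplus>u = S c\<oplus>u"
    using shift[of p] c T(4)[OF u] uA unfolding S_def by simp
   thus ?thesis using add.right_cancel[OF uA cl fA] unfolding S_def by blast
  qed
  ultimately show ?thesis by simp
 qed
 have sum: "finsum A (%k. S (\<zeta> ^ k)) {..<p} = of_nat p\<odot>u"
 proof -
  have "finsum A (%k. S (\<zeta> ^ k)) {..<p} =
    finsum A (%m. finsum A (%k. (\<zeta> ^ k) ^ m\<odot>(T ^^ m) u) {..<p}) {..<p}"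
   unfolding S_def by (rule finsum_swap) (use TA in auto)
  also have "... = finsum A (%m. (\<Sum>k<p. (\<zeta> ^ k) ^ m)\<odot>(T ^^ m) u) {..<p}"
   using TA by (simp add: finsum_smult_const)
  also have "... = finsum A (%m. (if 0 = m then of_nat p\<odot>u else \<zero>)) {..<p}"
  proof (rule finsum_cong')
   fix m assume m: "m\<in>{..<p}"
   show "(\<Sum>k<p. (\<zeta> ^ k) ^ m)\<odot>(T ^^ m) u = (if 0 = m then of_nat p\<odot>u else \<zero>)"
   proof (cases "m = 0")
    case False
    have "(\<Sum>k<p. (\<zeta> ^ k) ^ m) = (\<Sum>k<p. (\<zeta> ^ m) ^ k)"
     by (simp add: power_mult[symmetric] mult.commute)
    also have "... = ((\<zeta> ^ m) ^ p - 1) / (\<zeta> ^ m - 1)"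
     by (rule geometric_sum) (use zeta False m in auto)
    also have "(\<zeta> ^ m) ^ p = (\<zeta> ^ p) ^ m" by (simp add: power_mult[symmetric] mult.commute)
    finally show ?thesis using False zeta TA[of m] by simp
   qed simp
  qed (use TA[of 0] in auto)
  also have "... = of_nat p\<odot>u"
   using p TA[of 0] by (subst finsum_singleton) auto
  finally show ?thesis .
 qed
 define R where "R k = inverse (of_nat p)\<odot>S (\<zeta> ^ k)" for k
 have RV: "R k\<in>V" for k unfolding R_def by (intro V(4) SV)
 have "finsum A R {..<p} = inverse (of_nat p)\<odot>(of_nat p\<odot>u)"
  unfolding R_def sum[symmetric] using SV V(1) by (subst finsum_smult_r) auto
 also have "... = u" using p TA[of 0] by (simp add: smult_assoc1)
 finally have sumR: "finsum A R {..<p} = u" .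
 have "P (finsum A R {..<n}) & finsum A R {..<n}\<in>V" if "n \<le> p" for n
  using that
 proof (induction n)
  case (Suc n)
  have "P (R n)"
  proof (rule P(3)[OF RV])
   have 1: "(\<zeta> ^ n) ^ p = 1" by (metis power_mult power_one zeta(1) mult.commute)
   have SA: "S (\<zeta> ^ n)\<in>carrier A" "T (S (\<zeta> ^ n))\<in>carrier A" using SV T(1)[OF SV] V(1) by auto
   have 2: "\<zeta> ^ (p - n) * \<zeta> ^ n = 1" using Suc.prems zeta(1) by (simp add: power_add[symmetric])
   have "\<zeta> ^ (p - n)\<odot>S (\<zeta> ^ n) = \<zeta> ^ (p - n)\<odot>(\<zeta> ^ n\<odot>T (S (\<zeta> ^ n)))" using eig[OF 1] by simp
   also have "... = T (S (\<zeta> ^ n))" using SA 2 by (simp add: smult_assoc1)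
   finally have "T (S (\<zeta> ^ n)) = \<zeta> ^ (p - n)\<odot>S (\<zeta> ^ n)" by simp
   thus "T (R n) = \<zeta> ^ (p - n)\<odot>R n"
    unfolding R_def using SA SV by (simp add: T smult_assoc1 mult.commute)
  qed
  moreover have "finsum A R {..<Suc n} = R n\<oplus>finsum A R {..<n}"
   by (rule finsum_Suc) (use RV V(1) in auto)
  ultimately show ?case using Suc RV V(3) P(2) by auto
 qed (use P V in auto)
 from this[of p] show ?thesis using sumR by simp
qed

locale symbol_algebra = k_alg A for A :: "('k::field_char_0, 'a) module" (structure) +
 fixes \<zeta> :: 'k and p :: nat and x y :: 'a
 assumes p_pos: "p > 0"
  and zeta_p: "\<zeta> ^ p = 1" and zeta_primitive: "ALL m. 0 < m & m < p --> \<zeta> ^ m~=1"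
  and x_unit: "x\<in>Units A" and y_unit: "y\<in>Units A"
  and xy: "x\<otimes>y = \<zeta>\<odot>(y\<otimes>x)"
  and x_power: "x [^] p\<in>centre A" and y_power: "y [^] p\<in>centre A"
  and one_not_zero: "\<one>~=\<zero>"
  and commuting_with_generators: "!!a. a\<in>carrier A==>x\<otimes>a = a\<otimes>x==>y\<otimes>a = a\<otimes>y==>a\<in>centre A"
begin

lemma x_closed [simp]: "x\<in>carrier A" and y_closed [simp]: "y\<in>carrier A"
 using x_unit y_unit by (auto intro: Units_closed)

lemma zeta_nonzero: "\<zeta>~=0"
 using zeta_p p_pos by (auto simp: zero_power)

text \<open>
  Conjugation by \<open>x\<close> and \<open>y\<close> generates the torsion group that acts on the algebra with the monomials as
  eigenvectors; \<open>weight u c d\<close> says that \<open>u\<close> is a simultaneous eigenvector with eigenvalues \<open>c\<close> and \<open>d\<close>.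
\<close>

definition weight :: "'a => 'k => 'k => bool"
 where "weight u c d \<longleftrightarrow> u\<in>carrier A & x\<otimes>u = c\<odot>(u\<otimes>x) & y\<otimes>u = d\<odot>(u\<otimes>y)"

lemma weight_carrier: "weight u c d==>u\<in>carrier A"
 by (simp add: weight_def)

lemma weight_mult: 
 assumes "weight u c d" "weight v c' d'"
 shows "weight (u\<otimes>v) (c * c') (d * d')"
proof -
 have gen: "w\<otimes>(u\<otimes>v) = (c * c')\<odot>((u\<otimes>v)\<otimes>w)"
  if w: "w\<in>carrier A" "w\<otimes>u = c\<odot>(u\<otimes>w)" "w\<otimes>v = c'\<odot>(v\<otimes>w)" for w c c'
 proof -
  have uv: "u\<in>carrier A" "v\<in>carrier A" using assms by (auto simp: weight_def)
  have "w\<otimes>(u\<otimes>v) = (c\<odot>(u\<otimes>w))\<otimes>v" using w uv by (simp add: m_assoc[symmetric])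
  also have "... = c\<odot>(u\<otimes>(c'\<odot>(v\<otimes>w)))" using w uv by (simp add: m_assoc)
  also have "... = (c * c')\<odot>((u\<otimes>v)\<otimes>w)" using w uv by (simp add: m_assoc smult_assoc1)
  finally show ?thesis .
 qed
 show ?thesis using assms gen[of x] gen[of y] unfolding weight_def by auto
qed

lemma weight_one: "weight \<one> 1 1"
 by (simp add: weight_def)

lemma weight_pow: "weight u c d==>weight (u [^] (n::nat)) (c ^ n) (d ^ n)"
proof (induction n)
 case (Suc n)
 thus ?case using weight_mult[of "u [^] n" "c ^ n" "d ^ n" u c d] by (simp add: mult.commute)
qed (simp add: weight_one)

lemma weight_inv:
 assumes "weight u c d" "u\<in>Units A" "c~=0" "d~=0"
 shows "weight (inv u) (1 / c) (1 / d)"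
proof -
 have gen: "w\<otimes>inv u = (1 / c)\<odot>(inv u\<otimes>w)"
  if w: "w\<in>carrier A" "w\<otimes>u = c\<odot>(u\<otimes>w)" and "c~=0" for w c
 proof -
  have u: "u\<in>carrier A" "inv u\<in>carrier A" using assms by (auto simp: weight_def)
  have "inv u\<otimes>w = inv u\<otimes>(w\<otimes>u)\<otimes>inv u"
   using w(1) u assms(2) by (simp add: m_assoc)
  also have "... = c\<odot>((inv u\<otimes>u)\<otimes>w\<otimes>inv u)" unfolding w(2) using w u by (simp add: m_assoc)
  also have "... = c\<odot>(w\<otimes>inv u)" using w u assms(2) by simp
  finally show ?thesis using w u \<open>c~=0\<close> by (simp add: smult_assoc1)
 qed
 show ?thesis using assms gen[of x] gen[of y] unfolding weight_def by auto
qed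

lemma weight_centre: "weight u 1 1==>u\<in>centre A"
 using commuting_with_generators unfolding weight_def by simp

lemma centre_weight: "u\<in>centre A==>weight u 1 1"
 by (simp add: weight_def centre_iff)

lemma weight_x: "weight x 1 (1 / \<zeta>)"
 using xy zeta_nonzero by (simp add: weight_def smult_assoc1)

lemma weight_y: "weight y \<zeta> 1"
 using xy by (simp add: weight_def)

definition monomial :: "nat => nat => 'a"
 where "monomial i j = x [^] i\<otimes>y [^] j"

lemma monomial_unit: "monomial i j\<in>Units A"
 unfolding monomial_def by (intro Units_m_closed Units_pow_closed x_unit y_unit)

lemma monomial_closed [simp]: "monomial i j\<in>carrier A"
 using monomial_unit by (rule Units_closed)

lemma weight_monomial: "weight (monomial i j) (\<zeta> ^ j) ((1 / \<zeta>) ^ i)"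
 unfolding monomial_def using weight_mult[OF weight_pow[OF weight_x, of i] weight_pow[OF weight_y, of j]] by simp

lemma weight_eq_monomial:
 assumes "weight u (\<zeta> ^ j) ((1 / \<zeta>) ^ i)"
 obtains z where "z\<in>centre A" "u = z\<otimes>monomial i j"
proof
 have nz: "\<zeta> ^ j~=0" "(1 / \<zeta>) ^ i~=0" using zeta_nonzero by auto
 have u: "u\<in>carrier A" using assms by (rule weight_carrier)
 show "u\<otimes>inv (monomial i j)\<in>centre A"
  using weight_mult[OF assms weight_inv[OF weight_monomial monomial_unit nz]] nz
  by (intro weight_centre) (simp del: power_eq_0_iff)
 show "u = u\<otimes>inv (monomial i j)\<otimes>monomial i j"
  using u monomial_unit[of i j] by (simp add: m_assoc)
qed

lemma zeta_power_eq:
 assumes "i < p" "j < p" "\<zeta> ^ i = \<zeta> ^ j"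
 shows "i = j"
proof -
 have *: False if "i < j" "j < p" "\<zeta> ^ i = \<zeta> ^ j" for i j
 proof -
  have "\<zeta> ^ i * \<zeta> ^ (j - i) = \<zeta> ^ i * 1" using that unfolding power_add[symmetric] by simp
  hence "\<zeta> ^ (j - i) = 1" using zeta_nonzero by simp
  thus False using zeta_primitive that by auto
 qed
 show ?thesis using *[of i j] *[of j i] assms by (metis linorder_neqE_nat)
qed

definition conj_by :: "'a => 'a => 'a"
 where "conj_by w u = w\<otimes>u\<otimes>inv w"

lemma conj_by_closed: "w\<in>Units A==>u\<in>carrier A==>conj_by w u\<in>carrier A"
 unfolding conj_by_def by (auto intro: Units_closed)

lemma conj_by_add:
 "w\<in>Units A==>u\<in>carrier A==>v\<in>carrier A==>conj_by w (u\<oplus>v) = conj_by w u\<oplus>conj_by w v"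
 unfolding conj_by_def by (simp add: Units_closed r_distr l_distr)

lemma conj_by_smult:
 "w\<in>Units A==>u\<in>carrier A==>conj_by w ((c::'k)\<odot>u) = c\<odot>conj_by w u"
 unfolding conj_by_def by (simp add: Units_closed)

lemma conj_by_eq:
 assumes "w\<in>Units A" "u\<in>carrier A"
 shows "conj_by w u = (c::'k)\<odot>u \<longleftrightarrow> w\<otimes>u = c\<odot>(u\<otimes>w)"
proof
 have w: "w\<in>carrier A" "inv w\<in>carrier A" using assms by auto
 have "w\<otimes>u = conj_by w u\<otimes>w" unfolding conj_by_def using w assms by (simp add: m_assoc)
 thus "w\<otimes>u = c\<odot>(u\<otimes>w)" if "conj_by w u = c\<odot>u" using that w assms by simp
 show "conj_by w u = c\<odot>u" if "w\<otimes>u = c\<odot>(u\<otimes>w)"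
  unfolding conj_by_def that using w assms by (simp add: m_assoc)
qed

lemma conj_by_power:
 assumes w: "w\<in>Units A" and u: "u\<in>carrier A"
 shows "(conj_by w ^^ n) u = conj_by (w [^] n) u"
proof (induction n)
 case 0 thus ?case using u by (simp add: conj_by_def)
next
 case (Suc n)
 have wc: "w\<in>carrier A" "inv w\<in>carrier A" using w by auto
 have wn: "w [^] n\<in>Units A" using w by (rule Units_pow_closed)
 have comm: "w [^] n\<otimes>w = w\<otimes>w [^] n" using wc by (metis nat_pow_Suc nat_pow_Suc2)
 have i: "inv (w [^] Suc n) = inv (w [^] n)\<otimes>inv w"
 proof (rule inv_unique'[symmetric])
  have "w [^] n\<otimes>w\<otimes>(inv (w [^] n)\<otimes>inv w) = w\<otimes>(w [^] n\<otimes>inv (w [^] n))\<otimes>inv w"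
   unfolding comm using wc Units_closed[OF wn] Units_inv_closed[OF wn] by (simp add: m_assoc del: Units_r_inv Units_l_inv)
  thus "w [^] Suc n\<otimes>(inv (w [^] n)\<otimes>inv w) = \<one>" using wn w wc unfolding Units_r_inv[OF wn] by simp
  have "inv (w [^] n)\<otimes>inv w\<otimes>(w\<otimes>w [^] n) = inv (w [^] n)\<otimes>(inv w\<otimes>w)\<otimes>w [^] n"
   using wc Units_closed[OF wn] Units_inv_closed[OF wn] by (simp add: m_assoc)
  thus "inv (w [^] n)\<otimes>inv w\<otimes>w [^] Suc n = \<one>" using wn w wc comm by simp
 qed (use wc wn in auto)
 show ?case unfolding funpow.simps comp_def Suc unfolding conj_by_def i
  using wc wn u comm by (simp add: m_assoc Units_closed nat_pow_closed)
qed

lemma conj_by_central_power: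
 assumes w: "w\<in>Units A" "w [^] p\<in>centre A" and u: "u\<in>carrier A"
 shows "(conj_by w ^^ p) u = u"
proof -
 have wp: "w [^] p\<in>Units A" using w(1) by (rule Units_pow_closed)
 have "conj_by (w [^] p) u = (1::'k)\<odot>u"
  using centre_commute[OF w(2) u] wp u by (subst conj_by_eq) (auto simp: Units_closed)
 thus ?thesis using u by (simp add: conj_by_power[OF w(1) u])
qed

text \<open>
  Every subspace that is stable under conjugation by the two generators is spanned by the weight
  vectors that it contains.
\<close>

lemma weight_vector_induct:
 assumes V: "V \<subseteq> carrier A" "\<zero>\<in>V" "!!u v. u\<in>V==>v\<in>V==>u\<oplus>v\<in>V" "!!(c::'k) u. u\<in>V==>c\<odot>u\<in>V"
  and conj: "!!u. u\<in>V==>conj_by x u\<in>V" "!!u. u\<in>V==>conj_by y u\<in>V"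
  and P: "P \<zero>" "!!u v. u\<in>V==>v\<in>V==>P u==>P v==>P (u\<oplus>v)"
   "!!i j u. u\<in>V==>weight u (\<zeta> ^ j) ((1 / \<zeta>) ^ i)==>P u"
  and u: "u\<in>V"
 shows "P u"
proof -
 have pz: "of_nat p~=(0::'k)" using p_pos by simp
 have VA: "!!u. u\<in>V==>u\<in>carrier A" using V(1) by blast
 show ?thesis
 proof (rule eigenvector_induct[where T = "conj_by x" and V = V, OF p_pos pz zeta_p zeta_primitive V conj(1) _ _ _ P(1,2) _ u])
  fix j u assume u: "u\<in>V" "conj_by x u = \<zeta> ^ j\<odot>u"
  let ?V = "{u\<in>V. conj_by x u = \<zeta> ^ j\<odot>u}"
  note xeq = conj_by_eq[OF x_unit VA]
  have Vx: "!!u. u\<in>?V==>x\<otimes>u = \<zeta> ^ j\<odot>(u\<otimes>x)" using xeq by auto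
  show "P u"
  proof (rule eigenvector_induct[where T = "conj_by y" and V = ?V, OF p_pos pz zeta_p zeta_primitive])
   show "conj_by y u\<in>?V" if u: "u\<in>?V" for u
   proof -
    have uA: "u\<in>carrier A" using u VA by auto
    have "weight y \<zeta> 1" by (rule weight_y)
    have yi: "inv y\<in>carrier A" using y_unit by simp
    have "x\<otimes>conj_by y u = (x\<otimes>y)\<otimes>u\<otimes>inv y" unfolding conj_by_def using uA yi by (simp add: m_assoc)
    also have "... = \<zeta>\<odot>(y\<otimes>(x\<otimes>u)\<otimes>inv y)" unfolding xy using uA yi by (simp add: m_assoc)
    also have "... = (\<zeta> * \<zeta> ^ j)\<odot>(y\<otimes>u\<otimes>(x\<otimes>inv y))"
     unfolding Vx[OF u] using uA yi by (simp add: m_assoc smult_assoc1)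
    also have "x\<otimes>inv y = (1 / \<zeta>)\<odot>(inv y\<otimes>x)"
     using weight_inv[OF weight_y y_unit zeta_nonzero] by (simp add: weight_def)
    also have "(\<zeta> * \<zeta> ^ j)\<odot>(y\<otimes>u\<otimes>((1 / \<zeta>)\<odot>(inv y\<otimes>x))) = \<zeta> ^ j\<odot>(conj_by y u\<otimes>x)"
     unfolding conj_by_def using uA yi zeta_nonzero by (simp add: m_assoc smult_assoc1)
    finally show ?thesis using conj(2)[of u] u by (subst mem_Collect_eq, subst xeq) auto
   qed
   fix i u assume "u\<in>?V" "conj_by y u = \<zeta> ^ i\<odot>u"
   hence u: "u\<in>V" "x\<otimes>u = \<zeta> ^ j\<odot>(u\<otimes>x)" "y\<otimes>u = \<zeta> ^ i\<odot>(u\<otimes>y)"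
    using Vx conj_by_eq[OF y_unit VA] by auto
   have "(\<zeta> ^ i) ^ p = 1" by (metis power_mult power_one zeta_p mult.commute)
   moreover have "(\<zeta> ^ i) ^ p = \<zeta> ^ i * (\<zeta> ^ i) ^ (p - 1)" using p_pos by (cases p) auto
   ultimately have "(1 / \<zeta>) ^ (i * (p - 1)) = \<zeta> ^ i"
    using zeta_nonzero by (simp add: power_mult power_one_over field_simps)
   with u have "weight u (\<zeta> ^ j) ((1 / \<zeta>) ^ (i * (p - 1)))" by (simp add: weight_def VA)
   thus "P u" using P(3) u by blast
  next
   show "?V \<subseteq> carrier A" using VA by auto
   show "\<zero>\<in>?V" using V(2) x_unit by (simp add: conj_by_def)
   show "u\<in>?V" using u by simp
  qed (use V u P y_unit x_unit in \<open>auto simp: VA conj_by_add conj_by_smult smult_r_distr smult_assoc1 mult.commute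
    conj_by_central_power[OF y_unit y_power]\<close>)
 qed (use x_unit in \<open>auto simp: VA conj_by_add conj_by_smult conj_by_central_power[OF x_unit x_power]\<close>)
qed

lemma conj_by_weight:
 "weight u c d==>conj_by x u = c\<odot>u" "weight u c d==>conj_by y u = d\<odot>u"
 unfolding weight_def using conj_by_eq[OF x_unit] conj_by_eq[OF y_unit] by auto

lemma simple_ring_of_central_units:
 assumes units: "!!z. z\<in>centre A==>z~=\<zero>==>z\<in>Units A"
 shows "simple_ring A"
 unfolding simple_ring_def
proof (intro conjI allI impI)
 fix I assume I: "ideal I A"
 interpret I: ideal I A by (rule I)
 show "I = {\<zero>} | I = carrier A"
 proof (rule disjCI)
  assume "I~=carrier A"
  have sm: "c\<odot>u\<in>I" if "u\<in>I" for c :: 'k and u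
   using I.I_l_closed[OF that, of "c\<odot>\<one>"] I.Icarr[OF that] by simp
  have "u = \<zero>" if "u\<in>I" for u
  proof (rule weight_vector_induct[of I "%u. u = \<zero>"])
   fix i j w assume w: "w\<in>I" "weight w (\<zeta> ^ j) ((1 / \<zeta>) ^ i)"
   then obtain z where z: "z\<in>centre A" "w = z\<otimes>monomial i j" by (blast elim: weight_eq_monomial)
   show "w = \<zero>"
   proof (cases "z = \<zero>")
    case False
    hence "w\<in>Units A" using z units monomial_unit by auto
    hence "\<one>\<in>I" using I.I_l_closed[OF w(1), of "inv w"] by simp
    hence "I = carrier A" using I.one_imp_carrier by simp
    with \<open>I~=carrier A\<close> show ?thesis by blast
   qed (use z in simp)
  next
   show "conj_by x u\<in>I" if "u\<in>I" for u unfolding conj_by_def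
    using that x_unit by (intro I.I_r_closed I.I_l_closed) auto
   show "conj_by y u\<in>I" if "u\<in>I" for u unfolding conj_by_def
    using that y_unit by (intro I.I_r_closed I.I_l_closed) auto
  qed (use that sm I.Icarr in \<open>auto intro: I.a_closed\<close>)
  thus "I = {\<zero>}" using I.zero_closed by blast
 qed
qed (use ring_axioms one_not_zero in auto)

text \<open>
  Vectors of different weights are linearly independent over the centre: if \<open>w\<close> lies in the span of
  vectors of other weights, then applying \<open>conj_by x - c\<close> or \<open>conj_by y - d\<close> removes one of them.
\<close>

lemma Span_other_weights:
 assumes Z: "subfield (centre A) A"
  and Us: "!!u. u\<in>set Us==>EX c' d'. weight u c' d' & (c', d')~=(c, d)"
  and w: "weight w c d" "w\<in>Span (centre A) Us"
 shows "w = \<zero>"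
 using Us w
proof (induction Us arbitrary: w)
 case Nil
 thus ?case by simp
next
 case (Cons u Us)
 let ?S = "Span (centre A) Us"
 have Usc: "set Us \<subseteq> carrier A" using Cons.prems(1) weight_carrier by (meson list.set_intros(2) subsetI)
 note S = Span_subgroup_props[OF Z Usc] Span_smult_closed[OF Z Usc]
 have SA: "!!s. s\<in>?S==>s\<in>carrier A" using S(1) by blast
 have sm: "k\<odot>s\<in>?S" if "s\<in>?S" for k :: 'k and s
  using S(5)[OF centre_smult[OF centre_one, of k] that] SA[OF that] by simp
 have conjS: "conj_by g s\<in>Span (centre A) Vs"
  if g: "g\<in>Units A" and Vs: "!!v. v\<in>set Vs==>v\<in>carrier A & (EX k::'k. conj_by g v = k\<odot>v)"
   and s: "s\<in>Span (centre A) Vs" for g s Vs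
  using Vs s
 proof (induction Vs arbitrary: s)
  case Nil
  thus ?case using g by (simp add: conj_by_def Units_closed)
 next
  case (Cons v Vs)
  from Cons.prems(2) obtain z t where zt: "z\<in>centre A" "t\<in>Span (centre A) Vs" "s = z\<otimes>v\<oplus>t"
   by (auto simp: line_extension_mem_iff)
  obtain k :: 'k where k: "conj_by g v = k\<odot>v" "v\<in>carrier A" using Cons.prems(1)[of v] by auto
  have "set Vs \<subseteq> carrier A" using Cons.prems(1) by auto
  hence tA: "t\<in>carrier A" using zt(2) Span_subgroup_props(1)[OF Z] by blast
  have gA: "g\<in>carrier A" "inv g\<in>carrier A" using g by auto
  have zA: "z\<in>carrier A" using zt by (simp add: centre_carrier)
  have "conj_by g (z\<otimes>v) = z\<otimes>conj_by g v"
  proof -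
   have "conj_by g (z\<otimes>v) = (g\<otimes>z)\<otimes>(v\<otimes>inv g)"
    unfolding conj_by_def using gA zA k by (simp add: m_assoc)
   also have "g\<otimes>z = z\<otimes>g" using centre_commute[OF zt(1) gA(1)] by simp
   finally show ?thesis unfolding conj_by_def using gA zA k by (simp add: m_assoc)
  qed
  hence "conj_by g s = (k\<odot>z)\<otimes>v\<oplus>conj_by g t"
   unfolding zt(3) using k zA tA by (simp add: conj_by_add[OF g])
  moreover have "conj_by g t\<in>Span (centre A) Vs" using Cons zt by auto
  ultimately show ?case using centre_smult[OF zt(1)] by (auto simp: line_extension_mem_iff)
 qed
 from Cons.prems(1)[of u] obtain c' d' where u: "weight u c' d'" "(c', d')~=(c, d)" by auto
 from Cons.prems(3) obtain z s where zs: "z\<in>centre A" "s\<in>?S" "w = z\<otimes>u\<oplus>s"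
  by (auto simp: line_extension_mem_iff)
 have zA: "z\<in>carrier A" and sA: "s\<in>carrier A" and uA: "u\<in>carrier A" and wA: "w\<in>carrier A"
  using zs SA u Cons.prems(2) by (auto simp: centre_carrier weight_carrier)
 have zu: "weight (z\<otimes>u) c' d'" using weight_mult[OF centre_weight[OF zs(1)] u(1)] by simp
 have step: "w\<in>?S" if g: "g\<in>Units A" "!!v c d. weight v c d==>conj_by g v = pr (c, d)\<odot>v"
   and ne: "pr (c, d)~=pr (c', d')" for g and pr :: "'k\<times>'k => 'k"
 proof -
  let ?a = "pr (c, d)" and ?b = "pr (c', d')"
  have cs: "conj_by g s\<in>?S"
   by (rule conjS[OF g(1) _ zs(2)]) (use g(2) Cons.prems(1) weight_carrier in \<open>meson list.set_intros(2)\<close>)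
  have "?a\<odot>w = ?b\<odot>(z\<otimes>u)\<oplus>conj_by g s"
   using g(2)[OF Cons.prems(2)] g(2)[OF zu] zA uA sA unfolding zs(3) by (simp add: conj_by_add[OF g(1)])
  moreover have "?b\<odot>w = ?b\<odot>(z\<otimes>u)\<oplus>?b\<odot>s"
   unfolding zs(3) using zA uA sA by (simp add: smult_r_distr)
  ultimately have "?a\<odot>w\<oplus>(- 1)\<odot>(?b\<odot>w) = conj_by g s\<oplus>(- 1)\<odot>(?b\<odot>s)"
   using zA uA sA SA[OF cs] by (simp add: smult_minus_one minus_add r_neg1 r_neg2 a_assoc[symmetric])
    (simp add: a_ac r_neg r_neg1 r_neg2 minus_add)
  hence "(?a - ?b)\<odot>w = conj_by g s\<oplus>(- 1)\<odot>(?b\<odot>s)"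
   using smult_l_distr[OF wA, of ?a "- ?b"] wA by (simp add: smult_assoc1)
  also have "...\<in>?S" by (intro S(3) sm cs zs)
  finally have "inverse (?a - ?b)\<odot>((?a - ?b)\<odot>w)\<in>?S" by (rule sm)
  thus ?thesis using ne wA by (simp add: smult_assoc1)
 qed
 have "w\<in>?S"
 proof (cases "c = c'")
  case True
  thus ?thesis using u step[of y snd] y_unit conj_by_weight(2) by auto
 next
  case False
  thus ?thesis using step[of x fst] x_unit conj_by_weight(1) by auto
 qed
 thus ?case using Cons by auto
qed

lemma dimension_over_centre:
 assumes Z: "subfield (centre A) A"
 shows "dimension (p\<^sup>2) (centre A) (carrier A)"
proof -
 let ?m = "%(i, j). monomial i j"
 have indep: "independent (centre A) (map ?m ps)"
  if "distinct ps" "set ps \<subseteq> {..<p}\<times>{..<p}" for ps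
  using that
 proof (induction ps)
  case (Cons q ps)
  obtain i j where q: "q = (i, j)" by force
  have "monomial i j \<notin> Span (centre A) (map ?m ps)"
  proof
   assume m: "monomial i j\<in>Span (centre A) (map ?m ps)"
   have "monomial i j = \<zero>"
   proof (rule Span_other_weights[OF Z _ weight_monomial m])
    fix u assume "u\<in>set (map ?m ps)"
    then obtain i' j' where ij: "(i', j')\<in>set ps" "u = monomial i' j'" by auto
    hence ne: "(i', j')~=(i, j)" "i < p" "j < p" "i' < p" "j' < p" using Cons.prems q by auto
    have "(\<zeta> ^ j', (1 / \<zeta>) ^ i')~=(\<zeta> ^ j, (1 / \<zeta>) ^ i)"
    proof
     assume "(\<zeta> ^ j', (1 / \<zeta>) ^ i') = (\<zeta> ^ j, (1 / \<zeta>) ^ i)"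
     hence "\<zeta> ^ j' = \<zeta> ^ j" "\<zeta> ^ i' = \<zeta> ^ i" by (auto simp: power_one_over)
     thus False using ne zeta_power_eq by auto
    qed
    thus "EX c' d'. weight u c' d' & (c', d')~=(\<zeta> ^ j, (1 / \<zeta>) ^ i)"
     using weight_monomial[of i' j'] ij by blast
   qed
   hence "\<zero>\<in>Units A" using monomial_unit[of i j] by simp
   thus False using one_not_zero Units_l_inv[of \<zero>] by simp
  qed
  thus ?case using Cons q by (auto intro!: li_Cons)
 qed auto
 let ?ps = "List.product [0..<p] [0..<p]"
 let ?Us = "map ?m ?ps"
 have Usc: "set ?Us \<subseteq> carrier A" by auto
 note S = Span_subgroup_props[OF Z Usc] Span_smult_closed[OF Z Usc]
 have SA: "!!s. s\<in>Span (centre A) ?Us==>s\<in>carrier A" using S(1) by blast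
 have "u\<in>Span (centre A) ?Us" if "u\<in>carrier A" for u
 proof (rule weight_vector_induct[of "carrier A" "%u. u\<in>Span (centre A) ?Us"])
  fix i j u assume w: "weight u (\<zeta> ^ j) ((1 / \<zeta>) ^ i)"
  have red: "\<zeta> ^ n = \<zeta> ^ (n mod p)" for n
  proof -
   have "\<zeta> ^ n = \<zeta> ^ (p * (n div p) + n mod p)" by simp
   also have "... = \<zeta> ^ (n mod p)" unfolding power_add power_mult zeta_p by simp
   finally show ?thesis .
  qed
  have "weight u (\<zeta> ^ (j mod p)) ((1 / \<zeta>) ^ (i mod p))"
   using w red[of i] red[of j] by (simp add: power_one_over)
  then obtain z where z: "z\<in>centre A" "u = z\<otimes>monomial (i mod p) (j mod p)" by (rule weight_eq_monomial)
  have "(i mod p, j mod p)\<in>set ?ps" using p_pos by auto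
  hence "monomial (i mod p) (j mod p)\<in>set ?Us" by force
  hence "monomial (i mod p) (j mod p)\<in>Span (centre A) ?Us"
   using Span_base_incl[OF Z Usc] by blast
  thus "u\<in>Span (centre A) ?Us" unfolding z(2) by (rule S(5)[OF z(1)])
 next
  show "conj_by x u\<in>carrier A" if "u\<in>carrier A" for u using conj_by_closed[OF x_unit that] .
  show "conj_by y u\<in>carrier A" if "u\<in>carrier A" for u using conj_by_closed[OF y_unit that] .
 qed (use that S in auto)
 hence "Span (centre A) ?Us = carrier A" using SA by blast
 moreover have "independent (centre A) ?Us" by (rule indep) (auto simp: distinct_product)
 moreover have "length ?Us = p\<^sup>2" by (simp add: power2_eq_square)
 ultimately show ?thesis using dimensionI[OF Z] by metis
qed

end

section \<open>Automorphisms\<close>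

context k_alg
begin

lemma k_alg_homD:
 assumes "f\<in>k_alg_hom A A"
 shows "!!a. a\<in>carrier A==>f a\<in>carrier A"
  "!!a b. a\<in>carrier A==>b\<in>carrier A==>f (a\<otimes>b) = f a\<otimes>f b"
  "!!a b. a\<in>carrier A==>b\<in>carrier A==>f (a\<oplus>b) = f a\<oplus>f b"
  "f \<one> = \<one>" "!!(c::'k) a. a\<in>carrier A==>f (c\<odot>a) = c\<odot>f a"
 using assms unfolding k_alg_hom_def Ring.ring_hom_def by auto

lemma k_alg_homI:
 assumes "!!a. a\<in>carrier A==>f a\<in>carrier A"
  "!!a b. a\<in>carrier A==>b\<in>carrier A==>f (a\<otimes>b) = f a\<otimes>f b"
  "!!a b. a\<in>carrier A==>b\<in>carrier A==>f (a\<oplus>b) = f a\<oplus>f b"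
  "f \<one> = \<one>" "!!(c::'k) a. a\<in>carrier A==>f (c\<odot>a) = c\<odot>f a"
 shows "f\<in>k_alg_hom A A"
 using assms unfolding k_alg_hom_def Ring.ring_hom_def by auto

lemma subgroup_k_alg_aut: "subgroup (Bij (carrier A)\<inter>k_alg_hom A A) (BijGroup (carrier A))"
proof (rule group.subgroupI[OF group_BijGroup])
 show "Bij (carrier A)\<inter>k_alg_hom A A \<subseteq> carrier (BijGroup (carrier A))" by (auto simp: BijGroup_def)
 have "(\<lambda>a\<in>carrier A. a)\<in>Bij (carrier A)\<inter>k_alg_hom A A"
  by (intro IntI id_Bij k_alg_homI) auto
 thus "Bij (carrier A)\<inter>k_alg_hom A A~={}" by blast
next
 fix f assume f: "f\<in>Bij (carrier A)\<inter>k_alg_hom A A"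
 let ?g = "\<lambda>a\<in>carrier A. inv_into (carrier A) f a"
 have bij: "bij_betw f (carrier A) (carrier A)" using f by (auto simp: Bij_def)
 have g: "?g a\<in>carrier A" "f (?g a) = a" if "a\<in>carrier A" for a
  using that bij by (auto simp: bij_betw_def inv_into_into f_inv_into_f)
 have eq: "?g b = a" if "a\<in>carrier A" "b = f a" for a b
  using that bij f k_alg_homD(1)[of f a] by (auto simp: bij_betw_def)
 note h = k_alg_homD[of f]
 have "?g\<in>k_alg_hom A A"
 proof (rule k_alg_homI)
  fix a b assume ab: "a\<in>carrier A" "b\<in>carrier A"
  show "?g (a\<otimes>b) = ?g a\<otimes>?g b"
   by (rule eq) (use f h(2)[of "?g a" "?g b"] g[OF ab(1)] g[OF ab(2)] in auto)
  show "?g (a\<oplus>b) = ?g a\<oplus>?g b"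
   by (rule eq) (use f h(3)[of "?g a" "?g b"] g[OF ab(1)] g[OF ab(2)] in auto)
  show "?g (c\<odot>a) = c\<odot>?g a" for c :: 'k
   by (rule eq) (use f h(5)[of "?g a" c] g[OF ab(1)] in auto)
 next
  show "?g \<one> = \<one>" by (rule eq) (use f h(4) in auto)
 qed (use g in auto)
 thus "inv\<^bsub>BijGroup (carrier A)\<^esub> f\<in>Bij (carrier A)\<inter>k_alg_hom A A"
  using f restrict_inv_into_Bij[of f "carrier A"] by (auto simp: inv_BijGroup)
next
 fix f g assume f: "f\<in>Bij (carrier A)\<inter>k_alg_hom A A" and g: "g\<in>Bij (carrier A)\<inter>k_alg_hom A A"
 have "compose (carrier A) f g\<in>k_alg_hom A A"
  by (rule k_alg_homI) (use f g k_alg_homD[of f] k_alg_homD[of g] in \<open>auto simp: compose_def\<close>)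
 thus "f \<otimes>\<^bsub>BijGroup (carrier A)\<^esub> g\<in>Bij (carrier A)\<inter>k_alg_hom A A"
  using f g compose_Bij[of f "carrier A" g] by (auto simp: BijGroup_def)
qed

lemma group_k_alg_aut: "group (k_alg_aut A)"
 unfolding k_alg_aut_def using subgroup.subgroup_is_group[OF subgroup_k_alg_aut group_BijGroup] .

lemma carrier_k_alg_aut: "carrier (k_alg_aut A) = Bij (carrier A)\<inter>k_alg_hom A A"
 by (simp add: k_alg_aut_def)

lemma k_alg_aut_hom: "g\<in>carrier (k_alg_aut A)==>g\<in>k_alg_hom A A"
 by (simp add: carrier_k_alg_aut)

lemma k_alg_aut_mult:
 "g\<in>carrier (k_alg_aut A)==>h\<in>carrier (k_alg_aut A)==>a\<in>carrier A ==>
  (g \<otimes>\<^bsub>k_alg_aut A\<^esub> h) a = g (h a)"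
 by (simp add: k_alg_aut_def BijGroup_def compose_def)

lemma k_alg_aut_one: "a\<in>carrier A==>\<one>\<^bsub>k_alg_aut A\<^esub> a = a"
 by (simp add: k_alg_aut_def BijGroup_def)

lemma k_alg_aut_inv:
 assumes "g\<in>carrier (k_alg_aut A)" "a\<in>carrier A"
 shows "(inv\<^bsub>k_alg_aut A\<^esub> g) (g a) = a" "g ((inv\<^bsub>k_alg_aut A\<^esub> g) a) = a"
proof -
 interpret Aut: group "k_alg_aut A" by (rule group_k_alg_aut)
 have i: "inv\<^bsub>k_alg_aut A\<^esub> g\<in>carrier (k_alg_aut A)" using assms by simp
 show "(inv\<^bsub>k_alg_aut A\<^esub> g) (g a) = a"
  using k_alg_aut_mult[OF i assms(1,2)] Aut.l_inv[OF assms(1)] k_alg_aut_one[OF assms(2)] by simp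
 show "g ((inv\<^bsub>k_alg_aut A\<^esub> g) a) = a"
  using k_alg_aut_mult[OF assms(1) i assms(2)] Aut.r_inv[OF assms(1)] k_alg_aut_one[OF assms(2)] by simp
qed

lemma k_alg_aut_eqI:
 assumes "g\<in>carrier (k_alg_aut A)" "h\<in>carrier (k_alg_aut A)" "!!a. a\<in>carrier A==>g a = h a"
 shows "g = h"
 by (rule extensionalityI[of g "carrier A" h]) (use assms in \<open>auto simp: carrier_k_alg_aut Bij_def\<close>)

lemma k_alg_aut_Units:
 assumes g: "g\<in>carrier (k_alg_aut A)" and u: "u\<in>Units A"
 shows "g u\<in>Units A" "g (inv u) = inv (g u)"
proof -
 note h = k_alg_homD[OF k_alg_aut_hom[OF g]]
 have uc: "u\<in>carrier A" "inv u\<in>carrier A" using u by auto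
 have 1: "g u\<otimes>g (inv u) = \<one>" "g (inv u)\<otimes>g u = \<one>"
  using h(2)[OF uc] h(2)[OF uc(2,1)] u h(4) by auto
 show "g (inv u) = inv (g u)" by (rule inv_unique'[OF _ _ 1]) (use h(1) uc in auto)
 show "g u\<in>Units A" using 1 h(1)[OF uc(1)] h(1)[OF uc(2)] unfolding Units_def by auto
qed

end

section \<open>Characters of the residue field\<close>

definition chi :: "'k::field => 'p::prime_card mod_ring => 'k"
 where "chi \<zeta> a = \<zeta> ^ nat (to_int_mod_ring a)"

lemma of_nat_mod_card: "(of_nat (n mod CARD('p)) :: 'p::prime_card mod_ring) = of_nat n"
proof -
 have "(of_nat n :: 'p mod_ring) = of_nat (CARD('p) * (n div CARD('p)) + n mod CARD('p))" by simp
 also have "... = of_nat (n mod CARD('p))" unfolding of_nat_add of_nat_mult by simp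
 finally show ?thesis by simp
qed

lemma chi_of_nat:
 assumes "\<zeta> ^ CARD('p) = 1"
 shows "chi \<zeta> (of_nat n :: 'p::prime_card mod_ring) = \<zeta> ^ n"
proof -
 have "to_int_mod_ring (of_nat (n mod CARD('p)) :: 'p mod_ring) = int (n mod CARD('p))"
  unfolding of_nat_of_int_mod_ring comp_def by (rule to_int_mod_ring_of_int_mod_ring) auto
 hence "chi \<zeta> (of_nat n :: 'p mod_ring) = \<zeta> ^ (n mod CARD('p))"
  unfolding chi_def of_nat_mod_card by simp
 also have "... = \<zeta> ^ (CARD('p) * (n div CARD('p)) + n mod CARD('p))"
  unfolding power_add power_mult assms by simp
 also have "... = \<zeta> ^ n" by simp
 finally show ?thesis .
qed

context
 fixes \<zeta> :: "'k::field" and ty :: "'p::prime_card itself"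
 assumes zeta: "\<zeta> ^ CARD('p) = 1"
begin

lemma chi_add: "chi \<zeta> (a + b :: 'p mod_ring) = chi \<zeta> a * chi \<zeta> b"
proof -
 obtain i j where "a = of_nat i" "b = of_nat j" using surj_of_nat_mod_ring by metis
 thus ?thesis using chi_of_nat[OF zeta] by (simp add: of_nat_add[symmetric] power_add del: of_nat_add)
qed

lemma chi_0: "chi \<zeta> (0 :: 'p mod_ring) = 1"
 using chi_of_nat[OF zeta, of 0] by simp

lemma chi_1: "chi \<zeta> (1 :: 'p mod_ring) = \<zeta>"
 using chi_of_nat[OF zeta, of 1] by simp

lemma chi_minus_inverse: "chi \<zeta> (a :: 'p mod_ring) * chi \<zeta> (- a) = 1"
 using chi_add[of a "- a"] chi_0 by simp

lemma chi_nonzero: "chi \<zeta> (a :: 'p mod_ring)~=0"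
 using chi_minus_inverse[of a] by auto

lemma chi_minus: "chi \<zeta> (- a :: 'p mod_ring) = 1 / chi \<zeta> a"
 using chi_minus_inverse[of a] chi_nonzero[of a] by (simp add: field_simps)

lemma chi_mult_of_nat: "chi \<zeta> (of_nat n * a :: 'p mod_ring) = chi \<zeta> a ^ n"
 by (induction n) (auto simp: chi_0 chi_add distrib_right)

lemma chi_eq_1:
 assumes prim: "ALL m. 0 < m & m < CARD('p) --> \<zeta> ^ m~=1"
 shows "chi \<zeta> (a :: 'p mod_ring) = 1 \<longleftrightarrow> a = 0"
proof
 assume c: "chi \<zeta> a = 1"
 obtain i where i: "i < CARD('p)" "a = of_nat i" using surj_of_nat_mod_ring by blast
 hence "\<zeta> ^ i = 1" using c chi_of_nat[OF zeta] by simp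
 hence "i = 0" using prim i by auto
 thus "a = 0" using i by simp
qed (use chi_0 in simp)

end

section \<open>Symbol division algebras of prime degree\<close>

locale symbol_division_algebra = symbol_algebra A \<zeta> "CARD('p::prime_card)" x y
 for A :: "('k::field_char_0, 'a) module" (structure) and \<zeta> :: 'k and x y :: 'a and ty :: "'p::prime_card itself" +
 assumes division: "Units A = carrier A - {\<zero>}"
begin

lemmas chi_simps = chi_add[OF zeta_p] chi_0[OF zeta_p] chi_1[OF zeta_p] chi_minus[OF zeta_p]
lemmas chi_nz = chi_nonzero[OF zeta_p]

lemma nonzero_mult: "u\<in>carrier A==>v\<in>carrier A==>u~=\<zero>==>v~=\<zero>==>u\<otimes>v~=\<zero>"
 using Units_m_closed[of u v] division by auto

lemma nonzero_pow: "u\<in>carrier A==>u~=\<zero>==>u [^] (n::nat)~=\<zero>"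
 by (induction n) (use one_not_zero nonzero_mult in auto)

text \<open>\<open>wt u a b\<close> says that \<open>u\<close> is a central multiple of \<open>x\<^sup>a y\<^sup>b\<close>.\<close>

definition wt :: "'a => 'p mod_ring => 'p mod_ring => bool"
 where "wt u a b \<longleftrightarrow> weight u (chi \<zeta> b) (chi \<zeta> (- a))"

lemma wt_of_nat: "wt u (of_nat i) (of_nat j) \<longleftrightarrow> weight u (\<zeta> ^ j) ((1 / \<zeta>) ^ i)"
 unfolding wt_def by (simp add: chi_of_nat[OF zeta_p] chi_simps power_one_over)

lemma wt_carrier: "wt u a b==>u\<in>carrier A"
 by (simp add: wt_def weight_carrier)

lemma wt_mult: "wt u a b==>wt v a' b'==>wt (u\<otimes>v) (a + a') (b + b')"
 unfolding wt_def using weight_mult[of u "chi \<zeta> b" "chi \<zeta> (- a)" v "chi \<zeta> b'" "chi \<zeta> (- a')"]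
 by (simp only: minus_add_distrib chi_add[OF zeta_p])

lemma wt_pow: "wt u a b==>wt (u [^] n) (of_nat n * a) (of_nat n * b)"
 unfolding wt_def using weight_pow[of u "chi \<zeta> b" "chi \<zeta> (- a)" n]
  chi_mult_of_nat[OF zeta_p, of n "- a"] by (simp add: chi_mult_of_nat[OF zeta_p])

lemma wt_inv: "wt u a b==>u\<in>Units A==>wt (inv u) (- a) (- b)"
 unfolding wt_def using weight_inv[of u "chi \<zeta> b" "chi \<zeta> (- a)"] chi_nz by (simp add: chi_simps)

lemma wt_0_centre: "wt u 0 0==>u\<in>centre A"
 using weight_centre by (simp add: wt_def chi_simps)

lemma wt_monomial: "wt (monomial i j) (of_nat i) (of_nat j)"
 unfolding wt_of_nat by (rule weight_monomial)

lemma wt_proportional: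
 assumes "wt u a b" "wt v a b" "v~=\<zero>"
 obtains z where "z\<in>centre A" "u = z\<otimes>v"
proof
 have v: "v\<in>Units A" using assms wt_carrier division by auto
 show "u\<otimes>inv v\<in>centre A" using wt_mult[OF assms(1) wt_inv[OF assms(2) v]] by (intro wt_0_centre) simp
 show "u = u\<otimes>inv v\<otimes>v" using v Units_closed[OF v] wt_carrier[OF assms(1)] by (simp add: m_assoc)
qed

text \<open>Two weight vectors commute up to the value of the symplectic form on their weights.\<close>

lemma wt_commutation:
 assumes u: "wt u a b" and v: "wt v c d"
 shows "u\<otimes>v = chi \<zeta> (a * d - b * c)\<odot>(v\<otimes>u)"
proof -
 obtain i j where ij: "a = of_nat i" "b = of_nat j" using surj_of_nat_mod_ring by metis
 obtain z where z: "z\<in>centre A" "u = z\<otimes>monomial i j"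
  using wt_proportional[OF u[unfolded ij] wt_monomial] monomial_unit[of i j] division by blast
 have vA: "v\<in>carrier A" using v by (rule wt_carrier)
 have pw: "w [^] n\<otimes>v = e ^ n\<odot>(v\<otimes>w [^] n)"
  if w: "w\<in>carrier A" "w\<otimes>v = e\<odot>(v\<otimes>w)" for w n and e :: 'k
 proof (induction n)
  case (Suc n)
  have "w [^] Suc n\<otimes>v = w [^] n\<otimes>(w\<otimes>v)" using w vA by (simp add: m_assoc)
  also have "... = e\<odot>((w [^] n\<otimes>v)\<otimes>w)" unfolding w(2) using w vA by (simp add: m_assoc)
  also have "... = e ^ Suc n\<odot>(v\<otimes>w [^] Suc n)" unfolding Suc using w vA by (simp add: m_assoc smult_assoc1)
  finally show ?case .
 qed (use vA in simp)
 from v have wv: "x\<otimes>v = chi \<zeta> d\<odot>(v\<otimes>x)" "y\<otimes>v = chi \<zeta> (- c)\<odot>(v\<otimes>y)"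
  unfolding wt_def weight_def by auto
 have "monomial i j\<otimes>v = x [^] i\<otimes>(y [^] j\<otimes>v)" unfolding monomial_def using vA by (simp add: m_assoc)
 also have "... = chi \<zeta> (- c) ^ j\<odot>((x [^] i\<otimes>v)\<otimes>y [^] j)"
  unfolding pw[OF y_closed wv(2)] using vA by (simp add: m_assoc)
 also have "... = (chi \<zeta> d ^ i * chi \<zeta> (- c) ^ j)\<odot>(v\<otimes>monomial i j)"
  unfolding pw[OF x_closed wv(1)] monomial_def using vA by (simp add: m_assoc smult_assoc1 mult.commute)
 also have "chi \<zeta> d ^ i * chi \<zeta> (- c) ^ j = chi \<zeta> (a * d - b * c)"
  unfolding ij chi_mult_of_nat[OF zeta_p, symmetric] chi_add[OF zeta_p, symmetric] by simp
 finally have m: "monomial i j\<otimes>v = chi \<zeta> (a * d - b * c)\<odot>(v\<otimes>monomial i j)" .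
 have zA: "z\<in>carrier A" using z by (simp add: centre_carrier)
 have "u\<otimes>v = z\<otimes>(monomial i j\<otimes>v)" unfolding z(2) using zA vA by (simp add: m_assoc)
 also have "... = chi \<zeta> (a * d - b * c)\<odot>((z\<otimes>v)\<otimes>monomial i j)"
  unfolding m using zA vA by (simp add: m_assoc)
 also have "z\<otimes>v = v\<otimes>z" by (rule centre_commute[OF z(1) vA])
 finally show ?thesis unfolding z(2) using zA vA by (simp add: m_assoc)
qed

lemma wt_commute_iff:
 assumes "wt u a b" "wt v c d" "u~=\<zero>" "v~=\<zero>"
 shows "u\<otimes>v = v\<otimes>u \<longleftrightarrow> a * d = b * c"
proof -
 have uv: "u\<in>carrier A" "v\<in>carrier A" using assms wt_carrier by auto
 have "v\<otimes>u\<in>Units A" using assms uv division by (intro Units_m_closed) auto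
 hence "u\<otimes>v = v\<otimes>u \<longleftrightarrow> chi \<zeta> (a * d - b * c) = 1"
  using wt_commutation[OF assms(1,2)] smult_unit_cancel[of "v\<otimes>u" "chi \<zeta> (a * d - b * c)" 1]
   one_not_zero uv by auto
 thus ?thesis using chi_eq_1[OF zeta_p zeta_primitive] by simp
qed

lemma wt_induct:
 assumes V: "V \<subseteq> carrier A" "\<zero>\<in>V" "!!u v. u\<in>V==>v\<in>V==>u\<oplus>v\<in>V" "!!(c::'k) u. u\<in>V==>c\<odot>u\<in>V"
  and conj: "!!u. u\<in>V==>conj_by x u\<in>V" "!!u. u\<in>V==>conj_by y u\<in>V"
  and P: "P \<zero>" "!!u v. u\<in>V==>v\<in>V==>P u==>P v==>P (u\<oplus>v)"
   "!!a b u. u\<in>V==>wt u a b==>P u"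
  and u: "u\<in>V"
 shows "P u"
 by (rule weight_vector_induct[of V P, OF V conj P(1,2) _ u]) (use P(3) wt_of_nat in blast)+

definition centralizer :: "'a set => 'a set"
 where "centralizer S = {a\<in>carrier A. ALL s:S. a\<otimes>s = s\<otimes>a}"

lemma centralizer_closed:
 assumes S: "S \<subseteq> carrier A"
 shows "\<one>\<in>centralizer S" "\<zero>\<in>centralizer S"
  "!!a b. a\<in>centralizer S==>b\<in>centralizer S==>a\<oplus>b\<in>centralizer S"
  "!!a b. a\<in>centralizer S==>b\<in>centralizer S==>a\<otimes>b\<in>centralizer S"
  "!!(c::'k) a. a\<in>centralizer S==>c\<odot>a\<in>centralizer S"
  "!!a. a\<in>centralizer S==>\<ominus> a\<in>centralizer S"
  "!!a. a\<in>centralizer S==>a~=\<zero>==>a\<in>Units A & inv a\<in>centralizer S"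
proof -
 have SA: "!!s. s\<in>S==>s\<in>carrier A" using S by blast
 show 1: "\<one>\<in>centralizer S" "\<zero>\<in>centralizer S"
  using SA by (auto simp: centralizer_def)
 show "a\<oplus>b\<in>centralizer S" if "a\<in>centralizer S" "b\<in>centralizer S" for a b
  using that SA by (auto simp: centralizer_def l_distr r_distr)
 show "a\<otimes>b\<in>centralizer S" if "a\<in>centralizer S" "b\<in>centralizer S" for a b
 proof -
  have ab: "a\<in>carrier A" "b\<in>carrier A" using that by (auto simp: centralizer_def)
  have "a\<otimes>b\<otimes>s = s\<otimes>(a\<otimes>b)" if s: "s\<in>S" for s
  proof -
   have "a\<otimes>b\<otimes>s = a\<otimes>(b\<otimes>s)" using ab SA[OF s] by (simp add: m_assoc)
   also have "... = (a\<otimes>s)\<otimes>b"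
    using \<open>b\<in>centralizer S\<close> s ab SA[OF s] by (simp add: m_assoc centralizer_def)
   also have "... = s\<otimes>(a\<otimes>b)"
    using \<open>a\<in>centralizer S\<close> s ab SA[OF s] by (simp add: m_assoc[symmetric] centralizer_def)
   finally show ?thesis .
  qed
  thus ?thesis using ab by (simp add: centralizer_def)
 qed
 show sm: "c\<odot>a\<in>centralizer S" if "a\<in>centralizer S" for c :: 'k and a
  using that SA by (auto simp: centralizer_def)
 show "\<ominus> a\<in>centralizer S" if "a\<in>centralizer S" for a
  using sm[OF that, of "- 1"] that by (simp add: smult_minus_one centralizer_def)
 show "a\<in>Units A & inv a\<in>centralizer S" if "a\<in>centralizer S" "a~=\<zero>" for a
 proof -
  have a: "a\<in>Units A" using that division by (auto simp: centralizer_def)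
  thus ?thesis using that SA commute_inv[OF a] by (auto simp: centralizer_def)
 qed
qed

lemma centralizer_subfield:
 assumes "S \<subseteq> carrier A" "!!a b. a\<in>centralizer S==>b\<in>centralizer S==>a\<otimes>b = b\<otimes>a"
 shows "subfield (centralizer S) A"
proof (rule subfieldI_inverse)
 show "centralizer S \<subseteq> carrier A" by (auto simp: centralizer_def)
qed (fact one_not_zero centralizer_closed[OF assms(1)] assms(2) | rule centralizer_closed[OF assms(1)] assms(2); assumption)+

lemma maximal_subfield_centralizer:
 assumes L: "maximal_subfield A L" and a: "a\<in>carrier A" "!!l. l\<in>L==>a\<otimes>l = l\<otimes>a"
 shows "a\<in>L"
proof -
 have LS: "subfield L A" using L by (simp add: maximal_subfield_def)
 have LA: "L \<subseteq> carrier A" and Lc: "!!l m. l\<in>L==>m\<in>L==>l\<otimes>m = m\<otimes>l"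
  using subfieldE[OF LS] by auto
 let ?S = "insert a L"
 have S: "?S \<subseteq> carrier A" using LA a by auto
 have "?S \<subseteq> centralizer ?S" using S a Lc by (auto simp: centralizer_def)
 hence CC: "centralizer (centralizer ?S) \<subseteq> centralizer ?S" unfolding centralizer_def by blast
 have C: "centralizer ?S \<subseteq> carrier A" by (auto simp: centralizer_def)
 have "subfield (centralizer (centralizer ?S)) A"
  by (rule centralizer_subfield[OF C]) (use CC in \<open>auto simp: centralizer_def\<close>)
 moreover have SCC: "?S \<subseteq> centralizer (centralizer ?S)" using S by (auto simp: centralizer_def)
 ultimately have "centralizer (centralizer ?S) = L" using L unfolding maximal_subfield_def by blast
 thus ?thesis using SCC by blast
qed

text \<open>
  The centralizer of a non-central weight vector is a maximal subfield: its weight vectors are those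
  whose weight is proportional to the given one, because the symplectic form is non-degenerate, and
  so they commute with each other.
\<close>

lemma centralizer_weight_vector_maximal:
 assumes z: "wt z a b" "z~=\<zero>" "(a, b)~=(0, 0)"
 shows "maximal_subfield A (centralizer {z})"
proof -
 let ?L = "centralizer {z}"
 have zA: "z\<in>carrier A" using z wt_carrier by auto
 have S: "{z} \<subseteq> carrier A" using zA by simp
 note cl = centralizer_closed[OF S]
 have LA: "?L \<subseteq> carrier A" by (auto simp: centralizer_def)
 have conj: "conj_by g u\<in>?L" if u: "u\<in>?L" and g: "g\<in>Units A" "conj_by g z = (c::'k)\<odot>z" "c~=0" for g u c
 proof -
  have gA: "g\<in>carrier A" "inv g\<in>carrier A" and uA: "u\<in>carrier A" using u g LA by auto
  have mult: "conj_by g (v\<otimes>w) = conj_by g v\<otimes>conj_by g w" if "v\<in>carrier A" "w\<in>carrier A" for v w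
  proof -
   have "conj_by g v\<otimes>conj_by g w = g\<otimes>v\<otimes>(inv g\<otimes>g)\<otimes>w\<otimes>inv g"
    unfolding conj_by_def using gA that by (simp add: m_assoc del: Units_l_inv)
   thus ?thesis unfolding conj_by_def using gA g that by (simp add: m_assoc)
  qed
  have "c\<odot>(conj_by g u\<otimes>z) = c\<odot>(z\<otimes>conj_by g u)"
   using mult[OF uA zA] mult[OF zA uA] u g zA conj_by_closed[OF g(1) uA] by (simp add: centralizer_def)
  hence "inverse c\<odot>(c\<odot>(conj_by g u\<otimes>z)) = inverse c\<odot>(c\<odot>(z\<otimes>conj_by g u))" by simp
  thus ?thesis using g(3) zA conj_by_closed[OF g(1) uA] by (simp add: centralizer_def smult_assoc1)
 qed
 have conjx: "conj_by x u\<in>?L" and conjy: "conj_by y u\<in>?L" if "u\<in>?L" for u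
  using conj[OF that x_unit conj_by_weight(1)] conj[OF that y_unit conj_by_weight(2)] z(1) chi_nz
  unfolding wt_def by blast+
 have comm: "u\<otimes>v = v\<otimes>u" if u: "u\<in>?L" and v: "v\<in>?L" for u v
 proof (rule wt_induct[of ?L "%u. u\<otimes>v = v\<otimes>u", OF LA cl(2,3,5) conjx conjy _ _ _ u])
  fix a1 b1 u assume u: "u\<in>?L" and wu: "wt u a1 b1"
  show "u\<otimes>v = v\<otimes>u"
  proof (rule wt_induct[of ?L "%v. u\<otimes>v = v\<otimes>u", OF LA cl(2,3,5) conjx conjy _ _ _ v])
   fix a2 b2 v assume v: "v\<in>?L" and wv: "wt v a2 b2"
   show "u\<otimes>v = v\<otimes>u"
   proof (cases "u = \<zero> | v = \<zero>")
    case True thus ?thesis using u v LA by (auto simp: subsetD)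
   next
    case False
    hence e: "a1 * b = b1 * a" "a2 * b = b2 * a"
     using u v wt_commute_iff[OF wu z(1)] wt_commute_iff[OF wv z(1)] z(2) by (auto simp: centralizer_def)
    have "a * (a1 * b2 - b1 * a2) = a1 * (b2 * a) - a2 * (b1 * a)" by (simp add: algebra_simps)
    also have "... = 0" unfolding e[symmetric] by simp
    finally have a: "a * (a1 * b2 - b1 * a2) = 0" .
    have "b * (a1 * b2 - b1 * a2) = b2 * (a1 * b) - b1 * (a2 * b)" by (simp add: algebra_simps)
    also have "... = 0" unfolding e by simp
    finally have b: "b * (a1 * b2 - b1 * a2) = 0" .
    from a b have "a1 * b2 = b1 * a2" using z(3) by auto
    thus ?thesis using wt_commute_iff[OF wu wv] False by auto
   qed
  qed (use u LA in \<open>auto simp: subsetD l_distr r_distr\<close>)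
 qed (use v LA in \<open>auto simp: subsetD l_distr r_distr\<close>)
 show ?thesis unfolding maximal_subfield_def
 proof (intro conjI allI impI)
  show "subfield ?L A" by (rule centralizer_subfield[OF S comm])
  fix L' assume L': "subfield L' A & ?L \<subseteq> L'"
  have "z\<in>?L" using zA by (simp add: centralizer_def)
  hence "z\<in>L'" using L' by blast
  have "L' \<subseteq> ?L"
  proof
   fix l assume l: "l\<in>L'"
   have "l\<in>carrier A" using L' l by (meson subfieldE(3) subsetD)
   moreover have "l\<otimes>z = z\<otimes>l" using L' l \<open>z\<in>L'\<close> by (meson subfieldE(4))
   ultimately show "l\<in>?L" by (simp add: centralizer_def)
  qed
  thus "L' = ?L" using L' by blast
 qed
qed

lemma centralizer_proportional_weight:
 assumes z: "wt z a b" and w: "wt w (c * a) (c * b)" "z~=\<zero>"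
 shows "centralizer {z} \<subseteq> centralizer {w}"
proof -
 obtain n where n: "c = of_nat n" using surj_of_nat_mod_ring by blast
 have zA: "z\<in>carrier A" using z by (rule wt_carrier)
 obtain t where t: "t\<in>centre A" "w = t\<otimes>z [^] n"
  using wt_proportional[OF w(1)[unfolded n] wt_pow[OF z]] nonzero_pow[OF zA w(2)] by blast
 show ?thesis
 proof
  fix u assume u: "u\<in>centralizer {z}"
  hence uA: "u\<in>carrier A" by (simp add: centralizer_def)
  have "z [^] n\<in>centralizer {u}" by (induction n)
   (use u zA uA centralizer_closed(1,4)[of "{u}"] in \<open>auto simp: centralizer_def\<close>)
  moreover have "t\<in>centralizer {u}" using t(1) uA by (auto simp: centralizer_def centre_iff)
  ultimately have "w\<in>centralizer {u}" unfolding t(2) using uA by (intro centralizer_closed(4)) auto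
  thus "u\<in>centralizer {w}" using uA by (auto simp: centralizer_def)
 qed
qed

end

section \<open>The division algebra of fractions of skew polynomials\<close>

context
 fixes \<zeta> :: "'k::field_char_0" and A :: "('k, 'a) module" (structure) and \<iota> :: "(nat\<times>nat => 'k) => 'a"
 assumes frac: "division_algebra_of_fractions (skew_poly \<zeta>) A \<iota>"
begin

lemma frac_k_alg: "k_alg A"
 using frac unfolding division_algebra_of_fractions_def by unfold_locales blast

interpretation k_alg A by (rule frac_k_alg)

lemma frac_division: "Units A = carrier A - {\<zero>}"
 using frac unfolding division_algebra_of_fractions_def by blast

lemma skew_carrier: "f\<in>carrier (skew_poly \<zeta>) \<longleftrightarrow> finite {m. f m~=0}"
 by (simp add: skew_poly_def)

lemma skew_monom_carrier: "skew_monom i j\<in>carrier (skew_poly \<zeta>)"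
 unfolding skew_carrier skew_monom_def by (rule finite_subset[of _ "{(i, j)}"]) auto

lemma iota_hom:
 shows iota_closed: "f\<in>carrier (skew_poly \<zeta>)==>\<iota> f\<in>carrier A"
  and iota_mult: "f\<in>carrier (skew_poly \<zeta>)==>g\<in>carrier (skew_poly \<zeta>) ==>
   \<iota> (f \<otimes>\<^bsub>skew_poly \<zeta>\<^esub> g) = \<iota> f\<otimes>\<iota> g"
  and iota_add: "f\<in>carrier (skew_poly \<zeta>)==>g\<in>carrier (skew_poly \<zeta>) ==>
   \<iota> (%m. f m + g m) = \<iota> f\<oplus>\<iota> g"
  and iota_one: "\<iota> (skew_monom 0 0) = \<one>"
  and iota_smult: "f\<in>carrier (skew_poly \<zeta>)==>\<iota> (%m. c * f m) = c\<odot>\<iota> f"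
 using frac unfolding division_algebra_of_fractions_def k_alg_hom_def Ring.ring_hom_def
 by (auto simp: skew_poly_def)

lemma iota_inj: "f\<in>carrier (skew_poly \<zeta>)==>g\<in>carrier (skew_poly \<zeta>)==>\<iota> f = \<iota> g==>f = g"
 using frac unfolding division_algebra_of_fractions_def inj_on_def by blast

abbreviation "qmon i j \<equiv> \<iota> (skew_monom i j)"

lemma mon_closed: "qmon i j\<in>carrier A"
 by (intro iota_closed skew_monom_carrier)

lemma mon_mult: "qmon i j\<otimes>qmon i' j' = \<zeta> ^ (i * j')\<odot>qmon (i + i') (j + j')"
proof -
 have "qmon i j\<otimes>qmon i' j' = \<iota> (skew_monom i j \<otimes>\<^bsub>skew_poly \<zeta>\<^esub> skew_monom i' j')"
  by (simp add: iota_mult skew_monom_carrier)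
 also have "... = \<zeta> ^ (i * j')\<odot>qmon (i + i') (j + j')"
  unfolding skew_monom_mult using iota_smult[OF skew_monom_carrier] by (simp add: skew_poly_def)
 finally show ?thesis .
qed

lemma iota_zero: "\<iota> (%_. 0) = \<zero>"
 using iota_smult[OF skew_monom_carrier, of 0 0 0] mon_closed by simp

lemma iota_nonzero:
 assumes "f\<in>carrier (skew_poly \<zeta>)" "f~=(%_. 0)"
 shows "\<iota> f~=\<zero>"
 using iota_inj[of f "%_. 0"] assms iota_zero by (auto simp: skew_carrier)

lemma mon_independent:
 assumes "qmon i j = c\<odot>qmon i' j'"
 shows "(i, j) = (i', j')"
proof (rule ccontr)
 assume ne: "(i, j)~=(i', j')"
 have "\<iota> (skew_monom i j) = \<iota> (%m. c * skew_monom i' j' m)"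
  using assms by (simp add: iota_smult skew_monom_carrier)
 moreover have "(%m. c * skew_monom i' j' m)\<in>carrier (skew_poly \<zeta>)"
  unfolding skew_carrier skew_monom_def by (rule finite_subset[of _ "{(i', j')}"]) auto
 ultimately have "skew_monom i j = (%m. c * skew_monom i' j' m)" using iota_inj skew_monom_carrier by blast
 from fun_cong[OF this, of "(i, j)"] show False using ne by (auto simp: skew_monom_def split: if_splits)
qed

lemma mon_nonzero: "qmon i j~=\<zero>"
 by (rule iota_nonzero[OF skew_monom_carrier]) (metis (full_types) skew_monom_def zero_neq_one)

lemma frac_one_not_zero: "\<one>~=\<zero>"
 using mon_nonzero[of 0 0] iota_one by simp

lemma mon_eq_powers: "qmon i j = qmon 0 1 [^] j\<otimes>qmon 1 0 [^] i"
proof -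
 have "qmon 0 1 [^] n = qmon 0 n" for n
  using mon_closed by (induction n) (auto simp: iota_one mon_mult)
 moreover have "qmon 1 0 [^] n = qmon n 0" for n
  using mon_closed by (induction n) (auto simp: iota_one mon_mult)
 ultimately show ?thesis using mon_closed by (simp add: mon_mult)
qed

text \<open>The algebra is generated by \<open>x\<close> and \<open>y\<close> under sums, products, scalars and inverses.\<close>

lemma frac_induct:
 assumes a: "a\<in>carrier A"
  and gens: "P (qmon 1 0)" "P (qmon 0 1)" and one: "P \<one>"
  and add: "!!a b. a\<in>carrier A==>b\<in>carrier A==>P a==>P b==>P (a\<oplus>b)"
  and mult: "!!a b. a\<in>carrier A==>b\<in>carrier A==>P a==>P b==>P (a\<otimes>b)"
  and smult: "!!(c::'k) a. a\<in>carrier A==>P a==>P (c\<odot>a)"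
  and inv: "!!a. a\<in>Units A==>P a==>P (inv a)"
 shows "P a"
proof -
 have Ppow: "P (a [^] n)" if "a\<in>carrier A" "P a" for a and n :: nat
  using that by (induction n) (auto intro: one mult)
 have Pmon: "P (qmon i j)" for i j
  by (subst mon_eq_powers) (intro mult Ppow gens nat_pow_closed mon_closed)
 have Pfin: "P (\<iota> f)" if "finite S" "{m. f m~=0} \<subseteq> S" for f S
  using that
 proof (induction S arbitrary: f rule: finite_induct)
  case empty
  hence "f = (%_. 0)" by (auto simp: fun_eq_iff)
  thus ?case using smult[OF mon_closed Pmon, of 0 0 0] iota_zero mon_closed by simp
 next
  case (insert q S)
  obtain i j where q: "q = (i, j)" by force
  let ?g = "f(q := 0)" and ?h = "%m. f q * skew_monom i j m"
  have g: "{m. ?g m~=0} \<subseteq> S" using insert.prems by auto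
  have gc: "?g\<in>carrier (skew_poly \<zeta>)" unfolding skew_carrier by (rule finite_subset[OF g insert.hyps(1)])
  have hc: "?h\<in>carrier (skew_poly \<zeta>)"
   unfolding skew_carrier skew_monom_def by (rule finite_subset[of _ "{(i, j)}"]) auto
  have "f = (%m. ?g m + ?h m)" by (auto simp: fun_eq_iff q skew_monom_def)
  hence "\<iota> f = \<iota> ?g\<oplus>\<iota> ?h" using iota_add[OF gc hc] by simp
  moreover have "\<iota> ?h = f q\<odot>qmon i j" by (rule iota_smult[OF skew_monom_carrier])
  ultimately have e: "\<iota> f = \<iota> ?g\<oplus>f q\<odot>qmon i j" by simp
  show ?case unfolding e
   by (rule add[OF iota_closed[OF gc] smult_closed[OF mon_closed] insert.IH[OF g] smult[OF mon_closed Pmon]])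
 qed
 hence Pi: "P (\<iota> f)" if "f\<in>carrier (skew_poly \<zeta>)" for f using that unfolding skew_carrier by blast
 from a frac obtain f g where fg: "f\<in>carrier (skew_poly \<zeta>)" "g\<in>carrier (skew_poly \<zeta>)"
  "g~=\<zero>\<^bsub>skew_poly \<zeta>\<^esub>" "a = \<iota> f\<otimes>inv (\<iota> g)"
  unfolding division_algebra_of_fractions_def by blast
 have "\<iota> g\<in>Units A" using iota_nonzero[OF fg(2)] fg(3) iota_closed[OF fg(2)] frac_division
  by (auto simp: skew_poly_def)
 thus ?thesis unfolding fg(4) using fg Pi iota_closed by (intro mult inv) auto
qed

lemma frac_automorphisms_eq:
 assumes g: "g\<in>k_alg_hom A A" and h: "h\<in>k_alg_hom A A"
  and eq: "g (qmon 1 0) = h (qmon 1 0)" "g (qmon 0 1) = h (qmon 0 1)" and a: "a\<in>carrier A"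
 shows "g a = h a"
proof -
 note G = k_alg_homD[OF g] and H = k_alg_homD[OF h]
 show ?thesis
 proof (rule frac_induct[OF a])
  fix a assume a: "a\<in>Units A" "g a = h a"
  hence ac: "a\<in>carrier A" "inv a\<in>carrier A" by auto
  have u: "g a\<otimes>g (inv a) = \<one>" "g (inv a)\<otimes>g a = \<one>" "h a\<otimes>h (inv a) = \<one>" "h (inv a)\<otimes>h a = \<one>"
   using G(2)[OF ac] G(2)[OF ac(2,1)] H(2)[OF ac] H(2)[OF ac(2,1)] a G(4) H(4) by auto
  have "g (inv a) = inv (g a)" "h (inv a) = inv (h a)"
   using inv_unique'[OF _ _ u(1,2)] inv_unique'[OF _ _ u(3,4)] G(1) H(1) ac by auto
  thus "g (inv a) = h (inv a)" using a by simp
 qed (use G H eq in auto)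
qed

lemma frac_symbol_algebra:
 assumes p: "p > 0" and zeta: "\<zeta> ^ p = 1" "ALL m. 0 < m & m < p --> \<zeta> ^ m~=1"
 shows "symbol_algebra A \<zeta> p (qmon 1 0) (qmon 0 1)"
proof -
 have comm: "a\<in>centre A" if a: "a\<in>carrier A" "qmon 1 0\<otimes>a = a\<otimes>qmon 1 0" "qmon 0 1\<otimes>a = a\<otimes>qmon 0 1" for a
  unfolding centre_iff
 proof (intro conjI ballI)
  fix b assume "b\<in>carrier A"
  hence "b\<otimes>a = a\<otimes>b"
  proof (rule frac_induct)
   show "b\<otimes>c\<otimes>a = a\<otimes>(b\<otimes>c)" if "b\<in>carrier A" "c\<in>carrier A" "b\<otimes>a = a\<otimes>b" "c\<otimes>a = a\<otimes>c" for b c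
    using that a(1) m_assoc[of b c a] m_assoc[of b a c] m_assoc[of a b c] by simp
  qed (use a in \<open>auto simp: l_distr r_distr intro: commute_inv\<close>)
  thus "a\<otimes>b = b\<otimes>a" by simp
 qed (rule a(1))
 have units: "qmon i j\<in>Units A" for i j using mon_closed mon_nonzero frac_division by auto
 have px: "qmon 1 0 [^] n = qmon n 0" and py: "qmon 0 1 [^] n = qmon 0 n" for n :: nat
  using mon_eq_powers[of n 0] mon_eq_powers[of 0 n] mon_closed by auto
 show ?thesis
 proof unfold_locales
  show "qmon 1 0\<otimes>qmon 0 1 = \<zeta>\<odot>(qmon 0 1\<otimes>qmon 1 0)" using mon_closed by (simp add: mon_mult)
  show "qmon 1 0 [^] p\<in>centre A" "qmon 0 1 [^] p\<in>centre A"
   unfolding px py by (intro comm mon_closed; use mon_closed zeta in \<open>simp add: mon_mult\<close>)+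
 qed (use p zeta units frac_one_not_zero comm in auto)
qed

end

section \<open>Invariant maximal subfields\<close>

lemma (in k_alg) image_generated:
 assumes S: "S \<subseteq> carrier (k_alg_aut A)" and L: "L \<subseteq> carrier A" and inv: "!!s. s\<in>S==>s ` L = L"
  and g: "g\<in>carrier (subgroup_generated (k_alg_aut A) S)"
 shows "g ` L = L"
proof -
 interpret Aut: group "k_alg_aut A" by (rule group_k_alg_aut)
 let ?H = "{g\<in>carrier (k_alg_aut A). g ` L = L}"
 have "subgroup ?H (k_alg_aut A)"
 proof (rule Aut.subgroupI)
  have "\<one>\<^bsub>k_alg_aut A\<^esub> ` L = (%a. a) ` L"
   by (rule image_cong[OF refl]) (use k_alg_aut_one L in auto)
  hence "\<one>\<^bsub>k_alg_aut A\<^esub> ` L = L" by simp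
  thus "?H~={}" by blast
 next
  fix g assume g: "g\<in>?H"
  have "(inv\<^bsub>k_alg_aut A\<^esub> g) ` (g ` L) = L"
  proof -
   have "(%a. (inv\<^bsub>k_alg_aut A\<^esub> g) (g a)) ` L = (%a. a) ` L"
    by (rule image_cong[OF refl]) (use k_alg_aut_inv(1)[of g] g L in auto)
   thus ?thesis by (simp add: image_image)
  qed
  thus "inv\<^bsub>k_alg_aut A\<^esub> g\<in>?H" using g by auto
 next
  fix g h assume gh: "g\<in>?H" "h\<in>?H"
  have "(g \<otimes>\<^bsub>k_alg_aut A\<^esub> h) ` L = g ` (h ` L)"
   unfolding image_image using k_alg_aut_mult[of g h] gh L by (intro image_cong) auto
  thus "g \<otimes>\<^bsub>k_alg_aut A\<^esub> h\<in>?H" using gh by auto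
 qed auto
 hence "carrier (subgroup_generated (k_alg_aut A) S) \<subseteq> ?H"
  by (rule Aut.subgroup_generated_minimal) (use S inv in auto)
 thus ?thesis using g by blast
qed

context symbol_division_algebra
begin

lemma wt_x: "wt x 1 0"
 using weight_x by (simp add: wt_def chi_simps)

lemma wt_y: "wt y 0 1"
 using weight_y by (simp add: wt_def chi_simps)

lemma aut_nonzero: "g\<in>carrier (k_alg_aut A)==>u\<in>carrier A==>u~=\<zero>==>g u~=\<zero>"
 using k_alg_aut_Units(1)[of g u] division by auto

lemma aut_centre:
 assumes g: "g\<in>carrier (k_alg_aut A)" and z: "z\<in>centre A"
 shows "g z\<in>centre A"
 unfolding centre_iff
proof (intro conjI ballI)
 interpret Aut: group "k_alg_aut A" by (rule group_k_alg_aut)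
 note h = k_alg_homD[OF k_alg_aut_hom[OF g]]
 have zA: "z\<in>carrier A" using z by (rule centre_carrier)
 thus "g z\<in>carrier A" by (rule h(1))
 fix a assume a: "a\<in>carrier A"
 let ?b = "(inv\<^bsub>k_alg_aut A\<^esub> g) a"
 have b: "?b\<in>carrier A" using k_alg_homD(1)[OF k_alg_aut_hom[OF Aut.inv_closed[OF g]] a] .
 show "g z\<otimes>a = a\<otimes>g z"
  using h(2)[OF zA b] h(2)[OF b zA] centre_commute[OF z b] k_alg_aut_inv(2)[OF g a] by simp
qed

text \<open>The automorphism acts on weights through the matrix with rows \<open>(0, -1)\<close> and \<open>(1, -1)\<close>.\<close>

lemma wt_aut:
 assumes g: "g\<in>carrier (k_alg_aut A)" and gx: "g x = y" and gy: "g y = inv x\<otimes>inv y" and u: "wt u a b"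
 shows "wt (g u) (- b) (a - b)"
proof -
 note h = k_alg_homD[OF k_alg_aut_hom[OF g]]
 obtain i j where ij: "a = of_nat i" "b = of_nat j" using surj_of_nat_mod_ring by metis
 obtain z where z: "z\<in>centre A" "u = z\<otimes>monomial i j"
  using wt_proportional[OF u[unfolded ij] wt_monomial] monomial_unit[of i j] division by blast
 have hp: "g (v [^] n) = g v [^] n" if "v\<in>carrier A" for v and n :: nat
  using that by (induction n) (auto simp: h)
 have "g u = g z\<otimes>(y [^] i\<otimes>(inv x\<otimes>inv y) [^] j)"
  unfolding z(2) monomial_def using centre_carrier[OF z(1)] by (simp add: h hp gx gy)
 moreover have "wt (g z) 0 0"
  using centre_weight[OF aut_centre[OF g z(1)]] by (simp add: wt_def chi_simps)
 moreover have "wt (y [^] i) 0 a" using wt_pow[OF wt_y, of i] by (simp add: ij)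
 moreover have "wt ((inv x\<otimes>inv y) [^] j) (- b) (- b)"
  using wt_pow[OF wt_mult[OF wt_inv[OF wt_x x_unit] wt_inv[OF wt_y y_unit]], of j] by (simp add: ij)
 ultimately show ?thesis using wt_mult[OF _ wt_mult] by fastforce
qed

lemma image_centralizer:
 assumes g: "g\<in>carrier (k_alg_aut A)" and z: "z\<in>carrier A"
 shows "g ` centralizer {z} = centralizer {g z}"
proof -
 interpret Aut: group "k_alg_aut A" by (rule group_k_alg_aut)
 have sub: "g ` centralizer {z} \<subseteq> centralizer {g z}" if g: "g\<in>carrier (k_alg_aut A)" and z: "z\<in>carrier A" for g z
 proof -
  note h = k_alg_homD[OF k_alg_aut_hom[OF g]]
  show ?thesis using z h(2)[OF z] h(2)[OF _ z] h(1) by (auto simp: centralizer_def) metis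
 qed
 let ?i = "inv\<^bsub>k_alg_aut A\<^esub> g"
 have i: "?i\<in>carrier (k_alg_aut A)" using g by simp
 have gz: "g z\<in>carrier A" using k_alg_homD(1)[OF k_alg_aut_hom[OF g] z] .
 have "centralizer {g z} \<subseteq> g ` centralizer {z}"
 proof
  fix u assume u: "u\<in>centralizer {g z}"
  hence uA: "u\<in>carrier A" by (simp add: centralizer_def)
  have "?i u\<in>centralizer {z}" using sub[OF i gz] u k_alg_aut_inv(1)[OF g z] by auto
  hence "g (?i u)\<in>g ` centralizer {z}" by (rule imageI)
  thus "u\<in>g ` centralizer {z}" using k_alg_aut_inv(2)[OF g uA] by simp
 qed
 thus ?thesis using sub[OF g z] by blast
qed

text \<open>
  An invariant maximal subfield is stable under conjugation by \<open>x\<close> and \<open>y\<close>, so it is spanned by weight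
  vectors.  It contains a non-central one and its image, and they commute, so the weight is an
  eigenvector.  Conversely, the centralizer of a weight vector depends only on the line spanned by
  its weight.
\<close>

lemma invariant_maximal_subfield_iff:
 assumes t: "t\<in>carrier (k_alg_aut A)" "t x = y" "t y = inv x\<otimes>inv y"
  and S: "!!s. s\<in>S==>s\<in>carrier (k_alg_aut A) & (EX c d. s x = c\<odot>x & s y = d\<odot>y & c~=0 & d~=0)"
  and Sx: "EX s:S. ALL a:carrier A. s a = conj_by x a" and Sy: "EX s:S. ALL a:carrier A. s a = conj_by y a"
 shows "(EX L. maximal_subfield A L & (ALL s:insert t S. s ` L = L)) \<longleftrightarrow>
  (EX a b :: 'p mod_ring. (a, b)~=(0, 0) & a * (a - b) = b * (- b))"
proof (intro iffI; elim exE conjE)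
 fix L assume L: "maximal_subfield A L" and inv: "ALL s:insert t S. s ` L = L"
 have LS: "subfield L A" using L by (simp add: maximal_subfield_def)
 have LA: "L \<subseteq> carrier A" and Lc: "!!l m. l\<in>L==>m\<in>L==>l\<otimes>m = m\<otimes>l" and Lr: "subring L A"
  using subfieldE[OF LS] by auto
 note Lr = subringE[OF Lr]
 have Lsm: "c\<odot>l\<in>L" if "l\<in>L" for c :: 'k and l
 proof -
  have "c\<odot>\<one>\<in>L" by (rule maximal_subfield_centralizer[OF L]) (use LA in auto)
  hence "(c\<odot>\<one>)\<otimes>l\<in>L" using Lr(6) that by blast
  thus ?thesis using that LA by (auto simp: subsetD)
 qed
 have conj: "conj_by x u\<in>L" "conj_by y u\<in>L" if "u\<in>L" for u
  using that inv Sx Sy LA by (metis imageI insertCI subsetD)+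
 have "EX u:L. EX a b. wt u a b & u \<notin> centre A"
 proof (rule ccontr)
  assume no: "~ ?thesis"
  have "u\<in>centre A" if "u\<in>L" for u
  proof (rule wt_induct[of L "%u. u\<in>centre A", OF LA Lr(2) Lr(7) Lsm conj _ _ _ that])
   show "\<zero>\<in>centre A" by (simp add: centre_iff)
  qed (use no centre_add in auto)
  hence "a\<otimes>l = l\<otimes>a" if "a\<in>carrier A" "l\<in>L" for a l
   using that centre_commute[of l a] by auto
  hence "x\<in>L" "y\<in>L" by (auto intro!: maximal_subfield_centralizer[OF L])
  hence "x\<otimes>y = y\<otimes>x" by (rule Lc)
  thus False using wt_commute_iff[OF wt_x wt_y] x_unit y_unit division by auto
 qed
 then obtain u a b where u: "u\<in>L" "wt u a b" "u \<notin> centre A" by blast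
 have uA: "u\<in>carrier A" using u by (auto intro: wt_carrier)
 have u0: "u~=\<zero>" using u(3) by (auto simp: centre_iff)
 have "t u\<in>L" using inv u(1) by blast
 hence "u\<otimes>t u = t u\<otimes>u" using Lc u by blast
 hence "a * (a - b) = b * (- b)"
  using wt_commute_iff[OF u(2) wt_aut[OF t u(2)] u0 aut_nonzero[OF t(1) uA u0]] by blast
 moreover have "(a, b)~=(0, 0)" using u wt_0_centre by auto
 ultimately show "EX a b :: 'p mod_ring. (a, b)~=(0, 0) & a * (a - b) = b * (- b)" by blast
next
 fix a b :: "'p mod_ring" assume ab: "(a, b)~=(0, 0)" and q: "a * (a - b) = b * (- b)"
 obtain i j where ij: "a = of_nat i" "b = of_nat j" using surj_of_nat_mod_ring by metis
 define z where "z = monomial i j"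
 have z: "wt z a b" "z~=\<zero>" "z\<in>carrier A"
  unfolding z_def ij using wt_monomial monomial_unit[of i j] division by auto
 let ?L = "centralizer {z}"
 have same: "centralizer {w} = ?L" if w: "wt w (c * a) (c * b)" "c~=0" "w~=\<zero>" for w c
 proof
  have e: "inverse c * (c * a) = a" "inverse c * (c * b) = b"
   unfolding mult.assoc[symmetric] left_inverse[OF w(2)] by simp_all
  show "centralizer {w} \<subseteq> ?L"
   by (rule centralizer_proportional_weight[OF w(1), of z "inverse c", unfolded e, OF z(1) w(3)])
  show "?L \<subseteq> centralizer {w}" by (rule centralizer_proportional_weight[OF z(1) w(1) z(2)])
 qed
 have "a~=0" using ab q by auto
 hence 1: "- b = (- b / a) * a" by simp
 have "(- b / a) * b = (a * (a - b)) / a" unfolding q by simp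
 also have "... = a - b" using \<open>a~=0\<close> by simp
 finally have 2: "a - b = (- b / a) * b" by simp
 have "b~=0" using \<open>a~=0\<close> q by auto
 have "t ` ?L = ?L"
  unfolding image_centralizer[OF t(1) z(3)]
  by (rule same[of _ "- b / a"])
    (use wt_aut[OF t z(1)] 1 2 \<open>a~=0\<close> \<open>b~=0\<close> aut_nonzero[OF t(1) z(3,2)] in auto)
 moreover have "s ` ?L = ?L" if s: "s\<in>S" for s
 proof -
  from S[OF s] obtain c d where s: "s\<in>carrier (k_alg_aut A)" and c: "s x = c\<odot>x" "s y = d\<odot>y" "c~=0" "d~=0"
   by blast
  note h = k_alg_homD[OF k_alg_aut_hom[OF s]]
  have hp: "s (v [^] n) = e ^ n\<odot>(v [^] n)" if "v\<in>carrier A" "s v = e\<odot>v" for v e and n :: nat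
   using that by (induction n) (auto simp: h smult_assoc1 mult.commute)
  have "s z = (c ^ i * d ^ j)\<odot>z"
   unfolding z_def monomial_def by (simp add: h hp[OF x_closed c(1)] hp[OF y_closed c(2)] smult_assoc1 mult.commute)
  moreover have "wt (e\<odot>z) a b" for e :: 'k
   using z(1) z(3) unfolding wt_def weight_def by (auto simp: smult_assoc1 mult.commute)
  ultimately show ?thesis
   unfolding image_centralizer[OF s z(3)]
   using same[of "s z" 1] aut_nonzero[OF s z(3,2)] by simp
 qed
 ultimately show "EX L. maximal_subfield A L & (ALL s:insert t S. s ` L = L)"
  using centralizer_weight_vector_maximal[OF z(1,2) ab] by blast
qed

end

section \<open>Reducibility of the representation\<close>

lemma mult_mat_2_vec:
 fixes w :: "'f::comm_ring_1 vec"
 assumes "w\<in>carrier_vec 2"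
 shows "mat_of_rows_list 2 [[0, -1], [1, -1]] *\<^sub>v w = vec_of_list [- (w $ 1), w $ 0 - w $ 1]"
proof (rule eq_vecI)
 fix i assume i: "i < dim_vec (vec_of_list [- (w $ 1), w $ 0 - w $ 1])"
 hence "i = 0 | i = 1" by auto
 thus "(mat_of_rows_list 2 [[0, -1], [1, -1]] *\<^sub>v w) $ i = vec_of_list [- (w $ 1), w $ 0 - w $ 1] $ i"
  using assms by (auto simp: mat_of_rows_list_def scalar_prod_def row_def numeral_2_eq_2)
qed (simp add: mat_of_rows_list_def)

text \<open>In dimension two a proper nonzero invariant subspace is a line spanned by an eigenvector of the generator; the quadratic equation says that the vector and its image are proportional.\<close>

lemma reducible_iff_eigenvector:
 fixes \<phi> :: "'g => 'f::field mat" and G :: "('g, 'm) monoid_scheme" (structure)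
 assumes G: "group G" and t: "t\<in>carrier G" and H: "H = subgroup_generated G {t}"
  and phi: "\<phi>\<in>hom H (SL 2)" "\<phi> t = mat_of_rows_list 2 [[0, -1], [1, -1]]"
 shows "reducible_representation H 2 \<phi> \<longleftrightarrow> (EX a b :: 'f. (a, b)~=(0, 0) & a * (a - b) = b * (- b))"
proof -
 interpret group G by (rule G)
 have tH: "t\<in>carrier H" unfolding H carrier_subgroup_generated using t by (auto intro: generate.incl)
 have vv: "w = vec_of_list [w $ 0, w $ 1]" if "w\<in>carrier_vec 2" for w :: "'f vec"
  using that by (intro eq_vecI) (auto simp: less_Suc_eq numeral_2_eq_2)
 have vc: "vec_of_list [a, b]\<in>carrier_vec 2" for a b :: 'f by (rule carrier_vecI) simp
 have phit: "\<phi> t *\<^sub>v vec_of_list [a, b] = vec_of_list [- b, a - b]" for a b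
  unfolding phi(2) using mult_mat_2_vec[OF vc] by simp
 have v2: "vec_of_list [a, b] = vec 2 (%i. if i = 0 then a else b)" for a b :: 'f
 proof (rule eq_vecI)
  fix i assume "i < dim_vec (vec 2 (%i. if i = 0 then a else b))"
  hence "i = 0 | i = 1" by auto
  thus "vec_of_list [a, b] $ i = vec 2 (%i. if i = 0 then a else b) $ i" by auto
 qed simp
 have comb: "c\<cdot>\<^sub>vvec_of_list [a, b] = vec_of_list [c * a, c * b]"
  "vec_of_list [a, b] + vec_of_list [a', b'] = vec_of_list [a + a', b + b']" for a b a' b' c :: 'f
  unfolding v2 by (rule eq_vecI; simp)+
 have z0: "0\<^sub>v 2 = vec_of_list [0, 0 :: 'f]" unfolding v2 by (rule eq_vecI) simp_all
 have inj: "vec_of_list [a, b] = vec_of_list [a', b'] \<longleftrightarrow> a = a' & b = b'" for a b a' b' :: 'f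
  by (metis list_vec list.inject)
 show ?thesis
 proof
  assume "reducible_representation H 2 \<phi>"
  then obtain W where W: "VectorSpace.subspace class_ring W (module_vec TYPE('f) 2)" "W~={0\<^sub>v 2}"
   "W~=carrier_vec 2" "ALL g:carrier H. ALL w:W. \<phi> g *\<^sub>v w\<in>W"
   unfolding reducible_representation_def by blast
  from W(1) have sub: "LinearCombinations.submodule class_ring W (module_vec TYPE('f) 2)"
   unfolding VectorSpace.subspace_def by blast
  have Wc: "W \<subseteq> carrier_vec 2" and W0: "0\<^sub>v 2\<in>W" and Wa: "!!v w. v\<in>W==>w\<in>W==>v + w\<in>W"
   and Ws: "!!c v. v\<in>W==>c\<cdot>\<^sub>vv\<in>W"
   using LinearCombinations.submodule.subset[OF sub] LinearCombinations.submodule.zero_closed[OF sub]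
    LinearCombinations.submodule.m_closed[OF sub] LinearCombinations.submodule.smult_closed[OF sub]
   by (auto simp: module_vec_simps)
  obtain w where w: "w\<in>W" "w~=0\<^sub>v 2" using W(2) W0 by blast
  define a b where "a = w $ 0" and "b = w $ 1"
  have wab: "w = vec_of_list [a, b]" unfolding a_def b_def using vv Wc w by blast
  have ab: "(a, b)~=(0, 0)" using w(2) unfolding wab z0 by auto
  have wt: "vec_of_list [- b, a - b]\<in>W" using W(4) tH w(1) unfolding wab by (metis phit)
  have "a * (a - b) = b * (- b)"
  proof (rule ccontr)
   assume ne: "a * (a - b)~=b * (- b)"
   define D where "D = a * (a - b) - b * (- b)"
   have D: "D~=0" using ne unfolding D_def by (simp only: right_minus_eq not_False_eq_True)
   have "carrier_vec 2 \<subseteq> W"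
   proof
    fix v :: "'f vec" assume v: "v\<in>carrier_vec 2"
    define s r where "s = (v $ 0 * (a - b) + v $ 1 * b) / D" and "r = (a * v $ 1 - b * v $ 0) / D"
    have e: "s * a - r * b = v $ 0" "s * b + r * (a - b) = v $ 1"
    proof -
     have "s * a - r * b = ((v $ 0 * (a - b) + v $ 1 * b) * a - (a * v $ 1 - b * v $ 0) * b) / D"
      unfolding s_def r_def by (simp only: times_divide_eq_left diff_divide_distrib[symmetric])
     also have "(v $ 0 * (a - b) + v $ 1 * b) * a - (a * v $ 1 - b * v $ 0) * b = v $ 0 * D"
      unfolding D_def by (simp add: algebra_simps)
     finally show "s * a - r * b = v $ 0" using D by simp
     have "s * b + r * (a - b) = ((v $ 0 * (a - b) + v $ 1 * b) * b + (a * v $ 1 - b * v $ 0) * (a - b)) / D"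
      unfolding s_def r_def by (simp only: times_divide_eq_left add_divide_distrib[symmetric])
     also have "(v $ 0 * (a - b) + v $ 1 * b) * b + (a * v $ 1 - b * v $ 0) * (a - b) = v $ 1 * D"
      unfolding D_def by (simp add: algebra_simps)
     finally show "s * b + r * (a - b) = v $ 1" using D by simp
    qed
    have "s\<cdot>\<^sub>vvec_of_list [a, b] + r\<cdot>\<^sub>vvec_of_list [- b, a - b] = v"
     unfolding comb using e by (subst vv[OF v]) simp
    thus "v\<in>W" using Wa[OF Ws[OF w(1)[unfolded wab]] Ws[OF wt]] by metis
   qed
   thus False using Wc W(3) by blast
  qed
  thus "EX a b :: 'f. (a, b)~=(0, 0) & a * (a - b) = b * (- b)" using ab by blast
 next
  assume "EX a b :: 'f. (a, b)~=(0, 0) & a * (a - b) = b * (- b)"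
  then obtain a b :: 'f where ab: "(a, b)~=(0, 0)" and q: "a * (a - b) = b * (- b)" by blast
  let ?v = "vec_of_list [a, b]"
  have a0: "a~=0" using ab q by auto
  hence b0: "b~=0" using q by auto
  have "(- b / a) * b = (a * (a - b)) / a" unfolding q by simp
  also have "... = a - b" using a0 by simp
  finally have eig: "\<phi> t *\<^sub>v ?v = (- b / a)\<cdot>\<^sub>v?v" unfolding phit comb using a0 by simp
  have car: "\<phi> g\<in>carrier_mat 2 2" "det (\<phi> g) = 1" if "g\<in>carrier H" for g
   using phi(1) that unfolding hom_def SL_def by auto
  have mul: "\<phi> (g\<otimes>h) = \<phi> g * \<phi> h" if "g\<in>carrier H" "h\<in>carrier H" for g h
   using phi(1) that unfolding hom_def SL_def H subgroup_generated_def by auto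
  have Hgen: "carrier H = generate G {t}" unfolding H carrier_subgroup_generated using t by simp
  have oneH: "\<one>\<in>carrier H" unfolding Hgen by (rule generate.one)
  have one: "\<phi> \<one> = 1\<^sub>m 2"
  proof -
   have MM: "\<phi> \<one> * \<phi> \<one> = \<phi> \<one>" using mul[OF oneH oneH] by simp
   have M: "\<phi> \<one>\<in>carrier_mat 2 2" by (rule car(1)[OF oneH])
   have "\<phi> \<one>\<in>Units (ring_mat TYPE('f) 2 ())" by (rule det_non_zero_imp_unit[OF M]) (simp add: car(2)[OF oneH])
   then obtain B where B: "B\<in>carrier_mat 2 2" "B * \<phi> \<one> = 1\<^sub>m 2"
    unfolding Units_def ring_mat_def by auto
   have "\<phi> \<one> = (B * \<phi> \<one>) * \<phi> \<one>" unfolding B(2) using M by simp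
   also have "... = B * (\<phi> \<one> * \<phi> \<one>)" by (rule assoc_mult_mat[OF B(1) M M])
   finally show ?thesis using MM B by simp
  qed
  have scal: "EX c. c~=0 & \<phi> g *\<^sub>v ?v = c\<cdot>\<^sub>v?v" if "g\<in>generate G {t}" for g
   using that
  proof (induction rule: generate.induct)
   case one
   show ?case unfolding \<open>\<phi> \<one> = 1\<^sub>m 2\<close> using vc[of a b] by (intro exI[of _ 1]) auto
  next
   case (incl h)
   thus ?case using eig a0 b0 by (intro exI[of _ "- b / a"]) auto
  next
   case (inv h)
   hence h: "h = t" by simp
   have iH: "inv t\<in>carrier H" unfolding Hgen by (rule generate.inv) simp
   have "?v = \<phi> (inv t\<otimes>t) *\<^sub>v ?v" using t vc one by simp
   also have "... = \<phi> (inv t) *\<^sub>v (\<phi> t *\<^sub>v ?v)"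
    unfolding mul[OF iH tH] using car(1)[OF iH] car(1)[OF tH] vc by (simp add: assoc_mult_mat_vec)
   also have "... = (- b / a)\<cdot>\<^sub>v(\<phi> (inv t) *\<^sub>v ?v)"
    unfolding eig using car(1)[OF iH] vc by (simp add: mult_mat_vec)
   finally have "(- a / b)\<cdot>\<^sub>v?v = (- a / b)\<cdot>\<^sub>v((- b / a)\<cdot>\<^sub>v(\<phi> (inv t) *\<^sub>v ?v))" by simp
   also have "... = \<phi> (inv t) *\<^sub>v ?v" using a0 b0 by (simp add: smult_smult_assoc)
   finally show ?case unfolding h using a0 b0 by (intro exI[of _ "- a / b"]) auto
  next
   case (eng g h)
   then obtain c d where cd: "c~=0" "\<phi> g *\<^sub>v ?v = c\<cdot>\<^sub>v?v" "d~=0" "\<phi> h *\<^sub>v ?v = d\<cdot>\<^sub>v?v" by blast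
   have gh: "g\<in>carrier H" "h\<in>carrier H" using eng Hgen by auto
   have "\<phi> (g\<otimes>h) *\<^sub>v ?v = (d * c)\<cdot>\<^sub>v?v"
    unfolding mul[OF gh] using car(1)[OF gh(1)] car(1)[OF gh(2)] vc cd
    by (simp add: assoc_mult_mat_vec[of _ 2 2 _ 2] mult_mat_vec[of _ 2 2] smult_smult_assoc)
   thus ?case using cd by (intro exI[of _ "d * c"]) auto
  qed
  let ?W = "range (%c. c\<cdot>\<^sub>v?v)"
  have "reducible_representation H 2 \<phi>"
   unfolding reducible_representation_def
  proof (intro exI[of _ ?W] conjI ballI)
   have vs: "vectorspace class_ring (module_vec TYPE('f) 2)" by (rule vec_vs)
   show "VectorSpace.subspace class_ring ?W (module_vec TYPE('f) 2)"
   proof (rule VectorSpace.subspace.intro[OF vs], rule LinearCombinations.submodule.intro)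
    show "module class_ring (module_vec TYPE('f) 2)" using vs by (rule vectorspace.axioms(1))
    show "v \<oplus>\<^bsub>module_vec TYPE('f) 2\<^esub> w\<in>?W" if vw: "v\<in>?W" "w\<in>?W" for v w
    proof -
     from vw obtain c d where "v = c\<cdot>\<^sub>v?v" "w = d\<cdot>\<^sub>v?v" by blast
     hence "v + w = (c + d)\<cdot>\<^sub>v?v" by (simp add: add_smult_distrib_vec)
     thus ?thesis unfolding module_vec_simps by blast
    qed
    show "\<zero>\<^bsub>module_vec TYPE('f) 2\<^esub>\<in>?W" unfolding module_vec_simps z0
     by (rule range_eqI[of _ _ 0]) (simp only: comb mult_zero_left)
    show "c \<odot>\<^bsub>module_vec TYPE('f) 2\<^esub> w\<in>?W" if "w\<in>?W" for c w
     using that unfolding module_vec_simps by (auto simp: smult_smult_assoc)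
   qed (use vc in \<open>auto simp: module_vec_simps\<close>)
   have "1\<cdot>\<^sub>v?v\<in>?W" by blast
   moreover have "1\<cdot>\<^sub>v?v~=0\<^sub>v 2" unfolding comb z0 inj using ab by simp
   ultimately show "?W~={0\<^sub>v 2}" by blast
   show "?W~=carrier_vec 2"
   proof
    assume "?W = carrier_vec 2"
    hence "vec_of_list [1, 0]\<in>?W" using vc by blast
    then obtain c where "1 = c * a" "0 = c * b" unfolding comb image_iff inj by blast
    thus False using b0 by auto
   qed
   fix g w assume g: "g\<in>carrier H" and w: "w\<in>?W"
   from w obtain d where d: "w = d\<cdot>\<^sub>v?v" by blast
   from scal g obtain c where c: "\<phi> g *\<^sub>v ?v = c\<cdot>\<^sub>v?v" unfolding Hgen by blast
   have "\<phi> g *\<^sub>v w = (d * c)\<cdot>\<^sub>v?v" unfolding d using car(1)[OF g] vc c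
    by (simp add: mult_mat_vec[of _ 2 2] smult_smult_assoc)
   thus "\<phi> g *\<^sub>v w\<in>?W" by blast
  qed
  thus "reducible_representation H 2 \<phi>" .
 qed
qed

section \<open>The projective linear group\<close>

lemma smult_smult_mat: "a\<cdot>\<^sub>m(b\<cdot>\<^sub>mA) = (a * b :: 'k::semigroup_mult)\<cdot>\<^sub>mA"
 by (rule eq_matI) (auto simp: mult.assoc)

lemma one_smult_mat [simp]: "(1 :: 'k::monoid_mult)\<cdot>\<^sub>mA = A"
 by (rule eq_matI) auto

lemma carrier_GL: "g\<in>carrier (GL n) \<longleftrightarrow> g\<in>carrier_mat n n & det g~=(0::'k::field)"
proof
 assume "g\<in>carrier (GL n)"
 hence u: "g\<in>Units (ring_mat TYPE('k) n ())" by (simp add: GL_def units_of_def)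
 thus "g\<in>carrier_mat n n & det g~=0"
  using unit_imp_det_non_zero[OF u] by (auto simp: Units_def ring_mat_def)
next
 assume "g\<in>carrier_mat n n & det g~=0"
 thus "g\<in>carrier (GL n)"
  using det_non_zero_imp_unit[of g n "()"] by (simp add: GL_def units_of_def)
qed

lemma GL_simps: "g \<otimes>\<^bsub>GL n\<^esub> h = g * h" "\<one>\<^bsub>GL n\<^esub> = 1\<^sub>m n"
 by (simp_all add: GL_def units_of_def ring_mat_def)

lemma group_GL: "group (GL n :: 'k::field mat monoid)"
 unfolding GL_def by (rule monoid.units_group) (rule ring.is_monoid[OF ring_mat])

definition minv :: "nat => 'k::field mat => 'k mat"
 where "minv n g = inv\<^bsub>GL n\<^esub> g"

context
 fixes n :: nat
begin

lemma GL_mat [simp]: "g\<in>carrier (GL n)==>g\<in>carrier_mat n n"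
 by (simp add: carrier_GL)

lemma GL_dim [simp]: "g\<in>carrier (GL n)==>dim_row g = n" "g\<in>carrier (GL n)==>dim_col g = n"
 by (auto simp: carrier_GL)

lemma square_mult [simp]: "A\<in>carrier_mat n n==>B\<in>carrier_mat n n==>A * B\<in>carrier_mat n n"
 by (rule mult_carrier_mat)

lemma minv_GL [simp]: "g\<in>carrier (GL n)==>minv n g\<in>carrier (GL n)"
 unfolding minv_def by (rule group.inv_closed[OF group_GL])

lemma minv_mat [simp]: "g\<in>carrier (GL n)==>minv n g\<in>carrier_mat n n"
 by (rule GL_mat[OF minv_GL])

lemma minv_left: "g\<in>carrier (GL n)==>minv n g * g = 1\<^sub>m n"
 and minv_right: "g\<in>carrier (GL n)==>g * minv n g = 1\<^sub>m n"
 using group.l_inv[OF group_GL, of g n] group.r_inv[OF group_GL, of g n] by (simp_all add: minv_def GL_simps)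

lemma GL_mult: "g\<in>carrier (GL n)==>h\<in>carrier (GL n)==>g * h\<in>carrier (GL n)"
 using group.subgroup_self[OF group_GL, THEN subgroup.m_closed, of g n h] by (simp add: GL_simps)

lemma GL_one: "1\<^sub>m n\<in>carrier (GL n)"
 by (simp add: carrier_GL)

lemma GL_smult: "g\<in>carrier (GL n)==>c~=0==>c\<cdot>\<^sub>mg\<in>carrier (GL n)"
 by (auto simp: carrier_GL det_smult)

lemma minv_mult: "g\<in>carrier (GL n)==>h\<in>carrier (GL n)==>minv n (g * h) = minv n h * minv n g"
 using group.inv_mult_group[OF group_GL, of g n h] by (simp add: minv_def GL_simps)

lemma minv_one: "minv n (1\<^sub>m n) = 1\<^sub>m n"
 using monoid.inv_one[OF group.is_monoid[OF group_GL], of n] by (simp add: minv_def GL_simps)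

lemma mat_assoc: "A\<in>carrier_mat n n==>B\<in>carrier_mat n n==>C\<in>carrier_mat n n ==>
  (A * B) * C = A * (B * C)"
 by (rule assoc_mult_mat)

lemma smult_mult_mat:
 assumes "A\<in>carrier_mat n n" "B\<in>carrier_mat n n"
 shows "(c\<cdot>\<^sub>mA) * B = (c :: 'k::field)\<cdot>\<^sub>m(A * B)" "A * (c\<cdot>\<^sub>mB) = c\<cdot>\<^sub>m(A * B)"
 by (rule mult_smult_assoc_mat[OF assms], rule mult_smult_distrib[OF assms])

lemma minv_unique: "g\<in>carrier (GL n)==>h\<in>carrier_mat n n==>h * g = 1\<^sub>m n==>h = minv n g"
proof -
 assume a: "g\<in>carrier (GL n)" "h\<in>carrier_mat n n" "h * g = 1\<^sub>m n"
 have "h = h * (g * minv n g)" using a by (simp add: minv_right)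
 also have "... = (h * g) * minv n g"
  by (rule assoc_mult_mat[OF a(2), symmetric]) (use a in auto)
 finally show ?thesis using a minv_mat[OF a(1)] by simp
qed

lemma minv_smult: "g\<in>carrier (GL n)==>c~=0==>minv n (c\<cdot>\<^sub>mg) = (1 / c)\<cdot>\<^sub>mminv n g"
 by (rule minv_unique[symmetric])
   (auto simp: GL_smult minv_mat minv_left smult_mult_mat smult_smult_mat)

lemma cancel_minv:
 assumes "g\<in>carrier (GL n)" "m\<in>carrier_mat n n"
 shows "minv n g * (g * m) = m" "g * (minv n g * m) = m"
proof -
 have "minv n g * (g * m) = (minv n g * g) * m"
  by (rule assoc_mult_mat[OF _ _ assms(2), symmetric]) (use assms in auto)
 thus "minv n g * (g * m) = m" using assms by (simp add: minv_left)
 have "g * (minv n g * m) = (g * minv n g) * m"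
  by (rule assoc_mult_mat[OF _ _ assms(2), symmetric]) (use assms in auto)
 thus "g * (minv n g * m) = m" using assms by (simp add: minv_right)
qed

subsection \<open>Cosets\<close>

definition coset :: "'k::field mat => 'k mat set"
 where "coset g = scalars n #>\<^bsub>GL n\<^esub> g"

lemma scalars_sub: "scalars n \<subseteq> carrier (GL n)"
 unfolding scalars_def using GL_smult[OF GL_one] by auto

lemma coset_eq: "g\<in>carrier (GL n)==>coset g = {c\<cdot>\<^sub>mg | c. c~=0}"
proof -
 assume g: "g\<in>carrier (GL n)"
 have "c\<cdot>\<^sub>m1\<^sub>m n * g = c\<cdot>\<^sub>mg" for c
  using g by (simp add: smult_mult_mat(1)[of "1\<^sub>m n"])
 thus ?thesis unfolding coset_def r_coset_def scalars_def GL_simps by auto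
qed

lemma normal_scalars: "scalars n \<lhd> (GL n :: 'k::field mat monoid)"
proof -
 interpret group "GL n :: 'k mat monoid" by (rule group_GL)
 have sub: "subgroup (scalars n) (GL n :: 'k mat monoid)"
 proof (rule subgroupI)
  show "scalars n \<subseteq> carrier (GL n :: 'k mat monoid)" by (rule scalars_sub)
  have "1\<cdot>\<^sub>m1\<^sub>m n\<in>(scalars n :: 'k mat set)" unfolding scalars_def by (intro CollectI exI[of _ 1]) simp
  thus "scalars n~=({} :: 'k mat set)" by blast
  fix a :: "'k mat" assume "a\<in>scalars n"
  then obtain c where c: "c~=0" "a = c\<cdot>\<^sub>m1\<^sub>m n" by (auto simp: scalars_def)
  have "inv\<^bsub>GL n\<^esub> a = (1 / c)\<cdot>\<^sub>m1\<^sub>m n" using minv_smult[OF GL_one c(1)] unfolding minv_one unfolding c(2) minv_def .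
  thus "inv\<^bsub>GL n\<^esub> a\<in>scalars n" unfolding scalars_def using c by (intro CollectI exI[of _ "1 / c"]) auto
  fix b :: "'k mat" assume "b\<in>scalars n"
  then obtain d where d: "d~=0" "b = d\<cdot>\<^sub>m1\<^sub>m n" by (auto simp: scalars_def)
  have "a * b = (c * d)\<cdot>\<^sub>m1\<^sub>m n" unfolding c d
   by (simp add: smult_mult_mat smult_smult_mat mult.commute)
  thus "a \<otimes>\<^bsub>GL n\<^esub> b\<in>scalars n" unfolding scalars_def GL_simps using c d by (intro CollectI exI[of _ "c * d"]) auto
 qed
 show ?thesis
 proof (rule normal_invI[OF sub])
  fix g s :: "'k mat" assume g: "g\<in>carrier (GL n)" and "s\<in>scalars n"
  then obtain c where c: "c~=0" "s = c\<cdot>\<^sub>m1\<^sub>m n" by (auto simp: scalars_def)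
  have "g * s * minv n g = c\<cdot>\<^sub>m1\<^sub>m n"
   unfolding c using g minv_mat[OF g] minv_right[OF g]
   by (simp add: smult_mult_mat)
  thus "g \<otimes>\<^bsub>GL n\<^esub> s \<otimes>\<^bsub>GL n\<^esub> inv\<^bsub>GL n\<^esub> g\<in>scalars n"
   unfolding GL_simps minv_def[symmetric] scalars_def using c by blast
 qed
qed

lemma group_PGL: "group (PGL n :: 'k::field mat set monoid)"
 unfolding PGL_def by (rule normal.factorgroup_is_group[OF normal_scalars])

lemma carrier_PGL: "carrier (PGL n) = coset ` carrier (GL n :: 'k::field mat monoid)"
 unfolding PGL_def FactGroup_def RCOSETS_def coset_def by auto

lemma coset_PGL: "g\<in>carrier (GL n)==>coset g\<in>carrier (PGL n)"
 unfolding carrier_PGL by (rule imageI)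

lemma coset_mult:
 "g\<in>carrier (GL n)==>h\<in>carrier (GL n)==>coset g \<otimes>\<^bsub>PGL n\<^esub> coset h = coset (g * h)"
 using normal.rcos_sum[OF normal_scalars, of g h] unfolding coset_def PGL_def FactGroup_def by (simp add: GL_simps)

lemma coset_one: "coset (1\<^sub>m n) = \<one>\<^bsub>PGL n\<^esub>"
 unfolding coset_eq[OF GL_one] by (simp add: PGL_def FactGroup_def scalars_def)

lemma coset_inv: "g\<in>carrier (GL n)==>inv\<^bsub>PGL n\<^esub> (coset g) = coset (minv n g)"
 by (rule group.inv_equality[OF group_PGL]) (auto simp: coset_mult minv_GL minv_left coset_one coset_PGL)

lemma mem_coset_self: "g\<in>carrier (GL n)==>g\<in>coset g"
 unfolding coset_eq by (rule CollectI, rule exI[of _ 1]) simp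

lemma coset_eq_iff:
 assumes "g\<in>carrier (GL n)" "h\<in>carrier (GL n)"
 shows "coset g = coset h \<longleftrightarrow> (EX c. c~=0 & g = c\<cdot>\<^sub>mh)"
proof
 show "EX c. c~=0 & g = c\<cdot>\<^sub>mh" if "coset g = coset h"
  using mem_coset_self[OF assms(1)] that unfolding coset_eq[OF assms(2)] by auto
 assume "EX c. c~=0 & g = c\<cdot>\<^sub>mh"
 then obtain c where c: "c~=0" "g = c\<cdot>\<^sub>mh" by blast
 have "d\<cdot>\<^sub>mh = (d / c)\<cdot>\<^sub>mg" for d unfolding c(2) using c(1) by (simp add: smult_smult_mat)
 moreover have "d\<cdot>\<^sub>mg = (d * c)\<cdot>\<^sub>mh" for d unfolding c(2) by (simp add: smult_smult_mat)
 ultimately show "coset g = coset h"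
  unfolding coset_eq[OF assms(1)] coset_eq[OF assms(2)] using c(1)
  by (metis (no_types, opaque_lifting) divide_eq_0_iff mult_eq_0_iff)
qed

lemma coset_smult: "g\<in>carrier (GL n)==>c~=0==>coset (c\<cdot>\<^sub>mg) = coset g"
 by (subst coset_eq_iff) (auto intro: GL_smult)

lemma coset_mem: "g\<in>carrier (GL n)==>h\<in>coset g==>h\<in>carrier (GL n) & coset h = coset g"
proof -
 assume g: "g\<in>carrier (GL n)" and "h\<in>coset g"
 then obtain c where "c~=0" "h = c\<cdot>\<^sub>mg" unfolding coset_eq[OF g] by blast
 thus ?thesis using GL_smult[OF g] coset_smult[OF g] by simp
qed

lemma pgl_conj_coset:
 assumes g: "g\<in>carrier (GL n)" and m: "m\<in>carrier_mat n n"
 shows "pgl_conj n (coset g) m = g * m * minv n g"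
proof -
 have "(SOME h. h\<in>coset g)\<in>coset g" by (rule someI[of _ g]) (rule mem_coset_self[OF g])
 then obtain c where c: "c~=0" "(SOME h. h\<in>coset g) = c\<cdot>\<^sub>mg" unfolding coset_eq[OF g] by blast
 show ?thesis unfolding pgl_conj_def Let_def c(2) minv_def[symmetric] minv_smult[OF g c(1)]
  using c(1) g m minv_mat[OF g]
  by (simp add: smult_mult_mat smult_smult_mat)
qed

lemma PGL_cases:
 assumes "P\<in>carrier (PGL n)"
 obtains g where "g\<in>carrier (GL n)" "P = coset g"
 using assms unfolding carrier_PGL by blast

lemma pgl_conj_carrier: "P\<in>carrier (PGL n)==>m\<in>carrier_mat n n==>pgl_conj n P m\<in>carrier_mat n n"
 by (elim PGL_cases) (simp add: pgl_conj_coset minv_mat)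

lemma pgl_conj_mult:
 assumes "P\<in>carrier (PGL n)" "m\<in>carrier_mat n n" "m'\<in>carrier_mat n n"
 shows "pgl_conj n P (m * m') = pgl_conj n P m * pgl_conj n P m'"
proof -
 from assms(1) obtain g where g: "g\<in>carrier (GL n)" "P = coset g" by (rule PGL_cases)
 show ?thesis unfolding g(2) using g(1) assms minv_mat[OF g(1)]
  by (simp add: pgl_conj_coset cancel_minv mat_assoc)
qed

lemma pgl_conj_add:
 assumes "P\<in>carrier (PGL n)" "m\<in>carrier_mat n n" "m'\<in>carrier_mat n n"
 shows "pgl_conj n P (m + m') = pgl_conj n P m + pgl_conj n P m'"
proof -
 from assms(1) obtain g where g: "g\<in>carrier (GL n)" "P = coset g" by (rule PGL_cases)
 show ?thesis unfolding g(2) using g(1) assms minv_mat[OF g(1)]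
  by (simp add: pgl_conj_coset mult_add_distrib_mat[of _ n n _ n] add_mult_distrib_mat[of _ n n _ _ n])
qed

lemma pgl_conj_smult:
 assumes "P\<in>carrier (PGL n)" "m\<in>carrier_mat n n"
 shows "pgl_conj n P (c\<cdot>\<^sub>mm) = c\<cdot>\<^sub>mpgl_conj n P m"
proof -
 from assms(1) obtain g where g: "g\<in>carrier (GL n)" "P = coset g" by (rule PGL_cases)
 show ?thesis unfolding g(2) using g(1) assms minv_mat[OF g(1)]
  by (simp add: pgl_conj_coset smult_mult_mat)
qed

lemma pgl_conj_one: "P\<in>carrier (PGL n)==>pgl_conj n P (1\<^sub>m n) = 1\<^sub>m n"
 by (elim PGL_cases) (simp add: pgl_conj_coset minv_right)

lemma pgl_conj_by_one: "m\<in>carrier_mat n n==>pgl_conj n \<one>\<^bsub>PGL n\<^esub> m = m"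
 unfolding coset_one[symmetric] by (simp add: pgl_conj_coset GL_one minv_one)

lemma pgl_conj_comp:
 assumes "P\<in>carrier (PGL n)" "Q\<in>carrier (PGL n)" "m\<in>carrier_mat n n"
 shows "pgl_conj n (P \<otimes>\<^bsub>PGL n\<^esub> Q) m = pgl_conj n P (pgl_conj n Q m)"
proof -
 from assms(1) obtain g where g: "g\<in>carrier (GL n)" "P = coset g" by (rule PGL_cases)
 from assms(2) obtain h where h: "h\<in>carrier (GL n)" "Q = coset h" by (rule PGL_cases)
 show ?thesis unfolding g(2) h(2) using g(1) h(1) assms minv_mat[OF g(1)] minv_mat[OF h(1)]
  by (simp add: coset_mult pgl_conj_coset GL_mult minv_mult mat_assoc)
qed

subsection \<open>The structure of a variety on the projective linear group\<close>

lemma k_space_GL: "k_space (GL_space n)"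
 unfolding GL_space_def mat_space_def by (rule k_space_subspace[OF k_space_zariski])

lemma points_GL [simp]: "points (GL_space n) = carrier (GL n)"
 unfolding GL_space_def mat_space_def by (auto simp: carrier_GL)

lemma Union_coset:
 assumes "U \<subseteq> carrier (PGL n)"
 shows "\<Union>U = {g\<in>carrier (GL n). coset g\<in>U}"
proof
 show "\<Union>U \<subseteq> {g\<in>carrier (GL n). coset g\<in>U}"
 proof
  fix g assume "g\<in>\<Union>U"
  then obtain P where P: "P\<in>U" "g\<in>P" by blast
  with assms obtain h where h: "h\<in>carrier (GL n)" "P = coset h" by (meson PGL_cases subsetD)
  thus "g\<in>{g\<in>carrier (GL n). coset g\<in>U}" using P coset_mem[of h g] by auto
 qed
qed (use mem_coset_self in blast)

lemma openin_PGL: "openin (ftop (PGL_space n)) U \<longleftrightarrow>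
  U \<subseteq> carrier (PGL n) & openin (ftop (GL_space n)) {g\<in>carrier (GL n). coset g\<in>(U :: 'k::field mat set set)}"
proof -
 let ?o = "%U :: 'k mat set set. U \<subseteq> carrier (PGL n) & openin (ftop (GL_space n)) (\<Union>U)"
 have "istopology ?o"
  unfolding istopology_def
 proof (intro conjI allI impI)
  fix U V :: "'k mat set set" assume U: "?o U" and V: "?o V"
  thus "U\<inter>V \<subseteq> carrier (PGL n)" by blast
  have "\<Union>(U\<inter>V) = \<Union>U\<inter>\<Union>V"
   using Union_coset[of U] Union_coset[of V] Union_coset[of "U\<inter>V"] U V by auto
  thus "openin (ftop (GL_space n)) (\<Union>(U\<inter>V))" using U V by auto
 next
  fix K :: "'k mat set set set" assume K: "ALL U:K. ?o U"
  thus "\<Union>K \<subseteq> carrier (PGL n)" by blast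
  have "\<Union>(\<Union>K) = \<Union>((%U. \<Union>U) ` K)" by blast
  thus "openin (ftop (GL_space n)) (\<Union>(\<Union>K))" using K by auto
 qed
 hence "openin (ftop (PGL_space n)) U \<longleftrightarrow> ?o U"
  unfolding PGL_space_def by simp
 thus ?thesis using Union_coset[of U] by auto
qed

lemma regfun_PGL:
 "U \<subseteq> carrier (PGL n)==>f\<in>regfun (PGL_space n) U \<longleftrightarrow>
  (%g. f (coset g))\<in>regfun (GL_space n) {g\<in>carrier (GL n). coset g\<in>U}"
proof -
 assume U: "U \<subseteq> carrier (PGL n)"
 show ?thesis unfolding Union_coset[OF U, symmetric] by (simp add: PGL_space_def coset_def)
qed

lemma points_PGL [simp]: "points (PGL_space n :: ('k::field, 'k mat set) fspace) = carrier (PGL n)"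
proof
 have "{g\<in>carrier (GL n :: 'k mat monoid). coset g\<in>carrier (PGL n)} = carrier (GL n)" using coset_PGL by auto
 hence "openin (ftop (PGL_space n)) (carrier (PGL n :: 'k mat set monoid))"
  unfolding openin_PGL using openin_topspace[of "ftop (GL_space n :: ('k, 'k mat) fspace)"] by simp
 thus "carrier (PGL n) \<subseteq> points (PGL_space n :: ('k, 'k mat set) fspace)" by (rule openin_subset)
 show "points (PGL_space n :: ('k, 'k mat set) fspace) \<subseteq> carrier (PGL n)"
  using openin_topspace[of "ftop (PGL_space n :: ('k, 'k mat set) fspace)"] unfolding openin_PGL by blast
qed

lemma k_space_PGL: "k_space (PGL_space n :: ('k::field, 'k mat set) fspace)"
proof (rule k_spaceI)
 let ?c = "%U :: 'k mat set set. {g\<in>carrier (GL n). coset g\<in>U}"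
 fix U :: "'k mat set set" assume U: "openin (ftop (PGL_space n)) U"
 hence s: "U \<subseteq> carrier (PGL n)" and o: "openin (ftop (GL_space n)) (?c U)" by (auto simp: openin_PGL)
 note G = k_space_GL[where ?'a = 'k]
 show "(%_. c)\<in>regfun (PGL_space n) U" for c
  unfolding regfun_PGL[OF s] by (rule regfun_const[OF G o])
 show "(%x. f x + g x)\<in>regfun (PGL_space n) U"
  if "f\<in>regfun (PGL_space n) U" "g\<in>regfun (PGL_space n) U" for f g
  using that unfolding regfun_PGL[OF s] by (rule regfun_add[OF G o])
 show "(%x. f x * g x)\<in>regfun (PGL_space n) U"
  if "f\<in>regfun (PGL_space n) U" "g\<in>regfun (PGL_space n) U" for f g
  using that unfolding regfun_PGL[OF s] by (rule regfun_mult[OF G o])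
 fix f :: "'k mat set => 'k"
 have s': "{x\<in>U. f x~=0} \<subseteq> carrier (PGL n)" using s by blast
 have e: "?c {x\<in>U. f x~=0} = {g\<in>?c U. f (coset g)~=0}" by auto
 show "openin (ftop (PGL_space n)) {x\<in>U. f x~=0}" if f: "f\<in>regfun (PGL_space n) U"
  unfolding openin_PGL e using s' openin_regfun_nonzero[OF G o f[unfolded regfun_PGL[OF s]]] by blast
 show "(%x. inverse (f x))\<in>regfun (PGL_space n) {x\<in>U. f x~=0}" if f: "f\<in>regfun (PGL_space n) U"
  unfolding regfun_PGL[OF s'] e by (rule regfun_inverse[OF G o f[unfolded regfun_PGL[OF s]]])
 show "f\<in>regfun (PGL_space n) U"
  if loc: "!!x. x\<in>U==>EX V g. openin (ftop (PGL_space n)) V & x\<in>V & g\<in>regfun (PGL_space n) V & (ALL y:U\<inter>V. f y = g y)"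
  unfolding regfun_PGL[OF s]
 proof (rule regfun_local[OF G o])
  fix a assume "a\<in>?c U"
  hence a: "a\<in>carrier (GL n)" "coset a\<in>U" by auto
  from loc[OF a(2)] obtain V g where V: "openin (ftop (PGL_space n)) V" "coset a\<in>V" "g\<in>regfun (PGL_space n) V"
   "ALL y:U\<inter>V. f y = g y" by (elim exE conjE) (rule that)
  have Vs: "V \<subseteq> carrier (PGL n)" and Vo: "openin (ftop (GL_space n)) (?c V)" using V(1) by (auto simp: openin_PGL)
  show "EX W h. openin (ftop (GL_space n)) W & a\<in>W & h\<in>regfun (GL_space n) W & (ALL y:?c U\<inter>W. f (coset y) = h y)"
   by (rule exI[of _ "?c V"], rule exI[of _ "%a. g (coset a)"]) (use a V Vo regfun_PGL[OF Vs] in auto)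
 qed
qed

lemma morphism_coset: "morphism (GL_space n) (PGL_space n) coset"
proof (rule morphismI)
 fix V :: "'a mat set set" assume V: "openin (ftop (PGL_space n)) V"
 thus "openin (ftop (GL_space n)) {x\<in>points (GL_space n). coset x\<in>V}" by (simp add: openin_PGL)
 fix h :: "'a mat set => 'a" assume "h\<in>regfun (PGL_space n) V"
 thus "(%x. h (coset x))\<in>regfun (GL_space n) {x\<in>points (GL_space n). coset x\<in>V}"
  using V regfun_PGL[of V h] by (auto simp: openin_PGL)
qed (simp add: coset_PGL)

lemma regfun_PGL_points:
 assumes "(%g. f (coset g))\<in>regfun (GL_space n) (carrier (GL n))"
 shows "f\<in>regfun (PGL_space n) (carrier (PGL n))"
proof -
 have "{g\<in>carrier (GL n). coset g\<in>carrier (PGL n)} = carrier (GL n :: 'a mat monoid)"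
  using coset_PGL by blast
 thus ?thesis using assms by (subst regfun_PGL) auto
qed

end

section \<open>Matrix-valued morphisms\<close>

lemma points_mat [simp]: "points (mat_space n) = carrier_mat n n"
 by (simp add: mat_space_def)

lemma morphism_mat_space_iff:
 assumes X: "k_space X"
 shows "morphism X (mat_space n) F \<longleftrightarrow> (ALL x:points X. F x\<in>carrier_mat n n) &
  (ALL i<n. ALL j<n. (%x. F x $$ (i, j))\<in>regfun X (points X))"
proof (intro iffI conjI ballI allI impI)
 assume m: "morphism X (mat_space n) F"
 show "F x\<in>carrier_mat n n" if "x\<in>points X" for x using morphism_points[OF m that] by simp
 show "(%x. F x $$ (i, j))\<in>regfun X (points X)" if "i < n" "j < n" for i j
  by (rule morphism_zariski_coord[OF X m[unfolded mat_space_def], of "%m. m $$ (i, j)"])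
    (rule polyfun_coord, use that in blast)
next
 assume *: "(ALL x:points X. F x\<in>carrier_mat n n) & (ALL i<n. ALL j<n. (%x. F x $$ (i, j))\<in>regfun X (points X))"
 show "morphism X (mat_space n) F"
  unfolding mat_space_def by (rule morphism_into_zariski[OF X]) (use * in auto)
qed

context
 fixes X :: "('k::field, 'x) fspace" and n :: nat
 assumes X: "k_space X"
begin

lemma regfun_cong_points:
 "f\<in>regfun X (points X)==>(!!x. x\<in>points X==>f x = g x)==>g\<in>regfun X (points X)"
 by (rule regfun_restrict[OF X openin_topspace openin_topspace order_refl])

lemma morphism_mat_const: "M\<in>carrier_mat n n==>morphism X (mat_space n) (%_. M)"
 by (rule morphism_const[OF X]) simp

lemma morphism_mat_add:
 assumes "morphism X (mat_space n) F" "morphism X (mat_space n) F'"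
 shows "morphism X (mat_space n) (%x. F x + F' x)"
 unfolding morphism_mat_space_iff[OF X]
proof (intro conjI ballI allI impI)
 note F = assms(1)[unfolded morphism_mat_space_iff[OF X]] and F' = assms(2)[unfolded morphism_mat_space_iff[OF X]]
 show "F x + F' x\<in>carrier_mat n n" if "x\<in>points X" for x using F F' that by auto
 fix i j assume ij: "i < n" "j < n"
 show "(%x. (F x + F' x) $$ (i, j))\<in>regfun X (points X)"
 proof (rule regfun_cong_points)
  show "(%x. F x $$ (i, j) + F' x $$ (i, j))\<in>regfun X (points X)"
   by (intro regfun_add[OF X openin_topspace]) (use F F' ij in auto)
  show "F x $$ (i, j) + F' x $$ (i, j) = (F x + F' x) $$ (i, j)" if "x\<in>points X" for x
  proof -
   have "F x\<in>carrier_mat n n" "F' x\<in>carrier_mat n n" using F F' that by auto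
   thus ?thesis using ij by auto
  qed
 qed
qed

lemma morphism_mat_mult:
 assumes F: "morphism X (mat_space n) F" and F': "morphism X (mat_space n) F'"
 shows "morphism X (mat_space n) (%x. F x * F' x)"
 unfolding morphism_mat_space_iff[OF X]
proof (intro conjI ballI allI impI)
 note F = F[unfolded morphism_mat_space_iff[OF X]] and F' = F'[unfolded morphism_mat_space_iff[OF X]]
 show "F x * F' x\<in>carrier_mat n n" if "x\<in>points X" for x using F F' that by (intro mult_carrier_mat) auto
 fix i j assume ij: "i < n" "j < n"
 show "(%x. (F x * F' x) $$ (i, j))\<in>regfun X (points X)"
 proof (rule regfun_cong_points)
  show "(%x. \<Sum>k\<in>{0..<n}. F x $$ (i, k) * F' x $$ (k, j))\<in>regfun X (points X)"
   by (intro regfun_sum[OF X openin_topspace] regfun_mult[OF X openin_topspace]) (use F F' ij in auto)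
  show "(\<Sum>k\<in>{0..<n}. F x $$ (i, k) * F' x $$ (k, j)) = (F x * F' x) $$ (i, j)" if "x\<in>points X" for x
  proof -
   have "F x\<in>carrier_mat n n" "F' x\<in>carrier_mat n n" using F F' that by auto
   thus ?thesis using ij by (auto simp: scalar_prod_def)
  qed
 qed
qed

lemma morphism_mat_smult:
 assumes c: "c\<in>regfun X (points X)" and F: "morphism X (mat_space n) F"
 shows "morphism X (mat_space n) (%x. c x\<cdot>\<^sub>mF x)"
 unfolding morphism_mat_space_iff[OF X]
proof (intro conjI ballI allI impI)
 note F = F[unfolded morphism_mat_space_iff[OF X]]
 show "c x\<cdot>\<^sub>mF x\<in>carrier_mat n n" if "x\<in>points X" for x using F that by auto
 fix i j assume ij: "i < n" "j < n"
 show "(%x. (c x\<cdot>\<^sub>mF x) $$ (i, j))\<in>regfun X (points X)"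
 proof (rule regfun_cong_points)
  show "(%x. c x * F x $$ (i, j))\<in>regfun X (points X)"
   by (intro regfun_mult[OF X openin_topspace] c) (use F ij in auto)
  show "c x * F x $$ (i, j) = (c x\<cdot>\<^sub>mF x) $$ (i, j)" if "x\<in>points X" for x
  proof -
   have "F x\<in>carrier_mat n n" using F that by auto
   thus ?thesis using ij by auto
  qed
 qed
qed

lemma morphism_mat_diag:
 assumes "!!i. i < n==>(%x. d x i)\<in>regfun X (points X)"
 shows "morphism X (mat_space n) (%x. mat_diag n (d x))"
 unfolding morphism_mat_space_iff[OF X]
proof (intro conjI ballI allI impI)
 fix i j assume ij: "i < n" "j < n"
 show "(%x. mat_diag n (d x) $$ (i, j))\<in>regfun X (points X)"
  using ij assms[of j] regfun_const[OF X openin_topspace, of 0] by (cases "i = j") (auto simp: mat_diag_def)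
qed simp

lemma morphism_into_GL:
 assumes "morphism X (mat_space n) F" "!!x. x\<in>points X==>F x\<in>carrier (GL n)"
 shows "morphism X (GL_space n) F"
 unfolding GL_space_def by (rule morphism_into_subspace[OF X assms])

end

lemma morphism_GL_inclusion: "morphism (GL_space n) (mat_space n) (%g. g)"
 unfolding GL_space_def by (rule morphism_inclusion)

lemma fspace_isoI:
 assumes Y: "k_space Y" and f: "morphism X Y f" and g: "morphism Y X g"
  and gf: "!!x. x\<in>points X==>g (f x) = x" and fg: "!!y. y\<in>points Y==>f (g y) = y"
 shows "fspace_iso X Y f"
 unfolding fspace_iso_def
proof (intro conjI f)
 show bij: "bij_betw f (points X) (points Y)"
  by (rule bij_betw_byWitness[of _ g]) (use gf fg morphism_points[OF f] morphism_points[OF g] in auto)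
 show "morphism Y X (inv_into (points X) f)"
 proof (rule morphism_cong[OF Y g])
  fix y assume y: "y\<in>points Y"
  hence "inv_into (points X) f (f (g y)) = g y"
   using bij morphism_points[OF g y] by (intro inv_into_f_f) (auto simp: bij_betw_def)
  thus "g y = inv_into (points X) f y" using fg[OF y] by simp
 qed
qed

section \<open>Maximal tori\<close>

lemma GL_row_nonzero:
 assumes m: "m\<in>carrier (GL n)" and i: "i < n"
 shows "EX j<n. m $$ (i, j)~=0"
proof (rule ccontr)
 assume z: "~ ?thesis"
 have "(m * minv n m) $$ (i, i) = (\<Sum>k\<in>{0..<n}. m $$ (i, k) * minv n m $$ (k, i))"
  using GL_mat[OF m] minv_mat[OF m] i by (auto simp: scalar_prod_def)
 also have "... = 0" using z by (intro sum.neutral) auto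
 finally show False using minv_right[OF m] i by simp
qed

context
 fixes n :: nat
 assumes n: "n > 0"
begin

lemma mat_diag_GL:
 assumes "!!i. i < n==>d i~=(0::'k::field)"
 shows "mat_diag n d\<in>carrier (GL n)"
proof -
 have "mat_diag n d * mat_diag n (%i. 1 / d i) = 1\<^sub>m n"
  unfolding mat_diag_diag by (rule eq_matI) (use assms in \<open>auto simp: mat_diag_def\<close>)
 hence "det (mat_diag n d) * det (mat_diag n (%i. 1 / d i)) = 1"
  by (metis det_mult det_one mat_diag_dim)
 thus ?thesis unfolding carrier_GL by auto
qed

definition torus :: "'k::field mat => 'k mat set set"
 where "torus g = {coset n (g * mat_diag n d * minv n g) | d. ALL i<n. d i~=0}"

definition eig :: "'k::field mat => 'k mat => 'k mat"
 where "eig g m = minv n g * m * g"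

context
 fixes g :: "'k::field mat"
 assumes g: "g\<in>carrier (GL n)"
begin

lemma eig_GL: "m\<in>carrier (GL n)==>eig g m\<in>carrier (GL n)"
 unfolding eig_def by (intro GL_mult minv_GL g)

lemma eig_carrier: "m\<in>carrier_mat n n==>eig g m\<in>carrier_mat n n"
 unfolding eig_def using g by simp

lemma eig_conj: "m\<in>carrier_mat n n==>eig g (g * m * minv n g) = m"
 unfolding eig_def using g by (simp add: mat_assoc[where n = n] cancel_minv minv_left)

lemma conj_eig: "m\<in>carrier_mat n n==>g * eig g m * minv n g = m"
 unfolding eig_def using g by (simp add: mat_assoc[where n = n] cancel_minv minv_right)

lemma eig_mult:
 "m\<in>carrier_mat n n==>m'\<in>carrier_mat n n==>eig g (m * m') = eig g m * eig g m'"
 unfolding eig_def using g by (simp add: mat_assoc[where n = n] cancel_minv)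

lemma eig_smult: "m\<in>carrier_mat n n==>eig g (c\<cdot>\<^sub>mm) = c\<cdot>\<^sub>meig g m"
 unfolding eig_def using g by (simp add: smult_mult_mat[where n = n])

lemma diagonal_eq_mat_diag:
 assumes "m\<in>carrier_mat n n" "!!i j. i < n==>j < n==>i~=j==>m $$ (i, j) = (0::'k)"
 shows "m = mat_diag n (%i. m $$ (i, i))"
 by (rule eq_matI) (use assms in \<open>auto simp: mat_diag_def\<close>)

lemma conj_diag_GL: "(!!i. i < n==>d i~=0)==>g * mat_diag n d * minv n g\<in>carrier (GL n)"
 by (intro GL_mult mat_diag_GL g minv_GL)

lemma coset_in_torus_iff:
 assumes m: "m\<in>carrier (GL n)"
 shows "coset n m\<in>torus g \<longleftrightarrow> (ALL i<n. ALL j<n. i~=j --> eig g m $$ (i, j) = 0)"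
proof
 assume "coset n m\<in>torus g"
 then obtain d where d: "ALL i<n. d i~=0" "coset n m = coset n (g * mat_diag n d * minv n g)"
  unfolding torus_def by blast
 then obtain c where c: "m = c\<cdot>\<^sub>m(g * mat_diag n d * minv n g)"
  using coset_eq_iff[OF m conj_diag_GL] by auto
 have "eig g m = c\<cdot>\<^sub>mmat_diag n d"
  unfolding c using g by (subst eig_smult) (auto simp: eig_conj)
 thus "ALL i<n. ALL j<n. i~=j --> eig g m $$ (i, j) = 0" by (auto simp: mat_diag_def)
next
 assume z: "ALL i<n. ALL j<n. i~=j --> eig g m $$ (i, j) = 0"
 let ?d = "%i. eig g m $$ (i, i)"
 have e: "eig g m = mat_diag n ?d" by (rule diagonal_eq_mat_diag) (use z eig_carrier m in auto)
 have "?d i~=0" if "i < n" for i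
  using GL_row_nonzero[OF eig_GL[OF m] that] z that by metis
 thus "coset n m\<in>torus g"
  unfolding torus_def using conj_eig[of m] m e by (intro CollectI exI[of _ ?d]) auto
qed

lemma torus_sub: "torus g \<subseteq> carrier (PGL n)"
 unfolding torus_def using coset_PGL[OF conj_diag_GL] by auto

lemma conj_diag_mult:
 "(g * mat_diag n d * minv n g) * (g * mat_diag n d' * minv n g) = g * mat_diag n (%i. d i * d' i) * minv n g"
 using g by (simp add: mat_assoc[where n = n] cancel_minv mat_diag_diag[symmetric] del: mat_diag_diag)

lemma torusD: "P\<in>torus g==>EX d. (ALL i<n. d i~=0) & P = coset n (g * mat_diag n d * minv n g)"
 unfolding torus_def by blast

lemma torusI: "(!!i. i < n==>d i~=0)==>coset n (g * mat_diag n d * minv n g)\<in>torus g"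
 unfolding torus_def by blast

lemma torus_mult:
 assumes "!!i. i < n==>d i~=0" "!!i. i < n==>d' i~=0"
 shows "coset n (g * mat_diag n d * minv n g) \<otimes>\<^bsub>PGL n\<^esub> coset n (g * mat_diag n d' * minv n g) =
  coset n (g * mat_diag n (%i. d i * d' i) * minv n g)"
 by (simp add: coset_mult conj_diag_GL assms conj_diag_mult)

lemma torus_subgroup: "subgroup (torus g) (PGL n)"
proof (rule group.subgroupI[OF group_PGL torus_sub])
 show "torus g~={}" using torusI[of "%_. 1"] by auto
 fix P assume "P\<in>torus g"
 then obtain d where d: "!!i. i < n==>d i~=0" "P = coset n (g * mat_diag n d * minv n g)" by (blast dest: torusD)
 let ?e = "%i. 1 / d i"
 have e: "!!i. i < n==>?e i~=0" using d by auto
 have "mat_diag n (%i. ?e i * d i) = 1\<^sub>m n" by (rule eq_matI) (use d in \<open>auto simp: mat_diag_def\<close>)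
 moreover have "coset n (g * mat_diag n ?e * minv n g) \<otimes>\<^bsub>PGL n\<^esub> P =
   coset n (g * mat_diag n (%i. ?e i * d i) * minv n g)"
  unfolding d(2) by (rule torus_mult) (use e d(1) in auto)
 ultimately have "coset n (g * mat_diag n ?e * minv n g) \<otimes>\<^bsub>PGL n\<^esub> P = \<one>\<^bsub>PGL n\<^esub>"
  using g by (simp add: minv_right coset_one)
 hence "inv\<^bsub>PGL n\<^esub> P = coset n (g * mat_diag n ?e * minv n g)"
  by (rule group.inv_equality[OF group_PGL]) (use d coset_PGL[OF conj_diag_GL[OF e]] coset_PGL[OF conj_diag_GL[OF d(1)]] in auto)
 thus "inv\<^bsub>PGL n\<^esub> P\<in>torus g" using torusI[OF e] by simp
 fix Q assume "Q\<in>torus g"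
 then obtain d' where d': "!!i. i < n==>d' i~=0" "Q = coset n (g * mat_diag n d' * minv n g)" by (blast dest: torusD)
 have "P \<otimes>\<^bsub>PGL n\<^esub> Q = coset n (g * mat_diag n (%i. d i * d' i) * minv n g)"
  unfolding d(2) d'(2) by (rule torus_mult) (use d(1) d'(1) in auto)
 thus "P \<otimes>\<^bsub>PGL n\<^esub> Q\<in>torus g"
  using torusI[of "%i. d i * d' i"] d(1) d'(1) by simp
qed

lemma eig_regular: "i < n==>j < n==>(%m. eig g m $$ (i, j))\<in>regfun (GL_space n) (carrier (GL n))"
proof -
 have "morphism (GL_space n) (mat_space n) (%m. eig g m)"
  unfolding eig_def using g
  by (intro morphism_mat_mult[OF k_space_GL] morphism_mat_const[OF k_space_GL] morphism_GL_inclusion) auto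
 thus "i < n==>j < n==>(%m. eig g m $$ (i, j))\<in>regfun (GL_space n) (carrier (GL n))"
  unfolding morphism_mat_space_iff[OF k_space_GL] by simp
qed

lemma openin_eig_nonzero:
 "i < n==>j < n==>openin (ftop (GL_space n)) {m\<in>carrier (GL n). eig g m $$ (i, j)~=0}"
 using openin_regfun_nonzero[OF k_space_GL openin_topspace, of "%m. eig g m $$ (i, j)"] eig_regular by simp

lemma torus_closed: "closedin (ftop (PGL_space n)) (torus g)"
proof -
 have "{m\<in>carrier (GL n). coset n m\<in>carrier (PGL n) - torus g} =
   (\<Union>q\<in>{(i, j). i < n & j < n & i~=j}. {m\<in>carrier (GL n). eig g m $$ q~=0})"
  using coset_in_torus_iff coset_PGL by auto
 moreover have "openin (ftop (GL_space n)) (\<Union>q\<in>{(i, j). i < n & j < n & i~=j}. {m\<in>carrier (GL n). eig g m $$ q~=0})"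
  by (rule openin_Union) (use openin_eig_nonzero in auto)
 ultimately have "openin (ftop (PGL_space n)) (carrier (PGL n) - torus g)"
  unfolding openin_PGL by simp
 thus ?thesis unfolding closedin_def using torus_sub by simp
qed

text \<open>Ratios of eigenvalues do not depend on the representative, and they are the coordinates of the torus.\<close>

definition ratio :: "'k mat set => nat => 'k"
 where "ratio P i = (let m = (SOME m. m\<in>P) in eig g m $$ (i, i) / eig g m $$ (0, 0))"

lemma ratio_coset:
 assumes m: "m\<in>carrier (GL n)" and i: "i < n"
 shows "ratio (coset n m) i = eig g m $$ (i, i) / eig g m $$ (0, 0)"
proof -
 have "(SOME h. h\<in>coset n m)\<in>coset n m" by (rule someI[of _ m]) (rule mem_coset_self[OF m])
 then obtain c where c: "c~=0" "(SOME h. h\<in>coset n m) = c\<cdot>\<^sub>mm" unfolding coset_eq[OF m] by blast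
 have "eig g m\<in>carrier_mat n n" using m by (simp add: eig_carrier)
 thus ?thesis unfolding ratio_def Let_def c(2) using c(1) i n m by (simp add: eig_smult)
qed

lemma ratio_torus:
 assumes "!!i. i < n==>d i~=0" "i < n"
 shows "ratio (coset n (g * mat_diag n d * minv n g)) i = d i / d 0"
 using assms n by (subst ratio_coset[OF conj_diag_GL]) (auto simp: eig_conj mat_diag_def)

definition coords :: "'k mat set => 'k vec"
 where "coords P = vec (n - 1) (%i. ratio P (Suc i))"

definition of_coords :: "'k vec => 'k mat set"
 where "of_coords v = coset n (g * mat_diag n (%i. if i = 0 then 1 else v $ (i - 1)) * minv n g)"

lemma Gm_carrier: "v\<in>carrier (Gm_power r) \<longleftrightarrow> v\<in>carrier_vec r & (ALL i<r. v $ i~=0)"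
 by (simp add: Gm_power_def)

lemma of_coords_torus: "v\<in>carrier (Gm_power (n - 1))==>of_coords v\<in>torus g"
 unfolding of_coords_def by (rule torusI) (auto simp: Gm_carrier)

lemma coords_Gm: "P\<in>torus g==>coords P\<in>carrier (Gm_power (n - 1))"
 using n by (auto dest!: torusD simp: coords_def Gm_carrier ratio_torus)

lemma coords_of_coords: "v\<in>carrier (Gm_power (n - 1))==>coords (of_coords v) = v"
proof (rule eq_vecI)
 assume v: "v\<in>carrier (Gm_power (n - 1))"
 thus "dim_vec (coords (of_coords v)) = dim_vec v" by (auto simp: coords_def Gm_carrier)
 fix i assume "i < dim_vec v"
 hence i: "i < n - 1" using v by (auto simp: Gm_carrier)
 let ?d = "%i. if i = 0 then 1 else v $ (i - 1)"
 have d: "!!i. i < n==>?d i~=0" using v by (auto simp: Gm_carrier)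
 have "ratio (of_coords v) (Suc i) = ?d (Suc i) / ?d 0"
  unfolding of_coords_def by (rule ratio_torus[OF d]) (use i in auto)
 thus "coords (of_coords v) $ i = v $ i" using i by (simp add: coords_def)
qed

lemma of_coords_coords:
 assumes "P\<in>torus g"
 shows "of_coords (coords P) = P"
proof -
 from assms obtain d where d: "!!i. i < n==>d i~=0" "P = coset n (g * mat_diag n d * minv n g)" by (blast dest: torusD)
 let ?e = "%i. if i = 0 then 1 else coords P $ (i - 1)"
 have e: "?e i = d i / d 0" if "i < n" for i
  using that d n unfolding d(2) coords_def by (auto simp: ratio_torus)
 have "mat_diag n ?e = (1 / d 0)\<cdot>\<^sub>mmat_diag n d"
  by (rule eq_matI) (use e in \<open>auto simp: mat_diag_def\<close>)
 hence "of_coords (coords P) = coset n ((1 / d 0)\<cdot>\<^sub>m(g * mat_diag n d * minv n g))"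
  unfolding of_coords_def using g by (simp add: smult_mult_mat[where n = n])
 also have "... = P" unfolding d(2) by (rule coset_smult[OF conj_diag_GL]) (use d n in auto)
 finally show ?thesis .
qed

lemma coords_morphism:
 "morphism (subspace_of (PGL_space n) (torus g)) (subspace_of (affine_space (n - 1)) (carrier (Gm_power (n - 1)))) coords"
proof -
 let ?T = "subspace_of (PGL_space n) (torus g)"
 have kT: "k_space ?T" by (rule k_space_subspace[OF k_space_PGL])
 have pT: "points ?T = torus g" using torus_sub by auto
 let ?W = "{P\<in>carrier (PGL n). EX m:carrier (GL n). P = coset n m & eig g m $$ (0, 0)~=0}"
 have cW: "{m\<in>carrier (GL n). coset n m\<in>?W} = {m\<in>carrier (GL n). eig g m $$ (0, 0)~=0}"
 proof (intro Collect_cong conj_cong refl)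
  fix m :: "'k mat" assume m: "m\<in>carrier (GL n)"
  have "eig g m $$ (0, 0)~=0" if m': "m'\<in>carrier (GL n)" "coset n m = coset n m'" "eig g m' $$ (0, 0)~=0" for m'
  proof -
   obtain c where "c~=0" "m = c\<cdot>\<^sub>mm'" using m' coset_eq_iff[OF m m'(1)] by auto
   thus ?thesis using m' eig_carrier[of m'] n by (simp add: eig_smult)
  qed
  thus "coset n m\<in>?W \<longleftrightarrow> eig g m $$ (0, 0)~=0" using m coset_PGL[OF m] by blast
 qed
 have oW: "openin (ftop (PGL_space n)) ?W"
  unfolding openin_PGL cW using openin_eig_nonzero[OF n n] by blast
 have TW: "torus g \<subseteq> ?W"
 proof
  fix P assume P: "P\<in>torus g"
  then obtain d where d: "!!i. i < n==>d i~=0" "P = coset n (g * mat_diag n d * minv n g)" by (blast dest: torusD)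
  have "eig g (g * mat_diag n d * minv n g) = mat_diag n d" by (rule eig_conj) simp
  hence e: "eig g (g * mat_diag n d * minv n g) $$ (0, 0)~=0" using d(1)[OF n] n by (simp add: mat_diag_def)
  have G: "g * mat_diag n d * minv n g\<in>carrier (GL n)" by (rule conj_diag_GL) (rule d(1))
  have "P\<in>carrier (PGL n)" using P torus_sub by (rule subsetD[rotated])
  thus "P\<in>?W" using e G d(2) by (intro CollectI conjI bexI[of _ "g * mat_diag n d * minv n g"])
 qed
 have reg: "(%P. ratio P i)\<in>regfun (PGL_space n) ?W" if i: "i < n" for i
 proof (subst regfun_PGL)
  show "(%m. ratio (coset n m) i)\<in>regfun (GL_space n) {m\<in>carrier (GL n). coset n m\<in>?W}"
   unfolding cW
  proof (rule regfun_restrict[OF k_space_GL openin_eig_nonzero[OF n n] openin_eig_nonzero[OF n n] order_refl])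
   show "(%m. eig g m $$ (i, i) / eig g m $$ (0, 0))\<in>regfun (GL_space n) {m\<in>carrier (GL n). eig g m $$ (0, 0)~=0}"
    using regfun_divide[OF k_space_GL openin_topspace, of "%m. eig g m $$ (i, i)" n "%m. eig g m $$ (0, 0)"]
     eig_regular[OF i i] eig_regular[OF n n] by simp
   show "eig g m $$ (i, i) / eig g m $$ (0, 0) = ratio (coset n m) i"
    if "m\<in>{m\<in>carrier (GL n). eig g m $$ (0, 0)~=0}" for m
    using ratio_coset[of m i] that i by simp
  qed
 qed auto
 show ?thesis
 proof (rule morphism_into_subspace[OF kT])
  show "coords P\<in>carrier (Gm_power (n - 1))" if "P\<in>points ?T" for P using that coords_Gm pT by auto
  show "morphism ?T (affine_space (n - 1)) coords"
   unfolding affine_space_def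
  proof (rule morphism_into_zariski[OF kT])
   show "coords P\<in>carrier_vec (n - 1)" if "P\<in>points ?T" for P by (simp add: coords_def)
   fix f :: "'k vec => 'k" assume "f\<in>{(%v. v $ i) |i. i < n - 1}"
   then obtain i where i: "i < n - 1" "f = (%v. v $ i)" by blast
   have "(%P. f (coords P)) = (%P. ratio P (Suc i))" using i by (simp add: coords_def)
   thus "(%P. f (coords P))\<in>regfun ?T (points ?T)"
    using regfun_subspaceI[OF oW _ reg[of "Suc i"], of "torus g" "torus g"] TW i unfolding pT by simp
  qed
 qed
qed

lemma of_coords_morphism:
 "morphism (subspace_of (affine_space (n - 1)) (carrier (Gm_power (n - 1)))) (subspace_of (PGL_space n) (torus g)) of_coords"
proof -
 let ?A = "subspace_of (affine_space (n - 1)) (carrier (Gm_power (n - 1))) :: ('k, 'k vec) fspace"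
 have kA: "k_space ?A" unfolding affine_space_def by (rule k_space_subspace[OF k_space_zariski])
 have pA: "points ?A = carrier (Gm_power (n - 1))" unfolding affine_space_def by (auto simp: Gm_carrier)
 have co: "(%v. v $ i)\<in>regfun ?A (points ?A)" if "i < n - 1" for i
  unfolding affine_space_def
  by (rule regfun_subspaceI[OF openin_topspace]) (use that in \<open>auto intro!: polyfun_regular polyfun_coord\<close>)
 have "morphism ?A (GL_space n) (%v. g * mat_diag n (%i. if i = 0 then 1 else v $ (i - 1)) * minv n g)"
 proof (intro morphism_into_GL[OF kA] morphism_mat_mult[OF kA] morphism_mat_const[OF kA] morphism_mat_diag[OF kA])
  show "(%v. if i = 0 then 1 else v $ (i - 1))\<in>regfun ?A (points ?A)" if "i < n" for i
   using that co[of "i - 1"] regfun_const[OF kA openin_topspace, of 1] by (cases "i = 0") auto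
  show "g * mat_diag n (%i. if i = 0 then 1 else v $ (i - 1)) * minv n g\<in>carrier (GL n)" if "v\<in>points ?A" for v
   using that unfolding pA by (intro conj_diag_GL) (auto simp: Gm_carrier)
 qed (use g in auto)
 from morphism_compose[OF this morphism_coset] have "morphism ?A (PGL_space n) of_coords"
  unfolding of_coords_def .
 thus ?thesis by (rule morphism_into_subspace[OF kA]) (use of_coords_torus pA in auto)
qed

lemma torus_pgl_torus: "pgl_torus n (torus g)"
 unfolding pgl_torus_def
proof (intro conjI exI[of _ "n - 1"] exI[of _ coords])
 show "subgroup (torus g) (PGL n)" by (rule torus_subgroup)
 show "closedin (ftop (PGL_space n)) (torus g)" by (rule torus_closed)
 have pA: "points (subspace_of (affine_space (n - 1)) (carrier (Gm_power (n - 1))) :: ('k, 'k vec) fspace) = carrier (Gm_power (n - 1))"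
  unfolding affine_space_def by (auto simp: Gm_carrier)
 show "fspace_iso (subspace_of (PGL_space n) (torus g)) (subspace_of (affine_space (n - 1)) (carrier (Gm_power (n - 1)))) coords"
  by (rule fspace_isoI[OF _ coords_morphism of_coords_morphism])
    (use of_coords_coords coords_of_coords pA in \<open>auto simp: affine_space_def k_space_subspace k_space_zariski\<close>)
 show "coords\<in>iso (PGL n\<lparr>carrier := torus g\<rparr>) (Gm_power (n - 1))"
 proof (rule isoI)
  show "bij_betw coords (carrier (PGL n\<lparr>carrier := torus g\<rparr>)) (carrier (Gm_power (n - 1)))"
   by (rule bij_betw_byWitness[of _ of_coords]) (use of_coords_coords coords_of_coords coords_Gm of_coords_torus in auto)
  show "coords\<in>hom (PGL n\<lparr>carrier := torus g\<rparr>) (Gm_power (n - 1))"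
  proof (rule homI)
   fix P Q assume "P\<in>carrier (PGL n\<lparr>carrier := torus g\<rparr>)" "Q\<in>carrier (PGL n\<lparr>carrier := torus g\<rparr>)"
   hence PQ: "P\<in>torus g" "Q\<in>torus g" by auto
   from PQ(1) obtain d where d: "!!i. i < n==>d i~=0" "P = coset n (g * mat_diag n d * minv n g)" by (blast dest: torusD)
   from PQ(2) obtain d' where d': "!!i. i < n==>d' i~=0" "Q = coset n (g * mat_diag n d' * minv n g)" by (blast dest: torusD)
   show "coords (P \<otimes>\<^bsub>PGL n\<lparr>carrier := torus g\<rparr>\<^esub> Q) = coords P \<otimes>\<^bsub>Gm_power (n - 1)\<^esub> coords Q"
    unfolding d(2) d'(2) using d(1) d'(1)
    by (auto simp: torus_mult coords_def Gm_power_def ratio_torus intro!: eq_vecI)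
  qed (use coords_Gm in auto)
 qed
qed

end

lemma two_power_inject: "(2 :: 'b::field_char_0) ^ a = 2 ^ b==>a = b"
proof -
 assume "(2 :: 'b) ^ a = 2 ^ b"
 hence "(of_nat (2 ^ a) :: 'b) = of_nat (2 ^ b)" by simp
 hence "(2::nat) ^ a = 2 ^ b" by (simp only: of_nat_eq_iff)
 thus ?thesis by simp
qed

text \<open>
  Maximality: an element commuting with the class of \<open>diag(1, 2, 4, ...)\<close> multiplies this matrix by a
  scalar under conjugation.  In characteristic zero the differences of exponents of its non-zero
  entries are all equal, hence zero, and the element is diagonal.
\<close>

lemma torus_maximal:
 fixes g :: "'k::field_char_0 mat"
 assumes g: "g\<in>carrier (GL n)"
 shows "maximal_torus n (torus g)"
 unfolding maximal_torus_def
proof (intro conjI allI impI torus_pgl_torus[OF g])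
 fix T' assume T': "pgl_torus n T' & torus g \<subseteq> T'"
 from T' have sub: "subgroup T' (PGL n)" unfolding pgl_torus_def by blast
 have T'c: "T' \<subseteq> carrier (PGL n)" by (rule subgroup.subset[OF sub])
 from T' obtain r h where h: "h\<in>iso (PGL n\<lparr>carrier := T'\<rparr>) (Gm_power r :: 'k vec monoid)" unfolding pgl_torus_def
  by (elim conjE exE) (rule that)
 have comm: "P \<otimes>\<^bsub>PGL n\<^esub> Q = Q \<otimes>\<^bsub>PGL n\<^esub> P" if PQ: "P\<in>T'" "Q\<in>T'" for P Q
 proof -
  have inj: "inj_on h T'" and hm: "!!P Q. P\<in>T'==>Q\<in>T'==>h (P \<otimes>\<^bsub>PGL n\<^esub> Q) = h P \<otimes>\<^bsub>Gm_power r\<^esub> h Q"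
   using h by (auto simp: iso_def bij_betw_def hom_def)
  have "h (P \<otimes>\<^bsub>PGL n\<^esub> Q) = h (Q \<otimes>\<^bsub>PGL n\<^esub> P)"
   unfolding hm[OF PQ] hm[OF PQ(2,1)] by (simp add: Gm_power_def mult.commute)
  thus ?thesis using inj PQ subgroup.m_closed[OF sub] by (auto simp: inj_on_def)
 qed
 let ?d = "%i. 2 ^ i :: 'k" and ?t = "g * mat_diag n (%i. 2 ^ i :: 'k) * minv n g"
 have d: "!!i. ?d i~=0" by simp
 have tG: "?t\<in>carrier (GL n)" by (rule conj_diag_GL[OF g d])
 have "T' \<subseteq> torus g"
 proof
  fix P assume P: "P\<in>T'"
  then obtain m where m: "m\<in>carrier (GL n)" "P = coset n m" using T'c by (meson PGL_cases subsetD)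
  have "coset n ?t\<in>T'" using torusI[OF g, of ?d] d T' by blast
  from comm[OF P this] have "coset n (m * ?t) = coset n (?t * m)" using m tG by (simp add: coset_mult)
  then obtain c where c: "c~=0" "m * ?t = c\<cdot>\<^sub>m(?t * m)"
   using coset_eq_iff[OF GL_mult[OF m(1) tG] GL_mult[OF tG m(1)]] by blast
  define M where "M = eig g m"
  have M: "M\<in>carrier (GL n)" unfolding M_def by (rule eig_GL[OF g m(1)])
  have "M * mat_diag n ?d = c\<cdot>\<^sub>m(mat_diag n ?d * M)"
  proof -
   have D: "eig g ?t = mat_diag n ?d" by (rule eig_conj[OF g]) simp
   have "eig g (m * ?t) = M * mat_diag n ?d" "eig g (?t * m) = mat_diag n ?d * M"
    using eig_mult[OF g, of m ?t] eig_mult[OF g, of ?t m] m(1) tG unfolding D M_def by auto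
   moreover have "eig g (m * ?t) = c\<cdot>\<^sub>meig g (?t * m)"
    unfolding c(2) by (rule eig_smult[OF g]) (use m(1) tG in simp)
   ultimately show ?thesis by simp
  qed
  hence ent: "(M * mat_diag n ?d) $$ (i, j) = (c\<cdot>\<^sub>m(mat_diag n ?d * M)) $$ (i, j)" for i j by simp
  have e: "M $$ (i, j) * 2 ^ j = c * (2 ^ i * M $$ (i, j))" if "i < n" "j < n" for i j
   using ent[of i j] that M by (simp add: mat_diag_mult_left[of _ n n] mat_diag_mult_right[of _ n n])
  have e: "(2::'k) ^ j = c * 2 ^ i" if "i < n" "j < n" "M $$ (i, j)~=0" for i j
  proof -
   have "M $$ (i, j) * 2 ^ j = M $$ (i, j) * (c * 2 ^ i)" unfolding e[OF that(1,2)] by (simp only: mult_ac)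
   thus ?thesis using that(3) by simp
  qed
  obtain a where a: "a < n" "M $$ (0, a)~=0" using GL_row_nonzero[OF M n] by blast
  obtain b where b: "b < n" "M $$ (n - 1, b)~=0" using GL_row_nonzero[OF M, of "n - 1"] n by auto
  have ca: "c = 2 ^ a" using e[OF n a] by simp
  have "(2::'k) ^ b = 2 ^ (a + (n - 1))" using e[OF _ b] n unfolding ca power_add by simp
  hence "b = a + (n - 1)" by (rule two_power_inject)
  hence "a = 0" using b(1) by simp
  have "i = j" if "i < n" "j < n" "M $$ (i, j)~=0" for i j
  proof -
   have "(2::'k) ^ j = 2 ^ i" using e[OF that] ca \<open>a = 0\<close> by simp
   thus ?thesis by (rule two_power_inject[symmetric])
  qed
  thus "P\<in>torus g" unfolding m(2) coset_in_torus_iff[OF g m(1)] M_def by blast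
 qed
 thus "T' = torus g" using T' by blast
qed

section \<open>The torus of a matrix with distinct eigenvalues\<close>

lemma torus_eq_centralizer:
 fixes g :: "'k::field mat"
 assumes g: "g\<in>carrier (GL n)" and inj: "inj_on d {..<n}" and m: "m\<in>carrier (GL n)"
 shows "coset n m\<in>torus g \<longleftrightarrow> m * (g * mat_diag n d * minv n g) = (g * mat_diag n d * minv n g) * m"
proof -
 let ?t = "g * mat_diag n d * minv n g" and ?M = "eig g m"
 have t: "?t\<in>carrier_mat n n" and M: "?M\<in>carrier_mat n n" using g m by (auto simp: eig_carrier)
 have "m * ?t = ?t * m \<longleftrightarrow> eig g (m * ?t) = eig g (?t * m)"
  using conj_eig[OF g, of "m * ?t"] conj_eig[OF g, of "?t * m"] t m by (metis GL_mat square_mult)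
 also have "... \<longleftrightarrow> ?M * mat_diag n d = mat_diag n d * ?M"
 proof -
  have D: "eig g ?t = mat_diag n d" by (rule eig_conj[OF g]) simp
  have "eig g (m * ?t) = ?M * mat_diag n d" "eig g (?t * m) = mat_diag n d * ?M"
   using eig_mult[OF g _ t, of m] eig_mult[OF g t, of m] m unfolding D by auto
  thus ?thesis by simp
 qed
 also have "... \<longleftrightarrow> (ALL i<n. ALL j<n. ?M $$ (i, j) * d j = d i * ?M $$ (i, j))"
  unfolding mat_diag_mult_left[OF M] mat_diag_mult_right[OF M] by (auto simp: mat_eq_iff)
 also have "... \<longleftrightarrow> (ALL i<n. ALL j<n. i~=j --> ?M $$ (i, j) = 0)"
  using inj by (auto simp: inj_on_def mult.commute)
 finally show ?thesis using coset_in_torus_iff[OF g m] by simp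
qed

text \<open>The torus is the centralizer of a matrix with distinct eigenvalues, and rescaling that matrix does not change its centralizer.\<close>

lemma normalizer_torus:
 fixes g :: "'k::field mat"
 assumes g: "g\<in>carrier (GL n)" and inj: "inj_on d {..<n}" and X: "X = g * mat_diag n d * minv n g"
  and P: "P\<in>carrier (PGL n)" and c: "c~=0" and conj: "pgl_conj n P X = c\<cdot>\<^sub>mX"
 shows "P\<in>normalizer (PGL n) (torus g)"
proof -
 interpret PGL: group "PGL n :: 'k mat set monoid" by (rule group_PGL)
 have XA: "X\<in>carrier_mat n n" unfolding X using g by simp
 have inT: "Q \<otimes>\<^bsub>PGL n\<^esub> t \<otimes>\<^bsub>PGL n\<^esub> inv\<^bsub>PGL n\<^esub> Q\<in>torus g"
  if Q: "Q\<in>carrier (PGL n)" "pgl_conj n Q X = c\<cdot>\<^sub>mX" "c~=0" and t: "t\<in>torus g" for Q t c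
 proof -
  obtain q where q: "q\<in>carrier (GL n)" "Q = coset n q" using Q(1) by (rule PGL_cases)
  obtain m where m: "m\<in>carrier (GL n)" "t = coset n m" using t torus_sub[OF g] by (meson PGL_cases subsetD)
  have mX: "m * X = X * m" using t torus_eq_centralizer[OF g inj m(1)] unfolding m(2) X by blast
  have qX: "q * X * minv n q = c\<cdot>\<^sub>mX" using Q(2) unfolding q(2) by (simp add: pgl_conj_coset[OF q(1) XA])
  have qm: "q * m * minv n q\<in>carrier (GL n)" by (intro GL_mult q m minv_GL)
  have conjm: "q * (A * B) * minv n q = (q * A * minv n q) * (q * B * minv n q)"
   if "A\<in>carrier_mat n n" "B\<in>carrier_mat n n" for A B
   using that q(1) by (simp add: mat_assoc[where n = n] cancel_minv)
  have "c\<cdot>\<^sub>m((q * m * minv n q) * X) = q * (m * X) * minv n q"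
   using conjm[OF _ XA, of m] m(1) q(1) XA unfolding qX by (simp add: smult_mult_mat[where n = n])
  also have "... = c\<cdot>\<^sub>m(X * (q * m * minv n q))"
   unfolding mX using conjm[OF XA, of m] m(1) q(1) XA unfolding qX by (simp add: smult_mult_mat[where n = n])
  finally have "(1 / c)\<cdot>\<^sub>m(c\<cdot>\<^sub>m((q * m * minv n q) * X)) = (1 / c)\<cdot>\<^sub>m(c\<cdot>\<^sub>m(X * (q * m * minv n q)))" by simp
  hence "(q * m * minv n q) * X = X * (q * m * minv n q)" using Q(3) by (simp add: smult_smult_mat)
  hence "coset n (q * m * minv n q)\<in>torus g" using torus_eq_centralizer[OF g inj qm] unfolding X by blast
  thus ?thesis unfolding q(2) m(2) using q m by (simp add: coset_mult coset_inv GL_mult)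
 qed
 have iP: "inv\<^bsub>PGL n\<^esub> P\<in>carrier (PGL n)" using P by simp
 have "pgl_conj n (inv\<^bsub>PGL n\<^esub> P) (c\<cdot>\<^sub>mX) = X"
  using pgl_conj_comp[OF iP P XA] pgl_conj_by_one[OF XA] P unfolding conj by simp
 hence "(1 / c)\<cdot>\<^sub>m(c\<cdot>\<^sub>mpgl_conj n (inv\<^bsub>PGL n\<^esub> P) X) = (1 / c)\<cdot>\<^sub>mX"
  using pgl_conj_smult[OF iP XA] by simp
 hence conji: "pgl_conj n (inv\<^bsub>PGL n\<^esub> P) X = (1 / c)\<cdot>\<^sub>mX" using c by (simp add: smult_smult_mat)
 have TP: "torus g \<subseteq> carrier (PGL n)" by (rule torus_sub[OF g])
 have "P <#\<^bsub>PGL n\<^esub> torus g #>\<^bsub>PGL n\<^esub> (inv\<^bsub>PGL n\<^esub> P) = torus g"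
 proof
  show "P <#\<^bsub>PGL n\<^esub> torus g #>\<^bsub>PGL n\<^esub> (inv\<^bsub>PGL n\<^esub> P) \<subseteq> torus g"
   using inT[OF P conj c] by (auto simp: l_coset_def r_coset_def)
  show "torus g \<subseteq> P <#\<^bsub>PGL n\<^esub> torus g #>\<^bsub>PGL n\<^esub> (inv\<^bsub>PGL n\<^esub> P)"
  proof
   fix t assume t: "t\<in>torus g"
   let ?s = "inv\<^bsub>PGL n\<^esub> P \<otimes>\<^bsub>PGL n\<^esub> t \<otimes>\<^bsub>PGL n\<^esub> P"
   have "?s\<in>torus g" using inT[OF iP conji _ t] c P by simp
   moreover have "t = P \<otimes>\<^bsub>PGL n\<^esub> ?s \<otimes>\<^bsub>PGL n\<^esub> inv\<^bsub>PGL n\<^esub> P"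
   proof -
    have tc: "t\<in>carrier (PGL n)" using t TP by blast
    have "P \<otimes>\<^bsub>PGL n\<^esub> ?s \<otimes>\<^bsub>PGL n\<^esub> inv\<^bsub>PGL n\<^esub> P =
      (P \<otimes>\<^bsub>PGL n\<^esub> inv\<^bsub>PGL n\<^esub> P) \<otimes>\<^bsub>PGL n\<^esub> t \<otimes>\<^bsub>PGL n\<^esub> (P \<otimes>\<^bsub>PGL n\<^esub> inv\<^bsub>PGL n\<^esub> P)"
     using P tc by (simp add: PGL.m_assoc[symmetric]) (simp add: PGL.m_assoc)
    thus ?thesis using P tc by simp
   qed
   ultimately show "t\<in>P <#\<^bsub>PGL n\<^esub> torus g #>\<^bsub>PGL n\<^esub> (inv\<^bsub>PGL n\<^esub> P)"
    unfolding l_coset_def r_coset_def by blast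
  qed
 qed
 thus ?thesis unfolding normalizer_def stabilizer_def using P TP by simp
qed

end

section \<open>Matrices commuting up to a root of unity\<close>

lemma root_of_unity_orthogonality:
 fixes \<zeta> :: "'k::field_char_0"
 assumes zeta: "\<zeta> ^ n = 1" "ALL m. 0 < m & m < n --> \<zeta> ^ m~=1"
  and a: "!!k. (\<Sum>j<n. a j * (\<zeta> ^ j) ^ k) = 0" and l: "l < n"
 shows "a l = 0"
proof -
 have geo: "(\<Sum>k<n. (\<zeta> ^ (n - l + j)) ^ k) = (if j = l then of_nat n else 0)" if j: "j < n" for j
 proof (cases "j = l")
  case True
  hence "\<zeta> ^ (n - l + j) = 1" using l zeta(1) by simp
  thus ?thesis using True by simp
 next
  case False
  have ne: "\<zeta> ^ (n - l + j)~=1"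
  proof (cases "j < l")
   case True
   thus ?thesis using zeta(2) l by auto
  next
   case f: False
   hence "\<zeta> ^ (n - l + j) = \<zeta> ^ (n + (j - l))" using l by (intro arg_cong[of _ _ "%i. \<zeta> ^ i"]) auto
   also have "... = \<zeta> ^ (j - l)" unfolding power_add zeta(1) by simp
   finally show ?thesis using zeta(2) f False j by auto
  qed
  have "(\<Sum>k<n. (\<zeta> ^ (n - l + j)) ^ k) = ((\<zeta> ^ (n - l + j)) ^ n - 1) / (\<zeta> ^ (n - l + j) - 1)"
   by (rule geometric_sum[OF ne])
  also have "(\<zeta> ^ (n - l + j)) ^ n = (\<zeta> ^ n) ^ (n - l + j)" by (simp only: power_mult[symmetric] mult.commute)
  finally show ?thesis using False zeta(1) by simp
 qed
 have "0 = (\<Sum>k<n. (\<zeta> ^ (n - l)) ^ k * (\<Sum>j<n. a j * (\<zeta> ^ j) ^ k))" unfolding a by simp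
 also have "... = (\<Sum>k<n. \<Sum>j<n. a j * (\<zeta> ^ (n - l + j)) ^ k)"
  unfolding sum_distrib_left by (intro sum.cong refl) (simp only: power_add power_mult_distrib mult_ac)
 also have "... = (\<Sum>j<n. a j * (\<Sum>k<n. (\<zeta> ^ (n - l + j)) ^ k))"
  unfolding sum_distrib_left by (rule sum.swap)
 also have "... = (\<Sum>j<n. if j = l then a j * of_nat n else 0)"
  by (rule sum.cong[OF refl]) (use geo in auto)
 also have "... = a l * of_nat n" using l by (simp add: sum.delta)
 finally show ?thesis using l by auto
qed

text \<open>
  If \<open>XY = \<zeta>YX\<close>, then \<open>Y\<close> maps eigenvectors of \<open>X\<close> to eigenvectors with eigenvalue multiplied by
  \<open>\<zeta>\<close>, so the orbit of one eigenvector is an eigenbasis with distinct eigenvalues.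
\<close>

definition chain_matrix :: "nat => 'k::field mat => 'k vec => 'k mat"
 where "chain_matrix n Y v = mat n n (%(i, j). ((%u. Y *\<^sub>v u) ^^ j) v $ i)"

lemma smult_mat_mult_vec:
 "A\<in>carrier_mat n n==>w\<in>carrier_vec n==>(c\<cdot>\<^sub>mA) *\<^sub>v w = (c :: 'k::field)\<cdot>\<^sub>v(A *\<^sub>v w)"
 by (intro eq_vecI) auto

lemma chain_matrix_eigenbasis:
 fixes X Y :: "'k::field_char_0 mat"
 assumes zeta: "\<zeta> ^ n = 1" "ALL m. 0 < m & m < n --> \<zeta> ^ m~=1"
  and X: "X\<in>carrier_mat n n" and Y: "Y\<in>carrier (GL n)" and XY: "X * Y = \<zeta>\<cdot>\<^sub>m(Y * X)"
  and v: "v\<in>carrier_vec n" "v~=0\<^sub>v n" "X *\<^sub>v v = l\<cdot>\<^sub>vv" and l: "l~=0"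
 shows "chain_matrix n Y v\<in>carrier (GL n)"
  and "X * chain_matrix n Y v = chain_matrix n Y v * mat_diag n (%i. l * \<zeta> ^ i)"
proof -
 let ?g = "chain_matrix n Y v" and ?d = "%i. l * \<zeta> ^ i"
 define w where "w j = ((%u. Y *\<^sub>v u) ^^ j) v" for j
 have Yc: "Y\<in>carrier_mat n n" using Y by simp
 have wS: "w (Suc j) = Y *\<^sub>v w j" for j by (simp add: w_def)
 have wc: "w j\<in>carrier_vec n" for j by (induction j) (use v Yc wS in \<open>auto simp: w_def\<close>)
 have wn: "w j~=0\<^sub>v n" for j
 proof (induction j)
  case (Suc j)
  show ?case
  proof
   assume "w (Suc j) = 0\<^sub>v n"
   hence "minv n Y *\<^sub>v (Y *\<^sub>v w j) = 0\<^sub>v n" unfolding wS using minv_mat[OF Y] by auto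
   moreover have "minv n Y *\<^sub>v (Y *\<^sub>v w j) = (minv n Y * Y) *\<^sub>v w j"
    by (rule assoc_mult_mat_vec[OF minv_mat[OF Y] Yc wc, symmetric])
   ultimately show False using Suc minv_left[OF Y] wc[of j] by simp
  qed
 qed (use v w_def in simp)
 have Xw: "X *\<^sub>v w j = (l * \<zeta> ^ j)\<cdot>\<^sub>vw j" for j
 proof (induction j)
  case (Suc j)
  have "X *\<^sub>v w (Suc j) = (X * Y) *\<^sub>v w j" unfolding wS by (rule assoc_mult_mat_vec[OF X Yc wc, symmetric])
  also have "... = \<zeta>\<cdot>\<^sub>v((Y * X) *\<^sub>v w j)" unfolding XY
   by (rule smult_mat_mult_vec[OF mult_carrier_mat[OF Yc X] wc])
  also have "(Y * X) *\<^sub>v w j = Y *\<^sub>v (X *\<^sub>v w j)" by (rule assoc_mult_mat_vec[OF Yc X wc])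
  also have "Y *\<^sub>v (X *\<^sub>v w j) = (l * \<zeta> ^ j)\<cdot>\<^sub>vw (Suc j)" unfolding Suc wS by (rule mult_mat_vec[OF Yc wc])
  finally show ?case by (simp add: smult_smult_assoc mult_ac)
 qed (use v w_def in simp)
 have gc: "?g\<in>carrier_mat n n" by (simp add: chain_matrix_def)
 have gw: "?g $$ (i, j) = w j $ i" if "i < n" "j < n" for i j using that by (simp add: chain_matrix_def w_def)
 have col: "col ?g j = w j" if "j < n" for j
  by (rule eq_vecI) (use that gw wc[of j] gc in auto)
 show XG: "X * ?g = ?g * mat_diag n ?d"
 proof (rule eq_matI)
  fix i j assume "i < dim_row (?g * mat_diag n ?d)" "j < dim_col (?g * mat_diag n ?d)"
  hence ij: "i < n" "j < n" using gc by (auto simp: mat_diag_def)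
  have "(X * ?g) $$ (i, j) = row X i \<bullet> col ?g j" by (rule index_mult_mat(1)) (use ij X gc in auto)
  also have "... = (X *\<^sub>v w j) $ i" unfolding col[OF ij(2)] using ij X by simp
  also have "... = (l * \<zeta> ^ j) * w j $ i"
   unfolding Xw by (rule index_smult_vec(1)) (use wc[of j] ij in auto)
  also have "... = (?g * mat_diag n ?d) $$ (i, j)"
   unfolding mat_diag_mult_right[OF gc] using ij gw by simp
  finally show "(X * ?g) $$ (i, j) = (?g * mat_diag n ?d) $$ (i, j)" .
 qed (use X gc in \<open>auto simp: mat_diag_def\<close>)
 show "?g\<in>carrier (GL n)"
 proof (rule ccontr)
  assume "?g \<notin> carrier (GL n)"
  hence "det ?g = 0" using gc unfolding carrier_GL by simp
  hence "EX u. u\<in>carrier_vec n & u~=0\<^sub>v n & ?g *\<^sub>v u = 0\<^sub>v n"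
   by (rule det_0_iff_vec_prod_zero_field[OF gc, THEN iffD1])
  then obtain u where u: "u\<in>carrier_vec n" "u~=0\<^sub>v n" "?g *\<^sub>v u = 0\<^sub>v n"
   by (elim exE conjE) (rule that)
  have pow: "(?g * mat_diag n (%i. ?d i ^ k)) *\<^sub>v u = 0\<^sub>v n" for k
  proof (induction k)
   case 0
   thus ?case using u gc by simp
  next
   case (Suc k)
   have Dc: "mat_diag n (%i. ?d i ^ k)\<in>carrier_mat n n" by simp
   have "?g * mat_diag n (%i. ?d i ^ Suc k) = ?g * (mat_diag n ?d * mat_diag n (%i. ?d i ^ k))" by simp
   also have "... = (?g * mat_diag n ?d) * mat_diag n (%i. ?d i ^ k)"
    by (rule assoc_mult_mat[OF gc _ Dc, symmetric]) simp
   also have "... = X * (?g * mat_diag n (%i. ?d i ^ k))"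
    unfolding XG[symmetric] by (rule assoc_mult_mat[OF X gc Dc])
   finally have "(?g * mat_diag n (%i. ?d i ^ Suc k)) *\<^sub>v u = X *\<^sub>v ((?g * mat_diag n (%i. ?d i ^ k)) *\<^sub>v u)"
    using assoc_mult_mat_vec[OF X mult_carrier_mat[OF gc Dc] u(1)] by simp
   thus ?case unfolding Suc using X by auto
  qed
  have "w j $ i * u $ j = 0" if ij: "i < n" "j < n" for i j
  proof (rule root_of_unity_orthogonality[OF zeta _ ij(2), of "%j. w j $ i * u $ j"])
   fix k
   have "(\<Sum>j<n. w j $ i * (l * \<zeta> ^ j) ^ k * u $ j) = ((?g * mat_diag n (%i. ?d i ^ k)) *\<^sub>v u) $ i"
    unfolding mat_diag_mult_right[OF gc] using ij u gw
    by (auto simp: scalar_prod_def lessThan_atLeast0 intro!: sum.cong)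
   also have "... = 0" unfolding pow using ij by simp
   finally have "l ^ k * (\<Sum>j<n. w j $ i * u $ j * (\<zeta> ^ j) ^ k) = 0"
    unfolding sum_distrib_left power_mult_distrib by (simp add: mult_ac)
   thus "(\<Sum>j<n. w j $ i * u $ j * (\<zeta> ^ j) ^ k) = 0" using l by simp
  qed
  hence "u $ j = 0" if "j < n" for j
   using wn[of j] wc[of j] that by (auto simp: vec_eq_iff)
  thus False using u by (auto simp: vec_eq_iff)
 qed
qed

lemma exists_eigenvector:
 fixes X :: "'k::alg_closed_field mat"
 assumes X: "X\<in>carrier_mat n n" and n: "n > 0"
 obtains l v where "v\<in>carrier_vec n" "v~=0\<^sub>v n" "X *\<^sub>v v = l\<cdot>\<^sub>vv"
proof -
 have "degree (char_poly X) > 0" using degree_monic_char_poly[OF X] n by simp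
 then obtain l where "poly (char_poly X) l = 0" using alg_closed_imp_poly_has_root by blast
 hence "eigenvalue X l" using eigenvalue_root_char_poly[OF X] by simp
 then obtain v where "eigenvector X v l" unfolding eigenvalue_def by blast
 thus ?thesis using that X unfolding eigenvector_def by auto
qed

lemma q_commuting_diagonalizable:
 fixes X Y :: "'k::{alg_closed_field, field_char_0} mat"
 assumes zeta: "\<zeta> ^ n = 1" "ALL m. 0 < m & m < n --> \<zeta> ^ m~=1" and n: "n > 0"
  and X: "X\<in>carrier (GL n)" and Y: "Y\<in>carrier (GL n)" and XY: "X * Y = \<zeta>\<cdot>\<^sub>m(Y * X)"
 obtains g l where "g\<in>carrier (GL n)" "l~=0" "X = g * mat_diag n (%i. l * \<zeta> ^ i) * minv n g"
  "inj_on (%i. l * \<zeta> ^ i) {..<n}"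
proof -
 have Xc: "X\<in>carrier_mat n n" using X by simp
 obtain l v where v: "v\<in>carrier_vec n" "v~=0\<^sub>v n" "X *\<^sub>v v = l\<cdot>\<^sub>vv" by (rule exists_eigenvector[OF Xc n])
 have l: "l~=0"
 proof
  assume "l = 0"
  hence "X *\<^sub>v v = 0\<^sub>v n" using v by auto
  hence "minv n X *\<^sub>v (X *\<^sub>v v) = 0\<^sub>v n" using minv_mat[OF X] by auto
  moreover have "minv n X *\<^sub>v (X *\<^sub>v v) = (minv n X * X) *\<^sub>v v"
   by (rule assoc_mult_mat_vec[OF minv_mat[OF X] Xc v(1), symmetric])
  ultimately show False using minv_left[OF X] v by simp
 qed
 note g = chain_matrix_eigenbasis[OF zeta Xc Y XY v l]
 have "X = (X * chain_matrix n Y v) * minv n (chain_matrix n Y v)"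
  using X g(1) minv_right[OF g(1)] by (simp add: mat_assoc[where n = n])
 hence e: "X = chain_matrix n Y v * mat_diag n (%i. l * \<zeta> ^ i) * minv n (chain_matrix n Y v)"
  unfolding g(2) .
 have zn: "\<zeta>~=0" using zeta(1) n by (auto simp: zero_power)
 have *: False if ij: "i < j" "j < n" "\<zeta> ^ i = \<zeta> ^ j" for i j
 proof -
  have "\<zeta> ^ i * \<zeta> ^ (j - i) = \<zeta> ^ i * 1" using ij unfolding power_add[symmetric] by simp
  hence "\<zeta> ^ (j - i) = 1" using zn by simp
  thus False using zeta(2) ij by auto
 qed
 have "inj_on (%i. l * \<zeta> ^ i) {..<n}"
 proof (rule inj_onI)
  fix i j assume ij: "i\<in>{..<n}" "j\<in>{..<n}" "l * \<zeta> ^ i = l * \<zeta> ^ j"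
  thus "i = j" using *[of i j] *[of j i] l by (cases i j rule: linorder_cases) auto
 qed
 thus ?thesis using that g(1) l e by blast
qed

section \<open>Rational equivariant maps\<close>

lemma dense_open_topspace: "dense_open T (topspace T)"
 by (simp add: dense_open_def)

lemma dense_open_iff:
 "dense_open T U \<longleftrightarrow> openin T U & (ALL W. openin T W & W~={} --> U\<inter>W~={})"
 unfolding dense_open_def dense_intersects_open by blast

lemma dense_open_Int:
 assumes U: "dense_open T U" and V: "dense_open T V"
 shows "dense_open T (U\<inter>V)"
 unfolding dense_open_iff
proof (intro conjI allI impI)
 show "openin T (U\<inter>V)" using U V by (auto simp: dense_open_iff)
 fix W assume W: "openin T W & W~={}"
 hence "openin T (V\<inter>W)" "V\<inter>W~={}" using V by (auto simp: dense_open_iff)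
 hence "U\<inter>(V\<inter>W)~={}" using U by (simp add: dense_open_iff)
 thus "U\<inter>V\<inter>W~={}" by (simp add: Int_assoc)
qed

lemma dense_open_points: "dense_open T U==>U \<subseteq> topspace T"
 by (simp add: dense_open_iff openin_subset)

lemma irreducible_dense_open:
 "irreducible_space T==>openin T U==>U~={}==>dense_open T U"
 unfolding irreducible_space_def dense_open_iff by blast

definition generically_equal :: "'x topology => ('x => 'b) => ('x => 'b) => bool"
 where "generically_equal T f g \<longleftrightarrow> (EX U. dense_open T U & (ALL x:U. f x = g x))"

lemma generically_equalI: "dense_open T U==>(!!x. x\<in>U==>f x = g x)==>generically_equal T f g"
 unfolding generically_equal_def by blast

lemma generically_equal_refl: "generically_equal T f f"
 by (rule generically_equalI[OF dense_open_topspace]) simp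

lemma generically_equal_sym: "generically_equal T f g==>generically_equal T g f"
 unfolding generically_equal_def by metis

lemma generically_equal_combine:
 assumes "generically_equal T f f'" "generically_equal T g g'" "!!x. f x = f' x==>g x = g' x==>h x = h' x"
 shows "generically_equal T h h'"
proof -
 obtain U V where "dense_open T U" "ALL x:U. f x = f' x" "dense_open T V" "ALL x:V. g x = g' x"
  using assms(1,2) unfolding generically_equal_def by metis
 thus ?thesis by (intro generically_equalI[OF dense_open_Int[of T U V]]) (auto intro: assms(3))
qed

lemma generically_equal_trans:
 "generically_equal T f g==>generically_equal T g h==>generically_equal T f h"
 by (rule generically_equal_combine[of T f g g h]) simp_all

locale rational_maps =
 fixes n :: nat and X :: "('k::field, 'x) fspace" and act :: "'k mat set => 'x => 'x"
 assumes k_space: "k_space X"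
begin

abbreviation R where "R \<equiv> rat_reps n X act"
abbreviation cls where "cls \<equiv> rat_class n X act"
abbreviation ge where "ge \<equiv> generically_equal (ftop X)"
abbreviation KN where "KN \<equiv> kn_algebra n X act"

definition rep_on :: "('x => 'k mat) => 'x set => bool"
 where "rep_on f U \<longleftrightarrow> dense_open (ftop X) U & morphism (subspace_of X U) (mat_space n) f &
    (ALL P:carrier (PGL n). ALL x:U. act P x\<in>U --> f (act P x) = pgl_conj n P (f x))"

lemma rat_reps_iff: "f\<in>R \<longleftrightarrow> (EX U. rep_on f U)"
 by (simp add: rat_reps_def rep_on_def)

lemma rep_onD:
 assumes "rep_on f U"
 shows "dense_open (ftop X) U" "morphism (subspace_of X U) (mat_space n) f"
  "!!P x. P\<in>carrier (PGL n)==>x\<in>U==>act P x\<in>U==>f (act P x) = pgl_conj n P (f x)"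
  "!!x. x\<in>U==>f x\<in>carrier_mat n n"
proof -
 show 1: "dense_open (ftop X) U" and 2: "morphism (subspace_of X U) (mat_space n) f"
  and "!!P x. P\<in>carrier (PGL n)==>x\<in>U==>act P x\<in>U==>f (act P x) = pgl_conj n P (f x)"
  using assms unfolding rep_on_def by blast+
 show "f x\<in>carrier_mat n n" if "x\<in>U" for x
  using morphism_points[OF 2, of x] that dense_open_points[OF 1] by auto
qed

lemma rep_on_mono: "rep_on f U==>dense_open (ftop X) V==>V \<subseteq> U==>rep_on f V"
 unfolding rep_on_def using morphism_subspace_mono[OF k_space] by blast

lemma rep_on_common:
 assumes "f\<in>R" "g\<in>R"
 obtains U where "rep_on f U" "rep_on g U"
proof -
 obtain U V where "rep_on f U" "rep_on g V" using assms unfolding rat_reps_iff by blast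
 hence "rep_on f (U\<inter>V)" "rep_on g (U\<inter>V)"
  using rep_on_mono[of f U "U\<inter>V"] rep_on_mono[of g V "U\<inter>V"] dense_open_Int rep_onD(1) by blast+
 thus ?thesis using that by blast
qed

lemma k_space_on: "k_space (subspace_of X U)"
 by (rule k_space_subspace[OF k_space])

lemma R_mult: assumes "f\<in>R" "g\<in>R" shows "(%x. f x * g x)\<in>R"
proof -
 obtain U where U: "rep_on f U" "rep_on g U" by (rule rep_on_common[OF assms])
 note f = rep_onD[OF U(1)] and g = rep_onD[OF U(2)]
 have "rep_on (%x. f x * g x) U" unfolding rep_on_def
  using f g by (auto intro: morphism_mat_mult[OF k_space_on] simp: pgl_conj_mult)
 thus ?thesis unfolding rat_reps_iff by blast
qed

lemma R_add: assumes "f\<in>R" "g\<in>R" shows "(%x. f x + g x)\<in>R"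
proof -
 obtain U where U: "rep_on f U" "rep_on g U" by (rule rep_on_common[OF assms])
 note f = rep_onD[OF U(1)] and g = rep_onD[OF U(2)]
 have "rep_on (%x. f x + g x) U" unfolding rep_on_def
  using f g by (auto intro: morphism_mat_add[OF k_space_on] simp: pgl_conj_add)
 thus ?thesis unfolding rat_reps_iff by blast
qed

lemma R_smult: assumes "f\<in>R" shows "(%x. c\<cdot>\<^sub>mf x)\<in>R"
proof -
 obtain U where U: "rep_on f U" using assms unfolding rat_reps_iff by blast
 note f = rep_onD[OF U]
 have "rep_on (%x. c\<cdot>\<^sub>mf x) U" unfolding rep_on_def
  using f by (auto intro: morphism_mat_smult[OF k_space_on regfun_const[OF k_space_on openin_topspace]] simp: pgl_conj_smult)
 thus ?thesis unfolding rat_reps_iff by blast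
qed

lemma R_one: "(%_. 1\<^sub>m n)\<in>R"
proof -
 have "rep_on (%_. 1\<^sub>m n) (points X)" unfolding rep_on_def
  by (auto simp: pgl_conj_one dense_open_topspace intro: morphism_mat_const[OF k_space_on])
 thus ?thesis unfolding rat_reps_iff by blast
qed

lemma R_zero: "(%_. 0\<^sub>m n n)\<in>R"
proof -
 have "(%x. 0\<cdot>\<^sub>m1\<^sub>m n) = (%_::'x. 0\<^sub>m n n :: 'k mat)" by (intro ext eq_matI) auto
 thus ?thesis using R_smult[OF R_one, of 0] by simp
qed

lemma cls_def': "cls f = {g\<in>R. ge g f}"
 unfolding rat_class_def generically_equal_def by blast

lemma cls_cong: "ge f g==>cls f = cls g"
 unfolding cls_def' using generically_equal_trans generically_equal_sym by blast

lemma cls_self: "f\<in>R==>f\<in>cls f"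
 unfolding cls_def' by (simp add: generically_equal_refl)

lemma cls_eq_iff: "f\<in>R==>g\<in>R==>cls f = cls g \<longleftrightarrow> ge f g"
 using cls_cong cls_self unfolding cls_def' by blast

lemma KN_carrier: "carrier KN = cls ` R"
 by (simp add: kn_algebra_def)

lemma cls_carrier: "f\<in>R==>cls f\<in>carrier KN"
 unfolding KN_carrier by blast

lemma KN_cases: assumes "C\<in>carrier KN" obtains f where "f\<in>R" "C = cls f"
 using assms unfolding KN_carrier by blast

lemma mem_KN: "C\<in>carrier KN==>f\<in>C==>f\<in>R & C = cls f"
proof -
 assume C: "C\<in>carrier KN" and f: "f\<in>C"
 from C obtain g where g: "g\<in>R" "C = cls g" by (rule KN_cases)
 have fR: "f\<in>R" and fg: "ge f g" using f unfolding g(2) cls_def' by auto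
 thus ?thesis unfolding g(2) using cls_cong[OF fg] by simp
qed

lemma mem_cls: "g\<in>cls f==>ge g f"
 by (simp add: cls_def')

lemma cls_mult: assumes "f\<in>R" "g\<in>R" shows "cls f \<otimes>\<^bsub>KN\<^esub> cls g = cls (%x. f x * g x)"
proof -
 have *: "cls (%x. f' x * g' x) = cls (%x. f x * g x)" if "f'\<in>cls f" "g'\<in>cls g" for f' g'
  by (rule cls_cong, rule generically_equal_combine[OF mem_cls[OF that(1)] mem_cls[OF that(2)]]) simp
 have ne: "cls f~={}" "cls g~={}" using cls_self[OF assms(1)] cls_self[OF assms(2)] by blast+
 have "cls f \<otimes>\<^bsub>KN\<^esub> cls g = (\<Union>f'\<in>cls f. \<Union>g'\<in>cls g. cls (%x. f' x * g' x))"
  by (simp add: kn_algebra_def)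
 also have "... = (\<Union>f'\<in>cls f. \<Union>g'\<in>cls g. cls (%x. f x * g x))" by (intro SUP_cong refl *)
 also have "... = cls (%x. f x * g x)" by (simp add: ne)
 finally show ?thesis .
qed

lemma cls_add: assumes "f\<in>R" "g\<in>R" shows "cls f \<oplus>\<^bsub>KN\<^esub> cls g = cls (%x. f x + g x)"
proof -
 have *: "cls (%x. f' x + g' x) = cls (%x. f x + g x)" if "f'\<in>cls f" "g'\<in>cls g" for f' g'
  by (rule cls_cong, rule generically_equal_combine[OF mem_cls[OF that(1)] mem_cls[OF that(2)]]) simp
 have ne: "cls f~={}" "cls g~={}" using cls_self[OF assms(1)] cls_self[OF assms(2)] by blast+
 have "cls f \<oplus>\<^bsub>KN\<^esub> cls g = (\<Union>f'\<in>cls f. \<Union>g'\<in>cls g. cls (%x. f' x + g' x))"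
  by (simp add: kn_algebra_def)
 also have "... = (\<Union>f'\<in>cls f. \<Union>g'\<in>cls g. cls (%x. f x + g x))" by (intro SUP_cong refl *)
 also have "... = cls (%x. f x + g x)" by (simp add: ne)
 finally show ?thesis .
qed

lemma cls_smult: assumes "f\<in>R" shows "c \<odot>\<^bsub>KN\<^esub> cls f = cls (%x. c\<cdot>\<^sub>mf x)"
proof -
 have *: "cls (%x. c\<cdot>\<^sub>mf' x) = cls (%x. c\<cdot>\<^sub>mf x)" if "f'\<in>cls f" for f'
  by (rule cls_cong, rule generically_equal_combine[OF mem_cls[OF that] mem_cls[OF that]]) simp
 have ne: "cls f~={}" using cls_self[OF assms(1)] by blast
 have "c \<odot>\<^bsub>KN\<^esub> cls f = (\<Union>f'\<in>cls f. cls (%x. c\<cdot>\<^sub>mf' x))"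
  by (simp add: kn_algebra_def)
 also have "... = (\<Union>f'\<in>cls f. cls (%x. c\<cdot>\<^sub>mf x))" by (intro SUP_cong refl *)
 also have "... = cls (%x. c\<cdot>\<^sub>mf x)" by (simp add: ne)
 finally show ?thesis .
qed

lemma KN_one: "\<one>\<^bsub>KN\<^esub> = cls (%_. 1\<^sub>m n)" and KN_zero: "\<zero>\<^bsub>KN\<^esub> = cls (%_. 0\<^sub>m n n)"
 by (simp_all add: kn_algebra_def)

lemma mem_mult: "C\<in>carrier KN==>D\<in>carrier KN==>f\<in>C==>g\<in>D==>h\<in>C \<otimes>\<^bsub>KN\<^esub> D ==>
  ge h (%x. f x * g x)"
 using mem_KN[of C f] mem_KN[of D g] cls_mult[of f g] by (auto simp: cls_def')

lemma mem_smult: "C\<in>carrier KN==>f\<in>C==>h\<in>c \<odot>\<^bsub>KN\<^esub> C==>ge h (%x. c\<cdot>\<^sub>mf x)"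
 using mem_KN[of C f] cls_smult[of f c] by (auto simp: cls_def')

text \<open>A rational map that is not generically zero vanishes nowhere on a dense open set.\<close>

lemma generically_different:
 assumes irr: "irreducible_space (ftop X)" and f: "f\<in>R" and g: "g\<in>R" and ne: "~ ge f g"
 shows "EX U. dense_open (ftop X) U & (ALL x:U. f x~=g x)"
proof -
 obtain U where U: "rep_on f U" "rep_on g U" by (rule rep_on_common[OF f g])
 note fU = rep_onD[OF U(1)] and gU = rep_onD[OF U(2)]
 have oU: "opens X U" using fU(1) by (simp add: dense_open_iff)
 have pU: "points (subspace_of X U) = U" using openin_subset[OF oU] by auto
 obtain x where x: "x\<in>U" "f x~=g x" using ne generically_equalI[OF fU(1)] by blast
 then obtain i j where ij: "i < n" "j < n" "f x $$ (i, j)~=g x $$ (i, j)"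
  using fU(4)[OF x(1)] gU(4)[OF x(1)] by (metis carrier_matD eq_matI)
 have "(%x. f x $$ (i, j) + (- 1) * g x $$ (i, j))\<in>regfun (subspace_of X U) (points (subspace_of X U))"
  using fU(2) gU(2) ij(1,2) unfolding morphism_mat_space_iff[OF k_space_on]
  by (intro regfun_add[OF k_space_on openin_topspace] regfun_mult[OF k_space_on openin_topspace]
    regfun_const[OF k_space_on openin_topspace]) auto
 from openin_regfun_nonzero[OF k_space_on openin_topspace this]
 have "openin (subtopology (ftop X) U) {x\<in>U. f x $$ (i, j) - g x $$ (i, j)~=0}" unfolding pU by simp
 hence "opens X {x\<in>U. f x $$ (i, j) - g x $$ (i, j)~=0}"
  using oU openin_open_subtopology by blast
 hence "dense_open (ftop X) {x\<in>U. f x $$ (i, j) - g x $$ (i, j)~=0}"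
  by (rule irreducible_dense_open[OF irr]) (use x ij in auto)
 thus ?thesis by (intro exI[of _ "{x\<in>U. f x $$ (i, j) - g x $$ (i, j)~=0}"]) auto
qed

end

definition generically :: "'x topology => ('x => bool) => bool"
 where "generically T P \<longleftrightarrow> (EX U. dense_open T U & (ALL x:U. P x))"

lemma genericallyI: "dense_open T U==>(!!x. x\<in>U==>P x)==>generically T P"
 unfolding generically_def by blast

lemma generically_eq: "generically_equal T f g \<longleftrightarrow> generically T (%x. f x = g x)"
 by (simp add: generically_equal_def generically_def)

lemma generically_mono:
 assumes "generically T P" "!!x. x\<in>topspace T==>P x==>Q x"
 shows "generically T Q"
proof -
 obtain U where U: "dense_open T U" "ALL x:U. P x" using assms(1) unfolding generically_def by blast
 show ?thesis by (rule genericallyI[OF U(1)]) (use U assms(2) dense_open_points[OF U(1)] in blast)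
qed

lemma generically_conj:
 assumes "generically T P" "generically T Q"
 shows "generically T (%x. P x & Q x)"
proof -
 obtain U V where U: "dense_open T U" "ALL x:U. P x" and V: "dense_open T V" "ALL x:V. Q x"
  using assms unfolding generically_def by blast
 show ?thesis by (rule genericallyI[OF dense_open_Int[OF U(1) V(1)]]) (use U V in blast)
qed

lemma generically_finite:
 assumes "finite I" "!!i. i\<in>I==>generically T (P i)"
 shows "generically T (%x. ALL i:I. P i x)"
 using assms
proof (induction I rule: finite_induct)
 case empty
 show ?case by (rule genericallyI[OF dense_open_topspace]) simp
next
 case (insert i I)
 have "generically T (%x. P i x & (ALL i:I. P i x))" by (rule generically_conj) (use insert in auto)
 thus ?case by (rule generically_mono) simp
qed

section \<open>The algebra of rational equivariant maps\<close>

context rational_maps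
begin

lemma rep_generic: "f\<in>R==>generically (ftop X) (%x. f x\<in>carrier_mat n n)"
 unfolding rat_reps_iff using rep_onD by (blast intro: genericallyI)

lemma cls_eqI:
 assumes "f\<in>R" "g\<in>R" "h\<in>R"
  and "!!x. f x\<in>carrier_mat n n==>g x\<in>carrier_mat n n==>h x\<in>carrier_mat n n==>F x = F' x"
 shows "cls F = cls F'"
proof (rule cls_cong, unfold generically_eq)
 show "generically (ftop X) (%x. F x = F' x)"
  by (rule generically_mono[OF generically_conj[OF rep_generic[OF assms(1)]
     generically_conj[OF rep_generic[OF assms(2)] rep_generic[OF assms(3)]]]]) (use assms(4) in blast)
qed

lemma KN_monoid: "monoid KN"
proof (rule monoidI)
 fix A B C assume "A\<in>carrier KN" "B\<in>carrier KN"
 then obtain f g where fg: "f\<in>R" "A = cls f" "g\<in>R" "B = cls g" by (meson KN_cases)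
 show "A \<otimes>\<^bsub>KN\<^esub> B\<in>carrier KN" using fg by (simp add: cls_mult cls_carrier R_mult)
 assume "C\<in>carrier KN"
 then obtain h where h: "h\<in>R" "C = cls h" by (meson KN_cases)
 show "A \<otimes>\<^bsub>KN\<^esub> B \<otimes>\<^bsub>KN\<^esub> C = A \<otimes>\<^bsub>KN\<^esub> (B \<otimes>\<^bsub>KN\<^esub> C)"
  unfolding fg(2,4) h(2) cls_mult[OF fg(1,3)] cls_mult[OF R_mult[OF fg(1,3)] h(1)] cls_mult[OF fg(3) h(1)]
   cls_mult[OF fg(1) R_mult[OF fg(3) h(1)]]
  by (rule cls_eqI[OF fg(1,3) h(1)]) (rule assoc_mult_mat)
next
 show "\<one>\<^bsub>KN\<^esub>\<in>carrier KN" unfolding KN_one by (rule cls_carrier[OF R_one])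
 fix A assume "A\<in>carrier KN"
 then obtain f where f: "f\<in>R" "A = cls f" by (rule KN_cases)
 show "\<one>\<^bsub>KN\<^esub> \<otimes>\<^bsub>KN\<^esub> A = A" "A \<otimes>\<^bsub>KN\<^esub> \<one>\<^bsub>KN\<^esub> = A"
  unfolding KN_one f(2) cls_mult[OF R_one f(1)] cls_mult[OF f(1) R_one]
  by (rule cls_eqI[OF f(1) f(1) f(1)], simp)+
qed

lemma KN_abelian_group: "abelian_group KN"
proof (rule abelian_groupI)
 fix A B C assume "A\<in>carrier KN" "B\<in>carrier KN"
 then obtain f g where fg: "f\<in>R" "A = cls f" "g\<in>R" "B = cls g" by (meson KN_cases)
 show "A \<oplus>\<^bsub>KN\<^esub> B\<in>carrier KN" using fg by (simp add: cls_add cls_carrier R_add)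
 show "A \<oplus>\<^bsub>KN\<^esub> B = B \<oplus>\<^bsub>KN\<^esub> A"
  unfolding fg(2,4) cls_add[OF fg(1,3)] cls_add[OF fg(3,1)]
  by (rule cls_eqI[OF fg(1,3,3)]) (rule comm_add_mat)
 assume "C\<in>carrier KN"
 then obtain h where h: "h\<in>R" "C = cls h" by (meson KN_cases)
 show "A \<oplus>\<^bsub>KN\<^esub> B \<oplus>\<^bsub>KN\<^esub> C = A \<oplus>\<^bsub>KN\<^esub> (B \<oplus>\<^bsub>KN\<^esub> C)"
  unfolding fg(2,4) h(2) cls_add[OF fg(1,3)] cls_add[OF R_add[OF fg(1,3)] h(1)] cls_add[OF fg(3) h(1)]
   cls_add[OF fg(1) R_add[OF fg(3) h(1)]]
  by (rule cls_eqI[OF fg(1,3) h(1)]) (rule assoc_add_mat)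
next
 show "\<zero>\<^bsub>KN\<^esub>\<in>carrier KN" unfolding KN_zero by (rule cls_carrier[OF R_zero])
 fix A assume "A\<in>carrier KN"
 then obtain f where f: "f\<in>R" "A = cls f" by (rule KN_cases)
 show "\<zero>\<^bsub>KN\<^esub> \<oplus>\<^bsub>KN\<^esub> A = A"
  unfolding KN_zero f(2) cls_add[OF R_zero f(1)] by (rule cls_eqI[OF f(1) f(1) f(1)]) simp
 have "cls (%x. (- 1)\<cdot>\<^sub>mf x) \<oplus>\<^bsub>KN\<^esub> A = \<zero>\<^bsub>KN\<^esub>"
  unfolding KN_zero f(2) cls_add[OF R_smult[OF f(1)] f(1)]
  by (rule cls_eqI[OF f(1) f(1) f(1)], rule eq_matI) auto
 thus "EX B:carrier KN. B \<oplus>\<^bsub>KN\<^esub> A = \<zero>\<^bsub>KN\<^esub>" using cls_carrier[OF R_smult[OF f(1)]] by blast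
qed

lemma KN_ring: "ring KN"
proof (rule ringI[OF KN_abelian_group KN_monoid])
 fix A B C assume "A\<in>carrier KN" "B\<in>carrier KN" "C\<in>carrier KN"
 then obtain f g h where f: "f\<in>R" "A = cls f" and g: "g\<in>R" "B = cls g" and h: "h\<in>R" "C = cls h"
  by (meson KN_cases)
 show "(A \<oplus>\<^bsub>KN\<^esub> B) \<otimes>\<^bsub>KN\<^esub> C = A \<otimes>\<^bsub>KN\<^esub> C \<oplus>\<^bsub>KN\<^esub> B \<otimes>\<^bsub>KN\<^esub> C"
  unfolding f(2) g(2) h(2) cls_add[OF f(1) g(1)] cls_mult[OF R_add[OF f(1) g(1)] h(1)]
   cls_mult[OF f(1) h(1)] cls_mult[OF g(1) h(1)] cls_add[OF R_mult[OF f(1) h(1)] R_mult[OF g(1) h(1)]]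
  by (rule cls_eqI[OF f(1) g(1) h(1)]) (rule add_mult_distrib_mat)
 show "C \<otimes>\<^bsub>KN\<^esub> (A \<oplus>\<^bsub>KN\<^esub> B) = C \<otimes>\<^bsub>KN\<^esub> A \<oplus>\<^bsub>KN\<^esub> C \<otimes>\<^bsub>KN\<^esub> B"
  unfolding f(2) g(2) h(2) cls_add[OF f(1) g(1)] cls_mult[OF h(1) R_add[OF f(1) g(1)]]
   cls_mult[OF h(1) f(1)] cls_mult[OF h(1) g(1)] cls_add[OF R_mult[OF h(1) f(1)] R_mult[OF h(1) g(1)]]
  by (rule cls_eqI[OF f(1) g(1) h(1)]) (rule mult_add_distrib_mat)
qed

lemma KN_k_algebra: "k_algebra KN"
 unfolding k_algebra_def
proof (intro conjI KN_ring allI ballI)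
 show "module (class_ring :: 'k ring) KN"
 proof (rule moduleI)
  show "cring (class_ring :: 'k ring)" by (rule class_cring.cring_axioms)
  show "abelian_group KN" by (rule KN_abelian_group)
  fix c d A B assume "A\<in>carrier KN" "B\<in>carrier KN"
  then obtain f g where f: "f\<in>R" "A = cls f" and g: "g\<in>R" "B = cls g" by (meson KN_cases)
  show "c \<odot>\<^bsub>KN\<^esub> A\<in>carrier KN" unfolding f(2) cls_smult[OF f(1)] by (rule cls_carrier[OF R_smult[OF f(1)]])
  show "c \<odot>\<^bsub>KN\<^esub> (A \<oplus>\<^bsub>KN\<^esub> B) = c \<odot>\<^bsub>KN\<^esub> A \<oplus>\<^bsub>KN\<^esub> c \<odot>\<^bsub>KN\<^esub> B"
   unfolding f(2) g(2) cls_add[OF f(1) g(1)] cls_smult[OF R_add[OF f(1) g(1)]] cls_smult[OF f(1)] cls_smult[OF g(1)]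
    cls_add[OF R_smult[OF f(1)] R_smult[OF g(1)]]
   by (rule cls_eqI[OF f(1) g(1) g(1)]) (rule add_smult_distrib_left_mat)
 next
  fix c d A assume "A\<in>carrier KN"
  then obtain f where f: "f\<in>R" "A = cls f" by (rule KN_cases)
  show "(c \<oplus>\<^bsub>class_ring\<^esub> d) \<odot>\<^bsub>KN\<^esub> A = c \<odot>\<^bsub>KN\<^esub> A \<oplus>\<^bsub>KN\<^esub> d \<odot>\<^bsub>KN\<^esub> A"
   unfolding f(2) cls_smult[OF f(1)] cls_add[OF R_smult[OF f(1)] R_smult[OF f(1)]]
   by (rule cls_eqI[OF f(1) f(1) f(1)], rule eq_matI) (auto simp: distrib_right)
  show "(c \<otimes>\<^bsub>class_ring\<^esub> d) \<odot>\<^bsub>KN\<^esub> A = c \<odot>\<^bsub>KN\<^esub> (d \<odot>\<^bsub>KN\<^esub> A)"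
   unfolding f(2) cls_smult[OF f(1)] cls_smult[OF R_smult[OF f(1)]] by (simp add: smult_smult_mat)
  show "\<one>\<^bsub>class_ring\<^esub> \<odot>\<^bsub>KN\<^esub> A = A" unfolding f(2) cls_smult[OF f(1)] by simp
 qed
 fix c A B assume "A\<in>carrier KN" "B\<in>carrier KN"
 then obtain f g where f: "f\<in>R" "A = cls f" and g: "g\<in>R" "B = cls g" by (meson KN_cases)
 show "(c \<odot>\<^bsub>KN\<^esub> A) \<otimes>\<^bsub>KN\<^esub> B = c \<odot>\<^bsub>KN\<^esub> (A \<otimes>\<^bsub>KN\<^esub> B)"
  unfolding f(2) g(2) cls_smult[OF f(1)] cls_mult[OF f(1) g(1)] cls_mult[OF R_smult[OF f(1)] g(1)]
   cls_smult[OF R_mult[OF f(1) g(1)]]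
  by (rule cls_eqI[OF f(1) g(1) g(1)]) (rule mult_smult_assoc_mat)
 show "A \<otimes>\<^bsub>KN\<^esub> (c \<odot>\<^bsub>KN\<^esub> B) = c \<odot>\<^bsub>KN\<^esub> (A \<otimes>\<^bsub>KN\<^esub> B)"
  unfolding f(2) g(2) cls_smult[OF g(1)] cls_mult[OF f(1) g(1)] cls_mult[OF f(1) R_smult[OF g(1)]]
   cls_smult[OF R_mult[OF f(1) g(1)]]
  by (rule cls_eqI[OF f(1) g(1) g(1)]) (rule mult_smult_distrib)
qed

end

section \<open>Regular actions\<close>

locale equivariant_variety =
 fixes G :: "('g, 'm) monoid_scheme" and S :: "('k::field, 'g) fspace" and n :: nat
  and X :: "('k, 'x) fspace" and act :: "'g\<times>'k mat set => 'x => 'x"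
 assumes kX: "k_space X" and kS: "k_space S" and S: "points S = carrier G" and G: "group G"
  and regular: "regular_action (G \<times>\<times> PGL n) (prod_space S (PGL_space n)) X act"
begin

lemma group_action: "group_action (G \<times>\<times> PGL n) (points X) act"
 using regular by (simp add: regular_action_def)

lemma act_compose:
 "x\<in>points X==>g\<in>carrier G==>h\<in>carrier G==>P\<in>carrier (PGL n)==>Q\<in>carrier (PGL n) ==>
  act (g, P) (act (h, Q) x) = act (g \<otimes>\<^bsub>G\<^esub> h, P \<otimes>\<^bsub>PGL n\<^esub> Q) x"
 using group_action.composition_rule[OF group_action, of x "(g, P)" "(h, Q)"] by simp

lemma act_one: "x\<in>points X==>act (\<one>\<^bsub>G\<^esub>, \<one>\<^bsub>PGL n\<^esub>) x = x"
 using fun_cong[OF group_action.id_eq_one[OF group_action], of x] by simp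

lemma one_PGL: "\<one>\<^bsub>PGL n\<^esub>\<in>carrier (PGL n)"
 using group.is_monoid[OF group_PGL] by (rule monoid.one_closed)

lemma one_one: "\<one>\<^bsub>PGL n\<^esub> \<otimes>\<^bsub>PGL n\<^esub> \<one>\<^bsub>PGL n\<^esub> = \<one>\<^bsub>PGL n\<^esub>"
 by (rule monoid.l_one[OF group.is_monoid[OF group_PGL] one_PGL])

lemma one_G: "\<one>\<^bsub>G\<^esub>\<in>carrier G" and inv_G: "g\<in>carrier G==>inv\<^bsub>G\<^esub> g\<in>carrier G"
 using monoid.one_closed[OF group.is_monoid[OF G]] group.inv_closed[OF G] by simp_all

lemma act_closed: "x\<in>points X==>g\<in>carrier G==>P\<in>carrier (PGL n)==>act (g, P) x\<in>points X"
 using group_action.element_image[OF group_action, of "(g, P)" x] by simp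

lemma act_morphism:
 assumes "g\<in>carrier G" "P\<in>carrier (PGL n)"
 shows "morphism X X (act (g, P))"
proof -
 have kP: "k_space (prod_space S (PGL_space n))" by (rule k_space_prod[OF kS k_space_PGL])
 have "morphism X (prod_space (prod_space S (PGL_space n)) X) (%x. ((g, P), x))"
  by (rule morphism_pair[OF kP kX kX morphism_const[OF kX] morphism_id])
    (use assms S points_prod[OF kS k_space_PGL] in auto)
 moreover have "morphism (prod_space (prod_space S (PGL_space n)) X) X (%(g, x). act g x)"
  using regular by (simp add: regular_action_def)
 ultimately have "morphism X X (%x. (%(g, x). act g x) ((g, P), x))" by (rule morphism_compose)
 thus ?thesis by simp
qed

text \<open>The element \<open>g\<close> acts on functions through the point map of its inverse.\<close>

abbreviation shift :: "'g => 'x => 'x" where "shift g \<equiv> act (inv\<^bsub>G\<^esub> g, \<one>\<^bsub>PGL n\<^esub>)"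

lemma shift_morphism: "g\<in>carrier G==>morphism X X (shift g)"
 by (intro act_morphism inv_G one_PGL)

lemma shift_closed: "g\<in>carrier G==>x\<in>points X==>shift g x\<in>points X"
 by (intro act_closed inv_G one_PGL)

lemma shift_inverse: "g\<in>carrier G==>x\<in>points X==>shift g (act (g, \<one>\<^bsub>PGL n\<^esub>) x) = x"
 using act_compose[OF _ inv_G _ one_PGL one_PGL, of x g g] act_one[of x] group.l_inv[OF G, of g] by (simp add: one_one)

lemma dense_open_shift:
 assumes g: "g\<in>carrier G" and U: "dense_open (ftop X) U"
 shows "dense_open (ftop X) {x\<in>points X. shift g x\<in>U}"
 unfolding dense_open_iff
proof (intro conjI allI impI)
 show "opens X {x\<in>points X. shift g x\<in>U}"
  by (rule morphism_openin[OF shift_morphism[OF g]]) (use U in \<open>simp add: dense_open_iff\<close>)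
 fix W assume W: "opens X W & W~={}"
 have WX: "W \<subseteq> points X" using W openin_subset by blast
 let ?b = "act (g, \<one>\<^bsub>PGL n\<^esub>)"
 have "opens X {x\<in>points X. ?b x\<in>W}"
  by (rule morphism_openin[OF act_morphism[OF g one_PGL]]) (use W in blast)
 moreover obtain w where w: "w\<in>W" using W by blast
 have "?b (shift g w) = w"
  using act_compose[OF _ g inv_G[OF g] one_PGL one_PGL, of w] act_one[of w] w WX
   group.r_inv[OF G g] by (auto simp: one_one)
 hence "shift g w\<in>{x\<in>points X. ?b x\<in>W}" using w WX shift_closed[OF g] by auto
 ultimately have "U\<inter>{x\<in>points X. ?b x\<in>W}~={}" using U unfolding dense_open_iff by blast
 then obtain u where u: "u\<in>U" "u\<in>points X" "?b u\<in>W" by blast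
 have "shift g (?b u) = u" by (rule shift_inverse[OF g u(2)])
 hence "?b u\<in>{x\<in>points X. shift g x\<in>U}" using u act_closed[OF u(2) g one_PGL] by auto
 thus "{x\<in>points X. shift g x\<in>U}\<inter>W~={}" using u by blast
qed

lemma generically_shift:
 assumes g: "g\<in>carrier G" and P: "generically (ftop X) P"
 shows "generically (ftop X) (%x. P (shift g x))"
proof -
 obtain U where U: "dense_open (ftop X) U" "ALL x:U. P x" using P unfolding generically_def by blast
 show ?thesis by (rule genericallyI[OF dense_open_shift[OF g U(1)]]) (use U in auto)
qed

end

sublocale equivariant_variety \<subseteq> rational_maps n X "pgl_part G act"
 by unfold_locales (rule kX)

section \<open>Stabilizers in general position\<close>

definition mpow :: "nat => 'k::field mat => nat => 'k mat"
 where "mpow n M k = ((%A. A * M) ^^ k) (1\<^sub>m n)"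

lemma mpow_simps [simp]: "mpow n M 0 = 1\<^sub>m n" "mpow n M (Suc k) = mpow n M k * M"
 by (simp_all add: mpow_def)

lemma mpow_carrier [simp]: "M\<in>carrier_mat n n==>mpow n M k\<in>carrier_mat n n"
 by (induction k) auto

lemma mpow_smult: "M\<in>carrier_mat n n==>mpow n (c\<cdot>\<^sub>mM) k = c ^ k\<cdot>\<^sub>mmpow n M k"
 by (induction k) (auto simp: smult_mult_mat[where n = n] smult_smult_mat mult.commute)

lemma pgl_conj_mpow: "P\<in>carrier (PGL n)==>M\<in>carrier_mat n n==>pgl_conj n P (mpow n M k) = mpow n (pgl_conj n P M) k"
 by (induction k) (auto simp: pgl_conj_one pgl_conj_mult)

lemma mpow_conj_diag:
 assumes g: "g\<in>carrier (GL n)"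
 shows "mpow n (g * mat_diag n d * minv n g) k = g * mat_diag n (%i. d i ^ k) * minv n g"
proof (induction k)
 case 0
 show ?case using g by (simp add: minv_right)
next
 case (Suc k)
 have e: "mat_diag n (%i. d i ^ Suc k) = mat_diag n (%i. d i ^ k) * mat_diag n d" by (simp add: mult.commute)
 show ?case unfolding mpow_simps Suc e using g by (simp add: mat_assoc[where n = n] cancel_minv del: mat_diag_diag)
qed

text \<open>
  At a general point the values of the two generators are matrices with \<open>XY = \<zeta>YX\<close>, and the
  conjugation by the \<open>PGL\<close>-component of a stabilizer element moves them as the group element moves the
  generators.  An element mixing the generators would force equal \<open>p\<close>-th powers, so generically the
  matrix \<open>X\<close> is only rescaled and its torus is normalized.
\<close>

lemma stabilizers_normalize_tori_of_generators:
 fixes A :: "('k::{alg_closed_field, field_char_0}, 'a) module" (structure)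
  and X :: "('k, 'x) fspace" and G :: "('g, 'm) monoid_scheme"
 assumes assoc: "associated_variety G S p A \<alpha> X act"
  and S: "k_space S" "points S = carrier G" and fin: "finite (carrier G)"
  and p: "p > 0" and zeta: "\<zeta> ^ p = 1" "ALL m. 0 < m & m < p --> \<zeta> ^ m~=1"
  and x: "x\<in>Units A" and y: "y\<in>Units A" and xy: "x\<otimes>y = \<zeta>\<odot>(y\<otimes>x)"
  and ne: "x [^] p~=y [^] p"
  and cases: "!!g. g\<in>carrier G ==>
   (EX c. c~=0 & \<alpha> g x = c\<odot>x) | (EX c. c ^ p = 1 & \<alpha> g x = c\<odot>y) | (EX c. c ^ p = 1 & \<alpha> g y = c\<odot>x)"
 shows "stabilizers_normalize_tori G p X act"
proof -
 have csa: "central_simple_algebra A p" and action: "k_alg_action G A \<alpha>" and var: "variety X"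
  and irr: "irreducible_space (ftop X)"
  and reg: "regular_action (G \<times>\<times> PGL p) (prod_space S (PGL_space p)) X act"
  using assoc unfolding associated_variety_def by blast+
 have kalg: "k_algebra A" using csa unfolding central_simple_algebra_def by blast
 interpret k_alg A by unfold_locales (rule kalg)
 have ga: "group_action G (carrier A) \<alpha>" using action unfolding k_alg_action_def by blast
 interpret equivariant_variety G S p X act
  by (rule equivariant_variety.intro[OF variety_imp_k_space[OF var] S
     group_hom.axioms(1)[OF group_action.group_hom[OF ga]] reg])
 obtain \<psi> where psi: "\<psi>\<in>k_alg_hom A KN" "bij_betw \<psi> (carrier A) (carrier KN)"
   "ALL g:carrier G. ALL a:carrier A. \<psi> (\<alpha> g a) = kn_act G p X act g (\<psi> a)"
  using assoc unfolding associated_variety_def by blast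
 have pc: "!!a. a\<in>carrier A==>\<psi> a\<in>carrier KN"
  and pm: "!!a b. a\<in>carrier A==>b\<in>carrier A==>\<psi> (a\<otimes>b) = \<psi> a \<otimes>\<^bsub>KN\<^esub> \<psi> b"
  and p1: "\<psi> \<one> = \<one>\<^bsub>KN\<^esub>" and ps: "!!c a. a\<in>carrier A==>\<psi> (c\<odot>a) = c \<odot>\<^bsub>KN\<^esub> \<psi> a"
  using psi(1) unfolding k_alg_hom_def Ring.ring_hom_def by auto
 have ac: "\<alpha> g a\<in>carrier A" if "g\<in>carrier G" "a\<in>carrier A" for g a
  using group_action.element_image[OF ga that] by blast
 have xA: "x\<in>carrier A" "inv x\<in>carrier A" and yA: "y\<in>carrier A" "inv y\<in>carrier A" using x y by auto
 define r where "r a = (SOME f. f\<in>\<psi> a)" for a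
 have r: "r a\<in>\<psi> a" if a: "a\<in>carrier A" for a
 proof -
  obtain f where "f\<in>R" "\<psi> a = cls f" using pc[OF a] by (rule KN_cases)
  hence "f\<in>\<psi> a" using cls_self by simp
  thus ?thesis unfolding r_def by (rule someI[of "%f. f\<in>\<psi> a"])
 qed
 have rR: "r a\<in>R" and rc: "\<psi> a = cls (r a)" if a: "a\<in>carrier A" for a
  using mem_KN[OF pc[OF a] r[OF a]] by auto
 have r_mult: "ge (r (a\<otimes>b)) (%z. r a z * r b z)" if ab: "a\<in>carrier A" "b\<in>carrier A" for a b
  by (rule mem_mult[OF pc[OF ab(1)] pc[OF ab(2)] r[OF ab(1)] r[OF ab(2)]])
    (use r[of "a\<otimes>b"] pm[OF ab] ab in simp)
 have r_smult: "ge (r (c\<odot>a)) (%z. c\<cdot>\<^sub>mr a z)" if a: "a\<in>carrier A" for a c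
  by (rule mem_smult[OF pc[OF a] r[OF a]]) (use r[of "c\<odot>a"] ps[OF a] a in simp)
 have r_one: "ge (r \<one>) (%_. 1\<^sub>m p)"
  using r[of \<one>] unfolding p1 KN_one by (simp add: cls_def')
 have r_pow: "ge (r (a [^] k)) (%z. mpow p (r a z) k)" if a: "a\<in>carrier A" for a and k :: nat
 proof (induction k)
  case (Suc k)
  have "ge (r (a [^] k\<otimes>a)) (%z. r (a [^] k) z * r a z)" by (rule r_mult) (use a in auto)
  moreover have "ge (%z. r (a [^] k) z * r a z) (%z. mpow p (r a z) k * r a z)"
   by (rule generically_equal_combine[OF Suc Suc]) simp
  ultimately show ?case using generically_equal_trans by fastforce
 qed (use r_one in simp)
 have r_act: "ge (r (\<alpha> g a)) (%z. r a (shift g z))" if g: "g\<in>carrier G" and a: "a\<in>carrier A" for g a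
 proof -
  have "r (\<alpha> g a)\<in>(\<Union>f\<in>\<psi> a. cls (%z. f (shift g z)))"
   using r[OF ac[OF g a]] psi(3) g a unfolding kn_act_def by auto
  then obtain f where f: "f\<in>\<psi> a" "r (\<alpha> g a)\<in>cls (%z. f (shift g z))" by blast
  have "ge f (r a)" using f(1) unfolding rc[OF a] by (rule mem_cls)
  hence "ge (%z. f (shift g z)) (%z. r a (shift g z))"
   unfolding generically_eq by (rule generically_shift[OF g])
  thus ?thesis using mem_cls[OF f(2)] generically_equal_trans by blast
 qed
 obtain D where D: "rep_on (r x) D" "rep_on (r y) D" by (rule rep_on_common[OF rR[OF xA(1)] rR[OF yA(1)]])
 note Dx = rep_onD[OF D(1)] and Dy = rep_onD[OF D(2)]
 define move where "move g z \<longleftrightarrow>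
   (EX c. c~=0 & r (\<alpha> g x) z = c\<cdot>\<^sub>mr x z) | (EX c. c ^ p = 1 & r (\<alpha> g x) z = c\<cdot>\<^sub>mr y z) \<or>
   (EX c. c ^ p = 1 & r (\<alpha> g y) z = c\<cdot>\<^sub>mr x z)" for g z
 have gen_move: "generically (ftop X) (move g)" if g: "g\<in>carrier G" for g
  using cases[OF g]
 proof (elim disjE exE conjE)
  fix c assume "c~=0" "\<alpha> g x = c\<odot>x"
  thus ?thesis using r_smult[OF xA(1), of c] unfolding generically_eq
   by (elim generically_mono) (auto simp: move_def)
 next
  fix c assume "c ^ p = 1" "\<alpha> g x = c\<odot>y"
  thus ?thesis using r_smult[OF yA(1), of c] unfolding generically_eq
   by (elim generically_mono) (auto simp: move_def)
 next
  fix c assume "c ^ p = 1" "\<alpha> g y = c\<odot>x"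
  thus ?thesis using r_smult[OF xA(1), of c] unfolding generically_eq
   by (elim generically_mono) (auto simp: move_def)
 qed
 have gD: "generically (ftop X) (%z. z\<in>D)" by (rule genericallyI[OF Dx(1)])
 have gen_G: "generically (ftop X) (%z. ALL g:carrier G. move g z & shift g z\<in>D &
   r (\<alpha> g x) z = r x (shift g z) & r (\<alpha> g y) z = r y (shift g z))"
  by (intro generically_finite[OF fin] generically_conj gen_move generically_shift gD)
    (use r_act xA yA in \<open>auto simp: generically_eq[symmetric]\<close>)
 have gen_units: "generically (ftop X) (%z. r a z\<in>carrier (GL p))" if a: "a\<in>Units A" for a
 proof -
  have aA: "a\<in>carrier A" "inv a\<in>carrier A" using a by auto
  have "ge (%z. r a z * r (inv a) z) (%_. 1\<^sub>m p)"
   using generically_equal_trans[OF generically_equal_sym[OF r_mult[OF aA]]] r_one a by simp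
  hence "generically (ftop X) (%z. r a z\<in>carrier_mat p p & r (inv a) z\<in>carrier_mat p p & r a z * r (inv a) z = 1\<^sub>m p)"
   unfolding generically_eq by (intro generically_conj rep_generic rR aA)
  thus ?thesis
  proof (rule generically_mono)
   fix z assume z: "r a z\<in>carrier_mat p p & r (inv a) z\<in>carrier_mat p p & r a z * r (inv a) z = 1\<^sub>m p"
   hence "det (r a z) * det (r (inv a) z) = 1" by (metis det_mult det_one)
   thus "r a z\<in>carrier (GL p)" using z unfolding carrier_GL by auto
  qed
 qed
 have gen_xy: "generically (ftop X) (%z. r x z * r y z = \<zeta>\<cdot>\<^sub>m(r y z * r x z))"
 proof -
  have h1: "ge (r (x\<otimes>y)) (%z. r x z * r y z)" by (rule r_mult[OF xA(1) yA(1)])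
  have h2: "ge (r (\<zeta>\<odot>(y\<otimes>x))) (%z. \<zeta>\<cdot>\<^sub>mr (y\<otimes>x) z)" by (rule r_smult) (use xA yA in simp)
  have h3: "ge (r (y\<otimes>x)) (%z. r y z * r x z)" by (rule r_mult[OF yA(1) xA(1)])
  from generically_conj[OF h1[unfolded generically_eq xy] generically_conj[OF h2[unfolded generically_eq] h3[unfolded generically_eq]]]
  show ?thesis by (rule generically_mono) auto
 qed
 have gen_ne: "generically (ftop X) (%z. mpow p (r x z) p~=mpow p (r y z) p)"
 proof -
  have "~ ge (r (x [^] p)) (r (y [^] p))"
  proof
   assume "ge (r (x [^] p)) (r (y [^] p))"
   hence "\<psi> (x [^] p) = \<psi> (y [^] p)" using rc[of "x [^] p"] rc[of "y [^] p"] xA yA cls_cong by simp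
   thus False using psi(2) ne xA yA by (auto simp: bij_betw_def inj_on_def)
  qed
  hence "generically (ftop X) (%z. r (x [^] p) z~=r (y [^] p) z)"
   using generically_different[OF irr rR rR] xA yA unfolding generically_def by simp
  from generically_conj[OF this generically_conj[OF r_pow[OF xA(1), of p, unfolded generically_eq]
     r_pow[OF yA(1), of p, unfolded generically_eq]]]
  show ?thesis by (rule generically_mono) auto
 qed
 from generically_conj[OF gD generically_conj[OF gen_G generically_conj[OF gen_units[OF x]
    generically_conj[OF gen_units[OF y] generically_conj[OF gen_xy gen_ne]]]]]
 obtain U where U: "dense_open (ftop X) U" and good: "!!z. z\<in>U==>z\<in>D &
   (ALL g:carrier G. move g z & shift g z\<in>D & r (\<alpha> g x) z = r x (shift g z) & r (\<alpha> g y) z = r y (shift g z)) &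
   r x z\<in>carrier (GL p) & r y z\<in>carrier (GL p) & r x z * r y z = \<zeta>\<cdot>\<^sub>m(r y z * r x z) &
   mpow p (r x z) p~=mpow p (r y z) p"
  unfolding generically_def by blast
 show ?thesis unfolding stabilizers_normalize_tori_def
 proof (intro exI[of _ U] conjI ballI U)
  fix z assume z: "z\<in>U"
  have zX: "z\<in>points X" using z dense_open_points[OF U] by blast
  let ?X = "r x z" and ?Y = "r y z"
  from good[OF z] have zD: "z\<in>D" and XG: "?X\<in>carrier (GL p)" and YG: "?Y\<in>carrier (GL p)"
   and XY: "?X * ?Y = \<zeta>\<cdot>\<^sub>m(?Y * ?X)" and neq: "mpow p ?X p~=mpow p ?Y p" by auto
  have Xc: "?X\<in>carrier_mat p p" and Yc: "?Y\<in>carrier_mat p p" using XG YG by auto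
  obtain g l where g: "g\<in>carrier (GL p)" "l~=0" "?X = g * mat_diag p (%i. l * \<zeta> ^ i) * minv p g"
   and inj: "inj_on (%i. l * \<zeta> ^ i) {..<p}"
   by (rule q_commuting_diagonalizable[OF zeta p XG YG XY])
  have Xp: "mpow p ?X p = l ^ p\<cdot>\<^sub>m1\<^sub>m p"
  proof -
   have "(l * \<zeta> ^ i) ^ p = l ^ p" for i
   proof -
    have "(l * \<zeta> ^ i) ^ p = l ^ p * (\<zeta> ^ p) ^ i" by (simp only: power_mult_distrib power_mult[symmetric] mult.commute)
    thus ?thesis using zeta(1) by simp
   qed
   hence "mat_diag p (%i. (l * \<zeta> ^ i) ^ p) = l ^ p\<cdot>\<^sub>m1\<^sub>m p"
    by (intro eq_matI) (auto simp: mat_diag_def)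
   thus ?thesis unfolding g(3) mpow_conj_diag[OF g(1)] using g(1)
    by (simp add: smult_mult_mat[where n = p] minv_right)
  qed
  show "EX T. maximal_torus p T & stabilizer (G \<times>\<times> PGL p) act z \<subseteq> carrier G\<times>normalizer (PGL p) T"
  proof (intro exI conjI)
   show "maximal_torus p (torus p g)" by (rule torus_maximal[OF p g(1)])
   show "stabilizer (G \<times>\<times> PGL p) act z \<subseteq> carrier G\<times>normalizer (PGL p) (torus p g)"
   proof
    fix q assume "q\<in>stabilizer (G \<times>\<times> PGL p) act z"
    then obtain s P where q: "q = (s, P)" and s: "s\<in>carrier G" and P: "P\<in>carrier (PGL p)"
     and fix_z: "act (s, P) z = z" by (auto simp: stabilizer_def)
    have "shift s (act (s, P) z) = act (\<one>\<^bsub>G\<^esub>, P) z"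
     using act_compose[OF zX inv_G[OF s] s one_PGL P] group.l_inv[OF G s]
      monoid.l_one[OF group.is_monoid[OF group_PGL] P] by simp
    hence sz: "shift s z = pgl_part G act P z" unfolding fix_z by (simp add: pgl_part_def)
    from good[OF z] s have mv: "move s z" and sD: "shift s z\<in>D"
     and sx: "r (\<alpha> s x) z = r x (shift s z)" and sy: "r (\<alpha> s y) z = r y (shift s z)" by auto
    have cX: "pgl_conj p P ?X = r (\<alpha> s x) z" and cY: "pgl_conj p P ?Y = r (\<alpha> s y) z"
     using Dx(3)[OF P zD] Dy(3)[OF P zD] sD unfolding sx sy sz by auto
    have cXp: "pgl_conj p P (mpow p ?X p) = mpow p ?X p"
     unfolding Xp using P by (simp add: pgl_conj_smult pgl_conj_one)
    from mv consider (scale) c where "c~=0" "r (\<alpha> s x) z = c\<cdot>\<^sub>m?X"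
     | (mix) c where "c ^ p = 1" "r (\<alpha> s x) z = c\<cdot>\<^sub>m?Y" | (mix') c where "c ^ p = 1" "r (\<alpha> s y) z = c\<cdot>\<^sub>m?X"
     unfolding move_def by blast
    hence "P\<in>normalizer (PGL p) (torus p g)"
    proof cases
     case scale
     thus ?thesis using normalizer_torus[OF p g(1) inj g(3) P scale(1)] cX by simp
    next
     case mix
     have "mpow p ?X p = mpow p (c\<cdot>\<^sub>m?Y) p"
      using cXp pgl_conj_mpow[OF P Xc, of p] unfolding cX mix(2) by simp
     thus ?thesis using neq mix(1) by (simp add: mpow_smult[OF Yc])
    next
     case mix'
     have "pgl_conj p P (mpow p ?Y p) = mpow p ?X p"
      unfolding pgl_conj_mpow[OF P Yc] cY mix'(2) using mix'(1) by (simp add: mpow_smult[OF Xc])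
     hence "pgl_conj p P (mpow p ?Y p) = pgl_conj p P (mpow p ?X p)" using cXp by simp
     hence "pgl_conj p (inv\<^bsub>PGL p\<^esub> P) (pgl_conj p P (mpow p ?Y p)) =
       pgl_conj p (inv\<^bsub>PGL p\<^esub> P) (pgl_conj p P (mpow p ?X p))" by simp
     moreover have "pgl_conj p (inv\<^bsub>PGL p\<^esub> P) (pgl_conj p P M) = M" if "M\<in>carrier_mat p p" for M
      using pgl_conj_comp[OF group.inv_closed[OF group_PGL P] P that] pgl_conj_by_one[OF that]
       group.l_inv[OF group_PGL P] by simp
     ultimately show ?thesis using neq Xc Yc by simp
    qed
    thus "q\<in>carrier G\<times>normalizer (PGL p) (torus p g)" using q s by simp
   qed
  qed
 qed
qed

section \<open>The group generated by the scalings and the rotation\<close>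

lemma (in k_alg) inv_smult:
 assumes u: "u\<in>Units A" and c: "(c :: 'k)~=0"
 shows "inv (c\<odot>u) = (1 / c)\<odot>inv u"
proof -
 have "(1 / c)\<odot>inv u = inv (c\<odot>u)"
  by (rule inv_unique') (use u c in \<open>auto simp: smult_assoc1 Units_closed\<close>)
 thus ?thesis by simp
qed

lemma (in symbol_algebra) conj_by_hom:
 assumes w: "w\<in>Units A"
 shows "conj_by w\<in>k_alg_hom A A"
proof (rule k_alg_homI)
 fix a b assume ab: "a\<in>carrier A" "b\<in>carrier A"
 have wc: "w\<in>carrier A" "inv w\<in>carrier A" using w by auto
 have "w\<otimes>a\<otimes>inv w\<otimes>(w\<otimes>b\<otimes>inv w) = w\<otimes>a\<otimes>(inv w\<otimes>w)\<otimes>b\<otimes>inv w"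
  using ab wc by (simp add: m_assoc)
 thus "conj_by w (a\<otimes>b) = conj_by w a\<otimes>conj_by w b"
  unfolding conj_by_def using ab w wc by (simp add: m_assoc)
 show "conj_by w (a\<oplus>b) = conj_by w a\<oplus>conj_by w b" by (rule conj_by_add[OF w ab])
next
 show "conj_by w \<one> = \<one>" unfolding conj_by_def using w by (simp add: Units_closed)
 show "conj_by w (c\<odot>a) = c\<odot>conj_by w a" if "a\<in>carrier A" for c a by (rule conj_by_smult[OF w that])
qed (rule conj_by_closed[OF w])

context
 fixes p :: nat
  and \<zeta> :: "'k::{alg_closed_field, field_char_0}"
  and A :: "('k, 'a) module" (structure)
  and \<iota> :: "(nat\<times>nat => 'k) => 'a"
  and x y :: 'a
  and \<sigma> :: "nat => nat => 'a => 'a"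
  and \<tau> :: "'a => 'a"
  and G :: "('a => 'a) monoid"
 assumes p1: "p > 1"
  and zeta: "\<zeta> ^ p = 1" "ALL m. 0 < m & m < p --> \<zeta> ^ m~=1"
  and A: "division_algebra_of_fractions (skew_poly \<zeta>) A \<iota>"
  and x: "x = \<iota> (skew_monom 1 0)" and y: "y = \<iota> (skew_monom 0 1)"
  and sigma: "ALL a b. \<sigma> a b\<in>carrier (k_alg_aut A) &
         \<sigma> a b x = \<zeta> ^ a\<odot>x & \<sigma> a b y = \<zeta> ^ b\<odot>y"
  and tau: "\<tau>\<in>carrier (k_alg_aut A)" "\<tau> x = y" "\<tau> y = inv x\<otimes>inv y"
  and G: "G = subgroup_generated (k_alg_aut A) ({\<sigma> a b | a b. a < p & b < p}\<union>{\<tau>})"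
begin

lemma p: "p > 0"
 using p1 by simp

interpretation symbol_algebra A \<zeta> p x y
 unfolding x y by (rule frac_symbol_algebra[OF A p zeta])

interpretation Aut: group "k_alg_aut A" by (rule group_k_alg_aut)

abbreviation (input) generators :: "('a => 'a) set"
 where "generators \<equiv> {\<sigma> a b | a b. a < p & b < p}\<union>{\<tau>}"

lemma generators_aut: "generators \<subseteq> carrier (k_alg_aut A)"
 using sigma tau(1) by auto

lemma carrier_G: "carrier G = generate (k_alg_aut A) generators"
 unfolding G carrier_subgroup_generated using generators_aut by (simp only: Int_absorb1)

lemma G_aut: "g\<in>carrier G==>g\<in>carrier (k_alg_aut A)"
 unfolding carrier_G using Aut.generate_in_carrier[OF generators_aut] by blast

lemma invariant_iff_generators:
 assumes L: "L \<subseteq> carrier A"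
 shows "invariant_under G (%g. g) L \<longleftrightarrow> (ALL s:generators. s ` L = L)"
 unfolding invariant_under_def
proof
 assume "ALL g:carrier G. g ` L = L"
 moreover have "s\<in>carrier G" if "s\<in>generators" for s
  unfolding carrier_G using that by (rule generate.incl)
 ultimately show "ALL s:generators. s ` L = L" by blast
next
 assume s: "ALL s:generators. s ` L = L"
 show "ALL g:carrier G. g ` L = L"
 proof
  fix g assume g: "g\<in>carrier G"
  show "g ` L = L"
  proof (rule image_generated[OF generators_aut L])
   show "g\<in>carrier (subgroup_generated (k_alg_aut A) generators)" using g unfolding G .
  qed (rule bspec[OF s])
 qed
qed

text \<open>The scalings of the generators contain the conjugations by the generators, so an invariant subspace is stable under both conjugations.\<close>

lemma conj_by_x: "a\<in>carrier A==>\<sigma> 0 1 a = conj_by x a"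
proof (rule frac_automorphisms_eq[OF A _ conj_by_hom[OF x_unit]], fold x y)
 show "\<sigma> 0 1\<in>k_alg_hom A A" using sigma k_alg_aut_hom by blast
 have "conj_by x x = 1\<odot>x" unfolding conj_by_eq[OF x_unit x_closed] by simp
 thus "\<sigma> 0 1 x = conj_by x x" using sigma by simp
 have "conj_by x y = \<zeta>\<odot>y" unfolding conj_by_eq[OF x_unit y_closed] by (rule xy)
 thus "\<sigma> 0 1 y = conj_by x y" using sigma by simp
qed

lemma conj_by_y: "a\<in>carrier A==>\<sigma> (p - 1) 0 a = conj_by y a"
proof (rule frac_automorphisms_eq[OF A _ conj_by_hom[OF y_unit]], fold x y)
 show "\<sigma> (p - 1) 0\<in>k_alg_hom A A" using sigma k_alg_aut_hom by blast
 have "\<zeta> ^ (p - 1) * \<zeta> = 1" using p zeta(1) by (metis power_minus_mult)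
 hence "y\<otimes>x = \<zeta> ^ (p - 1)\<odot>(x\<otimes>y)" unfolding xy by (simp add: smult_assoc1)
 hence "conj_by y x = \<zeta> ^ (p - 1)\<odot>x" unfolding conj_by_eq[OF y_unit x_closed] .
 thus "\<sigma> (p - 1) 0 x = conj_by y x" using sigma by simp
 have "conj_by y y = 1\<odot>y" unfolding conj_by_eq[OF y_unit y_closed] by simp
 thus "\<sigma> (p - 1) 0 y = conj_by y y" using sigma by simp
qed

definition cyc :: "nat => 'a"
 where "cyc j = (if j mod 3 = 0 then x else if j mod 3 = 1 then y else inv x\<otimes>inv y)"

text \<open>
  The three elements \<open>x\<close>, \<open>y\<close> and \<open>(yx)\<^sup>-\<^sup>1\<close> are permuted cyclically up to powers of \<open>\<zeta>\<close>; as \<open>\<tau>\<close> permutes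
  them strictly, the property is inherited by the whole group.
\<close>

definition rotates :: "('a => 'a) => bool"
 where "rotates g \<longleftrightarrow> (EX i::nat. ALL j. EX m::nat. g (cyc j) = \<zeta> ^ m\<odot>cyc (j + i))"

lemma cyc_simps: "cyc 0 = x" "cyc 1 = y" "cyc (Suc 0) = y" "cyc 2 = inv x\<otimes>inv y"
 by (simp_all add: cyc_def)

lemma cyc_closed [simp]: "cyc j\<in>carrier A"
 using x_unit y_unit by (auto simp: cyc_def)

lemma cyc_mod: "cyc (j mod 3) = cyc j"
 by (simp add: cyc_def)

lemma cyc_eq: "j mod 3 = j' mod 3==>cyc j = cyc j'"
 by (metis cyc_mod)

lemma inverse_power: "1 / \<zeta> ^ m = \<zeta> ^ (m * (p - 1))"
proof -
 have "\<zeta> ^ (m * (p - 1)) * \<zeta> ^ m = (\<zeta> ^ p) ^ m"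
  unfolding power_add[symmetric] power_mult[symmetric] using p by (simp add: algebra_simps diff_mult_distrib2)
 thus ?thesis using zeta(1) zeta_nonzero by (simp add: field_simps)
qed

lemma rotates_sigma: "rotates (\<sigma> a b)"
 unfolding rotates_def
proof (rule exI[of _ 0], rule allI)
 fix j
 have s: "\<sigma> a b\<in>carrier (k_alg_aut A)" "\<sigma> a b x = \<zeta> ^ a\<odot>x" "\<sigma> a b y = \<zeta> ^ b\<odot>y" using sigma by auto
 have "\<sigma> a b (inv x\<otimes>inv y) = inv (\<sigma> a b x)\<otimes>inv (\<sigma> a b y)"
  using k_alg_homD(2)[OF k_alg_aut_hom[OF s(1)], of "inv x" "inv y"] k_alg_aut_Units(2)[OF s(1)] x_unit y_unit by simp
 also have "... = (\<zeta> ^ (a * (p - 1))\<odot>inv x)\<otimes>(\<zeta> ^ (b * (p - 1))\<odot>inv y)"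
  unfolding s inverse_power[symmetric] using inv_smult x_unit y_unit zeta_nonzero by simp
 also have "... = \<zeta> ^ (a * (p - 1) + b * (p - 1))\<odot>(inv x\<otimes>inv y)"
  using x_unit y_unit by (simp add: smult_assoc1 power_add mult.commute)
 finally show "EX m. \<sigma> a b (cyc j) = \<zeta> ^ m\<odot>cyc (j + 0)"
  unfolding cyc_def using s by auto
qed

lemma rotates_tau: "rotates \<tau>"
 unfolding rotates_def
proof (rule exI[of _ 1], rule allI)
 fix j
 have xA: "x\<in>carrier A" "inv x\<in>carrier A" "y\<in>carrier A" "inv y\<in>carrier A" using x_unit y_unit by auto
 have "\<tau> (inv x\<otimes>inv y) = inv y\<otimes>inv (inv x\<otimes>inv y)"
  using k_alg_homD(2)[OF k_alg_aut_hom[OF tau(1)] xA(2,4)] k_alg_aut_Units(2)[OF tau(1)] x_unit y_unit tau(2,3) by simp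
 also have "inv (inv x\<otimes>inv y) = y\<otimes>x"
 proof (rule inv_unique'[symmetric])
  have "inv x\<otimes>inv y\<otimes>(y\<otimes>x) = inv x\<otimes>(inv y\<otimes>y)\<otimes>x" "y\<otimes>x\<otimes>(inv x\<otimes>inv y) = y\<otimes>(x\<otimes>inv x)\<otimes>inv y"
   using xA by (simp_all add: m_assoc)
  thus "inv x\<otimes>inv y\<otimes>(y\<otimes>x) = \<one>" "y\<otimes>x\<otimes>(inv x\<otimes>inv y) = \<one>"
   using x_unit y_unit by simp_all
 qed (use xA in auto)
 also have "inv y\<otimes>(y\<otimes>x) = x" using xA y_unit by (simp add: m_assoc[symmetric])
 finally have "\<tau> (inv x\<otimes>inv y) = x" .
 have "\<tau> (cyc j) = cyc (j + 1)"
 proof -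
  have "j mod 3 = 0 | j mod 3 = 1 | j mod 3 = 2" by presburger
  thus ?thesis using \<open>\<tau> (inv x\<otimes>inv y) = x\<close> unfolding cyc_def by (elim disjE) (simp_all add: tau(2,3) mod_Suc)
 qed
 thus "EX m. \<tau> (cyc j) = \<zeta> ^ m\<odot>cyc (j + 1)" by (intro exI[of _ 0]) simp
qed

lemma rotates_mult:
 assumes g: "g\<in>carrier (k_alg_aut A)" "rotates g" and h: "h\<in>carrier (k_alg_aut A)" "rotates h"
 shows "rotates (g \<otimes>\<^bsub>k_alg_aut A\<^esub> h)"
proof -
 obtain i i' where i: "!!j. EX m. g (cyc j) = \<zeta> ^ m\<odot>cyc (j + i)" and i': "!!j. EX m. h (cyc j) = \<zeta> ^ m\<odot>cyc (j + i')"
  using g(2) h(2) unfolding rotates_def by blast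
 show ?thesis unfolding rotates_def
 proof (rule exI[of _ "i' + i"], rule allI)
  fix j
  obtain m m' where m': "h (cyc j) = \<zeta> ^ m'\<odot>cyc (j + i')" and m: "g (cyc (j + i')) = \<zeta> ^ m\<odot>cyc (j + i' + i)"
   using i i' by blast
  have "(g \<otimes>\<^bsub>k_alg_aut A\<^esub> h) (cyc j) = \<zeta> ^ (m' + m)\<odot>cyc (j + (i' + i))"
   using k_alg_aut_mult[OF g(1) h(1)] k_alg_homD(5)[OF k_alg_aut_hom[OF g(1)]] m m'
   by (simp add: smult_assoc1 power_add add.assoc)
  thus "EX m. (g \<otimes>\<^bsub>k_alg_aut A\<^esub> h) (cyc j) = \<zeta> ^ m\<odot>cyc (j + (i' + i))" by blast
 qed
qed

lemma rotates_inv: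
 assumes g: "g\<in>carrier (k_alg_aut A)" "rotates g"
 shows "rotates (inv\<^bsub>k_alg_aut A\<^esub> g)"
proof -
 obtain i where i: "!!j. EX m. g (cyc j) = \<zeta> ^ m\<odot>cyc (j + i)" using g(2) unfolding rotates_def by blast
 have ig: "inv\<^bsub>k_alg_aut A\<^esub> g\<in>carrier (k_alg_aut A)" using g(1) by simp
 show ?thesis unfolding rotates_def
 proof (rule exI[of _ "2 * i"], rule allI)
  fix j
  obtain m where m: "g (cyc (j + 2 * i)) = \<zeta> ^ m\<odot>cyc (j + 2 * i + i)" using i by blast
  have "cyc (j + 2 * i + i) = cyc j" by (rule cyc_eq) presburger
  hence "cyc (j + 2 * i) = \<zeta> ^ m\<odot>(inv\<^bsub>k_alg_aut A\<^esub> g) (cyc j)"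
   using m k_alg_aut_inv(1)[OF g(1), of "cyc (j + 2 * i)"] k_alg_homD(5)[OF k_alg_aut_hom[OF ig]] by simp
  hence "\<zeta> ^ (m * (p - 1))\<odot>cyc (j + 2 * i) = (inv\<^bsub>k_alg_aut A\<^esub> g) (cyc j)"
   unfolding inverse_power[symmetric] using zeta_nonzero k_alg_homD(1)[OF k_alg_aut_hom[OF ig]]
   by (simp add: smult_assoc1)
  thus "EX m. (inv\<^bsub>k_alg_aut A\<^esub> g) (cyc j) = \<zeta> ^ m\<odot>cyc (j + 2 * i)" by metis
 qed
qed

lemma rotates_G:
 assumes "g\<in>carrier G"
 shows "rotates g"
 using assms unfolding carrier_G
proof (induction rule: generate.induct)
 case one
 show ?case unfolding rotates_def
  by (rule exI[of _ 0], rule allI, rule exI[of _ 0]) (simp add: k_alg_aut_one)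
next
 case (incl h)
 thus ?case using rotates_sigma rotates_tau by blast
next
 case (inv h)
 hence "h\<in>carrier (k_alg_aut A)" "rotates h" using generators_aut rotates_sigma rotates_tau by blast+
 thus ?case by (rule rotates_inv)
next
 case (eng g h)
 thus ?case using rotates_mult Aut.generate_in_carrier[OF generators_aut] by blast
qed

text \<open>Depending on the amount of rotation, the element rescales the first generator, sends it to the second, or sends the second to the first.\<close>

lemma rotates_cases:
 assumes "rotates g"
 shows "(EX c. c~=0 & g x = c\<odot>x) | (EX c. c ^ p = 1 & g x = c\<odot>y) | (EX c. c ^ p = 1 & g y = c\<odot>x)"
proof -
 obtain i where i: "!!j. EX m. g (cyc j) = \<zeta> ^ m\<odot>cyc (j + i)" using assms unfolding rotates_def by blast
 have r: "(\<zeta> ^ m) ^ p = 1" for m using zeta(1) by (metis mult.commute power_mult power_one)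
 obtain m m' where m: "g x = \<zeta> ^ m\<odot>cyc i" and m': "g y = \<zeta> ^ m'\<odot>cyc (Suc i)"
  using i[of 0] i[of 1] by (auto simp: cyc_simps)
 have "i mod 3 = 0 | i mod 3 = 1 | Suc i mod 3 = 0" by presburger
 thus ?thesis
 proof (elim disjE)
  assume "i mod 3 = 0"
  hence "g x = \<zeta> ^ m\<odot>x" using m by (simp add: cyc_def)
  thus ?thesis using zeta_nonzero by (metis power_not_zero)
 next
  assume "i mod 3 = 1"
  hence "g x = \<zeta> ^ m\<odot>y" using m by (simp add: cyc_def)
  thus ?thesis using r by blast
 next
  assume "Suc i mod 3 = 0"
  hence "g y = \<zeta> ^ m'\<odot>x" using m' by (simp add: cyc_def)
  thus ?thesis using r by blast
 qed
qed

text \<open>An automorphism of the division algebra is determined by the images of the two generators, for which there are finitely many possibilities.\<close>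

lemma finite_G: "finite (carrier G)"
proof -
 define F where "F = (%(m, i). \<zeta> ^ m\<odot>cyc i) ` ({..<p}\<times>{..<3::nat})"
 have F: "\<zeta> ^ m\<odot>cyc i\<in>F" for m i
 proof -
  have "\<zeta> ^ m = \<zeta> ^ (m mod p)" using zeta(1) by (metis mod_mult_div_eq power_add power_mult power_one mult.right_neutral)
  hence "\<zeta> ^ m\<odot>cyc i = (%(m, i). \<zeta> ^ m\<odot>cyc i) (m mod p, i mod 3)" by (simp add: cyc_mod)
  thus ?thesis unfolding F_def using p by (intro image_eqI[of _ _ "(m mod p, i mod 3)"]) auto
 qed
 have inj: "inj_on (%g. (g x, g y)) (carrier G)"
 proof (rule inj_onI)
  fix g h assume g: "g\<in>carrier G" and h: "h\<in>carrier G" and e: "(g x, g y) = (h x, h y)"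
  show "g = h"
  proof (rule k_alg_aut_eqI[OF G_aut[OF g] G_aut[OF h]])
   fix a assume "a\<in>carrier A"
   thus "g a = h a"
    by (rule frac_automorphisms_eq[OF A k_alg_aut_hom[OF G_aut[OF g]] k_alg_aut_hom[OF G_aut[OF h]], rotated 2])
     (use e x y in auto)
  qed
 qed
 have sub: "(%g. (g x, g y)) ` carrier G \<subseteq> F\<times>F"
 proof (rule image_subsetI)
  fix g assume "g\<in>carrier G"
  then obtain i where i: "!!j. EX m. g (cyc j) = \<zeta> ^ m\<odot>cyc (j + i)" using rotates_G unfolding rotates_def by blast
  show "(g x, g y)\<in>F\<times>F" using i[of 0] i[of 1] F by (auto simp: cyc_simps)
 qed
 have "finite (F\<times>F)" unfolding F_def by simp
 from finite_imageD[OF finite_subset[OF sub this] inj] show ?thesis .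
qed

lemma powers_differ: "x [^] p~=y [^] p"
proof
 assume e: "x [^] p = y [^] p"
 have "\<iota> (skew_monom p 0) = x [^] p" "\<iota> (skew_monom 0 p) = y [^] p"
  using mon_eq_powers[OF A, of p 0] mon_eq_powers[OF A, of 0 p] x y x_closed y_closed by simp_all
 hence "\<iota> (skew_monom p 0) = 1\<odot>\<iota> (skew_monom 0 p)" using e by simp
 from mon_independent[OF A this] p show False by simp
qed

lemma fractions_stabilizers_normalize_tori:
 fixes XA :: "('k, 'x) fspace"
 assumes "associated_variety G (discrete_space (carrier G)) p A (%g. g) XA act"
 shows "stabilizers_normalize_tori G p XA act"
 by (rule stabilizers_normalize_tori_of_generators[OF assms k_space_discrete _ finite_G p zeta x_unit y_unit xy powers_differ
    rotates_cases[OF rotates_G]]) (simp_all add: discrete_space_def)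

end

text \<open>The group is generated by the rotation and by scalings among which are the conjugations by the two generators.\<close>

lemma fractions_invariant_maximal_subfield_iff:
 fixes p :: nat
  and \<zeta> :: "'k::{alg_closed_field, field_char_0}"
  and A :: "('k, 'a) module" (structure)
  and H :: "('a => 'a) monoid"
  and \<phi> :: "('a => 'a) => 'p::prime_card mod_ring mat"
 assumes p: "p = CARD('p)"
  and zeta: "\<zeta> ^ p = 1" "ALL m. 0 < m & m < p --> \<zeta> ^ m~=1"
  and A: "division_algebra_of_fractions (skew_poly \<zeta>) A \<iota>"
  and x: "x = \<iota> (skew_monom 1 0)" and y: "y = \<iota> (skew_monom 0 1)"
  and sigma: "ALL a b. \<sigma> a b\<in>carrier (k_alg_aut A) &
         \<sigma> a b x = \<zeta> ^ a\<odot>x & \<sigma> a b y = \<zeta> ^ b\<odot>y"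
  and tau: "\<tau>\<in>carrier (k_alg_aut A)" "\<tau> x = y" "\<tau> y = inv x\<otimes>inv y"
  and G: "G = subgroup_generated (k_alg_aut A) ({\<sigma> a b | a b. a < p & b < p}\<union>{\<tau>})"
  and H: "H = subgroup_generated (k_alg_aut A) {\<tau>}"
  and phi: "\<phi>\<in>hom H (SL 2)" "\<phi> \<tau> = mat_of_rows_list 2 [[0, -1], [1, -1]]"
 shows "(EX L. maximal_subfield A L & invariant_under G (%g. g) L) \<longleftrightarrow> reducible_representation H 2 \<phi>"
proof -
 have p1: "p > 1" unfolding p by (rule prime_gt_1_nat[OF prime_card])
 hence p0: "p > 0" by simp
 interpret symbol_division_algebra A \<zeta> x y "TYPE('p)"
  unfolding x y
  by (rule symbol_division_algebra.intro[OF frac_symbol_algebra[OF A p0 zeta, unfolded p]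
     symbol_division_algebra_axioms.intro[OF frac_division[OF A]]])
 note ctx = p1 zeta A x y sigma tau G
 let ?S = "{\<sigma> a b | a b. a < p & b < p}"
 have L: "L \<subseteq> carrier A" if "maximal_subfield A L" for L
  using that subfieldE(3) unfolding maximal_subfield_def by blast
 have "(EX L. maximal_subfield A L & invariant_under G (%g. g) L) \<longleftrightarrow>
   (EX L. maximal_subfield A L & (ALL s:insert \<tau> ?S. s ` L = L))"
 proof (intro ex_cong1 conj_cong refl)
  fix L assume "maximal_subfield A L"
  from invariant_iff_generators[OF ctx L[OF this]]
  show "invariant_under G (%g. g) L \<longleftrightarrow> (ALL s:insert \<tau> ?S. s ` L = L)"
   by (simp only: Un_insert_right Un_empty_right)
 qed
 also have "... \<longleftrightarrow> (EX a b::'p mod_ring. (a, b)~=(0, 0) & a * (a - b) = b * (- b))"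
 proof (rule invariant_maximal_subfield_iff[OF tau])
  show "s\<in>carrier (k_alg_aut A) & (EX c d. s x = c\<odot>x & s y = d\<odot>y & c~=0 & d~=0)" if "s\<in>?S" for s
   using that sigma zeta_nonzero power_not_zero[of \<zeta>] by blast
  have "\<sigma> 0 1\<in>?S"
   by (rule CollectI, rule exI[of _ 0], rule exI[of _ 1]) (use p0 p1 in simp)
  thus "EX s:?S. ALL a:carrier A. s a = conj_by x a"
   by (rule bexI[rotated], intro ballI conj_by_x[OF ctx])
  have "\<sigma> (p - 1) 0\<in>?S"
   by (rule CollectI, rule exI[of _ "p - 1"], rule exI[of _ 0]) (simp add: p0)
  thus "EX s:?S. ALL a:carrier A. s a = conj_by y a"
   by (rule bexI[rotated], intro ballI conj_by_y[OF ctx])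
 qed
 also have "... \<longleftrightarrow> reducible_representation H 2 \<phi>"
  using reducible_iff_eigenvector[where t = \<tau> and \<phi> = \<phi>, OF group_k_alg_aut tau(1) H phi] by simp
 finally show ?thesis .
qed

section \<open>Two by two matrices\<close>

lemma mult_mat_2:
 assumes "A\<in>carrier_mat 2 2" "B\<in>carrier_mat 2 2" "i < 2" "j < 2"
 shows "(A * B) $$ (i, j) = A $$ (i, 0) * B $$ (0, j) + A $$ (i, 1) * B $$ (1, j)"
 using assms by (simp add: scalar_prod_def numeral_2_eq_2)

lemma mat_2_eqI:
 assumes "A\<in>carrier_mat 2 2" "B\<in>carrier_mat 2 2"
  and "A $$ (0, 0) = B $$ (0, 0)" "A $$ (0, 1) = B $$ (0, 1)" "A $$ (1, 0) = B $$ (1, 0)" "A $$ (1, 1) = B $$ (1, 1)"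
 shows "A = B"
proof (rule eq_matI)
 fix i j assume "i < dim_row B" "j < dim_col B"
 hence "(i = 0 | i = 1) & (j = 0 | j = 1)" using assms(2) by auto
 thus "A $$ (i, j) = B $$ (i, j)" using assms(3-) by auto
qed (use assms in auto)

definition det2 :: "'k::field mat => 'k"
 where "det2 g = g $$ (0, 0) * g $$ (1, 1) - g $$ (0, 1) * g $$ (1, 0)"

definition adj2 :: "'k::field mat => 'k mat"
 where "adj2 g = mat 2 2 (%(i, j). if i = j then g $$ (1 - i, 1 - j) else - g $$ (i, j))"

lemma adj2_carrier [simp]: "adj2 g\<in>carrier_mat 2 2" "dim_row (adj2 g) = 2" "dim_col (adj2 g) = 2"
 by (simp_all add: adj2_def)

lemma adj2_entries [simp]: "adj2 g $$ (0, 0) = g $$ (1, 1)" "adj2 g $$ (0, 1) = - g $$ (0, 1)"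
 "adj2 g $$ (0, Suc 0) = - g $$ (0, 1)" "adj2 g $$ (Suc 0, 0) = - g $$ (1, 0)" "adj2 g $$ (Suc 0, Suc 0) = g $$ (0, 0)"
 "adj2 g $$ (1, 0) = - g $$ (1, 0)" "adj2 g $$ (1, 1) = g $$ (0, 0)"
 by (simp_all add: adj2_def)

lemma adj2_mult: "g\<in>carrier_mat 2 2==>adj2 g * g = det2 g\<cdot>\<^sub>m1\<^sub>m 2"
 by (rule mat_2_eqI) (auto simp: mult_mat_2 det2_def algebra_simps simp del: index_mult_mat(1))

lemma det2_iff: "g\<in>carrier (GL 2) \<longleftrightarrow> g\<in>carrier_mat 2 2 & det2 g~=(0::'k::field)"
proof (intro iffI conjI; (elim conjE)?)
 assume g: "g\<in>carrier (GL 2)"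
 show gc: "g\<in>carrier_mat 2 2" using g by simp
 show "det2 g~=0"
 proof
  assume "det2 g = 0"
  hence "adj2 g * g = 0\<^sub>m 2 2" using adj2_mult[OF gc] by (intro mat_2_eqI) auto
  hence "adj2 g * g * minv 2 g = 0\<^sub>m 2 2" using carrier_matD[OF minv_mat[OF g]] by simp
  hence "adj2 g = 0\<^sub>m 2 2" using g gc by (simp add: mat_assoc[where n = 2] minv_right right_mult_one_mat[OF adj2_carrier(1)])
  hence "adj2 g $$ (0, 0) = 0" "adj2 g $$ (0, 1) = 0" "adj2 g $$ (1, 0) = 0" "adj2 g $$ (1, 1) = 0" by simp_all
  hence z: "g = 0\<^sub>m 2 2" using gc by (intro mat_2_eqI) auto
  have "minv 2 g * 0\<^sub>m 2 2 = 0\<^sub>m 2 2" by (rule right_mult_zero_mat[OF minv_mat[OF g]])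
  hence "minv 2 g * g = 0\<^sub>m 2 2" by (subst (2) z)
  hence "(1\<^sub>m 2 :: 'k mat) $$ (0, 0) = 0\<^sub>m 2 2 $$ (0, 0)" using minv_left[OF g] by simp
  thus False by simp
 qed
next
 assume g: "g\<in>carrier_mat 2 2" "det2 g~=0"
 have "det (adj2 g) * det g = det2 g ^ 2 * det (1\<^sub>m 2 :: 'k mat)"
  using arg_cong[OF adj2_mult[OF g(1)], of det] g by (simp add: det_mult[of _ 2] det_smult)
 thus "g\<in>carrier (GL 2)" using g unfolding carrier_GL by auto
qed

lemma minv_2: "g\<in>carrier (GL 2)==>minv 2 g = (1 / det2 g)\<cdot>\<^sub>madj2 g"
proof -
 assume g: "g\<in>carrier (GL 2)"
 have "((1 / det2 g)\<cdot>\<^sub>madj2 g) * g = (1 / det2 g)\<cdot>\<^sub>m(adj2 g * g)"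
  using g by (simp add: smult_mult_mat[where n = 2])
 also have "... = 1\<^sub>m 2" using g det2_iff[of g] by (simp add: adj2_mult smult_smult_mat)
 finally show ?thesis by (rule minv_unique[OF g, symmetric, rotated]) simp
qed

lemma morphism_minv_2: "morphism (GL_space 2) (mat_space 2) (minv 2 :: 'k::field mat => 'k mat)"
 unfolding morphism_mat_space_iff[OF k_space_GL]
proof (intro conjI ballI allI impI)
 show "minv 2 g\<in>carrier_mat 2 2" if "g\<in>points (GL_space 2)" for g :: "'k mat" using that by simp
 fix i j :: nat assume ij: "i < 2" "j < 2"
 note o = openin_topspace[of "ftop (GL_space 2 :: ('k, 'k mat) fspace)"]
 have ent: "(%g :: 'k mat. g $$ (i, j))\<in>regfun (GL_space 2) (points (GL_space 2))" if "i < 2" "j < 2" for i j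
  using morphism_GL_inclusion[where n = 2] that unfolding morphism_mat_space_iff[OF k_space_GL] by blast
 have neg: "(%g. - f g)\<in>regfun (GL_space 2) (points (GL_space 2))"
  if "f\<in>regfun (GL_space 2) (points (GL_space 2))" for f :: "'k mat => 'k"
  using regfun_mult[OF k_space_GL o regfun_const[OF k_space_GL o, of "-1"] that] by simp
 have d: "(%g :: 'k mat. det2 g)\<in>regfun (GL_space 2) (points (GL_space 2))"
  unfolding det2_def diff_conv_add_uminus
  by (intro regfun_add[OF k_space_GL o] neg regfun_mult[OF k_space_GL o] ent) auto
 have a: "(%g :: 'k mat. adj2 g $$ (i, j))\<in>regfun (GL_space 2) (points (GL_space 2))"
  by (cases "i = j") (use ij neg[OF ent[OF ij]] ent[of "1 - i" "1 - j"] in \<open>simp_all add: adj2_def\<close>)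
 have e: "{g\<in>points (GL_space 2). det2 g~=(0 :: 'k)} = points (GL_space 2)" by (auto simp: det2_iff)
 show "(%g :: 'k mat. minv 2 g $$ (i, j))\<in>regfun (GL_space 2) (points (GL_space 2))"
  by (rule regfun_cong_points[OF k_space_GL regfun_divide[OF k_space_GL o a d, unfolded e]]) (use ij in \<open>simp add: minv_2\<close>)
qed

lemma morphism_pgl_conj_const:
 fixes M :: "'k::field mat"
 assumes M: "M\<in>carrier_mat 2 2"
 shows "morphism (PGL_space 2) (mat_space 2) (%P. pgl_conj 2 P M)"
 unfolding morphism_mat_space_iff[OF k_space_PGL]
proof (intro conjI ballI allI impI)
 show "pgl_conj 2 P M\<in>carrier_mat 2 2" if "P\<in>points (PGL_space 2)" for P using pgl_conj_carrier[OF _ M] that by simp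
 fix i j :: nat assume ij: "i < 2" "j < 2"
 have "morphism (GL_space 2) (mat_space 2) (%g. g * M * minv 2 g)"
  by (intro morphism_mat_mult[OF k_space_GL] morphism_GL_inclusion morphism_mat_const[OF k_space_GL M] morphism_minv_2)
 hence r: "(%g. (g * M * minv 2 g) $$ (i, j))\<in>regfun (GL_space 2) (points (GL_space 2))"
  using ij unfolding morphism_mat_space_iff[OF k_space_GL] by blast
 show "(%P. pgl_conj 2 P M $$ (i, j))\<in>regfun (PGL_space 2) (points (PGL_space 2))"
  unfolding points_PGL
 proof (rule regfun_PGL_points)
  show "(%g. pgl_conj 2 (coset 2 g) M $$ (i, j))\<in>regfun (GL_space 2) (carrier (GL 2))"
   unfolding points_GL[symmetric] by (rule regfun_cong_points[OF k_space_GL r]) (simp add: pgl_conj_coset[OF _ M])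
 qed
qed

text \<open>Conjugation is linear in the matrix, so it is enough to know that the four matrix units are conjugated regularly.\<close>

lemma morphism_pgl_conj:
 fixes Y :: "('k::field, 'y) fspace"
 assumes Y: "k_space Y" and P: "morphism Y (PGL_space 2) P" and F: "morphism Y (mat_space 2) F"
 shows "morphism Y (mat_space 2) (%y. pgl_conj 2 (P y) (F y))"
proof -
 define E :: "nat => nat => 'k mat" where "E r s = mat 2 2 (%(i, j). if i = r & j = s then 1 else 0)" for r s
 have E: "E r s\<in>carrier_mat 2 2" for r s by (simp add: E_def)
 have Fc: "F y\<in>carrier_mat 2 2" "P y\<in>carrier (PGL 2)" if "y\<in>points Y" for y
  using morphism_points[OF F that] morphism_points[OF P that] by simp_all
 have ent: "(%y. F y $$ (i, j))\<in>regfun Y (points Y)" if "i < 2" "j < 2" for i j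
  using F that unfolding morphism_mat_space_iff[OF Y] by blast
 have c: "morphism Y (mat_space 2) (%y. F y $$ (r, s)\<cdot>\<^sub>mpgl_conj 2 (P y) (E r s))" if "r < 2" "s < 2" for r s
  by (intro morphism_mat_smult[OF Y] ent that morphism_compose[OF P morphism_pgl_conj_const[OF E]])
 have "morphism Y (mat_space 2) (%y.
   F y $$ (0, 0)\<cdot>\<^sub>mpgl_conj 2 (P y) (E 0 0) + F y $$ (0, 1)\<cdot>\<^sub>mpgl_conj 2 (P y) (E 0 1) +
   (F y $$ (1, 0)\<cdot>\<^sub>mpgl_conj 2 (P y) (E 1 0) + F y $$ (1, 1)\<cdot>\<^sub>mpgl_conj 2 (P y) (E 1 1)))"
  by (intro morphism_mat_add[OF Y] c) auto
 thus ?thesis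
 proof (rule morphism_cong[OF Y])
  fix y assume y: "y\<in>points Y"
  have "F y = F y $$ (0, 0)\<cdot>\<^sub>mE 0 0 + F y $$ (0, 1)\<cdot>\<^sub>mE 0 1 + (F y $$ (1, 0)\<cdot>\<^sub>mE 1 0 + F y $$ (1, 1)\<cdot>\<^sub>mE 1 1)"
   using Fc(1)[OF y] by (intro mat_2_eqI) (auto simp: E_def)
  from arg_cong[OF this, of "pgl_conj 2 (P y)"]
  show "F y $$ (0, 0)\<cdot>\<^sub>mpgl_conj 2 (P y) (E 0 0) + F y $$ (0, 1)\<cdot>\<^sub>mpgl_conj 2 (P y) (E 0 1) +
   (F y $$ (1, 0)\<cdot>\<^sub>mpgl_conj 2 (P y) (E 1 0) + F y $$ (1, 1)\<cdot>\<^sub>mpgl_conj 2 (P y) (E 1 1)) = pgl_conj 2 (P y) (F y)"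
   by (simp only: pgl_conj_add[OF Fc(2)[OF y]] pgl_conj_smult[OF Fc(2)[OF y]] E smult_carrier_mat add_carrier_mat)
 qed
qed

section \<open>Closed subvarieties of affine space\<close>

lemma openin_mat_different:
 assumes Y: "k_space Y" and F: "morphism Y (mat_space n) F" and F': "morphism Y (mat_space n) F'"
 shows "opens Y {y\<in>points Y. F y~=F' y}"
proof -
 have "{y\<in>points Y. F y~=F' y} =
   \<Union> ((%(i, j). {y\<in>points Y. F y $$ (i, j) + (- 1) * F' y $$ (i, j)~=0}) ` ({..<n}\<times>{..<n}))" (is "?L = ?R")
 proof
  show "?L \<subseteq> ?R"
  proof
   fix y assume "y\<in>?L"
   hence y: "y\<in>points Y" "F y~=F' y" by auto
   have "F y\<in>carrier_mat n n" "F' y\<in>carrier_mat n n" using morphism_points[OF F y(1)] morphism_points[OF F' y(1)] by simp_all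
   then obtain i j where "i < n" "j < n" "F y $$ (i, j)~=F' y $$ (i, j)"
    using y(2) by (metis carrier_matD eq_matI)
   thus "y\<in>?R" using y(1) by (intro UN_I[of "(i, j)"]) auto
  qed
 qed auto
 moreover have "opens Y {y\<in>points Y. F y $$ (i, j) + (- 1) * F' y $$ (i, j)~=0}" if "i < n" "j < n" for i j
  using F F' that unfolding morphism_mat_space_iff[OF Y]
  by (intro openin_regfun_nonzero[OF Y openin_topspace] regfun_add[OF Y openin_topspace] regfun_mult[OF Y openin_topspace]
    regfun_const[OF Y openin_topspace]) auto
 ultimately show ?thesis by (auto intro!: openin_Union)
qed

lemma k_space_affine: "k_space (affine_space r)" and points_affine [simp]: "points (affine_space r) = carrier_vec r"
 by (simp_all add: affine_space_def k_space_zariski)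

lemma affine_coord: "i < r==>(%v. v $ i)\<in>regfun (subspace_of (affine_space r) Z) (points (subspace_of (affine_space r) Z))"
 using morphism_inclusion[of "affine_space r" Z] unfolding affine_space_def
 by (rule morphism_zariski_coord[OF k_space_subspace[OF k_space_zariski]]) (blast intro: polyfun_coord)

lemma morphism_into_affine:
 assumes Y: "k_space Y" and "!!y. y\<in>points Y==>\<Phi> y\<in>carrier_vec r\<inter>Z"
  and "!!i. i < r==>(%y. \<Phi> y $ i)\<in>regfun Y (points Y)"
 shows "morphism Y (subspace_of (affine_space r) Z) \<Phi>"
 using assms by (intro morphism_into_subspace[OF Y]) (auto simp: affine_space_def intro!: morphism_into_zariski[OF Y])

lemma openin_vec_different:
 fixes F F' :: "'y => 'k::field vec"
 assumes Y: "k_space Y" and c: "!!y. y\<in>points Y==>F y\<in>carrier_vec r & F' y\<in>carrier_vec r"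
  and F: "!!i. i < r==>(%y. F y $ i)\<in>regfun Y (points Y)" "!!i. i < r==>(%y. F' y $ i)\<in>regfun Y (points Y)"
 shows "opens Y {y\<in>points Y. F y~=F' y}"
proof -
 have "{y\<in>points Y. F y~=F' y} = \<Union> ((%i. {y\<in>points Y. F y $ i + (- 1) * F' y $ i~=0}) ` {..<r})" (is "?L = ?R")
 proof
  show "?L \<subseteq> ?R"
  proof
   fix y assume "y\<in>?L"
   hence y: "y\<in>points Y" "F y~=F' y" by auto
   then obtain i where "i < r" "F y $ i~=F' y $ i" using c[OF y(1)] by (metis carrier_vecD eq_vecI)
   thus "y\<in>?R" using y(1) by auto
  qed
 qed auto
 moreover have "opens Y {y\<in>points Y. F y $ i + (- 1) * F' y $ i~=0}" if "i < r" for i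
  using F that
  by (intro openin_regfun_nonzero[OF Y openin_topspace] regfun_add[OF Y openin_topspace] regfun_mult[OF Y openin_topspace]
    regfun_const[OF Y openin_topspace]) auto
 ultimately show ?thesis by (auto intro!: openin_Union)
qed

text \<open>A point of the diagonal is detected by the coordinates, so the diagonal is closed.\<close>

lemma variety_closed_affine:
 fixes Z :: "'k::field vec set"
 assumes Z: "closedin (ftop (affine_space r)) Z"
 shows "variety (subspace_of (affine_space r) Z)" (is "variety ?X")
proof -
 have kX: "k_space ?X" by (rule k_space_subspace[OF k_space_affine])
 have kXX: "k_space (prod_space ?X ?X)" by (rule k_space_prod[OF kX kX])
 have pX: "points ?X \<subseteq> carrier_vec r" by auto
 have "affine_variety (subspace_of ?X (points ?X))"
  unfolding affine_variety_def
 proof (intro conjI exI[of _ r] exI[of _ Z] exI[of _ "%x. x"] Z)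
  show "space_with_functions (subspace_of ?X (points ?X))"
   by (rule k_space_imp_space_with_functions[OF k_space_subspace[OF kX]])
  show "fspace_iso (subspace_of ?X (points ?X)) ?X (%x. x)"
   by (rule fspace_isoI[OF kX morphism_inclusion morphism_into_subspace[OF kX morphism_id]]) auto
 qed
 hence cover: "EX \<U>. finite \<U> & \<Union>\<U> = points ?X & (ALL U:\<U>. openin (ftop ?X) U & affine_variety (subspace_of ?X U))"
  using openin_topspace[of "ftop ?X"]
  by (intro exI[of _ "{points ?X}"])
    (simp only: finite.emptyI finite_insert Union_insert Union_empty Un_empty_right ball_simps simp_thms)
 have coord: "(%z. fst z $ i)\<in>regfun (prod_space ?X ?X) (points (prod_space ?X ?X))"
   "(%z. snd z $ i)\<in>regfun (prod_space ?X ?X) (points (prod_space ?X ?X))" if "i < r" for i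
  using morphism_regfun_points[OF kXX morphism_fst[OF kX kX] affine_coord[OF that]]
   morphism_regfun_points[OF kXX morphism_snd[OF kX kX] affine_coord[OF that]] by simp_all
 have "openin (ftop (prod_space ?X ?X)) {z\<in>points (prod_space ?X ?X). fst z~=snd z}"
  by (rule openin_vec_different[OF kXX _ coord, of r]) (auto simp: points_prod[OF kX kX])
 moreover have "points (prod_space ?X ?X) - {(x, x) | x. x\<in>points ?X} = {z\<in>points (prod_space ?X ?X). fst z~=snd z}"
  unfolding points_prod[OF kX kX] by auto
 ultimately have "closedin (ftop (prod_space ?X ?X)) {(x, x) | x. x\<in>points ?X}"
  unfolding closedin_def points_prod[OF kX kX] by auto
 thus ?thesis unfolding variety_def using cover k_space_imp_space_with_functions[OF kX] by blast
qed

section \<open>Finite groups as algebraic groups\<close>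

lemma points_discrete [simp]: "points (discrete_space F) = F"
 by (simp add: discrete_space_def)

lemma morphism_from_discrete: "(!!x. x\<in>F==>f x\<in>points Y)==>morphism (discrete_space F) Y f"
 by (rule morphismI) (auto simp: discrete_space_def)

text \<open>Points of a product of discrete spaces are open, so every map is a morphism.\<close>

lemma morphism_from_prod_discrete:
 fixes Y :: "('k::field, 'c) fspace" and F :: "'a set" and F' :: "'b set"
 assumes f: "!!x. x\<in>F\<times>F'==>f x\<in>points Y"
 shows "morphism (prod_space (discrete_space F) (discrete_space F')) Y f"
proof (rule morphismI)
 let ?D = "discrete_space F :: ('k, 'a) fspace" and ?D' = "discrete_space F' :: ('k, 'b) fspace"
 have k: "k_space ?D" "k_space ?D'" by (rule k_space_discrete)+
 have op: "a\<in>F==>openin (ftop ?D) {a}" "b\<in>F'==>openin (ftop ?D') {b}" for a b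
  by (simp_all add: discrete_space_def)
 show "x\<in>points (prod_space ?D ?D')==>f x\<in>points Y" for x using f by (simp add: points_prod[OF k])
 fix V
 let ?W = "{x\<in>points (prod_space ?D ?D'). f x\<in>V}"
 show "openin (ftop (prod_space ?D ?D')) ?W"
  unfolding openin_prod[OF k]
 proof
  fix w assume w: "w\<in>?W"
  then obtain a b where ab: "w = (a, b)" "a\<in>F" "b\<in>F'" by (auto simp: points_prod[OF k])
  show "EX U V h. openin (ftop ?D) U & openin (ftop ?D') V & h\<in>tensor_functions ?D ?D' U V &
   w\<in>U\<times>V & h w~=0 & {z\<in>U\<times>V. h z~=0} \<subseteq> ?W"
  proof (rule exI[of _ "{a}"], rule exI[of _ "{b}"], rule exI[of _ "%_. 1"], intro conjI op ab(2,3) tensor_functions_one[OF k])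
   show "{z\<in>{a}\<times>{b}. (1 :: 'k)~=0} \<subseteq> ?W" using w ab(1) by auto
  qed (use ab(1) in auto)
 qed
 fix h :: "'c => 'k"
 show "(%x. h (f x))\<in>regfun (prod_space ?D ?D') ?W"
  unfolding regfun_prod[OF k]
 proof
  fix w assume w: "w\<in>?W"
  then obtain a b where ab: "w = (a, b)" "a\<in>F" "b\<in>F'" by (auto simp: points_prod[OF k])
  show "EX U V g h'. openin (ftop ?D) U & openin (ftop ?D') V & w\<in>U\<times>V &
     g\<in>tensor_functions ?D ?D' U V & h'\<in>tensor_functions ?D ?D' U V & h' w~=0 &
     (ALL z:?W\<inter>U\<times>V. h' z~=0 --> h (f z) = g z / h' z)"
  proof (rule exI[of _ "{a}"], rule exI[of _ "{b}"], rule exI[of _ "%_. h (f w)"], rule exI[of _ "%_. 1"],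
    intro conjI op ab(2,3) tensor_functions_one[OF k])
   show "ALL z:?W\<inter>{a}\<times>{b}. (1 :: 'k)~=0 --> h (f z) = h (f w) / 1" using ab(1) by simp
  qed (use ab(1) in auto)
 qed
qed

lemma closedin_affine_finite:
 assumes F: "finite F" "F \<subseteq> carrier_vec r"
 shows "closedin (ftop (affine_space r :: ('k::field, 'k vec) fspace)) F"
proof -
 have "closedin (ftop (affine_space r :: ('k, 'k vec) fspace)) {v}" if v: "v\<in>carrier_vec r" for v :: "'k vec"
 proof -
  let ?A = "affine_space r :: ('k, 'k vec) fspace"
  have "(%v. v $ i)\<in>regfun ?A (points ?A)" if "i < r" for i
   using that unfolding affine_space_def by (intro polyfun_regular polyfun_coord) auto
  hence "openin (ftop ?A) {y\<in>points ?A. y~=v}"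
   by (intro openin_vec_different[OF k_space_affine, where r = r] regfun_const[OF k_space_affine openin_topspace]) (use v in auto)
  moreover have "{y\<in>points ?A. y~=v} = points ?A - {v}" by auto
  ultimately show ?thesis using v unfolding closedin_def by simp
 qed
 hence "closedin (ftop (affine_space r :: ('k, 'k vec) fspace)) (\<Union> ((%v. {v}) ` F))"
  using F by (intro closedin_Union) auto
 thus ?thesis by simp
qed

lemma affine_variety_discrete:
 fixes F :: "'k::field vec set"
 assumes F: "finite F" "F \<subseteq> carrier_vec r"
 shows "affine_variety (discrete_space F :: ('k, 'k vec) fspace)"
 unfolding affine_variety_def
proof (intro conjI exI[of _ r] exI[of _ F] exI[of _ "%x. x"])
 let ?A = "affine_space r :: ('k, 'k vec) fspace"
 show "space_with_functions (discrete_space F :: ('k, 'k vec) fspace)"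
  by (rule k_space_imp_space_with_functions[OF k_space_discrete])
 show "closedin (ftop ?A) F" by (rule closedin_affine_finite[OF F])
 have op: "openin (ftop ?A) (carrier_vec r - (F - V))" for V
  using closedin_affine_finite[of "F - V" r] F unfolding closedin_def by auto
 have "morphism (subspace_of ?A F) (discrete_space F) (%x. x)"
 proof (rule morphismI)
  fix V assume V: "openin (ftop (discrete_space F :: ('k, 'k vec) fspace)) V"
  hence VF: "V \<subseteq> F" by (simp add: discrete_space_def)
  have e: "{x\<in>points (subspace_of ?A F). x\<in>V} = (carrier_vec r - (F - V))\<inter>F" using VF F by auto
  have "openin (subtopology (ftop ?A) F) ((carrier_vec r - (F - V))\<inter>F)"
   unfolding openin_subtopology by (intro exI[of _ "carrier_vec r - (F - V)"] conjI op refl)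
  thus "openin (ftop (subspace_of ?A F)) {x\<in>points (subspace_of ?A F). x\<in>V}"
   unfolding e by simp
  fix h :: "'k vec => 'k"
  show "(%x. h x)\<in>regfun (subspace_of ?A F) {x\<in>points (subspace_of ?A F). x\<in>V}"
   unfolding regfun_subspace
  proof
   fix x assume x: "x\<in>{x\<in>points (subspace_of ?A F). x\<in>V}"
   show "EX W g. openin (ftop ?A) W & x\<in>W & g\<in>regfun ?A W & (ALL y:{x\<in>points (subspace_of ?A F). x\<in>V}\<inter>W. h y = g y)"
   proof (rule exI[of _ "carrier_vec r - (F - {x})"], rule exI[of _ "%_. h x"], intro conjI op regfun_const[OF k_space_affine])
    show "x\<in>carrier_vec r - (F - {x})" using x by simp
    show "ALL y:{x\<in>points (subspace_of ?A F). x\<in>V}\<inter>(carrier_vec r - (F - {x})). h y = h x" by auto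
   qed
  qed
 qed auto
 thus "fspace_iso (discrete_space F) (subspace_of ?A F) (%x. x)"
  using F(2) by (intro fspace_isoI[OF k_space_subspace[OF k_space_affine] morphism_from_discrete]) auto
qed

lemma alg_group_discrete:
 fixes G :: "('k::field vec, 'm) monoid_scheme"
 assumes G: "group G" and F: "finite (carrier G)" "carrier G \<subseteq> carrier_vec r"
 shows "alg_group G (discrete_space (carrier G) :: ('k, 'k vec) fspace)"
 unfolding alg_group_def
 using G affine_variety_discrete[OF F] monoid.m_closed[OF group.is_monoid[OF G]] group.inv_closed[OF G]
 by (auto intro!: morphism_from_discrete morphism_from_prod_discrete)

section \<open>Rational curves and irreducibility\<close>

definition line :: "('k::field, 'k) fspace"
 where "line = zariski_space UNIV {%s. s}"

lemma k_space_line: "k_space line" and points_line [simp]: "points line = UNIV"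
 by (simp_all add: line_def k_space_zariski)

lemma polyfun_line: "q\<in>polyfun {%s. s}==>EX p. q = poly (p :: 'k::field poly)"
proof (induction rule: polyfun.induct)
 case (polyfun_const c)
 show ?case by (rule exI[of _ "[:c:]"]) auto
next
 case (polyfun_coord f)
 thus ?case by (intro exI[of _ "[:0, 1:]"]) auto
next
 case (polyfun_add f g)
 then obtain p p' where "f = poly p" "g = poly p'" by blast
 thus ?case by (intro exI[of _ "p + p'"]) auto
next
 case (polyfun_mult f g)
 then obtain p p' where "f = poly p" "g = poly p'" by blast
 thus ?case by (intro exI[of _ "p * p'"]) auto
qed

text \<open>A nonzero polynomial has finitely many roots.\<close>

lemma openin_line_cofinite:
 assumes U: "openin (ftop (line :: ('k::field, 'k) fspace)) U" "U~={}"
 shows "finite (- U)"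
proof -
 obtain x where x: "x\<in>U" using U(2) by blast
 obtain q where q: "q\<in>polyfun {%s. s}" "q x~=0" "ALL y:UNIV. q y~=0 --> y\<in>U"
  using U(1) x unfolding line_def openin_zariski by blast
 obtain p where p: "q = poly p" using polyfun_line[OF q(1)] by blast
 have "p~=0" using q(2) p by auto
 hence "finite {y. poly p y = 0}" by (rule poly_roots_finite)
 thus ?thesis by (rule rev_finite_subset) (use q(3) p in auto)
qed

text \<open>Two nonempty open sets pull back to nonempty open, hence cofinite, sets of parameters, and the field is infinite.\<close>

lemma irreducible_by_curves:
 fixes X :: "('k::field_char_0, 'x) fspace"
 assumes ne: "points X~={}"
  and curve: "!!u v. u\<in>points X==>v\<in>points X ==>
   EX D c. opens line D & 0\<in>D & 1\<in>D & morphism (subspace_of line D) X c & c 0 = u & c 1 = v"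
 shows "irreducible_space (ftop X)"
 unfolding irreducible_space_def
proof (intro conjI ne allI impI; elim conjE)
 fix U V assume UV: "opens X U" "opens X V" "U~={}" "V~={}"
 obtain u v where uv: "u\<in>U" "v\<in>V" using UV by blast
 have "u\<in>points X" "v\<in>points X" using uv UV openin_subset by blast+
 then obtain D c where D: "opens line D" "0\<in>D" "1\<in>D" and c: "morphism (subspace_of line D) X c" "c 0 = u" "c 1 = v"
  using curve by blast
 have "opens line {s\<in>D. c s\<in>U'}" if U': "opens X U'" for U'
  using morphism_openin[OF c(1) U'] D(1) by (auto simp: openin_open_subtopology)
 hence "finite (- {s\<in>D. c s\<in>U})" "finite (- {s\<in>D. c s\<in>V})"
  using UV uv D c by (auto intro!: openin_line_cofinite)
 hence fin: "finite (- ({s\<in>D. c s\<in>U}\<inter>{s\<in>D. c s\<in>V}))" by (simp only: Compl_Int finite_Un)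
 have "{s\<in>D. c s\<in>U}\<inter>{s\<in>D. c s\<in>V}~={}"
 proof
  assume "{s\<in>D. c s\<in>U}\<inter>{s\<in>D. c s\<in>V} = {}"
  from fin[unfolded this] show False using infinite_UNIV_char_0[where 'a = 'k] by simp
 qed
 thus "U\<inter>V~={}" by blast
qed

section \<open>Group actions\<close>

lemma group_actionI:
 assumes G: "group G" and ext: "!!g. g\<in>carrier G==>act g\<in>extensional E"
  and closed: "!!g x. g\<in>carrier G==>x\<in>E==>act g x\<in>E"
  and mult: "!!g h x. g\<in>carrier G==>h\<in>carrier G==>x\<in>E==>act (g \<otimes>\<^bsub>G\<^esub> h) x = act g (act h x)"
  and one: "!!x. x\<in>E==>act \<one>\<^bsub>G\<^esub> x = x"
 shows "group_action G E act"
proof -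
 interpret group G by (rule G)
 have bij: "act g\<in>Bij E" if g: "g\<in>carrier G" for g
 proof -
  have "act g (act (inv\<^bsub>G\<^esub> g) x) = x" "act (inv\<^bsub>G\<^esub> g) (act g x) = x" if "x\<in>E" for x
   using mult[OF g inv_closed[OF g] that] mult[OF inv_closed[OF g] g that] g one[OF that] by simp_all
  hence "bij_betw (act g) E E" using closed g by (intro bij_betw_byWitness[of _ "act (inv\<^bsub>G\<^esub> g)"]) auto
  thus ?thesis using ext[OF g] by (simp add: Bij_def)
 qed
 have "act\<in>hom G (BijGroup E)"
 proof (rule homI)
  show "act g\<in>carrier (BijGroup E)" if "g\<in>carrier G" for g using bij[OF that] by (simp add: BijGroup_def)
  fix g h assume gh: "g\<in>carrier G" "h\<in>carrier G"
  have "act (g \<otimes>\<^bsub>G\<^esub> h) = compose E (act g) (act h)"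
   by (rule extensionalityI[OF ext compose_extensional]) (use gh mult in \<open>auto simp: compose_def\<close>)
  thus "act (g \<otimes>\<^bsub>G\<^esub> h) = act g \<otimes>\<^bsub>BijGroup E\<^esub> act h" using bij gh by (simp add: BijGroup_def)
 qed
 thus ?thesis unfolding group_action_def group_hom_def group_hom_axioms_def by (simp add: G group_BijGroup)
qed

section \<open>A homogeneous family of quaternion triples\<close>

locale tetrahedral =
 fixes \<omega> \<i>\<i> :: "'k::{alg_closed_field, field_char_0}"
 assumes omega: "\<omega> ^ 3 = 1" "\<omega>~=1" and ii: "\<i>\<i> * \<i>\<i> = - 1"
begin

lemma omega_mod: "\<omega> ^ (i mod 3) = \<omega> ^ i"
proof -
 have "\<omega> ^ i = \<omega> ^ (3 * (i div 3) + i mod 3)" by simp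
 also have "... = \<omega> ^ (i mod 3)" unfolding power_add power_mult omega(1) by simp
 finally show ?thesis by simp
qed

lemma omega_power_eq: "\<omega> ^ i = \<omega> ^ j \<longleftrightarrow> i mod 3 = j mod 3"
proof
 assume e: "\<omega> ^ i = \<omega> ^ j"
 have o0: "\<omega>~=0" using omega(1) by auto
 have o3: "\<omega> * (\<omega> * \<omega>) = 1" using omega(1) by (simp add: power3_eq_cube mult.assoc)
 have o2: "\<omega> * \<omega>~=1" using o3 omega(2) by auto
 have o21: "\<omega> * \<omega>~=\<omega>" using o0 omega(2) by auto
 have "i mod 3 = 0 | i mod 3 = 1 | i mod 3 = 2" "j mod 3 = 0 | j mod 3 = 1 | j mod 3 = 2" by presburger+
 moreover have "\<omega> ^ (i mod 3) = \<omega> ^ (j mod 3)" using e unfolding omega_mod .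
 ultimately show "i mod 3 = j mod 3"
  using omega(2) o2 o21 by (elim disjE) (simp_all add: power2_eq_square)
qed (metis omega_mod)

subsection \<open>The tetrahedral group\<close>

text \<open>
  An element of the alternating group on four letters is a cyclic rotation of three axes followed by
  reversals of an even number of them.  The axes are indexed by natural numbers modulo three, and the
  element with signs \<open>s\<close> and rotation \<open>j\<close> is the vector \<open>(s 0, s 1, s 2, \<omega>\<^sup>j)\<close>.
\<close>

definition signs :: "(nat => 'k) set"
 where "signs = {s. (ALL i. s i * s i = 1) & (ALL i. s (i + 3) = s i) & (ALL i. s i * s (i + 1) = s (i + 2))}"

lemma signsD: "s\<in>signs==>s i * s i = 1" "s\<in>signs==>s (i + 3) = s i" "s\<in>signs==>s i * s (i + 1) = s (i + 2)"
 by (auto simp: signs_def)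

lemma signs_mod: "s\<in>signs==>i mod 3 = j mod 3==>s i = s j"
proof -
 assume s: "s\<in>signs" and ij: "i mod 3 = j mod 3"
 have *: "s (n + 3 * m) = s n" for n m
 proof (induction m)
  case (Suc m)
  have "s (n + 3 * Suc m) = s (n + 3 * m + 3)" by (simp add: algebra_simps)
  thus ?case using Suc signsD(2)[OF s] by simp
 qed simp
 have "s n = s (n mod 3)" for n using *[of "n mod 3" "n div 3"] by simp
 thus ?thesis using ij by metis
qed

lemma signs_shift: "s\<in>signs==>(%i. s (i + j))\<in>signs"
proof -
 assume s: "s\<in>signs"
 have "s (i + 3 + j) = s (i + j)" "s (i + j) * s (i + 1 + j) = s (i + 2 + j)" for i
  using signsD(2)[OF s, of "i + j"] signsD(3)[OF s, of "i + j"] by (simp_all add: algebra_simps)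
 thus ?thesis using signsD(1)[OF s] unfolding signs_def by blast
qed

lemma signs_mult: "s\<in>signs==>s'\<in>signs==>(%i. s i * s' i)\<in>signs"
proof -
 assume s: "s\<in>signs" and s': "s'\<in>signs"
 have sq: "s i * s' i * (s i * s' i) = 1" for i
 proof -
  have "s i * s' i * (s i * s' i) = (s i * s i) * (s' i * s' i)" by (simp only: mult_ac)
  thus ?thesis unfolding signsD(1)[OF s] signsD(1)[OF s'] by simp
 qed
 have pr: "s i * s' i * (s (i + 1) * s' (i + 1)) = s (i + 2) * s' (i + 2)" for i
 proof -
  have "s i * s' i * (s (i + 1) * s' (i + 1)) = (s i * s (i + 1)) * (s' i * s' (i + 1))" by (simp only: mult_ac)
  thus ?thesis unfolding signsD(3)[OF s] signsD(3)[OF s'] .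
 qed
 show ?thesis unfolding signs_def
  by (intro CollectI conjI allI sq pr) (simp only: signsD(2)[OF s] signsD(2)[OF s'])
qed

lemma signs_one: "(%_. 1)\<in>signs"
 by (simp add: signs_def)

lemma signs_pm: "s\<in>signs==>s i = 1 | s i = - 1"
 using signsD(1)[of s i] square_eq_1_iff by blast

text \<open>The rotations by a half turn.\<close>

definition half_turn :: "nat => nat => 'k"
 where "half_turn k i = (if i mod 3 = k mod 3 then 1 else - 1)"

lemma half_turn_signs: "half_turn k\<in>signs"
proof -
 have k: "k mod 3 = 0 | k mod 3 = 1 | k mod 3 = 2" by presburger
 have "half_turn k i * half_turn k (i + 1) = half_turn k (i + 2)" for i
 proof -
  have "i mod 3 = 0 | i mod 3 = 1 | i mod 3 = 2" by presburger
  thus ?thesis using k unfolding half_turn_def by (elim disjE) (simp_all add: mod_Suc numeral_2_eq_2)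
 qed
 thus ?thesis unfolding signs_def by (auto simp: half_turn_def)
qed

definition el :: "(nat => 'k) => nat => 'k vec"
 where "el s j = vec 4 (%i. if i < 3 then s i else \<omega> ^ j)"

definition sg :: "'k vec => nat => 'k"
 where "sg g i = g $ (i mod 3)"

definition rot :: "'k vec => nat"
 where "rot g = (LEAST j. \<omega> ^ j = g $ 3)"

lemma sg_el: "s\<in>signs==>sg (el s j) i = s i"
 using signs_mod[of s "i mod 3" i] mod_less_divisor[of 3 i] by (simp add: sg_def el_def)

lemma rot_el: "rot (el s j) = j mod 3"
 unfolding rot_def
proof (rule Least_equality)
 show "\<omega> ^ (j mod 3) = el s j $ 3" by (simp add: el_def omega_mod)
 fix k assume "\<omega> ^ k = el s j $ 3"
 hence "k mod 3 = j mod 3" by (simp add: el_def omega_power_eq)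
 thus "j mod 3 \<le> k" by (metis mod_less_eq_dividend)
qed

lemma el_mod: "j mod 3 = j' mod 3==>el s j = el s j'"
 unfolding el_def using omega_power_eq by (metis (no_types, lifting))

definition tet :: "'k vec monoid"
 where "tet = \<lparr>carrier = {el s j | s j. s\<in>signs},
  mult = (%g h. el (%i. sg g i * sg h (i + rot g)) (rot g + rot h)),
  one = el (%_. 1) 0\<rparr>"

lemma tet_cases: assumes "g\<in>carrier tet" obtains s j where "s\<in>signs" "g = el s j"
 using assms unfolding tet_def by auto

lemma el_tet: "s\<in>signs==>el s j\<in>carrier tet"
 unfolding tet_def by auto

lemma tet_mult:
 assumes s: "s\<in>signs" "s'\<in>signs"
 shows "el s j \<otimes>\<^bsub>tet\<^esub> el s' j' = el (%i. s i * s' (i + j)) (j + j')"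
proof -
 have "el s j \<otimes>\<^bsub>tet\<^esub> el s' j' = el (%i. s i * s' (i + j mod 3)) (j mod 3 + j' mod 3)"
  unfolding tet_def by (simp add: sg_el[OF s(1)] sg_el[OF s(2)] rot_el)
 also have "(%i. s i * s' (i + j mod 3)) = (%i. s i * s' (i + j))"
  using signs_mod[OF s(2)] by (metis mod_add_right_eq)
 also have "el (%i. s i * s' (i + j)) (j mod 3 + j' mod 3) = el (%i. s i * s' (i + j)) (j + j')"
  by (rule el_mod) (simp add: mod_add_eq)
 finally show ?thesis .
qed

lemma tet_one: "\<one>\<^bsub>tet\<^esub> = el (%_. 1) 0"
 by (simp add: tet_def)

lemma tet_left_inverse: "s\<in>signs==>el (%i. s (i + 2 * j)) (2 * j) \<otimes>\<^bsub>tet\<^esub> el s j = \<one>\<^bsub>tet\<^esub>"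
 using tet_mult[OF signs_shift[of s "2 * j"], of s "2 * j" j] signsD(1)[of s]
 by (simp add: tet_one) (rule el_mod, simp)

lemma group_tet: "group tet"
proof (rule groupI)
 fix g h assume g: "g\<in>carrier tet" and h: "h\<in>carrier tet"
 obtain s j where s: "s\<in>signs" "g = el s j" using g by (rule tet_cases)
 obtain s' j' where s': "s'\<in>signs" "h = el s' j'" using h by (rule tet_cases)
 have m: "(%i. s i * s' (i + j))\<in>signs" by (rule signs_mult[OF s(1) signs_shift[OF s'(1)]])
 show "g \<otimes>\<^bsub>tet\<^esub> h\<in>carrier tet" unfolding s(2) s'(2) tet_mult[OF s(1) s'(1)] by (rule el_tet[OF m])
 fix k assume k: "k\<in>carrier tet"
 obtain s'' j'' where s'': "s''\<in>signs" "k = el s'' j''" using k by (rule tet_cases)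
 have m': "(%i. s' i * s'' (i + j'))\<in>signs" by (rule signs_mult[OF s'(1) signs_shift[OF s''(1)]])
 show "g \<otimes>\<^bsub>tet\<^esub> h \<otimes>\<^bsub>tet\<^esub> k = g \<otimes>\<^bsub>tet\<^esub> (h \<otimes>\<^bsub>tet\<^esub> k)"
  unfolding s(2) s'(2) s''(2) tet_mult[OF s(1) s'(1)] tet_mult[OF s'(1) s''(1)] tet_mult[OF m s''(1)] tet_mult[OF s(1) m']
  by (simp add: algebra_simps)
next
 show "\<one>\<^bsub>tet\<^esub>\<in>carrier tet" unfolding tet_one by (rule el_tet[OF signs_one])
 fix g assume "g\<in>carrier tet"
 then obtain s j where s: "s\<in>signs" "g = el s j" by (rule tet_cases)
 show "\<one>\<^bsub>tet\<^esub> \<otimes>\<^bsub>tet\<^esub> g = g" unfolding tet_one s(2) tet_mult[OF signs_one s(1)] by simp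
 show "EX h:carrier tet. h \<otimes>\<^bsub>tet\<^esub> g = \<one>\<^bsub>tet\<^esub>"
  unfolding s(2) by (rule bexI, rule tet_left_inverse[OF s(1)], rule el_tet[OF signs_shift[OF s(1)]])
qed

lemma tet_inv: "s\<in>signs==>inv\<^bsub>tet\<^esub> (el s j) = el (%i. s (i + 2 * j)) (2 * j)"
 by (rule group.inv_equality[OF group_tet tet_left_inverse]) (auto intro: el_tet signs_shift)

lemma finite_tet: "finite (carrier tet)"
proof (rule finite_subset)
 let ?f = "%(a, b, c, d :: 'k). vec 4 (%i. if i = 0 then a else if i = 1 then b else if i = 2 then c else d)"
 let ?B = "{1 :: 'k, - 1}"
 show "finite (?f ` (?B\<times>?B\<times>?B\<times>(%j. \<omega> ^ j) ` {..<3::nat}))" by simp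
 show "carrier tet \<subseteq> ?f ` (?B\<times>?B\<times>?B\<times>(%j. \<omega> ^ j) ` {..<3::nat})"
 proof
  fix g assume "g\<in>carrier tet"
  then obtain s j where s: "s\<in>signs" "g = el s j" by (rule tet_cases)
  have "g = ?f (s 0, s 1, s 2, \<omega> ^ (j mod 3))"
  proof (rule eq_vecI)
   fix i assume "i < dim_vec (?f (s 0, s 1, s 2, \<omega> ^ (j mod 3)))"
   hence "i = 0 | i = 1 | i = 2 | i = 3" by auto
   thus "g $ i = ?f (s 0, s 1, s 2, \<omega> ^ (j mod 3)) $ i" unfolding s(2) el_def by (elim disjE) (simp_all add: omega_mod)
  qed (simp add: s(2) el_def)
  moreover have "(s 0, s 1, s 2, \<omega> ^ (j mod 3))\<in>?B\<times>?B\<times>?B\<times>(%j. \<omega> ^ j) ` {..<3::nat}"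
   using signs_pm[OF s(1)] by auto
  ultimately show "g\<in>?f ` (?B\<times>?B\<times>?B\<times>(%j. \<omega> ^ j) ` {..<3::nat})" by (rule image_eqI)
 qed
qed

lemma tet_carrier_vec: "carrier tet \<subseteq> carrier_vec 4"
 unfolding tet_def el_def by auto

subsection \<open>The variety of triples\<close>

definition axis :: "'k vec => nat => 'k mat"
 where "axis v i = mat 2 2 (%(r, c). v $ (4 * (i mod 3) + 2 * r + c))"

definition param :: "'k vec => 'k"
 where "param v = v $ 12"

definition encode :: "(nat => 'k mat) => 'k => 'k vec"
 where "encode f t = vec 13 (%k. if k < 12 then f (k div 4) $$ (k mod 4 div 2, k mod 2) else t)"

lemma axis_carrier [simp]: "axis v i\<in>carrier_mat 2 2" "dim_row (axis v i) = 2" "dim_col (axis v i) = 2"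
 by (simp_all add: axis_def)

lemma axis_mod: "i mod 3 = j mod 3==>axis v i = axis v j"
 by (simp add: axis_def)

lemma axis_encode:
 assumes "!!i. f i\<in>carrier_mat 2 2"
 shows "axis (encode f t) i = f (i mod 3)"
proof (rule eq_matI)
 fix r c assume "r < dim_row (f (i mod 3))" "c < dim_col (f (i mod 3))"
 hence rc: "r < 2" "c < 2" using assms[of "i mod 3"] by auto
 let ?k = "4 * (i mod 3) + 2 * r + c"
 have m: "i mod 3 < 3" by simp
 have idx: "4 * a + 2 * r + c < 12 & (4 * a + 2 * r + c) div 4 = a & (4 * a + 2 * r + c) mod 4 div 2 = r &
   (4 * a + 2 * r + c) mod 2 = c" if "a < 3" for a
 proof -
  have "(a = 0 | a = 1 | a = 2) & (r = 0 | r = 1) & (c = 0 | c = 1)" using that rc by linarith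
  thus ?thesis by (elim conjE disjE) simp_all
 qed
 note idx = idx[OF m]
 thus "axis (encode f t) i $$ (r, c) = f (i mod 3) $$ (r, c)" using rc idx by (simp add: axis_def encode_def)
qed (use assms[of "i mod 3"] in auto)

lemma param_encode [simp]: "param (encode f t) = t"
 by (simp add: param_def encode_def)

lemma coord_axis: "k < 12==>v $ k = axis v (k div 4) $$ (k mod 4 div 2, k mod 2)"
proof -
 assume k: "k < 12"
 have "k div 4 mod 3 = k div 4" using k by simp
 moreover have "4 * (k div 4) + 2 * (k mod 4 div 2) + k mod 2 = k" "k mod 4 div 2 < 2" by presburger+
 ultimately have e: "4 * (k div 4 mod 3) + 2 * (k mod 4 div 2) + k mod 2 = k" "k mod 4 div 2 < 2" by simp_all
 have "axis v (k div 4) $$ (k mod 4 div 2, k mod 2) = v $ (4 * (k div 4 mod 3) + 2 * (k mod 4 div 2) + k mod 2)"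
  using e(2) by (simp add: axis_def)
 thus ?thesis unfolding e(1) by (rule sym)
qed

lemma triple_eqI:
 assumes "v\<in>carrier_vec 13" "w\<in>carrier_vec 13" "!!i. axis v i = axis w i" "param v = param w"
 shows "v = w"
proof (rule eq_vecI)
 fix k assume "k < dim_vec w"
 hence "k < 12 | k = 12" using assms(2) by auto
 thus "v $ k = w $ k" using coord_axis[of k v] coord_axis[of k w] assms(3,4) by (auto simp: param_def)
qed (use assms in auto)

lemma encode_carrier [simp]: "encode f t\<in>carrier_vec 13"
 by (simp add: encode_def)

definition triples :: "'k vec set"
 where "triples = {v\<in>carrier_vec 13. ALL i. axis v i * axis v i = (- 1)\<cdot>\<^sub>m1\<^sub>m 2 & axis v i * axis v (i + 1) = axis v (i + 2)}"

definition tvar :: "('k, 'k vec) fspace"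
 where "tvar = subspace_of (affine_space 13) triples"

lemma points_tvar [simp]: "points tvar = triples"
 unfolding tvar_def triples_def by auto

lemma k_space_tvar: "k_space tvar"
 unfolding tvar_def by (rule k_space_subspace[OF k_space_affine])

lemma morphism_axis_affine: "morphism (affine_space 13) (mat_space 2) (%v. axis v i)"
 unfolding morphism_mat_space_iff[OF k_space_affine]
proof (intro conjI ballI allI impI)
 fix r c :: nat assume rc: "r < 2" "c < 2"
 have m: "i mod 3 < 3" by simp
 have "4 * (i mod 3) + 2 * r + c < 13" using rc m by linarith
 thus "(%v. axis v i $$ (r, c))\<in>regfun (affine_space 13) (points (affine_space 13))"
  using rc unfolding affine_space_def by (auto simp: axis_def intro!: polyfun_regular polyfun_coord)
qed simp

lemma morphism_axis: "morphism tvar (mat_space 2) (%v. axis v i)"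
 unfolding tvar_def by (rule morphism_from_subspace[OF morphism_axis_affine])

lemma param_regular: "param\<in>regfun tvar (points tvar)"
 unfolding tvar_def param_def[abs_def] by (rule affine_coord) simp

lemma morphism_into_tvar:
 assumes Y: "k_space Y" and pts: "!!y. y\<in>points Y==>\<Phi> y\<in>triples"
  and ax: "!!i. morphism Y (mat_space 2) (%y. axis (\<Phi> y) i)" and pr: "(%y. param (\<Phi> y))\<in>regfun Y (points Y)"
 shows "morphism Y tvar \<Phi>"
 unfolding tvar_def
proof (rule morphism_into_affine[OF Y])
 show "\<Phi> y\<in>carrier_vec 13\<inter>triples" if "y\<in>points Y" for y using pts[OF that] by (simp add: triples_def)
 fix k :: nat assume "k < 13"
 then consider "k < 12" | "k = 12" by linarith
 thus "(%y. \<Phi> y $ k)\<in>regfun Y (points Y)"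
 proof cases
  case 1
  have "k mod 4 div 2 < 2" "k mod 2 < 2" by presburger+
  thus ?thesis using ax[of "k div 4"] unfolding morphism_mat_space_iff[OF Y] coord_axis[OF 1] by blast
 next
  case 2
  thus ?thesis using pr by (simp add: param_def)
 qed
qed

definition quaternion :: "'k vec => nat => bool"
 where "quaternion v i \<longleftrightarrow> axis v i * axis v i = (- 1)\<cdot>\<^sub>m1\<^sub>m 2 & axis v i * axis v (i + 1) = axis v (i + 2)"

lemma quaternion_mod: "quaternion v i \<longleftrightarrow> quaternion v (i mod 3)"
proof -
 have "(i + 1) mod 3 = (i mod 3 + 1) mod 3" "(i + 2) mod 3 = (i mod 3 + 2) mod 3" "i mod 3 = i mod 3 mod 3"
  by (simp_all add: mod_simps)
 from this[THEN axis_mod[of _ _ v]] show ?thesis unfolding quaternion_def by simp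
qed

lemma triples_iff: "v\<in>triples \<longleftrightarrow> v\<in>carrier_vec 13 & (ALL i:{..<3}. quaternion v i)"
proof -
 have "quaternion v i" if "ALL i:{..<3}. quaternion v i" for i
  unfolding quaternion_mod[of v i] by (rule bspec[OF that]) simp
 thus ?thesis unfolding triples_def quaternion_def[symmetric] mem_Collect_eq by (intro conj_cong iffI refl ballI allI) simp_all
qed

lemma triples_closed: "closedin (ftop (affine_space 13)) triples"
proof -
 let ?A = "affine_space 13 :: ('k, 'k vec) fspace"
 have q: "openin (ftop ?A) {v\<in>points ?A. ~ quaternion v i}" for i
 proof -
  have "openin (ftop ?A) ({v\<in>points ?A. axis v i * axis v i~=(- 1)\<cdot>\<^sub>m1\<^sub>m 2} \<union>
    {v\<in>points ?A. axis v i * axis v (i + 1)~=axis v (i + 2)})"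
   by (intro openin_Un openin_mat_different[OF k_space_affine, where n = 2] morphism_mat_mult[OF k_space_affine] morphism_axis_affine
     morphism_mat_const[OF k_space_affine] smult_carrier_mat one_carrier_mat)
  also have "{v\<in>points ?A. axis v i * axis v i~=(- 1)\<cdot>\<^sub>m1\<^sub>m 2}\<union>{v\<in>points ?A. axis v i * axis v (i + 1)~=axis v (i + 2)} =
    {v\<in>points ?A. ~ quaternion v i}"
   unfolding quaternion_def by (rule Set.set_eqI) (simp only: Un_iff mem_Collect_eq de_Morgan_conj conj_disj_distribL)
  finally show ?thesis .
 qed
 have "points ?A - triples = \<Union> ((%i. {v\<in>points ?A. ~ quaternion v i}) ` {..<3})"
  by (rule Set.set_eqI) (simp only: Diff_iff triples_iff points_affine UN_iff mem_Collect_eq, meson)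
 moreover have "openin (ftop ?A) (\<Union> ((%i. {v\<in>points ?A. ~ quaternion v i}) ` {..<3}))"
  by (rule openin_Union) (use q in \<open>elim imageE, simp only:\<close>)
 moreover have "triples \<subseteq> points ?A" using triples_iff by auto
 ultimately show ?thesis unfolding closedin_def by simp
qed

lemma variety_tvar: "variety tvar"
 unfolding tvar_def by (rule variety_closed_affine[OF triples_closed])

context
 fixes v assumes v: "v\<in>triples"
begin

lemma axis_square: "axis v i * axis v i = (- 1)\<cdot>\<^sub>m1\<^sub>m 2" and axis_next: "axis v i * axis v (i + 1) = axis v (i + 2)"
 using v by (auto simp: triples_def)

lemma minus_axis_left_inverse: "((- 1)\<cdot>\<^sub>maxis v i) * axis v i = 1\<^sub>m 2"
 by (simp add: smult_mult_mat[where n = 2] axis_square smult_smult_mat)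

lemma axis_GL: "axis v i\<in>carrier (GL 2)"
proof -
 have "det ((- 1)\<cdot>\<^sub>maxis v i) * det (axis v i) = 1"
  using arg_cong[OF minus_axis_left_inverse, of det i] by (simp add: det_mult[of _ 2])
 thus ?thesis unfolding carrier_GL by auto
qed

lemma minv_axis: "minv 2 (axis v i) = (- 1)\<cdot>\<^sub>maxis v i"
 by (rule minv_unique[OF axis_GL _ minus_axis_left_inverse, symmetric]) simp

lemma axis_anticommute: "axis v (i + 1) * axis v i = (- 1)\<cdot>\<^sub>maxis v (i + 2)"
proof -
 have "axis v i = axis v (i + 1) * axis v (i + 2)"
  using axis_next[of "i + 1"] axis_mod[of "i + 1 + 2" i] by simp
 hence "axis v (i + 1) * axis v i = (axis v (i + 1) * axis v (i + 1)) * axis v (i + 2)"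
  by (simp add: mat_assoc[where n = 2])
 thus ?thesis unfolding axis_square by (simp add: smult_mult_mat[where n = 2])
qed

lemma axis_commutation: "axis v i * axis v (i + 1) = (- 1)\<cdot>\<^sub>m(axis v (i + 1) * axis v i)"
 unfolding axis_anticommute axis_next by (simp add: smult_smult_mat)

end

text \<open>All triples are conjugate to the following one.\<close>

definition std :: "nat => 'k mat"
 where "std i = (let D = mat_diag 2 (%i. \<i>\<i> * (- 1) ^ i); J = mat 2 2 (%(r, c). if r = c then 0 else if r = 0 then - 1 else 1)
  in if i mod 3 = 0 then D else if i mod 3 = 1 then J else D * J)"

lemma std_carrier [simp]: "std i\<in>carrier_mat 2 2"
 by (auto simp: std_def Let_def)

lemma std_mult_one [simp]: "std i * 1\<^sub>m 2 = std i"
 by (rule right_mult_one_mat[OF std_carrier])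

lemma std_mod: "std (i mod 3) = std i"
 by (simp only: std_def mod_mod_trivial)

lemma std_simps: "std 0 = mat_diag 2 (%i. \<i>\<i> * (- 1) ^ i)"
 "std 1 = mat 2 2 (%(r, c). if r = c then 0 else if r = 0 then - 1 else 1)" "std 2 = std 0 * std 1"
 by (simp_all add: std_def Let_def)

lemma std_entries:
 "std 0 $$ (0, 0) = \<i>\<i>" "std 0 $$ (0, 1) = 0" "std 0 $$ (1, 0) = 0" "std 0 $$ (1, 1) = - \<i>\<i>"
 "std 1 $$ (0, 0) = 0" "std 1 $$ (0, 1) = - 1" "std 1 $$ (1, 0) = 1" "std 1 $$ (1, 1) = 0"
 "std 2 $$ (0, 0) = 0" "std 2 $$ (0, 1) = - \<i>\<i>" "std 2 $$ (1, 0) = - \<i>\<i>" "std 2 $$ (1, 1) = 0"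
proof -
 show e: "std 0 $$ (0, 0) = \<i>\<i>" "std 0 $$ (0, 1) = 0" "std 0 $$ (1, 0) = 0" "std 0 $$ (1, 1) = - \<i>\<i>"
  "std 1 $$ (0, 0) = 0" "std 1 $$ (0, 1) = - 1" "std 1 $$ (1, 0) = 1" "std 1 $$ (1, 1) = 0"
  by (simp_all add: std_simps(1,2) mat_diag_def del: One_nat_def)
 show "std 2 $$ (0, 0) = 0" "std 2 $$ (0, 1) = - \<i>\<i>" "std 2 $$ (1, 0) = - \<i>\<i>" "std 2 $$ (1, 1) = 0"
  unfolding std_simps(3) using e by (simp_all add: mult_mat_2[OF std_carrier std_carrier] del: index_mult_mat(1) One_nat_def)
qed

lemma std_relations: "std i * std i = (- 1)\<cdot>\<^sub>m1\<^sub>m 2" "std i * std (i + 1) = std (i + 2)"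
proof -
 have base: "std k * std k = (- 1)\<cdot>\<^sub>m1\<^sub>m 2 & std k * std l = std m"
  if "(k, l, m)\<in>{(0, 1, 2), (1, 2, 0), (2, 0, 1)}" for k l m :: nat
  using that by (elim insertE emptyE) (safe; intro mat_2_eqI;
   simp add: mult_mat_2[OF std_carrier std_carrier] std_entries ii del: index_mult_mat(1) One_nat_def)+
 have i: "(i mod 3, (i + 1) mod 3, (i + 2) mod 3)\<in>{(0, 1, 2), (1, 2, 0), (2, 0, 1)}"
 proof -
  have "i mod 3 = 0 | i mod 3 = 1 | i mod 3 = 2" by presburger
  thus ?thesis by (elim disjE) (simp_all add: mod_Suc numeral_2_eq_2)
 qed
 show "std i * std i = (- 1)\<cdot>\<^sub>m1\<^sub>m 2" "std i * std (i + 1) = std (i + 2)"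
  using base[OF i] unfolding std_mod by auto
qed

lemma std_triple: "encode std t\<in>triples"
 unfolding triples_def using std_relations by (simp add: axis_encode std_mod)

text \<open>An eigenvector of the first axis and its image under the second form a basis in which the first two axes have their standard matrices; the third axis is their product.\<close>

lemma standard_form:
 assumes v: "v\<in>triples"
 shows "EX g:carrier (GL 2). ALL i. axis v i = g * std i * minv 2 g"
proof -
 let ?X = "axis v 0" and ?Y = "axis v 1"
 have zeta: "(- 1 :: 'k) ^ 2 = 1" "ALL m. 0 < m & m < (2::nat) --> (- 1 :: 'k) ^ m~=1"
  by (auto simp: less_2_cases_iff)
 have XY: "?X * ?Y = (- 1)\<cdot>\<^sub>m(?Y * ?X)" using axis_commutation[OF v, of 0] by simp
 have YG: "?Y\<in>carrier (GL 2)" by (rule axis_GL[OF v])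
 obtain l u where u: "u\<in>carrier_vec 2" "u~=0\<^sub>v 2" "?X *\<^sub>v u = l\<cdot>\<^sub>vu"
  by (rule exists_eigenvector[OF axis_carrier(1)[of v 0]]) simp
 have "(- 1)\<cdot>\<^sub>vu = (?X * ?X) *\<^sub>v u"
  unfolding axis_square[OF v] smult_mat_mult_vec[OF one_carrier_mat u(1)] using u(1) by simp
 also have "... = ?X *\<^sub>v (?X *\<^sub>v u)" by (rule assoc_mult_mat_vec[OF axis_carrier(1) axis_carrier(1) u(1)])
 also have "... = (l * l)\<cdot>\<^sub>vu" unfolding u(3) using u by (simp add: mult_mat_vec[of _ 2 2] smult_smult_assoc)
 finally have e: "(- 1)\<cdot>\<^sub>vu = (l * l)\<cdot>\<^sub>vu" .
 obtain k where k: "k < 2" "u $ k~=0" using u(1,2) by (metis carrier_vecD eq_vecI index_zero_vec(1) zero_carrier_vec)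
 have "- u $ k = l * l * u $ k" using arg_cong[OF e, of "%w. w $ k"] k u(1) by simp
 moreover have "(l * l + 1) * u $ k = l * l * u $ k + u $ k" by (simp only: distrib_right mult_1_left)
 ultimately have "(l * l + 1) * u $ k = - u $ k + u $ k" by (simp only:)
 hence "(l * l + 1) * u $ k = 0" by simp
 hence "l * l + 1 = 0" using k(2) by simp
 hence ll: "(l - \<i>\<i>) * (l + \<i>\<i>) = 0" using ii by (simp add: algebra_simps)
 have i0: "\<i>\<i>~=0" using ii by auto
 have "EX w. w\<in>carrier_vec 2 & w~=0\<^sub>v 2 & ?X *\<^sub>v w = \<i>\<i>\<cdot>\<^sub>vw"
 proof (cases "l = \<i>\<i>")
  case False
  hence l: "l = - \<i>\<i>" using ll by (simp add: add_eq_0_iff)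
  have Yu: "?Y *\<^sub>v u\<in>carrier_vec 2" by (rule mult_mat_vec_carrier[OF axis_carrier(1) u(1)])
  have "?X *\<^sub>v (?Y *\<^sub>v u) = (?X * ?Y) *\<^sub>v u" by (rule assoc_mult_mat_vec[OF axis_carrier(1) axis_carrier(1) u(1), symmetric])
  also have "... = (- 1)\<cdot>\<^sub>v((?Y * ?X) *\<^sub>v u)" unfolding XY by (rule smult_mat_mult_vec[of _ 2]) (use u in auto)
  also have "(?Y * ?X) *\<^sub>v u = ?Y *\<^sub>v (?X *\<^sub>v u)" by (rule assoc_mult_mat_vec[OF axis_carrier(1) axis_carrier(1) u(1)])
  also have "... = l\<cdot>\<^sub>v(?Y *\<^sub>v u)" unfolding u(3) using u by (simp add: mult_mat_vec[of _ 2 2])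
  finally have 1: "?X *\<^sub>v (?Y *\<^sub>v u) = \<i>\<i>\<cdot>\<^sub>v(?Y *\<^sub>v u)" unfolding l by (simp add: smult_smult_assoc)
  have "?Y *\<^sub>v u~=0\<^sub>v 2"
  proof
   assume z: "?Y *\<^sub>v u = 0\<^sub>v 2"
   have "u = (minv 2 ?Y * ?Y) *\<^sub>v u" using u(1) minv_left[OF YG] by simp
   also have "... = minv 2 ?Y *\<^sub>v 0\<^sub>v 2" using assoc_mult_mat_vec[OF minv_mat[OF YG] axis_carrier(1) u(1)] z by simp
   also have "... = 0\<^sub>v 2" by (rule eq_vecI) (use minv_mat[OF YG] in auto)
   finally show False using u(2) by simp
  qed
  with 1 Yu show ?thesis by blast
 qed (use u in blast)
 then obtain w where w: "w\<in>carrier_vec 2" "w~=0\<^sub>v 2" "?X *\<^sub>v w = \<i>\<i>\<cdot>\<^sub>vw" by blast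
 define g where "g = chain_matrix 2 ?Y w"
 have g: "g\<in>carrier (GL 2)" and Xg: "?X * g = g * std 0"
  unfolding g_def std_simps(1) by (rule chain_matrix_eigenbasis[OF zeta axis_carrier(1) YG XY w i0])+
 have gc: "g\<in>carrier_mat 2 2" using g by simp
 have colg: "col g 0 = w" "col g 1 = ?Y *\<^sub>v w" unfolding g_def chain_matrix_def using w(1) by (auto intro!: eq_vecI)
 have "?Y *\<^sub>v (?Y *\<^sub>v w) = (- 1)\<cdot>\<^sub>vw"
  using assoc_mult_mat_vec[OF axis_carrier(1) axis_carrier(1) w(1), of v 1 v 1] w(1)
  unfolding axis_square[OF v] smult_mat_mult_vec[OF one_carrier_mat w(1)] by simp
 hence YYw: "(?Y *\<^sub>v (?Y *\<^sub>v w)) $ r = - w $ r" if "r < 2" for r using w(1) that by simp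
 have Yg: "?Y * g = g * std 1"
 proof (rule eq_matI)
  fix r c assume "r < dim_row (g * std 1)" "c < dim_col (g * std 1)"
  hence rc: "r < 2" "c = 0 | c = 1" using gc carrier_matD[OF std_carrier[of 1]] by auto
  have lhs: "(?Y * g) $$ (r, c) = (?Y *\<^sub>v col g c) $ r" using rc gc by auto
  have r1: "g $$ (r, 0) = w $ r" "g $$ (r, 1) = (?Y *\<^sub>v w) $ r"
   using arg_cong[OF colg(1), of "%w. w $ r"] arg_cong[OF colg(2), of "%w. w $ r"] rc gc by auto
  have r2: "(g * std 1) $$ (r, 0) = g $$ (r, 1)" "(g * std 1) $$ (r, 1) = - g $$ (r, 0)"
   using mult_mat_2[OF gc std_carrier rc(1), of 0] mult_mat_2[OF gc std_carrier rc(1), of 1] by (simp_all add: std_entries del: index_mult_mat(1) One_nat_def)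
  from rc(2) show "(?Y * g) $$ (r, c) = (g * std 1) $$ (r, c)"
  proof
   assume "c = 0"
   thus ?thesis using lhs r1 r2 colg by simp
  next
   assume "c = 1"
   thus ?thesis using lhs r1 r2 colg YYw[OF rc(1)] by simp
  qed
 qed (use gc carrier_matD[OF std_carrier[of 1]] in auto)
 have conj: "M = g * N * minv 2 g" if "M\<in>carrier_mat 2 2" "N\<in>carrier_mat 2 2" "M * g = g * N" for M N
 proof -
  have "M = M * (g * minv 2 g)" using that g by (simp add: minv_right)
  also have "... = g * N * minv 2 g" using that g by (simp add: mat_assoc[where n = 2, symmetric])
  finally show ?thesis .
 qed
 have c0: "?X = g * std 0 * minv 2 g" and c1: "?Y = g * std 1 * minv 2 g"
  by (rule conj; use Xg Yg in simp)+
 have "axis v 2 = ?X * ?Y" using axis_next[OF v, of 0] by (simp add: numeral_2_eq_2)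
 also have "... = g * std 0 * (minv 2 g * (g * (std 1 * minv 2 g)))"
  unfolding c0 c1 using g by (simp add: mat_assoc[where n = 2])
 also have "... = g * std 2 * minv 2 g" unfolding std_simps(3) using g by (simp add: cancel_minv mat_assoc[where n = 2])
 finally have c2: "axis v 2 = g * std 2 * minv 2 g" .
 have "axis v i = g * std i * minv 2 g" for i
 proof -
  have "i mod 3 = 0 | i mod 3 = 1 | i mod 3 = 2" by presburger
  thus ?thesis using c0 c1 c2 axis_mod[of i "i mod 3" v] std_mod[of i] by auto
 qed
 with g show ?thesis by blast
qed

lemma triples_transitive:
 assumes v: "v\<in>triples" and w: "w\<in>triples"
 shows "EX P:carrier (PGL 2). ALL i. axis w i = pgl_conj 2 P (axis v i)"
proof -
 obtain g where g': "g\<in>carrier (GL 2)" "ALL i. axis v i = g * std i * minv 2 g" using standard_form[OF v] by (elim bexE) (rule that)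
 note g = g'(1) g'(2)[rule_format]
 obtain h where h': "h\<in>carrier (GL 2)" "ALL i. axis w i = h * std i * minv 2 h" using standard_form[OF w] by (elim bexE) (rule that)
 note h = h'(1) h'(2)[rule_format]
 have hg: "h * minv 2 g\<in>carrier (GL 2)" using g h by (intro GL_mult) auto
 have "axis w i = pgl_conj 2 (coset 2 (h * minv 2 g)) (axis v i)" for i
 proof -
  have "pgl_conj 2 (coset 2 h) (pgl_conj 2 (coset 2 (minv 2 g)) (axis v i)) = h * (minv 2 g * axis v i * g) * minv 2 h"
   using g h minv_unique[of "minv 2 g" 2 g] by (simp add: pgl_conj_coset minv_right)
  also have "minv 2 g * axis v i * g = std i" unfolding g(2) using g(1) by (simp add: mat_assoc[where n = 2] cancel_minv minv_left)
  finally show ?thesis unfolding h(2)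
   using g(1) h(1) coset_mult[OF h(1) minv_GL[OF g(1)]] pgl_conj_comp[OF coset_PGL[OF h(1)] coset_PGL[OF minv_GL[OF g(1)]] axis_carrier(1)]
   by simp
 qed
 thus ?thesis using coset_PGL[OF hg] by blast
qed

text \<open>The first two axes generate the full matrix algebra.\<close>

lemma commuting_scalar:
 assumes v: "v\<in>triples" and m: "m\<in>carrier_mat 2 2" and c: "m * axis v 0 = axis v 0 * m" "m * axis v 1 = axis v 1 * m"
 shows "m = (m $$ (0, 0))\<cdot>\<^sub>m1\<^sub>m 2"
proof -
 obtain g where g': "g\<in>carrier (GL 2)" "ALL i. axis v i = g * std i * minv 2 g" using standard_form[OF v] by (elim bexE) (rule that)
 note g = g'(1) g'(2)[rule_format]
 define n where "n = minv 2 g * m * g"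
 have n: "n\<in>carrier_mat 2 2" unfolding n_def using g m by simp
 have comm: "n * std i = std i * n" if "m * axis v i = axis v i * m" for i
 proof -
  have "n * std i = minv 2 g * (m * axis v i) * g"
   unfolding n_def g(2) using g(1) m by (simp add: mat_assoc[where n = 2] minv_left)
  also have "... = std i * n" unfolding that unfolding n_def g(2) using g(1) m by (simp add: mat_assoc[where n = 2] cancel_minv)
  finally show ?thesis .
 qed
 have i0: "\<i>\<i>~=0" using ii by auto
 have ent: "(n * std i) $$ (r, s) = (std i * n) $$ (r, s)" if "i = 0 | i = 1" for i r s using that comm c by auto
 have e1: "n $$ (0, 1) * (- \<i>\<i>) = \<i>\<i> * n $$ (0, 1)" and e2: "n $$ (1, 0) * \<i>\<i> = - \<i>\<i> * n $$ (1, 0)" and e3: "n $$ (1, 1) = n $$ (0, 0)"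
  using ent[of 0 0 1] ent[of 0 1 0] ent[of 1 1 0]
  by (simp_all add: mult_mat_2[OF n std_carrier] mult_mat_2[OF std_carrier n] std_entries del: index_mult_mat(1) One_nat_def)
 have z: "n $$ (0, 1) = 0" "n $$ (1, 0) = 0"
 proof -
  have "2 * (\<i>\<i> * n $$ (0, 1)) = 0" "2 * (\<i>\<i> * n $$ (1, 0)) = 0" using e1 e2 by (simp_all add: algebra_simps)
  thus "n $$ (0, 1) = 0" "n $$ (1, 0) = 0" using i0 by simp_all
 qed
 have nn: "n = n $$ (0, 0)\<cdot>\<^sub>m1\<^sub>m 2" by (rule mat_2_eqI) (use n z e3 in auto)
 have "m = g * n * minv 2 g" unfolding n_def using g(1) m by (simp add: mat_assoc[where n = 2] cancel_minv minv_right)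
 also have "... = n $$ (0, 0)\<cdot>\<^sub>m1\<^sub>m 2" by (subst nn) (use g(1) in \<open>simp add: smult_mult_mat[where n = 2] minv_right\<close>)
 finally have mm: "m = n $$ (0, 0)\<cdot>\<^sub>m1\<^sub>m 2" .
 hence "m $$ (0, 0) = n $$ (0, 0)" by simp
 with mm show ?thesis by simp
qed

end

subsection \<open>The action\<close>

context tetrahedral
begin

definition tact :: "'k vec\<times>'k mat set => 'k vec => 'k vec"
 where "tact = (%(g, P). \<lambda>v\<in>triples.
  encode (%i. sg g i\<cdot>\<^sub>mpgl_conj 2 P (axis v (i + rot g))) (\<omega> ^ rot g * param v))"

context
 fixes s :: "nat => 'k" and j :: nat and P :: "'k mat set" and v :: "'k vec"
 assumes s: "s\<in>signs" and P: "P\<in>carrier (PGL 2)" and v: "v\<in>triples"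
begin

lemma axis_tact: "axis (tact (el s j, P) v) i = s i\<cdot>\<^sub>mpgl_conj 2 P (axis v (i + j))"
proof -
 have "axis (tact (el s j, P) v) i = s (i mod 3)\<cdot>\<^sub>mpgl_conj 2 P (axis v (i mod 3 + j mod 3))"
  using v by (simp add: tact_def axis_encode sg_el[OF s] rot_el pgl_conj_carrier[OF P])
 also have "s (i mod 3) = s i" by (rule signs_mod[OF s]) simp
 also have "axis v (i mod 3 + j mod 3) = axis v (i + j)" by (rule axis_mod) (simp add: mod_add_eq)
 finally show ?thesis .
qed

lemma param_tact: "param (tact (el s j, P) v) = \<omega> ^ j * param v"
 using v by (simp add: tact_def rot_el omega_mod)

text \<open>The sign conditions say exactly that the cyclic product relations survive the sign changes.\<close>

lemma tact_triples: "tact (el s j, P) v\<in>triples"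
 unfolding triples_def
proof (intro CollectI conjI allI)
 show "tact (el s j, P) v\<in>carrier_vec 13" using v by (simp add: tact_def)
 have c: "!!i. pgl_conj 2 P (axis v i)\<in>carrier_mat 2 2" by (rule pgl_conj_carrier[OF P axis_carrier(1)])
 fix i
 let ?a = "%i. pgl_conj 2 P (axis v (i + j))"
 have "(s i\<cdot>\<^sub>m?a i) * (s i'\<cdot>\<^sub>m?a i') = (s i * s i')\<cdot>\<^sub>mpgl_conj 2 P (axis v (i + j) * axis v (i' + j))" for i'
  using c by (simp add: smult_mult_mat[where n = 2] smult_smult_mat pgl_conj_mult[OF P] mult.commute)
 note m = this
 show "axis (tact (el s j, P) v) i * axis (tact (el s j, P) v) i = (- 1)\<cdot>\<^sub>m1\<^sub>m 2"
  unfolding axis_tact m axis_square[OF v] signsD(1)[OF s] pgl_conj_smult[OF P one_carrier_mat] pgl_conj_one[OF P] by simp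
 have n: "axis v (i + j) * axis v (i + 1 + j) = axis v (i + 2 + j)"
  using axis_next[OF v, of "i + j"] by (simp only: ac_simps)
 show "axis (tact (el s j, P) v) i * axis (tact (el s j, P) v) (i + 1) = axis (tact (el s j, P) v) (i + 2)"
  unfolding axis_tact m n signsD(3)[OF s] ..
qed

end

lemma tact_outside: "v \<notin> triples==>tact (g, P) v = undefined"
 by (simp add: tact_def)

lemma tact_compose:
 assumes s: "s\<in>signs" and s': "s'\<in>signs" and P: "P\<in>carrier (PGL 2)" and Q: "Q\<in>carrier (PGL 2)" and v: "v\<in>triples"
 shows "tact (el s j \<otimes>\<^bsub>tet\<^esub> el s' j', P \<otimes>\<^bsub>PGL 2\<^esub> Q) v = tact (el s j, P) (tact (el s' j', Q) v)"
proof -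
 have PQ: "P \<otimes>\<^bsub>PGL 2\<^esub> Q\<in>carrier (PGL 2)" using P Q group.is_monoid[OF group_PGL] by (rule monoid.m_closed[rotated])
 have m: "(%i. s i * s' (i + j))\<in>signs" by (rule signs_mult[OF s signs_shift[OF s']])
 have w: "tact (el s' j', Q) v\<in>triples" by (rule tact_triples[OF s' Q v])
 show ?thesis unfolding tet_mult[OF s s']
 proof (rule triple_eqI)
  show "tact (el (%i. s i * s' (i + j)) (j + j'), P \<otimes>\<^bsub>PGL 2\<^esub> Q) v\<in>carrier_vec 13"
   "tact (el s j, P) (tact (el s' j', Q) v)\<in>carrier_vec 13"
   using tact_triples[OF m PQ v] tact_triples[OF s P w] by (auto simp: triples_def)
  fix i
  show "axis (tact (el (%i. s i * s' (i + j)) (j + j'), P \<otimes>\<^bsub>PGL 2\<^esub> Q) v) i = axis (tact (el s j, P) (tact (el s' j', Q) v)) i"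
   unfolding axis_tact[OF m PQ v] axis_tact[OF s P w] axis_tact[OF s' Q v]
   by (simp add: pgl_conj_comp[OF P Q] pgl_conj_smult[OF P pgl_conj_carrier[OF Q]] smult_smult_mat add.assoc)
 next
  show "param (tact (el (%i. s i * s' (i + j)) (j + j'), P \<otimes>\<^bsub>PGL 2\<^esub> Q) v) = param (tact (el s j, P) (tact (el s' j', Q) v))"
   unfolding param_tact[OF m PQ v] param_tact[OF s P w] param_tact[OF s' Q v] by (simp add: power_add)
 qed
qed

lemma one_PGL_2: "\<one>\<^bsub>PGL 2\<^esub>\<in>carrier (PGL 2)"
 by (rule monoid.one_closed[OF group.is_monoid[OF group_PGL]])

lemma tact_one:
 assumes v: "v\<in>triples"
 shows "tact (\<one>\<^bsub>tet\<^esub>, \<one>\<^bsub>PGL 2\<^esub>) v = v"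
 unfolding tet_one
proof (rule triple_eqI)
 show "tact (el (%_. 1) 0, \<one>\<^bsub>PGL 2\<^esub>) v\<in>carrier_vec 13" "v\<in>carrier_vec 13"
  using tact_triples[OF signs_one one_PGL_2 v] v by (auto simp: triples_def)
qed (simp_all add: axis_tact[OF signs_one one_PGL_2 v] param_tact[OF signs_one one_PGL_2 v] pgl_conj_by_one)

lemma group_action_tact: "group_action (tet \<times>\<times> PGL 2) triples tact"
proof (rule group_actionI)
 show "group (tet \<times>\<times> (PGL 2 :: 'k mat set monoid))" by (rule DirProd_group[OF group_tet group_PGL])
 show "tact gP\<in>extensional triples" for gP :: "'k vec\<times>'k mat set" by (cases gP) (auto simp: extensional_def tact_outside)
 fix gP :: "'k vec\<times>'k mat set" and v assume gP: "gP\<in>carrier (tet \<times>\<times> PGL 2)" and v: "v\<in>triples"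
 then obtain g P where g: "gP = (g, P)" "g\<in>carrier tet" and P: "P\<in>carrier (PGL 2)" by auto
 obtain s j where s: "s\<in>signs" "g = el s j" using g(2) by (rule tet_cases)
 show "tact gP v\<in>triples" unfolding g(1) s(2) by (rule tact_triples[OF s(1) P v])
 fix hQ :: "'k vec\<times>'k mat set" assume hQ: "hQ\<in>carrier (tet \<times>\<times> PGL 2)"
 then obtain h Q where h: "hQ = (h, Q)" "h\<in>carrier tet" and Q: "Q\<in>carrier (PGL 2)" by auto
 obtain s' j' where s': "s'\<in>signs" "h = el s' j'" using h(2) by (rule tet_cases)
 show "tact (gP \<otimes>\<^bsub>tet \<times>\<times> PGL 2\<^esub> hQ) v = tact gP (tact hQ v)"
  unfolding g(1) h(1) s(2) s'(2) mult_DirProd by (rule tact_compose[OF s(1) s'(1) P Q v])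
next
 show "tact \<one>\<^bsub>tet \<times>\<times> PGL 2\<^esub> v = v" if "v\<in>triples" for v unfolding one_DirProd by (rule tact_one[OF that])
qed

abbreviation tspace :: "('k, 'k vec) fspace"
 where "tspace \<equiv> discrete_space (carrier tet)"

lemma alg_group_tet: "alg_group tet tspace"
 by (rule alg_group_discrete[OF group_tet finite_tet tet_carrier_vec])

lemma regular_action_tact: "regular_action (tet \<times>\<times> PGL 2) (prod_space tspace (PGL_space 2)) tvar tact"
 unfolding regular_action_def points_tvar
proof (intro conjI group_action_tact)
 let ?S = "prod_space tspace (PGL_space 2 :: ('k, 'k mat set) fspace)"
 let ?Y = "prod_space ?S tvar"
 have kS: "k_space ?S" by (rule k_space_prod[OF k_space_discrete k_space_PGL])
 have kY: "k_space ?Y" by (rule k_space_prod[OF kS k_space_tvar])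
 have g: "morphism ?Y tspace (%y. fst (fst y))"
  by (rule morphism_compose[OF morphism_fst[OF kS k_space_tvar] morphism_fst[OF k_space_discrete k_space_PGL]])
 have P: "morphism ?Y (PGL_space 2) (%y. snd (fst y))"
  by (rule morphism_compose[OF morphism_fst[OF kS k_space_tvar] morphism_snd[OF k_space_discrete k_space_PGL]])
 have v: "morphism ?Y tvar snd" by (rule morphism_snd[OF kS k_space_tvar])
 have h: "(%y. h (fst (fst y)))\<in>regfun ?Y (points ?Y)" for h :: "'k vec => 'k"
  by (rule morphism_regfun_points[OF kY g]) (simp add: discrete_space_def)
 note mult = regfun_mult[OF kY openin_topspace]
 have pts: "EX s j P v. y = ((el s j, P), v) & s\<in>signs & P\<in>carrier (PGL 2) & v\<in>triples" if "y\<in>points ?Y" for y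
 proof -
  have y: "fst (fst y)\<in>carrier tet" "snd (fst y)\<in>carrier (PGL 2)" "snd y\<in>triples"
   using that unfolding points_prod[OF kS k_space_tvar] points_prod[OF k_space_discrete k_space_PGL] by auto
  obtain s j where s: "s\<in>signs" "fst (fst y) = el s j" using y(1) by (rule tet_cases)
  show ?thesis
   by (intro exI[of _ s] exI[of _ j] exI[of _ "snd (fst y)"] exI[of _ "snd y"] conjI s(1) y(2,3)) (simp add: prod_eq_iff s(2))
 qed
 show "morphism ?Y tvar (%(g, x). tact g x)"
 proof (rule morphism_into_tvar[OF kY])
  fix y assume "y\<in>points ?Y"
  from pts[OF this] show "(%(g, x). tact g x) y\<in>triples" by (elim exE conjE) (simp add: tact_triples)
 next
  fix i
  let ?c = "%k y. if rot (fst (fst y)) = k then 1 else 0 :: 'k"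
  let ?M = "%y. ?c 0 y\<cdot>\<^sub>maxis (snd y) i + (?c 1 y\<cdot>\<^sub>maxis (snd y) (i + 1) + ?c 2 y\<cdot>\<^sub>maxis (snd y) (i + 2))"
  have "morphism ?Y (mat_space 2) (%y. sg (fst (fst y)) i\<cdot>\<^sub>mpgl_conj 2 (snd (fst y)) (?M y))"
   by (intro morphism_mat_smult[OF kY] morphism_pgl_conj[OF kY P] morphism_mat_add[OF kY] h
     morphism_compose[OF v morphism_axis])
  thus "morphism ?Y (mat_space 2) (%y. axis ((%(g, x). tact g x) y) i)"
  proof (rule morphism_cong[OF kY])
   fix y assume "y\<in>points ?Y"
   from pts[OF this] obtain s j P v where y: "y = ((el s j, P), v)" and sPv: "s\<in>signs" "P\<in>carrier (PGL 2)" "v\<in>triples"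
    by (elim exE conjE)
   have z: "(0 :: 'k)\<cdot>\<^sub>maxis v k = 0\<^sub>m 2 2" for k by (rule eq_matI) auto
   have "?M y = axis v (i + j mod 3)"
   proof -
    have "j mod 3 = 0 | j mod 3 = 1 | j mod 3 = 2" by presburger
    thus ?thesis unfolding y fst_conv snd_conv rot_el by (elim disjE) (simp_all add: z)
   qed
   also have "... = axis v (i + j)" by (rule axis_mod) (simp add: mod_simps)
   finally show "sg (fst (fst y)) i\<cdot>\<^sub>mpgl_conj 2 (snd (fst y)) (?M y) = axis ((%(g, x). tact g x) y) i"
    unfolding y by (simp add: axis_tact[OF sPv] sg_el[OF sPv(1)])
  qed
 next
  have "(%y. \<omega> ^ rot (fst (fst y)) * param (snd y))\<in>regfun ?Y (points ?Y)"
   by (intro mult h morphism_regfun_points[OF kY v] param_regular)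
  thus "(%y. param ((%(g, x). tact g x) y))\<in>regfun ?Y (points ?Y)"
  proof (rule regfun_cong_points[OF kY])
   fix y assume "y\<in>points ?Y"
   from pts[OF this] obtain s j P v where y: "y = ((el s j, P), v)" and sPv: "s\<in>signs" "P\<in>carrier (PGL 2)" "v\<in>triples"
    by (elim exE conjE)
   show "\<omega> ^ rot (fst (fst y)) * param (snd y) = param ((%(g, x). tact g x) y)"
    unfolding y by (simp add: param_tact[OF sPv] rot_el omega_mod)
  qed
 qed
qed

text \<open>The triples form one orbit of a connected group for each parameter: joining two conjugating matrices by a line of matrices joins any two points by a rational curve.\<close>

lemma irreducible_tvar: "irreducible_space (ftop tvar)"
proof (rule irreducible_by_curves)
 show "points tvar~={}" using std_triple by auto
 fix u v assume "u\<in>points tvar" "v\<in>points tvar"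
 hence u: "u\<in>triples" and v: "v\<in>triples" by simp_all
 obtain g where g': "g\<in>carrier (GL 2)" "ALL i. axis u i = g * std i * minv 2 g" using standard_form[OF u] by (elim bexE) (rule that)
 note g = g'(1) g'(2)[rule_format]
 obtain h where h': "h\<in>carrier (GL 2)" "ALL i. axis v i = h * std i * minv 2 h" using standard_form[OF v] by (elim bexE) (rule that)
 note h = h'(1) h'(2)[rule_format]
 define m where "m s = (1 - s)\<cdot>\<^sub>mg + s\<cdot>\<^sub>mh" for s
 define D where "D = {s. det2 (m s)~=0}"
 define c where "c s = encode (%i. m s * std i * minv 2 (m s)) ((1 - s) * param u + s * param v)" for s
 have mc: "m s\<in>carrier_mat 2 2" for s unfolding m_def using g h by simp
 have mG: "m s\<in>carrier (GL 2)" if "s\<in>D" for s using that mc unfolding det2_iff D_def by simp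
 note o = openin_topspace[of "ftop (line :: ('k, 'k) fspace)"]
 have sr: "(%s. s)\<in>regfun (line :: ('k, 'k) fspace) (points line)"
  unfolding line_def by (rule polyfun_regular) (blast intro: polyfun_coord)
 have "(%s. 1 + (- 1) * s)\<in>regfun (line :: ('k, 'k) fspace) (points line)"
  by (intro regfun_add[OF k_space_line o] regfun_mult[OF k_space_line o] regfun_const[OF k_space_line o] sr)
 hence sr': "(%s. 1 - s)\<in>regfun (line :: ('k, 'k) fspace) (points line)" by simp
 have m: "morphism line (mat_space 2) m"
  unfolding m_def[abs_def]
  by (intro morphism_mat_add[OF k_space_line] morphism_mat_smult[OF k_space_line] morphism_mat_const[OF k_space_line] sr sr')
    (use g h in auto)
 have ent: "(%s. m s $$ (i, j))\<in>regfun line (points line)" if "i < 2" "j < 2" for i j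
  using m that unfolding morphism_mat_space_iff[OF k_space_line] by blast
 have "(%s. m s $$ (0, 0) * m s $$ (1, 1) + (- 1) * (m s $$ (0, 1) * m s $$ (1, 0)))\<in>regfun line (points line)"
  by (intro regfun_add[OF k_space_line o] regfun_mult[OF k_space_line o] regfun_const[OF k_space_line o] ent) auto
 hence "(%s. det2 (m s))\<in>regfun line (points line)" by (simp add: det2_def)
 from openin_regfun_nonzero[OF k_space_line o this] have D: "opens line D" unfolding D_def by simp
 let ?L = "subspace_of line D"
 have kL: "k_space ?L" by (rule k_space_subspace[OF k_space_line])
 have pL: "points ?L = D" by simp
 have mL: "morphism ?L (GL_space 2) m"
  by (rule morphism_into_GL[OF kL morphism_from_subspace[OF m]]) (use mG in simp)
 have cs: "c s = tact (\<one>\<^bsub>tet\<^esub>, coset 2 (m s)) (encode std ((1 - s) * param u + s * param v))"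
  and ax: "axis (c s) i = m s * std i * minv 2 (m s)" if s: "s\<in>D" for s i
 proof -
  have mP: "coset 2 (m s)\<in>carrier (PGL 2)" by (rule coset_PGL[OF mG[OF s]])
  have car: "m s * std k * minv 2 (m s)\<in>carrier_mat 2 2" for k using mG[OF s] by simp
  show ax: "axis (c s) i = m s * std i * minv 2 (m s)" for i
   unfolding c_def axis_encode[OF car] std_mod ..
  show "c s = tact (\<one>\<^bsub>tet\<^esub>, coset 2 (m s)) (encode std ((1 - s) * param u + s * param v))"
   unfolding tet_one
  proof (rule triple_eqI)
   show "c s\<in>carrier_vec 13" by (simp add: c_def)
   show "tact (el (%_. 1) 0, coset 2 (m s)) (encode std ((1 - s) * param u + s * param v))\<in>carrier_vec 13"
    using tact_triples[OF signs_one mP std_triple] by (simp add: triples_def)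
  qed (simp_all add: ax axis_tact[OF signs_one mP std_triple] param_tact[OF signs_one mP std_triple]
    axis_encode std_mod pgl_conj_coset[OF mG[OF s]], simp add: c_def)
 qed
 have morph: "morphism ?L tvar c"
 proof (rule morphism_into_tvar[OF kL])
  fix s assume "s\<in>points ?L"
  hence s: "s\<in>D" by simp
  show "c s\<in>triples" unfolding cs[OF s] tet_one
   by (rule tact_triples[OF signs_one coset_PGL[OF mG[OF s]] std_triple])
 next
  fix i
  have "morphism ?L (mat_space 2) (%s. m s * std i * minv 2 (m s))"
   by (intro morphism_mat_mult[OF kL] morphism_compose[OF mL morphism_minv_2] morphism_compose[OF mL morphism_GL_inclusion]
     morphism_mat_const[OF kL] std_carrier)
  thus "morphism ?L (mat_space 2) (%s. axis (c s) i)"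
   by (rule morphism_cong[OF kL]) (use ax in simp)
 next
  have r: "(%s. s)\<in>regfun ?L (points ?L)" "(%s. 1 - s)\<in>regfun ?L (points ?L)"
   using morphism_regfun_points[OF kL morphism_inclusion sr] morphism_regfun_points[OF kL morphism_inclusion sr'] by simp_all
  show "(%s. param (c s))\<in>regfun ?L (points ?L)"
   unfolding c_def param_encode
   by (intro regfun_add[OF kL openin_topspace] regfun_mult[OF kL openin_topspace] regfun_const[OF kL openin_topspace] r)
 qed
 have m01: "m 0 = g" "m 1 = h" unfolding m_def using g h by (auto intro!: eq_matI)
 have D01: "0\<in>D" "1\<in>D" unfolding D_def using m01 g(1) h(1) det2_iff[of g] det2_iff[of h] by simp_all
 have c0: "c 0 = u"
  by (rule triple_eqI) (use u ax[OF D01(1)] g(2) m01 in \<open>auto simp: triples_def c_def\<close>)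
 have c1: "c 1 = v"
  by (rule triple_eqI) (use v ax[OF D01(2)] h(2) m01 in \<open>auto simp: triples_def c_def\<close>)
 show "EX D c. opens line D & 0\<in>D & 1\<in>D & morphism (subspace_of line D) tvar c & c 0 = u & c 1 = v"
  by (intro exI[of _ D] exI[of _ c] conjI D D01 morph c0 c1)
qed

text \<open>An element of the projective group fixing a triple commutes with its axes, so it is scalar.\<close>

lemma generically_free_tvar: "generically_free (PGL 2) tvar (pgl_part tet tact)"
 unfolding generically_free_def
proof (intro exI conjI ballI)
 show "dense_open (ftop tvar) (points tvar)" by (rule dense_open_topspace)
 fix v assume "v\<in>points tvar"
 hence v: "v\<in>triples" by simp
 show "stabilizer (PGL 2) (pgl_part tet tact) v = {\<one>\<^bsub>PGL 2\<^esub>}"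
 proof (intro equalityI subsetI)
  fix P :: "'k mat set" assume "P\<in>stabilizer (PGL 2) (pgl_part tet tact) v"
  hence P: "P\<in>carrier (PGL 2)" and fix_v: "tact (el (%_. 1) 0, P) v = v"
   by (simp_all add: stabilizer_def pgl_part_def tet_one)
  obtain g where g: "g\<in>carrier (GL 2)" "P = coset 2 g" using P by (rule PGL_cases)
  have "g * axis v i = axis v i * g" for i
  proof -
   have "axis v i = g * axis v i * minv 2 g"
    using axis_tact[OF signs_one P v, of 0 i] unfolding fix_v using g by (simp add: pgl_conj_coset)
   hence "axis v i * g = g * axis v i * minv 2 g * g" by simp
   thus ?thesis using g(1) by (simp add: mat_assoc[where n = 2] minv_left)
  qed
  hence e: "g = g $$ (0, 0)\<cdot>\<^sub>m1\<^sub>m 2" using commuting_scalar[OF v GL_mat[OF g(1)]] by blast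
  have nz: "g $$ (0, 0)~=0"
  proof
   assume "g $$ (0, 0) = 0"
   hence "det2 g = 0" by (subst e) (simp add: det2_def)
   thus False using g(1) det2_iff[of g] by simp
  qed
  have "P = \<one>\<^bsub>PGL 2\<^esub>" unfolding g(2) coset_one[symmetric] by (subst e) (rule coset_smult[OF GL_one nz])
  thus "P\<in>{\<one>\<^bsub>PGL 2\<^esub>}" by simp
 next
  fix P :: "'k mat set" assume "P\<in>{\<one>\<^bsub>PGL 2\<^esub>}"
  thus "P\<in>stabilizer (PGL 2) (pgl_part tet tact) v"
   using tact_one[OF v] one_PGL_2 by (simp add: stabilizer_def pgl_part_def)
 qed
qed

text \<open>Where the parameter does not vanish, a stabilizer element involves no rotation, because a rotation multiplies the parameter by a nontrivial cube root of unity.  What remains sends the first axis to itself up to sign, so it normalizes the torus of that axis.\<close>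

lemma stabilizers_tvar: "stabilizers_normalize_tori tet 2 tvar tact"
 unfolding stabilizers_normalize_tori_def
proof (intro exI[of _ "{v\<in>points tvar. param v~=0}"] conjI ballI)
 have "opens tvar {v\<in>points tvar. param v~=0}"
  by (rule openin_regfun_nonzero[OF k_space_tvar openin_topspace param_regular])
 moreover have "encode std 1\<in>{v\<in>points tvar. param v~=0}" using std_triple by simp
 ultimately show "dense_open (ftop tvar) {v\<in>points tvar. param v~=0}"
  by (intro irreducible_dense_open[OF irreducible_tvar]) blast+
 fix v assume "v\<in>{v\<in>points tvar. param v~=0}"
 hence v: "v\<in>triples" and pv: "param v~=0" by simp_all
 have zeta: "(- 1 :: 'k) ^ 2 = 1" "ALL m. 0 < m & m < (2::nat) --> (- 1 :: 'k) ^ m~=1"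
  by (auto simp: less_2_cases_iff)
 have XY: "axis v 0 * axis v 1 = (- 1)\<cdot>\<^sub>m(axis v 1 * axis v 0)" using axis_commutation[OF v, of 0] by simp
 obtain g l where g: "g\<in>carrier (GL 2)" "l~=0" "axis v 0 = g * mat_diag 2 (%i. l * (- 1) ^ i) * minv 2 g"
  and inj: "inj_on (%i. l * (- 1) ^ i) {..<2::nat}"
  by (rule q_commuting_diagonalizable[OF zeta _ axis_GL[OF v, of 0] axis_GL[OF v, of 1] XY]) simp
 show "EX T. maximal_torus 2 T & stabilizer (tet \<times>\<times> PGL 2) tact v \<subseteq> carrier tet\<times>normalizer (PGL 2) T"
 proof (intro exI[of _ "torus 2 g"] conjI subsetI)
  show "maximal_torus 2 (torus 2 g)" by (rule torus_maximal[OF _ g(1)]) simp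
  fix hP assume "hP\<in>stabilizer (tet \<times>\<times> PGL 2) tact v"
  then obtain h P where hP: "hP = (h, P)" "h\<in>carrier tet" and P: "P\<in>carrier (PGL 2)" and fix_v: "tact (h, P) v = v"
   by (auto simp: stabilizer_def)
  obtain s j where s: "s\<in>signs" "h = el s j" using hP(2) by (rule tet_cases)
  have "\<omega> ^ j * param v = param v" using param_tact[OF s(1) P v, of j] fix_v s(2) by simp
  hence "\<omega> ^ j = \<omega> ^ 0" using pv by simp
  hence j: "j mod 3 = 0" unfolding omega_power_eq by simp
  have "axis v (0 + j) = axis v 0" by (rule axis_mod) (use j in simp)
  hence "axis v 0 = s 0\<cdot>\<^sub>mpgl_conj 2 P (axis v 0)"
   using axis_tact[OF s(1) P v, of j 0] fix_v s(2) by simp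
  hence "s 0\<cdot>\<^sub>maxis v 0 = s 0\<cdot>\<^sub>m(s 0\<cdot>\<^sub>mpgl_conj 2 P (axis v 0))" by simp
  hence c: "pgl_conj 2 P (axis v 0) = s 0\<cdot>\<^sub>maxis v 0"
   unfolding smult_smult_mat signsD(1)[OF s(1)] by simp
  have "P\<in>normalizer (PGL 2) (torus 2 g)"
   by (rule normalizer_torus[OF _ g(1) inj g(3) P _ c]) (use signsD(1)[OF s(1), of 0] in auto)
  thus "hP\<in>carrier tet\<times>normalizer (PGL 2) (torus 2 g)" using hP by simp
 qed
qed

end

section \<open>The action on rational maps\<close>

context equivariant_variety
begin

lemma shift_commutes:
 assumes g: "g\<in>carrier G" and P: "P\<in>carrier (PGL n)" and x: "x\<in>points X"
 shows "shift g (act (\<one>\<^bsub>G\<^esub>, P) x) = act (\<one>\<^bsub>G\<^esub>, P) (shift g x)"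
proof -
 have m: "monoid G" "monoid (PGL n)" by (rule group.is_monoid[OF G], rule group.is_monoid[OF group_PGL])
 show ?thesis
  unfolding act_compose[OF x inv_G[OF g] one_G one_PGL P] act_compose[OF x one_G inv_G[OF g] P one_PGL]
   monoid.l_one[OF m(1) inv_G[OF g]] monoid.r_one[OF m(1) inv_G[OF g]] monoid.l_one[OF m(2) P] monoid.r_one[OF m(2) P] ..
qed

lemma shift_mult:
 assumes g: "g\<in>carrier G" and h: "h\<in>carrier G" and x: "x\<in>points X"
 shows "shift (g \<otimes>\<^bsub>G\<^esub> h) x = shift h (shift g x)"
 unfolding act_compose[OF x inv_G[OF h] inv_G[OF g] one_PGL one_PGL] group.inv_mult_group[OF G g h] one_one ..

lemma shift_R:
 assumes g: "g\<in>carrier G" and f: "f\<in>R"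
 shows "(%x. f (shift g x))\<in>R"
proof -
 obtain U where U: "rep_on f U" using f unfolding rat_reps_iff by blast
 note fU = rep_onD[OF U]
 let ?V = "{x\<in>points X. shift g x\<in>U}"
 have "rep_on (%x. f (shift g x)) ?V"
  unfolding rep_on_def
 proof (intro conjI ballI impI dense_open_shift[OF g fU(1)])
  have "morphism (subspace_of X ?V) (subspace_of X U) (shift g)"
   by (rule morphism_into_subspace[OF k_space_on morphism_from_subspace[OF shift_morphism[OF g]]]) auto
  from morphism_compose[OF this fU(2)] show "morphism (subspace_of X ?V) (mat_space n) (%x. f (shift g x))" .
  fix P x assume P: "P\<in>carrier (PGL n)" and x: "x\<in>?V" and Px: "pgl_part G act P x\<in>?V"
  have c: "shift g (pgl_part G act P x) = pgl_part G act P (shift g x)"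
   unfolding pgl_part_def by (rule shift_commutes[OF g P]) (use x in simp)
  show "f (shift g (pgl_part G act P x)) = pgl_conj n P (f (shift g x))"
   unfolding c by (rule fU(3)[OF P]) (use x Px c in auto)
 qed
 thus ?thesis unfolding rat_reps_iff by blast
qed

text \<open>Composition with the action of a group element maps representatives of a rational map to representatives, because generic agreement is preserved under translation.\<close>

lemma kn_act_cls:
 assumes g: "g\<in>carrier G" and f: "f\<in>R"
 shows "kn_act G n X act g (cls f) = cls (%x. f (shift g x))"
proof -
 have *: "cls (%x. f' (shift g x)) = cls (%x. f (shift g x))" if "f'\<in>cls f" for f'
  using mem_cls[OF that] unfolding generically_eq by (intro cls_cong) (auto simp: generically_eq intro: generically_shift[OF g])
 have ne: "cls f~={}" using cls_self[OF f] by blast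
 have "kn_act G n X act g (cls f) = (\<Union>f'\<in>cls f. cls (%x. f (shift g x)))"
  unfolding kn_act_def by (intro SUP_cong refl *)
 thus ?thesis by (simp add: ne)
qed

definition induced :: "'g => ('x => 'k mat) set => ('x => 'k mat) set"
 where "induced g = (\<lambda>C\<in>carrier KN. kn_act G n X act g C)"

lemma induced_cls: "g\<in>carrier G==>f\<in>R==>induced g (cls f) = cls (%x. f (shift g x))"
 by (simp add: induced_def kn_act_cls cls_carrier)

lemma ge_points: "(!!x. x\<in>points X==>f x = h x)==>ge f h"
 by (rule generically_equalI[OF dense_open_topspace])

lemma induced_action: "k_alg_action G KN induced"
 unfolding k_alg_action_def
proof (intro conjI ballI)
 show "group_action G (carrier KN) induced"
 proof (rule group_actionI[OF G])
  show "induced g\<in>extensional (carrier KN)" for g by (simp add: induced_def)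
  fix g C assume g: "g\<in>carrier G" and C: "C\<in>carrier KN"
  obtain f where f: "f\<in>R" "C = cls f" using C by (rule KN_cases)
  show "induced g C\<in>carrier KN" unfolding f(2) induced_cls[OF g f(1)] by (rule cls_carrier[OF shift_R[OF g f(1)]])
  fix h assume h: "h\<in>carrier G"
  have gh: "g \<otimes>\<^bsub>G\<^esub> h\<in>carrier G" using monoid.m_closed[OF group.is_monoid[OF G] g h] .
  show "induced (g \<otimes>\<^bsub>G\<^esub> h) C = induced g (induced h C)"
   unfolding f(2) induced_cls[OF gh f(1)] induced_cls[OF h f(1)] induced_cls[OF g shift_R[OF h f(1)]]
   by (rule cls_cong[OF ge_points]) (simp only: shift_mult[OF g h])
 next
  fix C assume "C\<in>carrier KN"
  then obtain f where f: "f\<in>R" "C = cls f" by (rule KN_cases)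
  have i: "inv\<^bsub>G\<^esub> \<one>\<^bsub>G\<^esub> = \<one>\<^bsub>G\<^esub>" by (rule monoid.inv_one[OF group.is_monoid[OF G]])
  show "induced \<one>\<^bsub>G\<^esub> C = C"
   unfolding f(2) induced_cls[OF one_G f(1)] by (rule cls_cong[OF ge_points]) (simp only: i act_one)
 qed
 fix g assume g: "g\<in>carrier G"
 show "induced g\<in>k_alg_hom KN KN"
 proof (rule k_alg.k_alg_homI[OF k_alg.intro[OF KN_k_algebra]])
  fix A assume "A\<in>carrier KN"
  then obtain f where f: "f\<in>R" "A = cls f" by (rule KN_cases)
  note sf = shift_R[OF g f(1)]
  show "induced g A\<in>carrier KN" unfolding f(2) induced_cls[OF g f(1)] by (rule cls_carrier[OF sf])
  show "induced g (c \<odot>\<^bsub>KN\<^esub> A) = c \<odot>\<^bsub>KN\<^esub> induced g A" for c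
   unfolding f(2) cls_smult[OF f(1)] induced_cls[OF g R_smult[OF f(1)]] induced_cls[OF g f(1)] cls_smult[OF sf] ..
  fix B assume "B\<in>carrier KN"
  then obtain h where h: "h\<in>R" "B = cls h" by (rule KN_cases)
  note sh = shift_R[OF g h(1)]
  show "induced g (A \<otimes>\<^bsub>KN\<^esub> B) = induced g A \<otimes>\<^bsub>KN\<^esub> induced g B"
   unfolding f(2) h(2) cls_mult[OF f(1) h(1)] induced_cls[OF g R_mult[OF f(1) h(1)]] induced_cls[OF g f(1)] induced_cls[OF g h(1)] cls_mult[OF sf sh] ..
  show "induced g (A \<oplus>\<^bsub>KN\<^esub> B) = induced g A \<oplus>\<^bsub>KN\<^esub> induced g B"
   unfolding f(2) h(2) cls_add[OF f(1) h(1)] induced_cls[OF g R_add[OF f(1) h(1)]] induced_cls[OF g f(1)] induced_cls[OF g h(1)] cls_add[OF sf sh] ..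
 next
  show "induced g \<one>\<^bsub>KN\<^esub> = \<one>\<^bsub>KN\<^esub>" unfolding KN_one induced_cls[OF g R_one] ..
 qed
qed

end

section \<open>The algebra of the family\<close>

sublocale tetrahedral \<subseteq> equivariant_variety tet "discrete_space (carrier tet)" 2 tvar tact
 by (rule equivariant_variety.intro[OF k_space_tvar k_space_discrete points_discrete group_tet regular_action_tact])

context tetrahedral
begin

interpretation k_alg KN
 by unfold_locales (rule KN_k_algebra)

lemma ge_triples: "(!!v. v\<in>triples==>f v = h v)==>cls f = cls h"
 by (rule cls_cong[OF ge_points]) simp

lemma generically_point: "generically (ftop tvar) P==>EX v:triples. P v"
proof -
 assume "generically (ftop tvar) P"
 then obtain U where U: "dense_open (ftop tvar) U" "ALL v:U. P v" unfolding generically_def by blast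
 have "points tvar~={}" using std_triple by auto
 hence "U\<inter>points tvar~={}" using U(1) openin_topspace unfolding dense_open_iff by blast
 thus ?thesis using U(2) by auto
qed

lemma pgl_part_tact:
 assumes P: "P\<in>carrier (PGL 2)" and v: "v\<in>triples"
 shows "axis (pgl_part tet tact P v) i = pgl_conj 2 P (axis v i)" "param (pgl_part tet tact P v) = param v"
  "pgl_part tet tact P v\<in>triples"
 unfolding pgl_part_def tet_one
 using axis_tact[OF signs_one P v, of 0 i] param_tact[OF signs_one P v, of 0] tact_triples[OF signs_one P v, of 0]
 by simp_all

lemma axis_R: "(%v. axis v i)\<in>R"
proof -
 have "rep_on (%v. axis v i) (points tvar)"
  unfolding rep_on_def
  by (intro conjI ballI impI dense_open_topspace morphism_from_subspace[OF morphism_axis]) (simp add: pgl_part_tact)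
 thus ?thesis unfolding rat_reps_iff by blast
qed

lemma scalar_R:
 assumes U: "dense_open (ftop tvar) U" and s: "s\<in>regfun tvar U"
  and inv: "!!P v. P\<in>carrier (PGL 2)==>v\<in>U==>pgl_part tet tact P v\<in>U==>s (pgl_part tet tact P v) = s v"
 shows "(%v. s v\<cdot>\<^sub>m1\<^sub>m 2)\<in>R"
proof -
 have o: "opens tvar U" using U by (simp add: dense_open_iff)
 have p: "points (subspace_of tvar U) = U" using dense_open_points[OF U] by auto
 have "s\<in>regfun (subspace_of tvar U) (points (subspace_of tvar U))"
  unfolding p by (rule regfun_subspaceI[OF o subset_refl s])
 hence "morphism (subspace_of tvar U) (mat_space 2) (%v. s v\<cdot>\<^sub>m1\<^sub>m 2)"
  by (intro morphism_mat_smult[OF k_space_on] morphism_mat_const[OF k_space_on]) auto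
 hence "rep_on (%v. s v\<cdot>\<^sub>m1\<^sub>m 2) U"
  unfolding rep_on_def using U inv by (auto simp: pgl_conj_smult pgl_conj_one)
 thus ?thesis unfolding rat_reps_iff by blast
qed

definition ax :: "nat => ('k vec => 'k mat) set"
 where "ax i = cls (%v. axis v i)"

lemma ax_closed [simp]: "ax i\<in>carrier KN"
 unfolding ax_def by (rule cls_carrier[OF axis_R])

lemma ax_mod: "i mod 3 = j mod 3==>ax i = ax j"
 unfolding ax_def by (rule ge_triples) (rule axis_mod)

lemma ax_mult: "ax i \<otimes>\<^bsub>KN\<^esub> ax j = cls (%v. axis v i * axis v j)"
 unfolding ax_def by (rule cls_mult[OF axis_R axis_R])

lemma ax_square: "ax i \<otimes>\<^bsub>KN\<^esub> ax i = (- 1) \<odot>\<^bsub>KN\<^esub> \<one>\<^bsub>KN\<^esub>"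
 unfolding ax_mult KN_one cls_smult[OF R_one] by (rule ge_triples) (rule axis_square)

lemma ax_next: "ax i \<otimes>\<^bsub>KN\<^esub> ax (i + 1) = ax (i + 2)"
 unfolding ax_mult unfolding ax_def by (rule ge_triples) (rule axis_next)

lemma ax_commutation: "ax i \<otimes>\<^bsub>KN\<^esub> ax (i + 1) = (- 1) \<odot>\<^bsub>KN\<^esub> (ax (i + 1) \<otimes>\<^bsub>KN\<^esub> ax i)"
 unfolding ax_mult cls_smult[OF R_mult[OF axis_R axis_R]] by (rule ge_triples) (rule axis_commutation)

lemma ax_inverse: "ax i \<otimes>\<^bsub>KN\<^esub> ((- 1) \<odot>\<^bsub>KN\<^esub> ax i) = \<one>\<^bsub>KN\<^esub>" "((- 1) \<odot>\<^bsub>KN\<^esub> ax i) \<otimes>\<^bsub>KN\<^esub> ax i = \<one>\<^bsub>KN\<^esub>"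
 by (simp_all add: ax_square smult_assoc1)

lemma ax_unit: "ax i\<in>Units KN"
 unfolding Units_def using ax_inverse[of i] by (intro CollectI conjI bexI[of _ "(- 1) \<odot>\<^bsub>KN\<^esub> ax i"]) simp_all

lemma inv_ax: "inv\<^bsub>KN\<^esub> (ax i) = (- 1) \<odot>\<^bsub>KN\<^esub> ax i"
 by (rule inv_unique'[OF _ _ ax_inverse, symmetric]) simp_all

lemma KN_one_not_zero: "\<one>\<^bsub>KN\<^esub>~=\<zero>\<^bsub>KN\<^esub>"
proof
 assume "\<one>\<^bsub>KN\<^esub> = \<zero>\<^bsub>KN\<^esub>"
 hence "ge (%_. 1\<^sub>m 2 :: 'k mat) (%_. 0\<^sub>m 2 2)" unfolding KN_one KN_zero cls_eq_iff[OF R_one R_zero] .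
 then obtain v where "(1\<^sub>m 2 :: 'k mat) = 0\<^sub>m 2 2" unfolding generically_eq using generically_point by blast
 hence "(1\<^sub>m 2 :: 'k mat) $$ (0, 0) = 0\<^sub>m 2 2 $$ (0, 0)" by simp
 thus False by simp
qed

lemma commuting_generically_scalar:
 assumes f: "f\<in>R" and c: "ax 0 \<otimes>\<^bsub>KN\<^esub> cls f = cls f \<otimes>\<^bsub>KN\<^esub> ax 0" "ax 1 \<otimes>\<^bsub>KN\<^esub> cls f = cls f \<otimes>\<^bsub>KN\<^esub> ax 1"
 shows "generically (ftop tvar) (%v. f v = f v $$ (0, 0)\<cdot>\<^sub>m1\<^sub>m 2)"
proof -
 have g: "generically (ftop tvar) (%v. axis v i * f v = f v * axis v i)" if "ax i \<otimes>\<^bsub>KN\<^esub> cls f = cls f \<otimes>\<^bsub>KN\<^esub> ax i" for i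
  using that unfolding ax_def cls_mult[OF axis_R f] cls_mult[OF f axis_R] cls_eq_iff[OF R_mult[OF axis_R f] R_mult[OF f axis_R]] generically_eq .
 show ?thesis
 proof (rule generically_mono[OF generically_conj[OF rep_generic[OF f] generically_conj[OF g[OF c(1)] g[OF c(2)]]]])
  fix v assume "v\<in>points tvar" and e: "f v\<in>carrier_mat 2 2 & axis v 0 * f v = f v * axis v 0 & axis v 1 * f v = f v * axis v 1"
  hence "v\<in>triples" by simp
  thus "f v = f v $$ (0, 0)\<cdot>\<^sub>m1\<^sub>m 2" by (rule commuting_scalar) (use e in auto)
 qed
qed

lemma generically_scalar_central:
 assumes f: "f\<in>R" and s: "generically (ftop tvar) (%v. f v = s v\<cdot>\<^sub>m1\<^sub>m 2)"
 shows "cls f\<in>centre KN"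
 unfolding centre_iff
proof (intro conjI ballI cls_carrier[OF f])
 fix B assume "B\<in>carrier KN"
 then obtain h where h: "h\<in>R" "B = cls h" by (rule KN_cases)
 have "ge (%v. f v * h v) (%v. h v * f v)"
  unfolding generically_eq
  by (rule generically_mono[OF generically_conj[OF s rep_generic[OF h(1)]]]) (auto simp: smult_mult_mat[where n = 2])
 thus "cls f \<otimes>\<^bsub>KN\<^esub> B = B \<otimes>\<^bsub>KN\<^esub> cls f"
  unfolding h(2) cls_mult[OF f h(1)] cls_mult[OF h(1) f] by (rule cls_cong)
qed

lemma symbol_algebra_KN: "symbol_algebra KN (- 1) 2 (ax 0) (ax 1)"
proof unfold_locales
 show "(- 1 :: 'k) ^ 2 = 1" "ALL m. 0 < m & m < (2::nat) --> (- 1 :: 'k) ^ m~=1" by (auto simp: less_2_cases_iff)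
 show "ax 0 \<otimes>\<^bsub>KN\<^esub> ax 1 = (- 1) \<odot>\<^bsub>KN\<^esub> (ax 1 \<otimes>\<^bsub>KN\<^esub> ax 0)" using ax_commutation[of 0] by simp
 have pow: "ax i [^]\<^bsub>KN\<^esub> n = (- 1) \<odot>\<^bsub>KN\<^esub> \<one>\<^bsub>KN\<^esub>" if "n = Suc (Suc 0)" for i n
  unfolding that by (simp add: ax_square)
 have "ax i [^]\<^bsub>KN\<^esub> (2::nat) = (- 1) \<odot>\<^bsub>KN\<^esub> \<one>\<^bsub>KN\<^esub>" for i by (rule pow) simp
 thus "ax 0 [^]\<^bsub>KN\<^esub> (2::nat)\<in>centre KN" "ax 1 [^]\<^bsub>KN\<^esub> (2::nat)\<in>centre KN" using centre_smult[OF centre_one] by simp_all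
 fix a assume "a\<in>carrier KN" and c: "ax 0 \<otimes>\<^bsub>KN\<^esub> a = a \<otimes>\<^bsub>KN\<^esub> ax 0" "ax 1 \<otimes>\<^bsub>KN\<^esub> a = a \<otimes>\<^bsub>KN\<^esub> ax 1"
 then obtain f where f: "f\<in>R" "a = cls f" by (elim KN_cases)
 show "a\<in>centre KN" unfolding f(2)
  by (rule generically_scalar_central[OF f(1) commuting_generically_scalar[OF f(1)]]) (use c f(2) in auto)
qed (use ax_unit KN_one_not_zero in auto)

text \<open>A central element is an invariant scalar function.\<close>

lemma central_form:
 assumes z: "z\<in>centre KN"
 shows "EX U s. dense_open (ftop tvar) U & s\<in>regfun tvar U &
  (ALL P:carrier (PGL 2). ALL v:U. pgl_part tet tact P v\<in>U --> s (pgl_part tet tact P v) = s v) &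
  (%v. s v\<cdot>\<^sub>m1\<^sub>m 2)\<in>R & z = cls (%v. s v\<cdot>\<^sub>m1\<^sub>m 2)"
proof -
 obtain f where f: "f\<in>R" "z = cls f" using centre_carrier[OF z] by (rule KN_cases)
 have "generically (ftop tvar) (%v. f v = f v $$ (0, 0)\<cdot>\<^sub>m1\<^sub>m 2)"
  by (rule commuting_generically_scalar[OF f(1)]) (use centre_commute[OF z, unfolded f(2)] in auto)
 then obtain U1 where U1: "dense_open (ftop tvar) U1" "!!v. v\<in>U1==>f v = f v $$ (0, 0)\<cdot>\<^sub>m1\<^sub>m 2"
  unfolding generically_def by blast
 obtain U0 where U0: "rep_on f U0" using f(1) unfolding rat_reps_iff by blast
 let ?U = "U0\<inter>U1" and ?s = "%v. f v $$ (0, 0)"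
 have dU: "dense_open (ftop tvar) ?U" by (rule dense_open_Int[OF rep_onD(1)[OF U0] U1(1)])
 hence oU: "opens tvar ?U" by (simp add: dense_open_iff)
 have rU: "rep_on f ?U" by (rule rep_on_mono[OF U0 dU]) simp
 have p: "points (subspace_of tvar ?U) = ?U" using dense_open_points[OF dU] by auto
 have "?s\<in>regfun (subspace_of tvar ?U) ?U"
  using rep_onD(2)[OF rU] unfolding morphism_mat_space_iff[OF k_space_on] p by simp
 hence s: "?s\<in>regfun tvar ?U" by (rule regfun_subspace_open[OF k_space_tvar oU])
 have inv: "?s (pgl_part tet tact P v) = ?s v" if "P\<in>carrier (PGL 2)" "v\<in>?U" "pgl_part tet tact P v\<in>?U" for P v
 proof -
  have "f (pgl_part tet tact P v) = pgl_conj 2 P (?s v\<cdot>\<^sub>m1\<^sub>m 2)"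
   using rep_onD(3)[OF rU that] U1(2)[of v] that by simp
  thus ?thesis using that(1) by (simp add: pgl_conj_smult pgl_conj_one)
 qed
 have sR: "(%v. ?s v\<cdot>\<^sub>m1\<^sub>m 2)\<in>R" by (rule scalar_R[OF dU s inv])
 have "z = cls (%v. ?s v\<cdot>\<^sub>m1\<^sub>m 2)"
  unfolding f(2) by (rule cls_cong[OF generically_equalI[OF U1(1)]]) (rule U1(2))
 thus ?thesis
  by (intro exI[of _ ?U] exI[of _ ?s] conjI ballI impI dU s sR) (rule inv)
qed

text \<open>A nonzero invariant function is invertible on the dense open set where it does not vanish.\<close>

lemma central_units:
 assumes z: "z\<in>centre KN" and z0: "z~=\<zero>\<^bsub>KN\<^esub>"
 shows "z\<in>Units KN"
proof -
 obtain U s where U: "dense_open (ftop tvar) U" and s: "s\<in>regfun tvar U"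
  and inv': "ALL P:carrier (PGL 2). ALL v:U. pgl_part tet tact P v\<in>U --> s (pgl_part tet tact P v) = s v"
  and sR: "(%v. s v\<cdot>\<^sub>m1\<^sub>m 2)\<in>R" and zs: "z = cls (%v. s v\<cdot>\<^sub>m1\<^sub>m 2)"
  using central_form[OF z] by (elim exE conjE) (rule that)
 note inv = inv'[rule_format]
 have oU: "opens tvar U" using U by (simp add: dense_open_iff)
 let ?V = "{v\<in>U. s v~=0}"
 have oV: "opens tvar ?V" by (rule openin_regfun_nonzero[OF k_space_tvar oU s])
 have "?V~={}"
 proof
  assume "?V = {}"
  hence "ge (%v. s v\<cdot>\<^sub>m1\<^sub>m 2) (%_. 0\<^sub>m 2 2)" by (intro generically_equalI[OF U] eq_matI) auto
  thus False using z0 unfolding zs KN_zero using cls_cong by blast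
 qed
 hence dV: "dense_open (ftop tvar) ?V" by (rule irreducible_dense_open[OF irreducible_tvar oV])
 have tR: "(%v. inverse (s v)\<cdot>\<^sub>m1\<^sub>m 2)\<in>R"
  by (rule scalar_R[OF dV regfun_inverse[OF k_space_tvar oU s]]) (use inv in auto)
 have 1: "z \<otimes>\<^bsub>KN\<^esub> cls (%v. inverse (s v)\<cdot>\<^sub>m1\<^sub>m 2) = \<one>\<^bsub>KN\<^esub>"
  unfolding zs cls_mult[OF sR tR] KN_one
  by (rule cls_cong[OF generically_equalI[OF dV]]) (simp add: smult_mult_mat[where n = 2] smult_smult_mat)
 thus ?thesis
  unfolding Units_def using centre_commute[OF z cls_carrier[OF tR]] cls_carrier[OF tR] centre_carrier[OF z]
  by (intro CollectI conjI bexI[of _ "cls (%v. inverse (s v)\<cdot>\<^sub>m1\<^sub>m 2)"]) simp_all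
qed

abbreviation polyparam :: "('k => 'k) => ('k vec => 'k mat) set"
 where "polyparam q \<equiv> cls (%v. q (param v)\<cdot>\<^sub>m1\<^sub>m 2)"

lemma polyparam_R:
 assumes q: "q\<in>polyfun {%s. s}"
 shows "(%v. q (param v)\<cdot>\<^sub>m1\<^sub>m 2)\<in>R"
proof (rule scalar_R[OF dense_open_topspace])
 show "(%v. q (param v))\<in>regfun tvar (points tvar)"
  by (rule polyfun_compose_regular[OF k_space_tvar _ q]) (use param_regular in auto)
qed (simp add: pgl_part_tact)

abbreviation gen :: "('k vec => 'k mat) set set"
 where "gen \<equiv> generate_field KN (range (%c. c \<odot>\<^bsub>KN\<^esub> \<one>\<^bsub>KN\<^esub>)\<union>{polyparam (%s. s)})"

lemma polyparam_gen: "q\<in>polyfun {%s. s}==>polyparam q\<in>gen"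
proof (induction rule: polyfun.induct)
 case (polyfun_const c)
 have "polyparam (%_. c) = c \<odot>\<^bsub>KN\<^esub> \<one>\<^bsub>KN\<^esub>" unfolding KN_one cls_smult[OF R_one] ..
 thus ?case by (simp only:) (rule generate_field.incl, blast)
next
 case (polyfun_coord f)
 thus ?case by (intro generate_field.incl) auto
next
 case (polyfun_add f g)
 have "polyparam (%s. f s + g s) = polyparam f \<oplus>\<^bsub>KN\<^esub> polyparam g"
  unfolding cls_add[OF polyparam_R[OF polyfun_add.hyps(1)] polyparam_R[OF polyfun_add.hyps(2)]]
  by (rule ge_triples, rule eq_matI) (auto simp: distrib_right)
 thus ?case using polyfun_add.IH by (simp only: generate_field.eng_add)
next
 case (polyfun_mult f g)
 have "polyparam (%s. f s * g s) = polyparam f \<otimes>\<^bsub>KN\<^esub> polyparam g"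
  unfolding cls_mult[OF polyparam_R[OF polyfun_mult.hyps(1)] polyparam_R[OF polyfun_mult.hyps(2)]]
  by (rule ge_triples) (simp add: smult_mult_mat[where n = 2] smult_smult_mat mult.commute)
 thus ?case using polyfun_mult.IH by (simp only: generate_field.eng_mult)
qed

lemma polyparam_central: "q\<in>polyfun {%s. s}==>polyparam q\<in>centre KN"
 by (rule generically_scalar_central[OF polyparam_R]) (auto intro: genericallyI[OF dense_open_topspace])

lemma gen_central: "a\<in>gen==>a\<in>centre KN"
proof (induction rule: generate_field.induct)
 case (incl h)
 thus ?case using centre_smult[OF centre_one] polyparam_central[OF polyfun_coord] by auto
qed (use centre_uminus centre_inv central_units centre_add centre_mult in auto)

lemma morphism_param: "morphism tvar line param"
 unfolding line_def by (rule morphism_into_zariski[OF k_space_tvar]) (use param_regular in auto)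

text \<open>
  An invariant function is determined by its values on a line of triples with fixed axes, since every
  orbit with a given parameter meets that line; on the line it is a rational function of the parameter.
\<close>

lemma central_gen:
 assumes z: "z\<in>centre KN"
 shows "z\<in>gen"
proof -
 obtain U s where U: "dense_open (ftop tvar) U" and s: "s\<in>regfun tvar U"
  and inv': "ALL P:carrier (PGL 2). ALL v:U. pgl_part tet tact P v\<in>U --> s (pgl_part tet tact P v) = s v"
  and sR: "(%v. s v\<cdot>\<^sub>m1\<^sub>m 2)\<in>R" and zs: "z = cls (%v. s v\<cdot>\<^sub>m1\<^sub>m 2)"
  using central_form[OF z] by (elim exE conjE) (rule that)
 note inv = inv'[rule_format]
 have oU: "opens tvar U" using U by (simp add: dense_open_iff)
 have "generically (ftop tvar) (%v. v\<in>U)" by (rule genericallyI[OF U])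
 from generically_point[OF this] obtain u where u: "u\<in>triples" "u\<in>U" by blast
 define c where "c t = encode (axis u) t" for t
 have cax: "axis (c t) i = axis u i" for t i
  unfolding c_def using axis_encode[of "axis u" t i] axis_mod[of "i mod 3" i u] by simp
 have cpar: "param (c t) = t" for t by (simp add: c_def)
 have ct: "c t\<in>triples" for t using u(1) unfolding triples_def mem_Collect_eq cax by (simp add: c_def)
 have c: "morphism line tvar c"
 proof (rule morphism_into_tvar[OF k_space_line])
  show "morphism line (mat_space 2) (%t. axis (c t) i)" for i
   unfolding cax by (rule morphism_mat_const[OF k_space_line axis_carrier(1)])
  show "(%t. param (c t))\<in>regfun line (points line)"
   unfolding cpar line_def by (rule polyfun_regular) (blast intro: polyfun_coord)
 qed (rule ct)
 define D where "D = {t\<in>points line. c t\<in>U}"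
 have D: "opens line D" unfolding D_def by (rule morphism_openin[OF c oU])
 have cu: "c (param u) = u" by (rule triple_eqI) (use u(1) ct[of "param u"] cax cpar in \<open>auto simp: triples_def\<close>)
 hence pD: "param u\<in>D" using u(2) by (simp add: D_def)
 have "(%t. s (c t))\<in>regfun line D" unfolding D_def by (rule morphism_regfun[OF c oU s])
 from bspec[OF this[unfolded line_def regfun_zariski] pD]
 obtain g h where g: "g\<in>polyfun {%s. s}" and h: "h\<in>polyfun {%s. s}" "h (param u)~=0"
  and gh': "ALL t:D. h t~=0 --> s (c t) = g t / h t"
  by (elim bexE conjE) (rule that)
 note gh = gh'[rule_format]
 define W where "W = {v\<in>points tvar. param v\<in>{t\<in>D. h t~=0}}\<inter>U"
 have "opens line {t\<in>D. h t~=0}"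
  by (rule openin_regfun_nonzero[OF k_space_line D]) (use polyfun_regular[OF h(1)] in \<open>simp add: line_def\<close>)
 hence oW: "opens tvar W" unfolding W_def by (intro openin_Int oU morphism_openin[OF morphism_param])
 have uW: "u\<in>W" unfolding W_def using u pD h(2) by simp
 have dW: "dense_open (ftop tvar) W" by (rule irreducible_dense_open[OF irreducible_tvar oW]) (use uW in blast)
 have sW: "s v * h (param v) = g (param v)" if v: "v\<in>W" for v
 proof -
  have vU: "v\<in>U" and vt: "v\<in>triples" and p: "param v\<in>D" "h (param v)~=0" using v by (auto simp: W_def)
  obtain P where P: "P\<in>carrier (PGL 2)" and ax: "ALL i. axis v i = pgl_conj 2 P (axis (c (param v)) i)"
   using triples_transitive[OF ct[of "param v"] vt] by (elim bexE) (rule that)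
  have "pgl_part tet tact P (c (param v)) = v"
   by (rule triple_eqI) (use pgl_part_tact[OF P ct[of "param v"]] vt ax cpar in \<open>auto simp: triples_def\<close>)
  hence "s v = s (c (param v))" using inv[OF P, of "c (param v)"] p(1) vU by (simp add: D_def)
  thus ?thesis using gh[OF p] p(2) by simp
 qed
 have zc: "z\<in>carrier KN" by (rule centre_carrier[OF z])
 have eq: "z \<otimes>\<^bsub>KN\<^esub> polyparam h = polyparam g"
  unfolding zs cls_mult[OF sR polyparam_R[OF h(1)]]
  by (rule cls_cong[OF generically_equalI[OF dW]]) (simp add: smult_mult_mat[where n = 2] smult_smult_mat sW mult.commute[of "h _"])
 have "polyparam h~=\<zero>\<^bsub>KN\<^esub>"
 proof
  assume "polyparam h = \<zero>\<^bsub>KN\<^esub>"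
  hence "ge (%v. h (param v)\<cdot>\<^sub>m1\<^sub>m 2) (%_. 0\<^sub>m 2 2)" unfolding KN_zero cls_eq_iff[OF polyparam_R[OF h(1)] R_zero] .
  from generically_conj[OF this[unfolded generically_eq] genericallyI[OF dW, of "%v. v\<in>W"]]
  have "EX v:triples. h (param v)\<cdot>\<^sub>m1\<^sub>m 2 = 0\<^sub>m 2 2 & v\<in>W" by (intro generically_point) simp
  then obtain v where v: "h (param v)\<cdot>\<^sub>m1\<^sub>m 2 = (0\<^sub>m 2 2 :: 'k mat)" "v\<in>W" by blast
  have "(h (param v)\<cdot>\<^sub>m1\<^sub>m 2) $$ (0, 0) = (0\<^sub>m 2 2 :: 'k mat) $$ (0, 0)" unfolding v(1) ..
  thus False using v(2) by (simp add: W_def)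
 qed
 note nz = this
 have hU: "polyparam h\<in>Units KN" by (rule central_units[OF polyparam_central[OF h(1)] nz])
 have "z = z \<otimes>\<^bsub>KN\<^esub> polyparam h \<otimes>\<^bsub>KN\<^esub> inv\<^bsub>KN\<^esub> (polyparam h)" using zc hU by (simp add: m_assoc Units_closed)
 also have "...\<in>gen" unfolding eq
  by (intro generate_field.eng_mult generate_field.m_inv polyparam_gen g h(1) nz)
 finally show ?thesis .
qed

text \<open>The algebra is a quaternion algebra over its center: the classes of the first two axes are anticommuting units with central squares.\<close>

lemma central_simple_KN: "central_simple_algebra KN 2"
proof -
 interpret symbol_algebra KN "- 1" 2 "ax 0" "ax 1" by (rule symbol_algebra_KN)
 have Z: "subfield (centre KN) KN" by (rule centre_subfield[OF KN_one_not_zero central_units])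
 have "centre KN = gen" using central_gen gen_central by blast
 hence "EX S. finite S & S \<subseteq> centre KN & centre KN = generate_field KN (range (%c. c \<odot>\<^bsub>KN\<^esub> \<one>\<^bsub>KN\<^esub>)\<union>S)"
  using polyparam_central[OF polyfun_coord] by (intro exI[of _ "{polyparam (%s. s)}"]) simp
 thus ?thesis
  unfolding central_simple_algebra_def
  using KN_k_algebra simple_ring_of_central_units[OF central_units] dimension_over_centre[OF Z] by blast
qed

lemma associated_variety_tvar: "associated_variety tet tspace 2 KN induced tvar tact"
 unfolding associated_variety_def
proof (intro conjI central_simple_KN induced_action variety_tvar irreducible_tvar regular_action_tact generically_free_tvar
  exI[of _ "%a. a"] ballI)
 show "(%a. a)\<in>k_alg_hom KN KN" by (rule k_alg_homI) simp_all
 show "bij_betw (%a. a) (carrier KN) (carrier KN)" by (simp add: bij_betw_def)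
qed (simp add: induced_def)

end

section \<open>No invariant maximal etale subalgebra\<close>

context tetrahedral
begin

interpretation k_alg KN
 by unfold_locales (rule KN_k_algebra)

interpretation symbol_algebra KN "- 1" 2 "ax 0" "ax 1"
 by (rule symbol_algebra_KN)

lemma residues_mod_3: "i mod 3 = k mod 3 | i mod 3 = (k + 1) mod 3 | i mod 3 = (k + 2) mod (3::nat)"
proof -
 have "i mod 3 = 0 | i mod 3 = 1 | i mod 3 = 2" "k mod 3 = 0 | k mod 3 = 1 | k mod 3 = 2" by presburger+
 thus ?thesis by (elim disjE) (simp_all add: mod_Suc numeral_2_eq_2)
qed

lemma axis_half_turn:
 assumes v: "v\<in>triples"
 shows "axis v k * axis v i * ((- 1)\<cdot>\<^sub>maxis v k) = half_turn k i\<cdot>\<^sub>maxis v i"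
proof -
 have anti: "axis v k * axis v i * ((- 1)\<cdot>\<^sub>maxis v k) = (- 1)\<cdot>\<^sub>maxis v i"
  if c: "axis v k * axis v i = (- 1)\<cdot>\<^sub>m(axis v i * axis v k)"
  unfolding c by (simp add: smult_mult_mat[where n = 2] smult_smult_mat mat_assoc[where n = 2] axis_square[OF v])
 from residues_mod_3[of i k] show ?thesis
 proof (elim disjE)
  assume i: "i mod 3 = k mod 3"
  have e: "axis v i = axis v k" by (rule axis_mod[OF i])
  have h: "half_turn k i = 1" unfolding half_turn_def i by simp
  show ?thesis unfolding e h axis_square[OF v] by (simp add: smult_mult_mat[where n = 2] smult_smult_mat)
 next
  assume i: "i mod 3 = (k + 1) mod 3"
  have "axis v i = axis v (k + 1)" by (rule axis_mod[OF i])
  hence "axis v k * axis v i = (- 1)\<cdot>\<^sub>m(axis v i * axis v k)" using axis_commutation[OF v, of k] by simp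
  moreover have "half_turn k i = - 1" 
  proof -
   have "i mod 3~=k mod 3" using i by presburger
   thus ?thesis unfolding half_turn_def by simp
  qed
  ultimately show ?thesis using anti by simp
 next
  assume i: "i mod 3 = (k + 2) mod 3"
  have k: "k mod 3 = (i + 1) mod 3" using mod_add_cong[OF i refl, of 1] by simp
  have "axis v k = axis v (i + 1)" by (rule axis_mod[OF k])
  hence "axis v k * axis v i = (- 1)\<cdot>\<^sub>m(axis v i * axis v k)"
   using axis_commutation[OF v, of i] by (simp add: smult_smult_mat)
  moreover have "half_turn k i = - 1" 
  proof -
   have "i mod 3~=k mod 3" using i by presburger
   thus ?thesis unfolding half_turn_def by simp
  qed
  ultimately show ?thesis using anti by simp
 qed
qed

text \<open>The half turns act on the algebra as conjugation by the axes, since on the variety they act as elements of \<open>PGL\<^sub>2\<close>.\<close>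

lemma shift_half_turn:
 assumes v: "v\<in>triples"
 shows "shift (el (half_turn k) 0) v = pgl_part tet tact (coset 2 (axis v k)) v"
proof -
 have P: "coset 2 (axis v k)\<in>carrier (PGL 2)" by (rule coset_PGL[OF axis_GL[OF v]])
 have i: "inv\<^bsub>tet\<^esub> (el (half_turn k) 0) = el (half_turn k) 0" using tet_inv[OF half_turn_signs, of k 0] by simp
 note sh = axis_tact[OF half_turn_signs one_PGL_2 v, of k 0] param_tact[OF half_turn_signs one_PGL_2 v, of k 0]
  tact_triples[OF half_turn_signs one_PGL_2 v, of k 0]
 show ?thesis
  unfolding i
 proof (rule triple_eqI)
  fix i
  have "pgl_conj 2 (coset 2 (axis v k)) (axis v i) = half_turn k i\<cdot>\<^sub>maxis v i"
   using axis_half_turn[OF v, of k i] by (simp add: pgl_conj_coset[OF axis_GL[OF v]] minv_axis[OF v])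
  thus "axis (tact (el (half_turn k) 0, \<one>\<^bsub>PGL 2\<^esub>) v) i = axis (pgl_part tet tact (coset 2 (axis v k)) v) i"
   unfolding sh(1) pgl_part_tact(1)[OF P v] by (simp add: pgl_conj_by_one)
 qed (use sh pgl_part_tact[OF P v] in \<open>auto simp: triples_def\<close>)
qed

lemma induced_half_turn:
 assumes C: "C\<in>carrier KN"
 shows "induced (el (half_turn k) 0) C = ax k \<otimes>\<^bsub>KN\<^esub> C \<otimes>\<^bsub>KN\<^esub> inv\<^bsub>KN\<^esub> (ax k)"
proof -
 obtain f where f: "f\<in>R" "C = cls f" using C by (rule KN_cases)
 obtain U where U: "rep_on f U" using f(1) unfolding rat_reps_iff by blast
 note fU = rep_onD[OF U]
 have g: "el (half_turn k) 0\<in>carrier tet" by (rule el_tet[OF half_turn_signs])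
 have gU: "generically (ftop tvar) (%v. v\<in>U)" by (rule genericallyI[OF fU(1)])
 have "ge (%v. f (shift (el (half_turn k) 0) v)) (%v. axis v k * f v * ((- 1)\<cdot>\<^sub>maxis v k))"
  unfolding generically_eq
 proof (rule generically_mono[OF generically_conj[OF gU generically_shift[OF g gU]]])
  fix v assume "v\<in>points tvar" and vU: "v\<in>U & shift (el (half_turn k) 0) v\<in>U"
  hence v: "v\<in>triples" by simp
  have P: "coset 2 (axis v k)\<in>carrier (PGL 2)" by (rule coset_PGL[OF axis_GL[OF v]])
  have "f (shift (el (half_turn k) 0) v) = pgl_conj 2 (coset 2 (axis v k)) (f v)"
   unfolding shift_half_turn[OF v] by (rule fU(3)[OF P]) (use vU in \<open>auto simp: shift_half_turn[OF v]\<close>)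
  thus "f (shift (el (half_turn k) 0) v) = axis v k * f v * ((- 1)\<cdot>\<^sub>maxis v k)"
   using fU(4)[of v] vU by (simp add: pgl_conj_coset[OF axis_GL[OF v]] minv_axis[OF v])
 qed
 hence "induced (el (half_turn k) 0) C = cls (%v. axis v k * f v * ((- 1)\<cdot>\<^sub>maxis v k))"
  unfolding f(2) induced_cls[OF g f(1)] by (rule cls_cong)
 also have "... = ax k \<otimes>\<^bsub>KN\<^esub> C \<otimes>\<^bsub>KN\<^esub> inv\<^bsub>KN\<^esub> (ax k)"
  unfolding inv_ax unfolding ax_def f(2) cls_mult[OF axis_R f(1)] cls_smult[OF axis_R]
   cls_mult[OF R_mult[OF axis_R f(1)] R_smult[OF axis_R]] ..
 finally show ?thesis .
qed

text \<open>The rotation permutes the axes cyclically.\<close>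

lemma induced_rotation: "induced (el (%_. 1) 1) (ax i) = ax (i + 2)"
proof -
 have g: "el (%_. 1) 1\<in>carrier tet" by (rule el_tet[OF signs_one])
 have i: "inv\<^bsub>tet\<^esub> (el (%_. 1) 1) = el (%_. 1) 2" using tet_inv[OF signs_one, of 1] by simp
 show ?thesis unfolding ax_def induced_cls[OF g axis_R] i
  by (rule ge_triples) (simp add: axis_tact[OF signs_one one_PGL_2] pgl_conj_by_one)
qed

lemma pow_of_square:
 assumes x: "x\<in>carrier KN" "x \<otimes>\<^bsub>KN\<^esub> x = (- 1) \<odot>\<^bsub>KN\<^esub> \<one>\<^bsub>KN\<^esub>"
 shows "EX c. c~=0 & x [^]\<^bsub>KN\<^esub> (m::nat) = c \<odot>\<^bsub>KN\<^esub> (if even m then \<one>\<^bsub>KN\<^esub> else x)"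
proof (induction m)
 case 0
 show ?case by (rule exI[of _ 1]) simp
next
 case (Suc m)
 then obtain c where c: "c~=0" "x [^]\<^bsub>KN\<^esub> m = c \<odot>\<^bsub>KN\<^esub> (if even m then \<one>\<^bsub>KN\<^esub> else x)" by blast
 show ?case
 proof (cases "even m")
  case True
  thus ?thesis using c x by (intro exI[of _ c]) simp
 next
  case False
  thus ?thesis using c x by (intro exI[of _ "- c"]) (simp add: smult_assoc1)
 qed
qed

text \<open>An invariant subalgebra containing the center is stable under conjugation by the axes, hence spanned over the center by the unit and the axes it contains.  It is larger than the center, so it contains an axis, and then all axes by the rotation; but the axes do not commute.\<close>

lemma no_invariant_etale:
 assumes E: "maximal_etale_subalgebra KN 2 E" and inv: "invariant_under tet induced E"
 shows False
proof -
 have sub: "subring E KN" and comm: "!!a b. a\<in>E==>b\<in>E==>a \<otimes>\<^bsub>KN\<^esub> b = b \<otimes>\<^bsub>KN\<^esub> a"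
  using E unfolding maximal_etale_subalgebra_def by (auto dest: subcring.axioms(1) subcring.sub_m_comm)
 have ZE: "centre KN \<subseteq> E" and dim: "ring.dimension KN 2 (centre KN) E"
  using E unfolding maximal_etale_subalgebra_def by blast+
 note EK = subringE(1)[OF sub] and E0 = subringE(2)[OF sub] and Em = subringE(6)[OF sub] and Ea = subringE(7)[OF sub]
 have Es: "c \<odot>\<^bsub>KN\<^esub> a\<in>E" if a: "a\<in>E" for c a
 proof -
  have "(c \<odot>\<^bsub>KN\<^esub> \<one>\<^bsub>KN\<^esub>) \<otimes>\<^bsub>KN\<^esub> a\<in>E" using Em[OF subsetD[OF ZE centre_smult[OF centre_one]] a] .
  thus ?thesis using a EK by auto
 qed
 have image: "induced g a\<in>E" if "g\<in>carrier tet" "a\<in>E" for g a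
  using inv that unfolding invariant_under_def by blast
 have conj: "conj_by (ax k) a\<in>E" if "a\<in>E" for k a
  using image[OF el_tet[OF half_turn_signs] that, of k 0] induced_half_turn[of a k] that EK
  unfolding conj_by_def by auto
 have Z: "subfield (centre KN) KN" by (rule centre_subfield[OF KN_one_not_zero central_units])
 have rot: "ax (i + 2)\<in>E" if "ax i\<in>E" for i
  using image[OF el_tet[OF signs_one, of 1] that] unfolding induced_rotation .
 have noax: False if k: "ax k\<in>E" for k
 proof -
  have a: "ax i\<in>E" for i
  proof -
   have k2: "ax (k + 2)\<in>E" and "ax (k + 2 + 2)\<in>E" using rot[OF k] rot[OF rot[OF k]] by simp_all
   moreover have "ax (k + 2 + 2) = ax (k + 1)" by (rule ax_mod) presburger
   ultimately have k1: "ax (k + 1)\<in>E" by simp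
   from residues_mod_3[of i k] show ?thesis
    using k k1 k2 ax_mod[of i k] ax_mod[of i "k + 1"] ax_mod[of i "k + 2"] by (elim disjE) simp_all
  qed
  have "(- 1) \<odot>\<^bsub>KN\<^esub> (ax 1 \<otimes>\<^bsub>KN\<^esub> ax 0) = 1 \<odot>\<^bsub>KN\<^esub> (ax 1 \<otimes>\<^bsub>KN\<^esub> ax 0)"
   using comm[OF a[of 0] a[of 1]] ax_commutation[of 0] by simp
  from smult_unit_cancel[OF _ this KN_one_not_zero] have "(- 1 :: 'k) = 1" using ax_unit by blast
  thus False by simp
 qed
 have weights: "u\<in>centre KN" if u: "u\<in>E" and w: "weight u ((- 1) ^ j) ((1 / (- 1)) ^ i)" for u i j
 proof (rule ccontr)
  assume nc: "u \<notin> centre KN"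
  obtain z where z: "z\<in>centre KN" "u = z \<otimes>\<^bsub>KN\<^esub> monomial i j" using w by (rule weight_eq_monomial)
  have z0: "z~=\<zero>\<^bsub>KN\<^esub>"
  proof
   assume "z = \<zero>\<^bsub>KN\<^esub>"
   hence "u = z" unfolding z(2) using l_null[OF monomial_closed] by simp
   thus False using nc z(1) by simp
  qed
  have zU: "z\<in>Units KN" by (rule central_units[OF z(1) z0])
  have zc: "z\<in>carrier KN" "inv\<^bsub>KN\<^esub> z\<in>carrier KN" using zU by auto
  have "monomial i j = inv\<^bsub>KN\<^esub> z \<otimes>\<^bsub>KN\<^esub> u" 
   using m_assoc[OF zc(2) zc(1) monomial_closed[of i j]] Units_l_inv[OF zU] l_one[OF monomial_closed[of i j]] unfolding z(2) by simp
  hence mE: "monomial i j\<in>E" using Em[OF subsetD[OF ZE centre_inv[OF z(1) zU]] u] by simp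
  obtain c d where c: "c~=0" "ax 0 [^]\<^bsub>KN\<^esub> i = c \<odot>\<^bsub>KN\<^esub> (if even i then \<one>\<^bsub>KN\<^esub> else ax 0)"
   and d: "d~=0" "ax 1 [^]\<^bsub>KN\<^esub> j = d \<odot>\<^bsub>KN\<^esub> (if even j then \<one>\<^bsub>KN\<^esub> else ax 1)"
   using pow_of_square[OF ax_closed ax_square, of 0 i] pow_of_square[OF ax_closed ax_square, of 1 j] by blast
  define e where "e = (if even i then \<one>\<^bsub>KN\<^esub> else ax 0) \<otimes>\<^bsub>KN\<^esub> (if even j then \<one>\<^bsub>KN\<^esub> else ax 1)"
  have ec: "e\<in>carrier KN" unfolding e_def by auto
  have m: "monomial i j = (c * d) \<odot>\<^bsub>KN\<^esub> e"
   unfolding monomial_def c(2) d(2) e_def by (simp add: smult_assoc1 mult.commute)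
  have "(1 / (c * d)) \<odot>\<^bsub>KN\<^esub> monomial i j = e" unfolding m using c d ec by (simp add: smult_assoc1)
  hence eE: "e\<in>E" using Es[OF mE] by metis
  show False
  proof (cases "even i")
   case True
   show False
   proof (cases "even j")
    case True
    hence "e = \<one>\<^bsub>KN\<^esub>" using \<open>even i\<close> by (simp add: e_def)
    hence "u\<in>centre KN" unfolding z(2) m by (intro centre_mult z(1) centre_smult) simp
    thus False using nc by simp
   next
    case False
    hence "e = ax 1" using \<open>even i\<close> by (simp add: e_def)
    thus False using noax[of 1] eE by simp
   qed
  next
   case odd: False
   show False
   proof (cases "even j")
    case True
    hence "e = ax 0" using odd by (simp add: e_def)
    thus False using noax[of 0] eE by simp
   next
    case False
    hence "e = ax 2" using odd ax_next[of 0] by (simp add: e_def numeral_2_eq_2[symmetric])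
    thus False using noax[of 2] eE by simp
   qed
  qed
 qed
 have "E \<subseteq> centre KN"
 proof
  fix u assume u: "u\<in>E"
  show "u\<in>centre KN"
  proof (rule weight_vector_induct[OF EK E0 Ea Es conj conj _ _ _ u])
   show "\<zero>\<^bsub>KN\<^esub>\<in>centre KN" using centre_smult[OF centre_one, of 0] by simp
   show "a \<oplus>\<^bsub>KN\<^esub> b\<in>centre KN" if "a\<in>centre KN" "b\<in>centre KN" for a b by (rule centre_add[OF that])
   show "a\<in>centre KN" if "a\<in>E" "weight a ((- 1) ^ j) ((1 / (- 1)) ^ i)" for i j a by (rule weights[OF that])
  qed
 qed
 hence "E = centre KN" using ZE by blast
 hence "(2::nat) = 1" using dimension_is_inj[OF Z dim[unfolded \<open>E = centre KN\<close>] dimension_one[OF Z]] by simp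
 thus False by simp
qed

end

text \<open>Roots of \<open>1 + X + X\<^sup>2\<close> and \<open>1 + X\<^sup>2\<close>; in characteristic zero a root of the former is a nontrivial cube root of unity.\<close>

lemma tetrahedral_exists: "EX \<omega> i :: 'k::{alg_closed_field, field_char_0}. tetrahedral \<omega> i"
proof -
 obtain w :: 'k where "(\<Sum>k\<le>2. 1 * w ^ k) = 0" using alg_closed[of 2 "%_. 1"] by auto
 hence w: "1 + w + w * w = 0" by (simp add: numeral_2_eq_2)
 obtain i :: 'k where "(\<Sum>k\<le>2. (if k = 1 then 0 else 1) * i ^ k) = 0"
  using alg_closed[of 2 "%k. if k = 1 then 0 else 1"] by auto
 hence i: "1 + i * i = 0" by (simp add: numeral_2_eq_2)
 have "w ^ 3 - 1 = (w - 1) * (1 + w + w * w)" by (simp add: power3_eq_cube algebra_simps)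
 hence "w ^ 3 = 1" using w by simp
 moreover have "w~=1" using w by auto
 moreover have "i * i = - 1" using i by (simp add: add_eq_0_iff)
 ultimately show ?thesis unfolding tetrahedral_def by blast
qed

theorem proposition15p3:
  fixes p :: nat
    and \<zeta> :: "'k::{alg_closed_field, field_char_0}"
    and A :: "('k, 'a) module"
    and \<iota> :: "(nat \<times> nat \<Rightarrow> 'k) \<Rightarrow> 'a"
    and x y :: 'a
    and \<sigma> :: "nat \<Rightarrow> nat \<Rightarrow> 'a \<Rightarrow> 'a"
    and \<tau> :: "'a \<Rightarrow> 'a"
    and G H :: "('a \<Rightarrow> 'a) monoid"
    and \<phi> :: "('a \<Rightarrow> 'a) \<Rightarrow> 'p::prime_card mod_ring mat"
  assumes p: "p = CARD('p)"
    and zeta: "\<zeta> ^ p = 1" "\<forall>m. 0 < m \<and> m < p \<longrightarrow> \<zeta> ^ m \<noteq> 1"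
    and A: "division_algebra_of_fractions (skew_poly \<zeta>) A \<iota>"
    and x: "x = \<iota> (skew_monom 1 0)" and y: "y = \<iota> (skew_monom 0 1)"
    and sigma: "\<forall>a b. \<sigma> a b \<in> carrier (k_alg_aut A) \<and>
                  \<sigma> a b x = \<zeta> ^ a \<odot>\<^bsub>A\<^esub> x \<and> \<sigma> a b y = \<zeta> ^ b \<odot>\<^bsub>A\<^esub> y"
    and tau: "\<tau> \<in> carrier (k_alg_aut A)" "\<tau> x = y" "\<tau> y = inv\<^bsub>A\<^esub> x \<otimes>\<^bsub>A\<^esub> inv\<^bsub>A\<^esub> y"
    and G: "G = subgroup_generated (k_alg_aut A) ({\<sigma> a b | a b. a < p \<and> b < p} \<union> {\<tau>})"
    and H: "H = subgroup_generated (k_alg_aut A) {\<tau>}"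
    and phi: "\<phi> \<in> hom H (SL 2)" "\<phi> \<tau> = mat_of_rows_list 2 [[0, -1], [1, -1]]"
  shows
    "(\<forall>(XA :: ('k, 'x) fspace) act.
        associated_variety G (discrete_space (carrier G)) p A (\<lambda>g. g) XA act \<longrightarrow>
        stabilizers_normalize_tori G p XA act)
     \<and>
     ((\<exists>L. maximal_subfield A L \<and> invariant_under G (\<lambda>g. g) L) \<longleftrightarrow>
        reducible_representation H 2 \<phi>)
     \<and>
     \<not> (\<forall>(n' :: nat) (G' :: 'k vec monoid) S'
          (A' :: ('k, ('k vec \<Rightarrow> 'k mat) set) module) \<alpha>' (X' :: ('k, 'k vec) fspace) act'.
          alg_group G' S' \<and> associated_variety G' S' n' A' \<alpha>' X' act' \<and>
          stabilizers_normalize_tori G' n' X' act' \<longrightarrow>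
          (\<exists>E. maximal_etale_subalgebra A' n' E \<and> invariant_under G' \<alpha>' E))"
proof (intro conjI allI impI)
  have "p > 1" unfolding p by (rule prime_gt_1_nat[OF prime_card])
  note ctx = this zeta A x y sigma tau G
  fix XA :: "('k, 'x) fspace" and act
  assume "associated_variety G (discrete_space (carrier G)) p A (\<lambda>g. g) XA act"
  then show "stabilizers_normalize_tori G p XA act"
    by (rule fractions_stabilizers_normalize_tori[OF ctx])
next
  show "(\<exists>L. maximal_subfield A L \<and> invariant_under G (\<lambda>g. g) L) \<longleftrightarrow> reducible_representation H 2 \<phi>"
    by (rule fractions_invariant_maximal_subfield_iff[where \<tau> = \<tau> and \<phi> = \<phi> and \<sigma> = \<sigma>,
          OF p zeta A x y sigma tau G H phi])
next
  obtain \<omega> i :: 'k where "tetrahedral \<omega> i" using tetrahedral_exists by blast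
  then interpret T: tetrahedral \<omega> i .
  show "\<not> (\<forall>(n' :: nat) (G' :: 'k vec monoid) S'
          (A' :: ('k, ('k vec \<Rightarrow> 'k mat) set) module) \<alpha>' (X' :: ('k, 'k vec) fspace) act'.
          alg_group G' S' \<and> associated_variety G' S' n' A' \<alpha>' X' act' \<and>
          stabilizers_normalize_tori G' n' X' act' \<longrightarrow>
          (\<exists>E. maximal_etale_subalgebra A' n' E \<and> invariant_under G' \<alpha>' E))"
  proof
    assume all: "\<forall>(n' :: nat) (G' :: 'k vec monoid) S'
          (A' :: ('k, ('k vec \<Rightarrow> 'k mat) set) module) \<alpha>' (X' :: ('k, 'k vec) fspace) act'.
          alg_group G' S' \<and> associated_variety G' S' n' A' \<alpha>' X' act' \<and>
          stabilizers_normalize_tori G' n' X' act' \<longrightarrow>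
          (\<exists>E. maximal_etale_subalgebra A' n' E \<and> invariant_under G' \<alpha>' E)"
    from all[rule_format, OF conjI[OF T.alg_group_tet conjI[OF T.associated_variety_tvar T.stabilizers_tvar]]]
    show False by (elim exE conjE) (rule T.no_invariant_etale)
  qed
qed

end
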